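(* Let $\Omega\subseteq\mathbb{R}^n$ be open and let $P(t,x,D_x)$ be a first-order partial differential operator with real principal symbol $P_1$ and coefficients in $\mathcal{C}^\infty(\mathbb{R}\times\Omega)$ which are constant outside some compact subset of $\Omega$. Let $u\in\mathcal{G}(\Omega\times\mathbb{R})$ be the (unique) solution of the homogeneous Cauchy problem $$\partial_t u+iP(t,x,D_x)u=0,\qquad u(\cdot,0)=g\in\mathcal{G}(\Omega),$$ and denote by $\gamma(x_0,\xi_0)$ the maximal bicharacteristic curve passing through the characteristic point $(x_0,0;\xi_0,-P_1(0,x_0,\xi_0))\in T^*(\Omega\times\mathbb{R})\setminus0$. Then the generalized wave front set of $u$ is given by $$\mathrm{WF}_{\mathrm g}(u)=\bigcup_{(x_0,\xi_0)\in\mathrm{WF}_{\mathrm g}(g)}\gamma(x_0,\xi_0).$$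
   Context: Notation: $D_x=-i\partial_x$; for an open set $X\subseteq\mathbb{R}^d$, $T^*(X)\setminus0=X\times(\mathbb{R}^d\setminus\{0\})$; points of $T^*(\Omega\times\mathbb{R})$ are written $(x,t;\xi,\tau)$; $\langle\xi\rangle=(1+|\xi|^2)^{1/2}$; $\hat v$ is the Fourier transform $\hat v(\xi)=\int e^{-ix\xi}v(x)\,dx$. Colombeau algebras (for any open $X\subseteq\mathbb{R}^d$; nets are indexed by $\varepsilon\in(0,1]$): $\mathcal{E}_M(X)$ is the set of nets $(u_\varepsilon)_\varepsilon$ in $\mathcal{C}^\infty(X)$ such that for all compact $K\subset X$ and all multi-indices $\alpha$ there is $p\in\mathbb{R}$ with $\|\partial^\alpha u_\varepsilon\|_{L^\infty(K)}=O(\varepsilon^{-p})$ as $\varepsilon\to0$. $\mathcal{N}(X)$ is the set of $(u_\varepsilon)_\varepsilon\in\mathcal{E}_M(X)$ such that for all compact $K\subset X$ and all $q$, $\|u_\varepsilon\|_{L^\infty(K)}=O(\varepsilon^q)$. $\mathcal{G}(X)=\mathcal{E}_M(X)/\mathcal{N}(X)$. Differential operators with smooth coefficients and restrictions $u(\cdot,t)=[(u_\varepsilon(\cdot,t))_\varepsilon]\in\mathcal{G}(\Omega)$ of $u\in\mathcal{G}(\Omega\times\mathbb{R})$ to fixed $t$ are defined on representatives; equations hold in the Colombeau algebras. Generalized wave front set: $u=[(u_\varepsilon)_\varepsilon]\in\mathcal{G}(X)$ is $\mathcal{G}^\infty$-microlocally regular at $(x_0,\xi_0)\in T^*(X)\setminus0$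 if there are $\phi\in\mathcal{C}^\infty_{\mathrm c}(X)$ with $\phi(x_0)=1$, a conic neighborhood $\Gamma$ of $\xi_0$ and $N$ such that for all $l$: $\sup_{\xi\in\Gamma}\langle\xi\rangle^l|\widehat{\phi u_\varepsilon}(\xi)|=O(\varepsilon^{-N})$ as $\varepsilon\to0$. $\mathrm{WF}_{\mathrm g}(u)\subseteq T^*(X)\setminus0$ is the complement of the set of such points. Bicharacteristic curves are the integral curves (viewed as subsets of $T^*(\Omega\times\mathbb{R})\setminus0$) of the Hamilton vector field of the function $(x,t;\xi,\tau)\mapsto\tau+P_1(t,x,\xi)$, contained in its zero set.
   Formalization: Uniqueness of the solution of the Cauchy problem, which fails for general open Ω (for example Ω=(0,1), P=D_x, g=0, u=h(x−t) with h vanishing on (0,1)), is taken as a hypothesis: u is assumed to be a solution and the only one. *)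

theory Defs
  imports "HOL-Analysis.Analysis"
begin

section \<open>Smooth functions on open subsets of a Euclidean space\<close>

text \<open>
  Functions on an open set \<open>X\<close> are represented by total functions; their values outside \<open>X\<close>
  are irrelevant to everything below.
\<close>

definition partial_deriv ::
    "'a::euclidean_space \<Rightarrow> ('a \<Rightarrow> 'b::real_normed_vector) \<Rightarrow> 'a \<Rightarrow> 'b" where
  "partial_deriv b f x = frechet_derivative f (at x) b"

text \<open>
  A multi-index is encoded as the list of the coordinate directions in which one differentiates.
  The order of the list does not matter for smooth functions, so lists of basis vectors
  describe exactly the derivatives \<open>\<partial>\<^sup>\<alpha>\<close>.
\<close>

primrec iter_partial ::
    "'a::euclidean_space list \<Rightarrow> ('a \<Rightarrow> 'b::real_normed_vector) \<Rightarrow> 'a \<Rightarrow> 'b" where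
  "iter_partial [] f = f"
| "iter_partial (b # bs) f = partial_deriv b (iter_partial bs f)"

definition smooth_on ::
    "'a::euclidean_space set \<Rightarrow> ('a \<Rightarrow> 'b::real_normed_vector) \<Rightarrow> bool" where
  "smooth_on X f \<longleftrightarrow>
     (\<forall>bs. set bs \<subseteq> Basis \<longrightarrow> (\<forall>x\<in>X. iter_partial bs f differentiable (at x)))"

definition test_function :: "'a::euclidean_space set \<Rightarrow> ('a \<Rightarrow> complex) \<Rightarrow> bool" where
  "test_function X \<phi> \<longleftrightarrow>
     smooth_on UNIV \<phi> \<and> compact (closure {x. \<phi> x \<noteq> 0}) \<and> closure {x. \<phi> x \<noteq> 0} \<subseteq> X"

section \<open>Colombeau algebras\<close>

text \<open>
  Nets are indexed by \<open>\<epsilon> \<in> (0,1]\<close>; the values of a function of type \<open>real \<Rightarrow> _\<close> at other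
  parameters are ignored.
\<close>

type_synonym 'a net = "real \<Rightarrow> 'a \<Rightarrow> complex"

text \<open>
  \<open>sup_bigo S F r\<close> says \<open>sup\<^bsub>S\<^esub> F\<^sub>\<epsilon> = O(\<epsilon>\<^sup>r)\<close> as \<open>\<epsilon> \<rightarrow> 0\<close>, for nets \<open>F\<close> of nonnegative functions.
  It is written out because the supremum of the empty set, or of an unbounded set, of reals is
  an unspecified number.
\<close>

definition sup_bigo :: "'a set \<Rightarrow> (real \<Rightarrow> 'a \<Rightarrow> real) \<Rightarrow> real \<Rightarrow> bool" where
  "sup_bigo S F r \<longleftrightarrow>
     (\<exists>C. eventually (\<lambda>\<epsilon>. \<forall>x\<in>S. F \<epsilon> x \<le> C * \<epsilon> powr r) (at_right 0))"

definition moderate_nets :: "'a::euclidean_space set \<Rightarrow> 'a net set" where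
  "moderate_nets X =
     {u. (\<forall>\<epsilon>\<in>{0<..1}. smooth_on X (u \<epsilon>)) \<and>
         (\<forall>K bs. compact K \<and> K \<subseteq> X \<and> set bs \<subseteq> Basis \<longrightarrow>
            (\<exists>p. sup_bigo K (\<lambda>\<epsilon> x. cmod (iter_partial bs (u \<epsilon>) x)) (- p)))}"

definition negligible_nets :: "'a::euclidean_space set \<Rightarrow> 'a net set" where
  "negligible_nets X =
     {u \<in> moderate_nets X.
        \<forall>K q. compact K \<and> K \<subseteq> X \<longrightarrow> sup_bigo K (\<lambda>\<epsilon> x. cmod (u \<epsilon> x)) q}"

definition colombeau_rel :: "'a::euclidean_space set \<Rightarrow> ('a net \<times> 'a net) set" where
  "colombeau_rel X =
     {(u, v). u \<in> moderate_nets X \<and> v \<in> moderate_nets X \<and>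
              (\<lambda>\<epsilon> x. u \<epsilon> x - v \<epsilon> x) \<in> negligible_nets X}"

definition colombeau :: "'a::euclidean_space set \<Rightarrow> 'a net set set" where
  "colombeau X = moderate_nets X // colombeau_rel X"

definition colombeau_class :: "'a::euclidean_space set \<Rightarrow> 'a net \<Rightarrow> 'a net set" where
  "colombeau_class X u = colombeau_rel X `` {u}"

text \<open>
  The map \<open>\<G>(X) \<rightarrow> \<G>(Y)\<close> induced by applying \<open>L\<close> to each member of a representative. The union
  over all representatives is the usual way of defining a function on a quotient set.
\<close>

definition colombeau_lift ::
    "'b::euclidean_space set \<Rightarrow> (('a \<Rightarrow> complex) \<Rightarrow> 'b \<Rightarrow> complex) \<Rightarrow>
     'a::euclidean_space net set \<Rightarrow> 'b net set" where
  "colombeau_lift Y L U = (\<Union>u\<in>U. colombeau_class Y (\<lambda>\<epsilon>. L (u \<epsilon>)))"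

section \<open>The generalized wave front set\<close>

definition fourier :: "('a::euclidean_space \<Rightarrow> complex) \<Rightarrow> 'a \<Rightarrow> complex" where
  "fourier v \<xi> = (LINT x|lborel. exp (- \<i> * complex_of_real (x \<bullet> \<xi>)) * v x)"

definition japanese_bracket :: "'a::real_normed_vector \<Rightarrow> real" where
  "japanese_bracket \<xi> = sqrt (1 + (norm \<xi>)\<^sup>2)"

definition conic_nbhd :: "'a::real_normed_vector \<Rightarrow> 'a set \<Rightarrow> bool" where
  "conic_nbhd \<xi>0 \<Gamma> \<longleftrightarrow>
     open \<Gamma> \<and> \<xi>0 \<in> \<Gamma> \<and> 0 \<notin> \<Gamma> \<and> (\<forall>\<xi>\<in>\<Gamma>. \<forall>c>0. c *\<^sub>R \<xi> \<in> \<Gamma>)"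

definition cotangent_minus_zero :: "'a::real_vector set \<Rightarrow> ('a \<times> 'a) set" where
  "cotangent_minus_zero X = X \<times> (UNIV - {0})"

text \<open>
  The condition does not depend on the representative \<open>u\<close>.
\<close>

definition microlocally_regular ::
    "'a::euclidean_space set \<Rightarrow> 'a net set \<Rightarrow> 'a \<Rightarrow> 'a \<Rightarrow> bool" where
  "microlocally_regular X U x0 \<xi>0 \<longleftrightarrow>
     (\<exists>u\<in>U. \<exists>\<phi> \<Gamma>. \<exists>N::nat.
        test_function X \<phi> \<and> \<phi> x0 = 1 \<and> conic_nbhd \<xi>0 \<Gamma> \<and>
        (\<forall>l::nat. sup_bigo \<Gamma>
           (\<lambda>\<epsilon> \<xi>. japanese_bracket \<xi> ^ l * cmod (fourier (\<lambda>x. \<phi> x * u \<epsilon> x) \<xi>)) (- real N)))"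

definition WF_g :: "'a::euclidean_space set \<Rightarrow> 'a net set \<Rightarrow> ('a \<times> 'a) set" where
  "WF_g X U = {(x, \<xi>) \<in> cotangent_minus_zero X. \<not> microlocally_regular X U x \<xi>}"

section \<open>Bicharacteristic curves\<close>

definition hamilton_field ::
    "('a \<times> 'a \<Rightarrow> real) \<Rightarrow> 'a::euclidean_space \<times> 'a \<Rightarrow> 'a \<times> 'a" where
  "hamilton_field p z =
     ((\<Sum>b\<in>Basis. partial_deriv (0, b) p z *\<^sub>R b),
      - (\<Sum>b\<in>Basis. partial_deriv (b, 0) p z *\<^sub>R b))"

text \<open>
  \<open>c\<close> is considered only on the open interval \<open>I\<close>. Maximality refers to extensions of the
  parametrized curve; the maximal curve itself is the set \<open>c ` I\<close>, which is uniquely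
  determined by any of its points if \<open>p\<close> is smooth.
\<close>

definition bicharacteristic ::
    "'a::euclidean_space set \<Rightarrow> ('a \<times> 'a \<Rightarrow> real) \<Rightarrow> real set \<Rightarrow> (real \<Rightarrow> 'a \<times> 'a) \<Rightarrow> bool"
  where
  "bicharacteristic X p I c \<longleftrightarrow>
     open I \<and> is_interval I \<and> I \<noteq> {} \<and>
     (\<forall>s\<in>I. c s \<in> cotangent_minus_zero X \<and> p (c s) = 0 \<and>
            (c has_vector_derivative hamilton_field p (c s)) (at s))"

definition maximal_bicharacteristic ::
    "'a::euclidean_space set \<Rightarrow> ('a \<times> 'a \<Rightarrow> real) \<Rightarrow> real set \<Rightarrow> (real \<Rightarrow> 'a \<times> 'a) \<Rightarrow> bool"
  where
  "maximal_bicharacteristic X p I c \<longleftrightarrow>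
     bicharacteristic X p I c \<and>
     (\<forall>J d. bicharacteristic X p J d \<and> I \<subseteq> J \<and> (\<forall>s\<in>I. d s = c s) \<longrightarrow> J = I)"

definition bicharacteristic_through ::
    "'a::euclidean_space set \<Rightarrow> ('a \<times> 'a \<Rightarrow> real) \<Rightarrow> 'a \<times> 'a \<Rightarrow> ('a \<times> 'a) set" where
  "bicharacteristic_through X p z =
     (THE C. z \<in> C \<and> (\<exists>I c. maximal_bicharacteristic X p I c \<and> C = c ` I))"

section \<open>The Cauchy problem\<close>

text \<open>
  The operator is \<open>P(t,x,D\<^sub>x) = \<Sum>\<^sub>j a\<^sub>j(t,x) D\<^sub>j + b(t,x)\<close> with \<open>D\<^sub>j = -i \<partial>\<^sub>j\<close>. It acts on
  functions of \<open>(x,t)\<close>, whereas its coefficients are functions of \<open>(t,x)\<close>.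
\<close>

definition principal_symbol ::
    "('n::finite \<Rightarrow> real \<times> (real^'n) \<Rightarrow> complex) \<Rightarrow> real \<Rightarrow> (real^'n) \<Rightarrow> (real^'n) \<Rightarrow> complex" where
  "principal_symbol a t x \<xi> = (\<Sum>j\<in>UNIV. a j (t, x) * complex_of_real (\<xi> $ j))"

definition first_order_op ::
    "('n::finite \<Rightarrow> real \<times> (real^'n) \<Rightarrow> complex) \<Rightarrow> (real \<times> (real^'n) \<Rightarrow> complex) \<Rightarrow>
     ((real^'n) \<times> real \<Rightarrow> complex) \<Rightarrow> (real^'n) \<times> real \<Rightarrow> complex" where
  "first_order_op a b v = (\<lambda>(x, t).
     (\<Sum>j\<in>UNIV. a j (t, x) * (- \<i> * partial_deriv (axis j 1, 0) v (x, t))) + b (t, x) * v (x, t))"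

definition evolution_op ::
    "('n::finite \<Rightarrow> real \<times> (real^'n) \<Rightarrow> complex) \<Rightarrow> (real \<times> (real^'n) \<Rightarrow> complex) \<Rightarrow>
     ((real^'n) \<times> real \<Rightarrow> complex) \<Rightarrow> (real^'n) \<times> real \<Rightarrow> complex" where
  "evolution_op a b v = (\<lambda>z. partial_deriv (0, 1) v z + \<i> * first_order_op a b v z)"

definition time_slice ::
    "(real^'n::finite) set \<Rightarrow> real \<Rightarrow> ((real^'n) \<times> real) net set \<Rightarrow> (real^'n) net set" where
  "time_slice \<Omega> t = colombeau_lift \<Omega> (\<lambda>v x. v (x, t))"

definition cauchy_solution ::
    "(real^'n::finite) set \<Rightarrow> ('n \<Rightarrow> real \<times> (real^'n) \<Rightarrow> complex) \<Rightarrow>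
     (real \<times> (real^'n) \<Rightarrow> complex) \<Rightarrow> (real^'n) net set \<Rightarrow> ((real^'n) \<times> real) net set \<Rightarrow> bool"
  where
  "cauchy_solution \<Omega> a b g u \<longleftrightarrow>
     u \<in> colombeau (\<Omega> \<times> UNIV) \<and>
     colombeau_lift (\<Omega> \<times> UNIV) (evolution_op a b) u
       = colombeau_class (\<Omega> \<times> UNIV) (\<lambda>\<epsilon> z. 0) \<and>
     time_slice \<Omega> 0 u = g"

definition constant_outside_compact ::
    "(real^'n::finite) set \<Rightarrow> (real \<times> (real^'n) \<Rightarrow> complex) \<Rightarrow> bool" where
  "constant_outside_compact \<Omega> f \<longleftrightarrow>
     (\<exists>K. compact K \<and> K \<subseteq> \<Omega> \<and> f constant_on (UNIV \<times> (\<Omega> - K)))"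

text \<open>
  The function \<open>\<tau> + P\<^sub>1(t,x,\<xi>)\<close>; the real part only changes the type, since \<open>P\<^sub>1\<close> will be
  assumed to be real valued.
\<close>

definition char_function ::
    "('n::finite \<Rightarrow> real \<times> (real^'n) \<Rightarrow> complex) \<Rightarrow>
     ((real^'n) \<times> real) \<times> ((real^'n) \<times> real) \<Rightarrow> real" where
  "char_function a = (\<lambda>((x, t), (\<xi>, \<tau>)). \<tau> + Re (principal_symbol a t x \<xi>))"

definition bichar_curve ::
    "(real^'n::finite) set \<Rightarrow> ('n \<Rightarrow> real \<times> (real^'n) \<Rightarrow> complex) \<Rightarrow> (real^'n) \<Rightarrow> (real^'n) \<Rightarrow>
     (((real^'n) \<times> real) \<times> ((real^'n) \<times> real)) set" where
  "bichar_curve \<Omega> a x0 \<xi>0 =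
     bicharacteristic_through (\<Omega> \<times> UNIV) (char_function a)
       ((x0, 0), (\<xi>0, - Re (principal_symbol a 0 x0 \<xi>0)))"

end

theory Submission
  imports Defs "HOL-Probability.Probability"
begin

text \<open>
  Extend the coefficients smoothly by constants to all of space; then the characteristic field
  \<open>V = (a, 1)\<close> is globally Lipschitz in \<open>x\<close> and its flow gives smooth mutually inverse coordinates
  \<open>G(y, t)\<close> and \<open>(F, t)\<close>. Up to negligible errors the solution is
  \<open>u(G(y, t)) = e\<^bsup>-i\<beta>(y, t)\<^esup> g(y)\<close> with \<open>\<beta>\<close> the integral of the zeroth-order coefficient along the
  characteristic, provided that the characteristics do not cross the boundary of \<open>\<Omega>\<close>; this is
  exactly what the assumed uniqueness gives. So \<open>u\<close> is, up to a smooth nonvanishing factor, the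
  pullback of \<open>g\<close> by the submersion \<open>F\<close>, and conversely \<open>g\<close> is recovered from \<open>u \<circ> G\<close> by averaging
  over \<open>t\<close>. Regularity passes through a smooth map by Fourier inversion and non-stationary
  phase: \<open>\<phi> (w \<circ> F)\<close> decays near \<open>\<zeta>\<close> if \<open>w\<close> decays near every \<open>\<eta>\<close> with \<open>DF\<^sup>T \<eta> = \<zeta>\<close>. Finally
  \<open>s \<mapsto> (G(x, s), DF\<^sup>T \<xi>)\<close> is the bicharacteristic through \<open>(x, 0; \<xi>, -P\<^sub>1)\<close>.
\<close>

section \<open>Calculus of smooth functions\<close>

text \<open>The order \<open>N\<close> in \<open>microlocally_regular\<close> has to serve every
  \<open>l\<close> at once, while each further derivative of a moderate net may cost another power
  of 1/\<epsilon>. Hence the pullback estimates never differentiate the net: it enters linearly,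
  through bounds on the Fourier transform of a localization, and all decay produced on the way comes
  from fixed maps and cut-offs. Solution and transported data are compared in the supremum norm on
  compact sets; decay is recovered by playing the negligible error off against the moderate bound. A
  second obstacle is that the equation, the initial value and the regularity may each be witnessed
  by a different representative, so all of these have to be compared. Covectors \<zeta> that do not
  annihilate \<open>V\<close> lie outside the range of the transpose of \<open>DF\<close>. They are
  covered by the same pullback lemma with an empty cone for the data, which is why the wave front
  set of \<open>u\<close> stays in the characteristic set. Uniqueness directly excludes only
  characteristics that enter \<Omega>. That none leaves \<Omega> follows because the field outside
  \<open>K\<close> is one constant for all times, so that an exit could be shifted in time into an
  entrance.\<close>

primrec ndiff :: "nat \<Rightarrow> 'a::euclidean_space set \<Rightarrow> ('a \<Rightarrow> 'b::real_normed_vector) \<Rightarrow> bool" where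
  "ndiff 0 X f \<longleftrightarrow> continuous_on X f"
| "ndiff (Suc k) X f \<longleftrightarrow>
     (\<forall>x\<in>X. f differentiable (at x)) \<and> (\<forall>b\<in>Basis. ndiff k X (partial_deriv b f))"

lemma has_derivative_cong_open:
  assumes "open X" "x \<in> X" "\<And>y. y \<in> X \<Longrightarrow> f y = g y"
  shows "(f has_derivative D) (at x) \<longleftrightarrow> (g has_derivative D) (at x)"
  using has_derivative_transform_within_open[OF _ assms(1,2), of f D UNIV g]
    has_derivative_transform_within_open[OF _ assms(1,2), of g D UNIV f] assms(3) by auto

lemma partial_deriv_cong_open:
  assumes "open X" "x \<in> X" "\<And>y. y \<in> X \<Longrightarrow> f y = g y"
  shows "partial_deriv b f x = partial_deriv b g x"
  unfolding partial_deriv_def frechet_derivative_def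
  using has_derivative_cong_open[OF assms] by simp

lemma partial_deriv_eq:
  "(f has_derivative D) (at x) \<Longrightarrow> partial_deriv b f x = D b"
  unfolding partial_deriv_def using frechet_derivative_at by metis

lemma ndiff_cong:
  assumes "open X" "\<And>x. x \<in> X \<Longrightarrow> f x = g x"
  shows "ndiff k X f \<longleftrightarrow> ndiff k X g"
  using assms(2)
proof (induction k arbitrary: f g)
  case 0
  then show ?case by (simp cong: continuous_on_cong)
next
  case (Suc k)
  have "f differentiable (at x) \<longleftrightarrow> g differentiable (at x)" if "x \<in> X" for x
    unfolding differentiable_def by (intro ex_cong1 has_derivative_cong_open[OF assms(1) that Suc.prems])
  moreover have "ndiff k X (partial_deriv b f) \<longleftrightarrow> ndiff k X (partial_deriv b g)" for b
    by (rule Suc.IH) (rule partial_deriv_cong_open[OF assms(1) _ Suc.prems])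
  ultimately show ?case by simp
qed

lemma ndiff_SucD: "ndiff (Suc k) X f \<Longrightarrow> ndiff k X f"
proof (induction k arbitrary: f)
  case 0
  then show ?case
    by (auto intro!: continuous_at_imp_continuous_on differentiable_imp_continuous_within)
qed simp

lemma ndiff_continuous: "ndiff k X f \<Longrightarrow> continuous_on X f"
  by (induction k) (use ndiff_SucD in auto)

lemma ndiff_has_derivative:
  "ndiff (Suc k) X f \<Longrightarrow> x \<in> X \<Longrightarrow> (f has_derivative frechet_derivative f (at x)) (at x)"
  by (simp add: frechet_derivative_works)

text \<open>Inductions on the order go through this rule: any formula for the derivative that is
  valid on the open set may replace the abstract \<open>frechet_derivative\<close>.\<close>

lemma ndiff_SucI:
  assumes "open X" "\<And>x. x \<in> X \<Longrightarrow> (f has_derivative f' x) (at x)"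
    "\<And>b. b \<in> Basis \<Longrightarrow> ndiff k X (\<lambda>x. f' x b)"
  shows "ndiff (Suc k) X f"
proof -
  have "ndiff k X (partial_deriv b f)" if "b \<in> Basis" for b
    using ndiff_cong[OF assms(1), of "partial_deriv b f" "\<lambda>x. f' x b"]
      partial_deriv_eq[OF assms(2)] assms(3)[OF that] by auto
  then show ?thesis using assms(2) by (auto simp: differentiable_def)
qed

section \<open>Closure of finite differentiability under algebra and composition\<close>

lemma ndiff_const: "ndiff k X (\<lambda>x. c)"
proof (induction k arbitrary: c)
  case (Suc k)
  have "partial_deriv b (\<lambda>x. c) = (\<lambda>x. 0)" for b :: 'a
    by (rule ext) (rule partial_deriv_eq, rule has_derivative_const)
  then show ?case using Suc by simp
qed simp

lemma ndiff_bounded_linear: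
  assumes "open X" "bounded_linear L" "ndiff k X f"
  shows "ndiff k X (\<lambda>x. L (f x))"
  using assms(3)
proof (induction k arbitrary: f)
  case 0
  then show ?case using assms(2)
    by (simp add: bounded_linear.continuous_on)
next
  case (Suc k)
  show ?case
  proof (rule ndiff_SucI[OF assms(1)])
    show "((\<lambda>x. L (f x)) has_derivative (\<lambda>h. L (frechet_derivative f (at x) h))) (at x)" if "x \<in> X" for x
      using bounded_linear.has_derivative[OF assms(2) ndiff_has_derivative[OF Suc.prems that]] .
    show "ndiff k X (\<lambda>x. L (frechet_derivative f (at x) b))" if "b \<in> Basis" for b
      using Suc.IH[of "partial_deriv b f"] Suc.prems that by (simp add: partial_deriv_def[abs_def])
  qed
qed

lemma ndiff_add:
  assumes "open X" "ndiff k X f" "ndiff k X g"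
  shows "ndiff k X (\<lambda>x. f x + g x)"
  using assms(2,3)
proof (induction k arbitrary: f g)
  case 0
  then show ?case by (simp add: continuous_on_add)
next
  case (Suc k)
  show ?case
  proof (rule ndiff_SucI[OF assms(1)])
    show "((\<lambda>x. f x + g x) has_derivative
        (\<lambda>h. frechet_derivative f (at x) h + frechet_derivative g (at x) h)) (at x)" if "x \<in> X" for x
      by (intro has_derivative_add ndiff_has_derivative[OF Suc.prems(1) that]
          ndiff_has_derivative[OF Suc.prems(2) that])
    show "ndiff k X (\<lambda>x. frechet_derivative f (at x) b + frechet_derivative g (at x) b)"
      if "b \<in> Basis" for b
      using Suc.IH[of "partial_deriv b f" "partial_deriv b g"] Suc.prems that
      by (simp add: partial_deriv_def[abs_def])
  qed
qed

lemma ndiff_minus: "open X \<Longrightarrow> ndiff k X f \<Longrightarrow> ndiff k X (\<lambda>x. - f x)"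
  by (rule ndiff_bounded_linear[OF _ bounded_linear_minus[OF bounded_linear_ident]])

lemma ndiff_diff:
  "open X \<Longrightarrow> ndiff k X f \<Longrightarrow> ndiff k X g \<Longrightarrow> ndiff k X (\<lambda>x. f x - g x)"
  using ndiff_add[OF _ _ ndiff_minus, of X k f g] by simp

lemma ndiff_sum:
  assumes "open X" "\<And>i. i \<in> I \<Longrightarrow> ndiff k X (f i)"
  shows "ndiff k X (\<lambda>x. \<Sum>i\<in>I. f i x)"
  using assms(2)
  by (induction I rule: infinite_finite_induct) (auto intro: ndiff_const ndiff_add[OF assms(1)])

lemma ndiff_bilinear:
  assumes "open X" "bounded_bilinear P" "ndiff k X f" "ndiff k X g"
  shows "ndiff k X (\<lambda>x. P (f x) (g x))"
  using assms(3,4)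
proof (induction k arbitrary: f g)
  case 0
  then show ?case using bounded_bilinear.continuous_on[OF assms(2)] by auto
next
  case (Suc k)
  show ?case
  proof (rule ndiff_SucI[OF assms(1)])
    show "((\<lambda>x. P (f x) (g x)) has_derivative
        (\<lambda>h. P (f x) (frechet_derivative g (at x) h) + P (frechet_derivative f (at x) h) (g x))) (at x)"
      if "x \<in> X" for x
      by (intro bounded_bilinear.FDERIV[OF assms(2)] ndiff_has_derivative[OF Suc.prems(1) that]
          ndiff_has_derivative[OF Suc.prems(2) that])
    show "ndiff k X (\<lambda>x. P (f x) (frechet_derivative g (at x) b)
        + P (frechet_derivative f (at x) b) (g x))" if "b \<in> Basis" for b
      using Suc.IH[of "partial_deriv b f" g] Suc.IH[of f "partial_deriv b g"]
        Suc.prems ndiff_SucD[OF Suc.prems(1)] ndiff_SucD[OF Suc.prems(2)] that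
      by (intro ndiff_add[OF assms(1)]) (simp_all add: partial_deriv_def[abs_def])
  qed
qed

lemmas ndiff_mult = ndiff_bilinear[OF _ bounded_bilinear_mult]
  and ndiff_scaleR = ndiff_bilinear[OF _ bounded_bilinear_scaleR]
  and ndiff_inner = ndiff_bilinear[OF _ bounded_bilinear_inner]
  and ndiff_blinfun_apply = ndiff_bilinear[OF _ bounded_bilinear_blinfun_apply]

lemma ndiff_ident: assumes "open X" shows "ndiff k X (\<lambda>x. x)"
proof (cases k)
  case (Suc j)
  show ?thesis unfolding Suc
    by (rule ndiff_SucI[OF assms, where f' = "\<lambda>x h. h"]) (auto intro: ndiff_const)
qed simp

lemmas ndiff_linear = ndiff_bounded_linear[OF _ _ ndiff_ident]

lemma has_derivative_sum_Basis:
  assumes "(f has_derivative D) (at x)"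
  shows "D v = (\<Sum>b\<in>Basis. (v \<bullet> b) *\<^sub>R D b)"
proof -
  have "linear D" using assms has_derivative_linear by blast
  then have "D (\<Sum>b\<in>Basis. (v \<bullet> b) *\<^sub>R b) = (\<Sum>b\<in>Basis. (v \<bullet> b) *\<^sub>R D b)"
    by (simp add: linear_sum linear_cmul)
  then show ?thesis by (simp add: euclidean_representation)
qed

lemma ndiff_partial_deriv_any:
  assumes "open X" "ndiff (Suc k) X f"
  shows "ndiff k X (partial_deriv v f)"
proof -
  have "ndiff k X (\<lambda>x. \<Sum>b\<in>Basis. (v \<bullet> b) *\<^sub>R partial_deriv b f x)"
    using assms by (intro ndiff_sum ndiff_bounded_linear[OF _ bounded_linear_scaleR_right]) auto
  moreover have "partial_deriv v f x = (\<Sum>b\<in>Basis. (v \<bullet> b) *\<^sub>R partial_deriv b f x)" if "x \<in> X" for x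
    unfolding partial_deriv_def
    by (rule has_derivative_sum_Basis[OF ndiff_has_derivative[OF assms(2) that]])
  ultimately show ?thesis using ndiff_cong[OF assms(1)] by (metis (no_types, lifting))
qed

lemma ndiff_compose:
  fixes f :: "'b::euclidean_space \<Rightarrow> 'c::real_normed_vector" and G :: "'a::euclidean_space \<Rightarrow> 'b"
  assumes X: "open X" and Y: "open Y" and GY: "\<And>x. x \<in> X \<Longrightarrow> G x \<in> Y"
    and "ndiff k Y f" "ndiff k X G"
  shows "ndiff k X (\<lambda>x. f (G x))"
  using assms(4,5)
proof (induction k arbitrary: f)
  case 0
  then show ?case using GY continuous_on_compose2[of Y f X G] by auto
next
  case (Suc k)
  note dG = ndiff_has_derivative[OF Suc.prems(2)]
  note df = ndiff_has_derivative[OF Suc.prems(1) GY]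
  show ?case
  proof (rule ndiff_SucI[OF assms(1)])
    show "((\<lambda>x. f (G x)) has_derivative
        (\<lambda>h. frechet_derivative f (at (G x)) (frechet_derivative G (at x) h))) (at x)" if "x \<in> X" for x
      using has_derivative_compose[OF dG[OF that] df[OF that]] .
    fix b :: 'a assume b: "b \<in> Basis"
    \<comment> \<open>The chain rule in coordinates: the inner map contributes scalar factors of
      order \<open>k\<close>, and the induction hypothesis applies to the partial derivatives of
      \<open>f\<close> composed with the unchanged \<open>G\<close>.\<close>
    have "ndiff k X (\<lambda>x. \<Sum>c\<in>Basis. (partial_deriv b G x \<bullet> c) *\<^sub>R partial_deriv c f (G x))"
      using Suc.prems b ndiff_SucD[OF Suc.prems(2)]
      by (intro ndiff_sum X ndiff_scaleR ndiff_bounded_linear[OF X bounded_linear_inner_left] Suc.IH) auto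
    moreover have "frechet_derivative f (at (G x)) (frechet_derivative G (at x) b)
        = (\<Sum>c\<in>Basis. (partial_deriv b G x \<bullet> c) *\<^sub>R partial_deriv c f (G x))" if "x \<in> X" for x
      unfolding partial_deriv_def by (rule has_derivative_sum_Basis[OF df[OF that]])
    ultimately show "ndiff k X (\<lambda>x. frechet_derivative f (at (G x)) (frechet_derivative G (at x) b))"
      using ndiff_cong[OF X] by (metis (no_types, lifting))
  qed
qed

lemma ndiff_Pair:
  assumes "open X" "ndiff k X f" "ndiff k X g"
  shows "ndiff k X (\<lambda>x. (f x, g x))"
proof -
  have "ndiff k X (\<lambda>x. (f x, 0) + (0, g x))"
    using assms by (intro ndiff_add ndiff_bounded_linear[where L = "\<lambda>y. (y, 0)"]
        ndiff_bounded_linear[where L = "\<lambda>y. (0, y)"])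
      (auto intro: bounded_linear_Pair bounded_linear_ident bounded_linear_zero)
  then show ?thesis by simp
qed

text \<open>In finite dimension \<open>L x\<close> is the sum of the rank-one operators
  \<open>T b (L x b)\<close>, and \<open>T b\<close> is bounded linear, so regularity in operator
  norm can be tested on basis vectors. This makes derivative matrices usable as coefficients of
  linear differential equations.\<close>

lemma ndiff_blinfun:
  fixes L :: "'p::euclidean_space \<Rightarrow> ('a::euclidean_space \<Rightarrow>\<^sub>L 'b::real_normed_vector)"
  assumes X: "open X" and "\<And>b. b \<in> Basis \<Longrightarrow> ndiff k X (\<lambda>x. blinfun_apply (L x) b)"
  shows "ndiff k X L"
proof -
  define T where "T b y = Blinfun (\<lambda>h. (h \<bullet> b) *\<^sub>R y)" for b :: 'a and y :: 'b
  have Tapp: "blinfun_apply (T b y) h = (h \<bullet> b) *\<^sub>R y" for b y h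
    unfolding T_def by (subst bounded_linear_Blinfun_apply)
      (auto intro: bounded_linear_compose[OF bounded_linear_scaleR_left bounded_linear_inner_left])
  have T: "bounded_linear (T b)" for b
  proof (rule bounded_linear_intro)
    show "norm (T b y) \<le> norm y * norm b" for y
    proof (rule norm_blinfun_bound)
      fix h
      have "\<bar>h \<bullet> b\<bar> * norm y \<le> (norm h * norm b) * norm y"
        by (intro mult_right_mono Cauchy_Schwarz_ineq2) auto
      then show "norm (T b y h) \<le> norm y * norm b * norm h" by (simp add: Tapp mult_ac)
    qed auto
  qed (auto intro!: blinfun_eqI simp: Tapp blinfun.bilinear_simps scaleR_add_right)
  have "L x = (\<Sum>b\<in>Basis. T b (L x b))" for x
  proof (rule blinfun_eqI)
    fix h
    have "L x h = L x (\<Sum>b\<in>Basis. (h \<bullet> b) *\<^sub>R b)" by (simp add: euclidean_representation)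
    then show "L x h = (\<Sum>b\<in>Basis. T b (L x b)) h"
      by (simp add: blinfun.sum_left Tapp blinfun.sum_right blinfun.scaleR_right)
  qed
  moreover have "ndiff k X (\<lambda>x. \<Sum>b\<in>Basis. T b (L x b))"
    by (intro ndiff_sum X ndiff_bounded_linear[OF X T] assms(2))
  ultimately show ?thesis by simp
qed

lemma iter_partial_append: "iter_partial (as @ bs) f = iter_partial as (iter_partial bs f)"
  by (induction as) auto

text \<open>\<open>smooth_on\<close> speaks of words of derivatives, \<open>ndiff\<close> of an
  order to induct on. The former peels off the outermost derivative and the latter the innermost,
  hence \<open>bs @ [b]\<close> and the reverse induction.\<close>

lemma smooth_on_iff_ndiff:
  assumes "open X" shows "smooth_on X f \<longleftrightarrow> (\<forall>k. ndiff k X f)"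
proof
  have "ndiff k X f" if "smooth_on X f" for k
    using that
  proof (induction k arbitrary: f)
    case 0
    then have "\<forall>x\<in>X. f differentiable (at x)" unfolding smooth_on_def by (auto dest: spec[of _ "[]"])
    then show ?case
      by (auto intro!: continuous_at_imp_continuous_on differentiable_imp_continuous_within)
  next
    case (Suc k)
    have "smooth_on X (partial_deriv b f)" if "b \<in> Basis" for b
      unfolding smooth_on_def
    proof (intro allI impI)
      fix bs :: "'a list" assume "set bs \<subseteq> Basis"
      then show "\<forall>x\<in>X. iter_partial bs (partial_deriv b f) differentiable at x"
        using Suc.prems[unfolded smooth_on_def, rule_format, of "bs @ [b]"] that
        by (simp add: iter_partial_append)
    qed
    moreover have "\<forall>x\<in>X. f differentiable (at x)"
      using Suc.prems unfolding smooth_on_def by (auto dest: spec[of _ "[]"])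
    ultimately show ?case using Suc.IH by auto
  qed
  then show "smooth_on X f \<Longrightarrow> \<forall>k. ndiff k X f" by blast
next
  assume f: "\<forall>k. ndiff k X f"
  have "ndiff k X (iter_partial bs f)" if "set bs \<subseteq> Basis" "\<forall>k. ndiff k X f" for k bs
    using that
  proof (induction bs arbitrary: f k rule: rev_induct)
    case (snoc b bs)
    have "\<forall>k. ndiff k X (partial_deriv b f)"
      using snoc.prems by (metis ndiff.simps(2) in_set_conv_decomp subsetD)
    then show ?case using snoc.IH[of "partial_deriv b f"] snoc.prems
      by (simp add: iter_partial_append)
  qed simp
  from this[of _ "Suc 0"] f show "smooth_on X f" unfolding smooth_on_def by auto
qed

section \<open>Smooth functions on open sets\<close>

lemma smooth_on_ndiff: "open X \<Longrightarrow> smooth_on X f \<Longrightarrow> ndiff k X f"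
  by (simp add: smooth_on_iff_ndiff)

lemma smooth_on_cong: "open X \<Longrightarrow> (\<And>x. x \<in> X \<Longrightarrow> f x = g x) \<Longrightarrow> smooth_on X f \<longleftrightarrow> smooth_on X g"
  by (simp add: smooth_on_iff_ndiff cong: ndiff_cong)

lemma smooth_on_subset: "smooth_on X f \<Longrightarrow> Y \<subseteq> X \<Longrightarrow> smooth_on Y f"
  unfolding smooth_on_def by blast

lemma smooth_on_imp_continuous: "open X \<Longrightarrow> smooth_on X f \<Longrightarrow> continuous_on X f"
  using smooth_on_ndiff[of X f 0] by simp

lemma smooth_on_has_derivative:
  "smooth_on X f \<Longrightarrow> x \<in> X \<Longrightarrow> (f has_derivative frechet_derivative f (at x)) (at x)"
  unfolding smooth_on_def by (auto dest: spec[of _ "[]"] simp: frechet_derivative_works)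

lemma smooth_on_Un:
  assumes "smooth_on X f" "smooth_on Y f" shows "smooth_on (X \<union> Y) f"
  using assms unfolding smooth_on_def by blast

context
  fixes X :: "'a::euclidean_space set"
  assumes X: "open X"
begin

lemma smooth_on_const: "smooth_on X (\<lambda>x. c)"
  by (simp add: smooth_on_iff_ndiff[OF X] ndiff_const)

lemma smooth_on_ident: "smooth_on X (\<lambda>x. x)"
  by (simp add: smooth_on_iff_ndiff[OF X] ndiff_ident[OF X])

lemma smooth_on_bounded_linear: "bounded_linear L \<Longrightarrow> smooth_on X f \<Longrightarrow> smooth_on X (\<lambda>x. L (f x))"
  by (simp add: smooth_on_iff_ndiff[OF X] ndiff_bounded_linear[OF X])

lemma smooth_on_add: "smooth_on X f \<Longrightarrow> smooth_on X g \<Longrightarrow> smooth_on X (\<lambda>x. f x + g x)"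
  by (simp add: smooth_on_iff_ndiff[OF X] ndiff_add[OF X])

lemma smooth_on_minus: "smooth_on X f \<Longrightarrow> smooth_on X (\<lambda>x. - f x)"
  by (simp add: smooth_on_iff_ndiff[OF X] ndiff_minus[OF X])

lemma smooth_on_diff: "smooth_on X f \<Longrightarrow> smooth_on X g \<Longrightarrow> smooth_on X (\<lambda>x. f x - g x)"
  by (simp add: smooth_on_iff_ndiff[OF X] ndiff_diff[OF X])

lemma smooth_on_sum: "(\<And>i. i \<in> I \<Longrightarrow> smooth_on X (f i)) \<Longrightarrow> smooth_on X (\<lambda>x. \<Sum>i\<in>I. f i x)"
  by (simp add: smooth_on_iff_ndiff[OF X] ndiff_sum[OF X])

lemma smooth_on_bilinear:
  "bounded_bilinear P \<Longrightarrow> smooth_on X f \<Longrightarrow> smooth_on X g \<Longrightarrow> smooth_on X (\<lambda>x. P (f x) (g x))"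
  by (simp add: smooth_on_iff_ndiff[OF X] ndiff_bilinear[OF X])

lemma smooth_on_mult:
  fixes f :: "'a \<Rightarrow> 'b::real_normed_algebra"
  shows "smooth_on X f \<Longrightarrow> smooth_on X g \<Longrightarrow> smooth_on X (\<lambda>x. f x * g x)"
  by (rule smooth_on_bilinear[OF bounded_bilinear_mult])

lemma smooth_on_scaleR: "smooth_on X f \<Longrightarrow> smooth_on X g \<Longrightarrow> smooth_on X (\<lambda>x. f x *\<^sub>R g x)"
  by (rule smooth_on_bilinear[OF bounded_bilinear_scaleR])

lemma smooth_on_inner:
  fixes f :: "'a \<Rightarrow> 'b::real_inner"
  shows "smooth_on X f \<Longrightarrow> smooth_on X g \<Longrightarrow> smooth_on X (\<lambda>x. f x \<bullet> g x)"
  by (rule smooth_on_bilinear[OF bounded_bilinear_inner])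

lemma smooth_on_Pair: "smooth_on X f \<Longrightarrow> smooth_on X g \<Longrightarrow> smooth_on X (\<lambda>x. (f x, g x))"
  by (simp add: smooth_on_iff_ndiff[OF X] ndiff_Pair[OF X])

lemma smooth_on_partial_deriv: "smooth_on X f \<Longrightarrow> smooth_on X (partial_deriv v f)"
  by (simp add: smooth_on_iff_ndiff[OF X] ndiff_partial_deriv_any[OF X] del: ndiff.simps)

lemma smooth_on_compose:
  fixes G :: "'a \<Rightarrow> 'b::euclidean_space"
  shows "open Y \<Longrightarrow> smooth_on Y f \<Longrightarrow> smooth_on X G \<Longrightarrow> (\<And>x. x \<in> X \<Longrightarrow> G x \<in> Y)
    \<Longrightarrow> smooth_on X (\<lambda>x. f (G x))"
  by (simp add: smooth_on_iff_ndiff X ndiff_compose[OF X])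

end

text \<open>Induction on the order for all members of \<open>Q\<close> simultaneously; it serves for
  an explicit family that reproduces itself under differentiation, such as the multiples of
  \<open>exp\<close>.\<close>

lemma smooth_on_coinduct:
  assumes "open X" "Q f" and step: "\<And>f. Q f \<Longrightarrow> \<exists>f'. (\<forall>x\<in>X. (f has_derivative f' x) (at x))
      \<and> (\<forall>b\<in>Basis. \<exists>g. Q g \<and> (\<forall>x\<in>X. f' x b = g x))"
  shows "smooth_on X f"
proof -
  have "ndiff k X f" for k
    using assms(2)
  proof (induction k arbitrary: f)
    case 0
    obtain f' where "\<forall>x\<in>X. (f has_derivative f' x) (at x)" using step[OF 0] by blast
    then show ?case
      by (auto intro!: continuous_at_imp_continuous_on has_derivative_continuous)
  next
    case (Suc k)
    obtain f' where f': "\<And>x. x \<in> X \<Longrightarrow> (f has_derivative f' x) (at x)"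
        "\<And>b. b \<in> Basis \<Longrightarrow> \<exists>g. Q g \<and> (\<forall>x\<in>X. f' x b = g x)" using step[OF Suc.prems] by blast
    show ?case
    proof (rule ndiff_SucI[OF assms(1) f'(1)])
      fix b :: 'a assume "b \<in> Basis"
      then obtain g where "Q g" "\<forall>x\<in>X. f' x b = g x" using f'(2) by blast
      then show "ndiff k X (\<lambda>x. f' x b)" using Suc.IH[of g] ndiff_cong[OF assms(1), of _ g] by metis
    qed
  qed
  then show ?thesis by (simp add: smooth_on_iff_ndiff[OF assms(1)])
qed

lemma smooth_on_exp: "open X \<Longrightarrow> smooth_on X (exp :: complex \<Rightarrow> complex)"
proof (rule smooth_on_coinduct[where Q = "\<lambda>f. \<exists>c. f = (\<lambda>x. c * exp x)"])
  show "\<exists>f'. (\<forall>x\<in>X. (f has_derivative f' x) (at x)) \<and>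
        (\<forall>b\<in>Basis. \<exists>g. (\<exists>c. g = (\<lambda>x. c * exp x)) \<and> (\<forall>x\<in>X. f' x b = g x))"
    if "\<exists>c. f = (\<lambda>x. c * exp x)" for f :: "complex \<Rightarrow> complex"
  proof -
    from that obtain c where f: "f = (\<lambda>x. c * exp x)" by blast
    have "(f has_derivative (\<lambda>h. c * (h * exp x))) (at x)" for x
      unfolding f by (auto intro!: derivative_eq_intros)
    then show ?thesis
      by (intro exI[of _ "\<lambda>x h. c * (h * exp x)"])
        (auto intro!: exI[of _ "c * _"] exI[of _ "\<lambda>x. c * _ * exp x"] simp: mult.assoc)
  qed
qed (auto intro: exI[of _ 1])

lemma smooth_on_inverse:
  assumes "open X" "smooth_on X f" "\<And>x. x \<in> X \<Longrightarrow> f x \<noteq> 0"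
  shows "smooth_on X (\<lambda>x. inverse (f x) :: 'b::real_normed_field)"
proof -
  have "ndiff k X (\<lambda>x. inverse (f x))" for k
  proof (induction k)
    case 0
    then show ?case using smooth_on_imp_continuous[OF assms(1,2)] assms(3)
      by (auto intro: continuous_intros)
  next
    case (Suc k)
    show ?case
    proof (rule ndiff_SucI[OF assms(1)])
      show "((\<lambda>x. inverse (f x)) has_derivative
          (\<lambda>h. - (inverse (f x) * frechet_derivative f (at x) h * inverse (f x)))) (at x)" if "x \<in> X" for x
        using that assms by (intro Deriv.has_derivative_inverse smooth_on_has_derivative) auto
      show "ndiff k X (\<lambda>x. - (inverse (f x) * frechet_derivative f (at x) b * inverse (f x)))" for b
        using ndiff_partial_deriv_any[OF assms(1) smooth_on_ndiff[OF assms(1,2)], of k b]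
        unfolding partial_deriv_def
        by (intro ndiff_minus ndiff_mult Suc assms(1))
    qed
  qed
  then show ?thesis by (simp add: smooth_on_iff_ndiff[OF assms(1)])
qed

lemma smooth_on_cexp:
  assumes "open X" "smooth_on X f" shows "smooth_on X (\<lambda>x. exp (f x) :: complex)"
  by (rule smooth_on_compose[OF assms(1) open_UNIV smooth_on_exp assms(2)]) auto

lemma smooth_on_of_real:
  "open X \<Longrightarrow> smooth_on X f \<Longrightarrow> smooth_on X (\<lambda>x. complex_of_real (f x))"
  by (rule smooth_on_bounded_linear[OF _ bounded_linear_of_real])

text \<open>The open sets \<open>U\<close> and \<open>- K\<close> cover the space, and on the second
  one the function is identically zero.\<close>

lemma smooth_on_zero_extension:
  assumes "open U" "closed K" "K \<subseteq> U" "smooth_on U f" "\<And>x. x \<notin> K \<Longrightarrow> f x = 0"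
  shows "smooth_on UNIV f"
proof -
  have "smooth_on (- K) f"
    using smooth_on_cong[of "- K" f "\<lambda>x. 0"] smooth_on_const[of "- K"] assms by auto
  then show ?thesis using smooth_on_Un[OF assms(4), of "- K"] assms(3) by (simp add: Un_absorb1 double_compl
      Compl_partition sup.absorb2 Compl_subset_Compl_iff) (metis Compl_partition2 assms(3) smooth_on_subset subset_UNIV Un_mono order_refl sup_commute)
qed

section \<open>Ordinary differential equations with parameters\<close>

text \<open>This is the integral of \<open>f\<close> from 0 to \<open>s\<close>. Rescaling to
  \<open>{0..1}\<close> avoids a case distinction on the sign of \<open>s\<close>, and makes
  continuity in \<open>s\<close> and in parameters a statement about integrals over a fixed
  interval.\<close>

definition line_int :: "(real \<Rightarrow> 'b::banach) \<Rightarrow> real \<Rightarrow> 'b" where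
  "line_int f s = integral {0..1} (\<lambda>\<sigma>. s *\<^sub>R f (\<sigma> * s))"

lemma line_int_zero: "line_int f 0 = 0"
  by (simp add: line_int_def)

lemma line_int_integrable:
  fixes f :: "real \<Rightarrow> 'b::banach"
  assumes "continuous_on UNIV f" shows "(\<lambda>\<sigma>. s *\<^sub>R f (\<sigma> * s)) integrable_on {0..1::real}"
proof (rule integrable_continuous_interval)
  have "continuous_on {0..1} (\<lambda>\<sigma>. f (\<sigma> * s))"
    by (rule continuous_on_compose2[OF assms]) (auto intro!: continuous_intros)
  then show "continuous_on {0..1} (\<lambda>\<sigma>. s *\<^sub>R f (\<sigma> * s))" by (intro continuous_intros)
qed

text \<open>On an interval around both 0 and \<open>s\<close> there is an antiderivative
  \<open>Q\<close>, and the fundamental theorem for \<sigma> \<mapsto>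
  \<open>Q (\<sigma> * r)\<close> identifies the rescaled integral with
  \<open>Q r - Q 0\<close>.\<close>

lemma has_vector_derivative_line_int:
  assumes f: "continuous_on UNIV f"
  shows "(line_int f has_vector_derivative f s) (at s)"
proof -
  define n where "n = \<bar>s\<bar> + 1"
  define Q where "Q r = integral {-n..r} f" for r
  have Qd: "(Q has_vector_derivative f r) (at r)" if "\<bar>r\<bar> < n" for r
  proof -
    have "(Q has_vector_derivative f r) (at r within {-n..n})"
      unfolding Q_def using that
      by (intro integral_has_vector_derivative continuous_on_subset[OF f]) auto
    moreover have "at r within {-n..n} = at r"
      using that by (intro at_within_interior) auto
    ultimately show ?thesis by simp
  qed
  have eq: "line_int f r = Q r - Q 0" if r: "\<bar>r\<bar> < n" for r
  proof -
    have h: "((\<lambda>\<sigma>. r *\<^sub>R f (\<sigma> * r)) has_integral (Q (1 * r) - Q (0 * r))) {0..1}"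
    proof (rule fundamental_theorem_of_calculus)
      fix \<sigma> :: real assume \<sigma>: "\<sigma> \<in> {0..1}"
      have "\<bar>\<sigma> * r\<bar> \<le> \<bar>r\<bar>" using \<sigma> by (simp add: abs_mult mult_left_le_one_le)
      then have "\<bar>\<sigma> * r\<bar> < n" using r by simp
      moreover have "((\<lambda>\<sigma>. \<sigma> * r) has_vector_derivative r) (at \<sigma>)"
        by (auto intro!: derivative_eq_intros simp: has_real_derivative_iff_has_vector_derivative[symmetric])
      ultimately have "((Q \<circ> (\<lambda>\<sigma>. \<sigma> * r)) has_vector_derivative r *\<^sub>R f (\<sigma> * r)) (at \<sigma>)"
        using vector_diff_chain_at[of "\<lambda>\<sigma>. \<sigma> * r" r \<sigma> Q] Qd by blast
      then show "((\<lambda>\<sigma>. Q (\<sigma> * r)) has_vector_derivative r *\<^sub>R f (\<sigma> * r)) (at \<sigma> within {0..1})"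
        by (simp add: comp_def has_vector_derivative_at_within)
    qed simp
    show ?thesis unfolding line_int_def integral_unique[OF h] by simp
  qed
  have "((\<lambda>r. Q r - Q 0) has_vector_derivative f s) (at s)"
    using Qd[of s] by (auto simp: n_def intro!: derivative_eq_intros)
  then show ?thesis
    using eq has_vector_derivative_transform_within_open[of "\<lambda>r. Q r - Q 0" "f s" s "ball 0 n" "line_int f"]
    by (auto simp: n_def dist_real_def)
qed

text \<open>Each integration gains one power of \<open>s\<close> and a factor 1/(k+1); repeated,
  this yields the factorials in the Picard iteration.\<close>

lemma line_int_bound_power:
  assumes "continuous_on UNIV f" "\<And>r. \<bar>r\<bar> \<le> \<bar>s\<bar> \<Longrightarrow> norm (f r) \<le> c * \<bar>r\<bar> ^ k"
  shows "norm (line_int f s) \<le> c * \<bar>s\<bar> ^ Suc k / real (Suc k)"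
proof -
  have I: "((\<lambda>\<sigma>. c * \<bar>s\<bar> ^ Suc k * \<sigma> ^ k) has_integral (c * \<bar>s\<bar> ^ Suc k / real (Suc k))) {0..1}"
  proof -
    have "((\<lambda>\<sigma>. \<sigma> ^ k) has_integral (1 ^ Suc k / real (Suc k) - 0 ^ Suc k / real (Suc k))) {0..1::real}"
      by (rule fundamental_theorem_of_calculus)
        (auto intro!: derivative_eq_intros simp: has_real_derivative_iff_has_vector_derivative[symmetric]
          simp del: power_Suc)
    from has_integral_mult_right[OF this, of "c * \<bar>s\<bar> ^ Suc k"] show ?thesis by simp
  qed
  have "norm (integral {0..1} (\<lambda>\<sigma>. s *\<^sub>R f (\<sigma> * s))) \<le> integral {0..1} (\<lambda>\<sigma>. c * \<bar>s\<bar> ^ Suc k * \<sigma> ^ k)"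
  proof (rule integral_norm_bound_integral[OF line_int_integrable[OF assms(1)]])
    fix \<sigma> :: real assume \<sigma>: "\<sigma> \<in> {0..1}"
    then have "\<bar>\<sigma> * s\<bar> \<le> \<bar>s\<bar>" by (simp add: abs_mult mult_left_le_one_le)
    from assms(2)[OF this] have "\<bar>s\<bar> * norm (f (\<sigma> * s)) \<le> \<bar>s\<bar> * (c * \<bar>\<sigma> * s\<bar> ^ k)"
      by (intro mult_left_mono) auto
    then show "norm (s *\<^sub>R f (\<sigma> * s)) \<le> c * \<bar>s\<bar> ^ Suc k * \<sigma> ^ k"
      using \<sigma> by (simp add: abs_mult power_mult_distrib mult_ac)
  qed (use I in auto)
  then show ?thesis unfolding line_int_def integral_unique[OF I] .
qed

lemma line_int_diff:
  assumes "continuous_on UNIV f" "continuous_on UNIV g"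
  shows "line_int f s - line_int g s = line_int (\<lambda>r. f r - g r) s"
  unfolding line_int_def scaleR_diff_right
  by (rule Henstock_Kurzweil_Integration.integral_diff[symmetric]) (intro line_int_integrable assms)+

lemma continuous_on_line_int_param:
  fixes f :: "real \<Rightarrow> 'p::topological_space \<Rightarrow> 'b::banach"
  assumes "continuous_on UNIV (\<lambda>(r, p). f r p)"
  shows "continuous_on UNIV (\<lambda>(s, p). line_int (\<lambda>r. f r p) s)"
proof -
  have "continuous_on UNIV (\<lambda>x. integral (cbox 0 1) (\<lambda>\<sigma>. fst x *\<^sub>R f (\<sigma> * fst x) (snd x)))"
  proof (rule integral_continuous_on_param)
    have "continuous_on (UNIV \<times> cbox 0 1) (\<lambda>x. (case (snd x * fst (fst x), snd (fst x)) of (r, p) \<Rightarrow> f r p))"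
      by (rule continuous_on_compose2[OF assms]) (auto intro!: continuous_intros)
    then show "continuous_on (UNIV \<times> cbox 0 1) (\<lambda>(x, \<sigma>). fst x *\<^sub>R f (\<sigma> * fst x) (snd x))"
      unfolding split_beta by (auto intro!: continuous_intros)
  qed
  then show ?thesis by (simp add: line_int_def split_beta)
qed

text \<open>The Lipschitz bound is global in the unknown, with a constant that may depend on the
  range of time and parameter; this gives solutions for all times. The state space is a Banach space
  because the locale is also applied to operator-valued unknowns.\<close>

locale picard =
  fixes F :: "real \<Rightarrow> 'p::euclidean_space \<Rightarrow> 'b::banach \<Rightarrow> 'b" and x0 :: "'p \<Rightarrow> 'b"
  assumes F: "continuous_on UNIV (\<lambda>(s, p, x). F s p x)"
    and x0: "continuous_on UNIV x0"
    and lip: "\<And>S. \<exists>L. \<forall>s p x y. \<bar>s\<bar> \<le> S \<longrightarrow> norm p \<le> S \<longrightarrow> norm (F s p x - F s p y) \<le> L * norm (x - y)"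
begin

primrec iter :: "nat \<Rightarrow> real \<times> 'p \<Rightarrow> 'b" where
  "iter 0 = (\<lambda>(s, p). x0 p)"
| "iter (Suc k) = (\<lambda>(s, p). x0 p + line_int (\<lambda>r. F r p (iter k (r, p))) s)"

lemma continuous_F:
  assumes "continuous_on UNIV X" shows "continuous_on UNIV (\<lambda>(r, p). F r p (X (r, p)))"
proof -
  have "continuous_on UNIV (\<lambda>z. case (fst z, snd z, X z) of (s, p, x) \<Rightarrow> F s p x)"
    by (rule continuous_on_compose2[OF F]) (auto intro!: continuous_intros assms)
  then show ?thesis by (simp add: split_beta)
qed

lemma continuous_F1:
  assumes "continuous_on UNIV X" shows "continuous_on UNIV (\<lambda>r. F r p (X (r, p)))"
proof -
  have "continuous_on UNIV (\<lambda>r. case (r, p) of (r, p) \<Rightarrow> F r p (X (r, p)))"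
    by (rule continuous_on_compose2[OF continuous_F[OF assms]]) (auto intro!: continuous_intros)
  then show ?thesis by simp
qed

lemma continuous_iter: "continuous_on UNIV (iter k)"
proof (induction k)
  case 0
  have "continuous_on UNIV (\<lambda>z::real \<times> 'p. x0 (snd z))"
    by (rule continuous_on_compose2[OF x0]) (auto intro!: continuous_intros)
  then show ?case by (simp add: split_beta)
next
  case (Suc k)
  have "continuous_on UNIV (\<lambda>z::real \<times> 'p. x0 (snd z))"
    by (rule continuous_on_compose2[OF x0]) (auto intro!: continuous_intros)
  then show ?case using continuous_on_line_int_param[OF continuous_F[OF Suc]]
    by (auto simp: split_beta intro!: continuous_intros)
qed

text \<open>The limit of the iterates, written as a telescoping series so that uniform convergence
  follows from the Weierstrass test.\<close>

definition sol :: "real \<times> 'p \<Rightarrow> 'b" where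
  "sol z = iter 0 z + (\<Sum>k. iter (Suc k) z - iter k z)"

lemma uniform_limit_iter: "uniform_limit ({-S..S} \<times> cball 0 S) iter sol sequentially"
proof -
  let ?A = "{-S..S} \<times> cball (0::'p) S"
  obtain L where L: "\<And>s p x y. \<bar>s\<bar> \<le> S \<Longrightarrow> norm p \<le> S \<Longrightarrow> norm (F s p x - F s p y) \<le> L * norm (x - y)"
    using lip[of S] by blast
  have cA: "compact ?A" by (intro compact_Times) auto
  have "bounded ((\<lambda>z. iter (Suc 0) z - iter 0 z) ` ?A)"
    by (rule compact_imp_bounded[OF compact_continuous_image[OF _ cA]])
      (rule continuous_on_subset[OF continuous_on_diff[OF continuous_iter continuous_iter] subset_UNIV])
  then obtain C where C: "\<And>z. z \<in> ?A \<Longrightarrow> norm (iter (Suc 0) z - iter 0 z) \<le> C"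
    unfolding bounded_iff by auto
  \<comment> \<open>The increments are dominated by terms of an exponential series: the Lipschitz
    bound costs a factor \<open>\<bar>L\<bar>\<close>, and the integration supplies the next factor
    of the factorial.\<close>
  have step: "norm (iter (Suc k) (s, p) - iter k (s, p)) \<le> C * \<bar>L\<bar> ^ k / fact k * \<bar>s\<bar> ^ k"
    if sp: "\<bar>s\<bar> \<le> S" "norm p \<le> S" for k s p
    using sp(1)
  proof (induction k arbitrary: s)
    case 0
    then show ?case using C[of "(s, p)"] sp(2) by (simp add: abs_le_iff)
  next
    case (Suc k)
    have "norm (F r p (iter (Suc k) (r, p)) - F r p (iter k (r, p)))
        \<le> (C * \<bar>L\<bar> ^ Suc k / fact k) * \<bar>r\<bar> ^ k" if "\<bar>r\<bar> \<le> \<bar>s\<bar>" for r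
    proof -
      have r: "\<bar>r\<bar> \<le> S" using that Suc.prems by simp
      have "norm (F r p (iter (Suc k) (r, p)) - F r p (iter k (r, p)))
          \<le> L * norm (iter (Suc k) (r, p) - iter k (r, p))" by (rule L[OF r sp(2)])
      also have "\<dots> \<le> \<bar>L\<bar> * norm (iter (Suc k) (r, p) - iter k (r, p))"
        by (intro mult_right_mono) auto
      also have "\<dots> \<le> \<bar>L\<bar> * (C * \<bar>L\<bar> ^ k / fact k * \<bar>r\<bar> ^ k)"
        by (intro mult_left_mono Suc.IH r) auto
      finally show ?thesis by (simp add: mult_ac)
    qed
    note * = line_int_bound_power[OF continuous_on_diff[OF continuous_F1[OF continuous_iter[of "Suc k"]]
          continuous_F1[OF continuous_iter[of k]]] this]
    have "iter (Suc (Suc k)) (s, p) - iter (Suc k) (s, p)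
        = line_int (\<lambda>r. F r p (iter (Suc k) (r, p))) s - line_int (\<lambda>r. F r p (iter k (r, p))) s"
      by (subst iter.simps(2), subst (2) iter.simps(2)) simp
    also have "\<dots> = line_int (\<lambda>r. F r p (iter (Suc k) (r, p)) - F r p (iter k (r, p))) s"
      by (rule line_int_diff[OF continuous_F1[OF continuous_iter] continuous_F1[OF continuous_iter]])
    finally show ?case using *[of s] by (simp add: mult.commute[of "1 + real k"] del: iter.simps)
  qed
  have "uniform_limit ?A (\<lambda>n z. \<Sum>k<n. iter (Suc k) z - iter k z)
      (\<lambda>z. \<Sum>k. iter (Suc k) z - iter k z) sequentially"
  proof (rule Weierstrass_m_test)
    show "norm (iter (Suc k) z - iter k z) \<le> C * ((\<bar>L\<bar> * S) ^ k / fact k)" if "z \<in> ?A" for k z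
    proof -
      obtain s p where z: "z = (s, p)" by (cases z)
      have sp: "\<bar>s\<bar> \<le> S" "norm p \<le> S" using that z by auto
      have "0 \<le> C" using C[of z] that norm_ge_zero order_trans by blast
      have "C * \<bar>L\<bar> ^ k / fact k * \<bar>s\<bar> ^ k \<le> C * \<bar>L\<bar> ^ k / fact k * S ^ k"
        using sp \<open>0 \<le> C\<close> by (intro mult_left_mono power_mono) auto
      then show ?thesis using step[OF sp, of k] unfolding z by (simp add: power_mult_distrib)
    qed
    have "summable (\<lambda>k. (\<bar>L\<bar> * S) ^ k / fact k)"
      using summable_exp[of "\<bar>L\<bar> * S"] by (simp add: field_simps)
    then show "summable (\<lambda>k. C * ((\<bar>L\<bar> * S) ^ k / fact k))" by (rule summable_mult)
  qed
  then have "uniform_limit ?A (\<lambda>n z. iter 0 z + (\<Sum>k<n. iter (Suc k) z - iter k z)) sol sequentially"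
    unfolding sol_def by (intro uniform_limit_intros) auto
  moreover have "iter 0 z + (\<Sum>k<n. iter (Suc k) z - iter k z) = iter n z" for n z
    by (induction n) (simp_all add: algebra_simps eq_diff_eq del: iter.simps)
  ultimately show ?thesis by (simp only:)
qed

lemma continuous_sol: "continuous_on UNIV sol"
proof -
  have "isCont sol z" for z
  proof -
    define S where "S = norm z + 1"
    have "continuous_on ({-S..S} \<times> cball 0 S) sol"
      by (rule uniform_limit_theorem[OF _ uniform_limit_iter])
        (auto intro!: always_eventually continuous_on_subset[OF continuous_iter] simp del: iter.simps)
    moreover have "z \<in> interior ({-S..S} \<times> cball 0 S)"
    proof -
      have "norm (fst z) < S" "norm (snd z) < S"
        using norm_fst_le[of "fst z" "snd z"] norm_snd_le[of "snd z" "fst z"] by (auto simp: S_def)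
      then show ?thesis by (cases z) (auto simp: interior_Times abs_less_iff)
    qed
    ultimately show ?thesis using continuous_on_interior by blast
  qed
  then show ?thesis by (simp add: continuous_at_imp_continuous_on)
qed

text \<open>Passage to the limit in the recursion for \<open>iter\<close>; uniform convergence on a
  box containing the whole segment from 0 to \<open>s\<close> carries it through the
  integral.\<close>

lemma sol_fixpoint: "sol (s, p) = x0 p + line_int (\<lambda>r. F r p (sol (r, p))) s"
proof -
  define S where "S = \<bar>s\<bar> + norm p"
  obtain L where L: "\<And>s p x y. \<bar>s\<bar> \<le> S \<Longrightarrow> norm p \<le> S \<Longrightarrow> norm (F s p x - F s p y) \<le> L * norm (x - y)"
    using lip[of S] by blast
  have lim: "(\<lambda>n. iter (Suc n) (s, p)) \<longlonglongrightarrow> sol (s, p)"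
  proof (rule LIMSEQ_Suc, rule tendsto_uniform_limitI[OF uniform_limit_iter[of S]])
    show "(s, p) \<in> {- S..S} \<times> cball 0 S"
      using norm_ge_zero[of p] abs_ge_self[of s] abs_ge_minus_self[of s] abs_ge_zero[of s]
      by (simp add: S_def del: norm_ge_zero abs_ge_zero abs_ge_self abs_ge_minus_self)
  qed
  have "(\<lambda>n. line_int (\<lambda>r. F r p (iter n (r, p))) s) \<longlonglongrightarrow> line_int (\<lambda>r. F r p (sol (r, p))) s"
  proof (rule LIMSEQ_I)
    fix e :: real assume e: "e > 0"
    \<comment> \<open>Chosen so that \<open>\<bar>L\<bar> * e' * \<bar>s\<bar>\<close> is less than
      \<open>e\<close>; the added ones keep the denominator positive.\<close>
    define e' where "e' = e / ((\<bar>L\<bar> + 1) * (\<bar>s\<bar> + 1))"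
    have e': "e' > 0" using e by (auto simp: e'_def intro!: divide_pos_pos mult_pos_pos add_nonneg_pos)
    obtain N where N: "\<And>n z. n \<ge> N \<Longrightarrow> z \<in> {-S..S} \<times> cball 0 S \<Longrightarrow> dist (iter n z) (sol z) < e'"
      using uniform_limitD[OF uniform_limit_iter[of S] e'] unfolding eventually_sequentially by blast
    have "norm (line_int (\<lambda>r. F r p (iter n (r, p))) s - line_int (\<lambda>r. F r p (sol (r, p))) s) < e"
      if n: "n \<ge> N" for n
    proof -
      have "norm (line_int (\<lambda>r. F r p (iter n (r, p)) - F r p (sol (r, p))) s)
          \<le> (\<bar>L\<bar> * e') * \<bar>s\<bar> ^ Suc 0 / real (Suc 0)"
      proof (rule line_int_bound_power)
        show "continuous_on UNIV (\<lambda>r. F r p (iter n (r, p)) - F r p (sol (r, p)))"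
          by (intro continuous_on_diff continuous_F1 continuous_iter continuous_sol)
        fix r assume r: "\<bar>r\<bar> \<le> \<bar>s\<bar>"
        have "norm (F r p (iter n (r, p)) - F r p (sol (r, p))) \<le> L * norm (iter n (r, p) - sol (r, p))"
          using r norm_ge_zero[of p] by (intro L) (auto simp: S_def simp del: norm_ge_zero)
        also have "\<dots> \<le> \<bar>L\<bar> * norm (iter n (r, p) - sol (r, p))" by (intro mult_right_mono) auto
        also have "\<dots> \<le> \<bar>L\<bar> * e'"
        proof (intro mult_left_mono)
          have "\<bar>r\<bar> \<le> S" "norm p \<le> S" using r norm_ge_zero[of p] by (auto simp: S_def simp del: norm_ge_zero)
          then show "norm (iter n (r, p) - sol (r, p)) \<le> e'"
            using N[OF n, of "(r, p)"] by (simp add: dist_norm abs_le_iff less_imp_le)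
        qed auto
        finally show "norm (F r p (iter n (r, p)) - F r p (sol (r, p))) \<le> \<bar>L\<bar> * e' * \<bar>r\<bar> ^ 0" by simp
      qed
      also have "\<dots> = e' * (\<bar>L\<bar> * \<bar>s\<bar>)" by simp
      also have "\<dots> < e' * ((\<bar>L\<bar> + 1) * (\<bar>s\<bar> + 1))"
        using e' by (intro mult_strict_left_mono) (auto simp: algebra_simps add_nonneg_pos)
      also have "\<dots> = e" by (simp add: e'_def add_nonneg_eq_0_iff)
      finally show ?thesis
        by (simp add: line_int_diff continuous_F1 continuous_iter continuous_sol)
    qed
    then show "\<exists>N. \<forall>n\<ge>N. norm (line_int (\<lambda>r. F r p (iter n (r, p))) s
        - line_int (\<lambda>r. F r p (sol (r, p))) s) < e" by blast
  qed
  then have "(\<lambda>n. iter (Suc n) (s, p)) \<longlonglongrightarrow> x0 p + line_int (\<lambda>r. F r p (sol (r, p))) s"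
    by (auto intro!: tendsto_intros)
  then show ?thesis using LIMSEQ_unique[OF lim] by blast
qed

lemma sol_0: "sol (0, p) = x0 p"
  by (subst sol_fixpoint) (simp add: line_int_zero)

lemma sol_has_vector_derivative:
  "((\<lambda>s. sol (s, p)) has_vector_derivative F s p (sol (s, p))) (at s)"
proof -
  have "((\<lambda>s. x0 p + line_int (\<lambda>r. F r p (sol (r, p))) s) has_vector_derivative 0 + F s p (sol (s, p))) (at s)"
    by (intro has_vector_derivative_add has_vector_derivative_line_int
        continuous_F1[OF continuous_sol]) (auto intro: derivative_eq_intros)
  then show ?thesis by (simp flip: sol_fixpoint)
qed

end

text \<open>The weighted energy exp(K r) |d r|^2 does not increase on the way from \<open>s0\<close>
  to \<open>s1\<close> and starts at zero. The sign of \<open>K\<close> depends on the direction of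
  travel, so the lemma covers backward time too.\<close>

lemma gronwall_zero:
  fixes d :: "real \<Rightarrow> 'b::real_inner"
  assumes d: "\<And>r. r \<in> closed_segment s0 s1 \<Longrightarrow> (d has_vector_derivative d' r) (at r)"
    and L: "\<And>r. r \<in> closed_segment s0 s1 \<Longrightarrow> norm (d' r) \<le> L * norm (d r)"
    and "d s0 = 0"
  shows "d s1 = 0"
proof -
  define K where "K = (if s0 \<le> s1 then - 2 * L else 2 * L)"
  define g where "g r = exp (K * r) * (d r \<bullet> d r)" for r
  define g' where "g' r = exp (K * r) * (2 * (d r \<bullet> d' r) + K * (d r \<bullet> d r))" for r
  have g: "(g has_real_derivative g' r) (at r)" if "r \<in> closed_segment s0 s1" for r
  proof -
    have "((\<lambda>r. d r \<bullet> d r) has_vector_derivative (d r \<bullet> d' r + d' r \<bullet> d r)) (at r)"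
      using bounded_bilinear.has_vector_derivative[OF bounded_bilinear_inner d[OF that] d[OF that]] .
    then have 1: "((\<lambda>r. d r \<bullet> d r) has_real_derivative 2 * (d r \<bullet> d' r)) (at r)"
      by (simp add: has_real_derivative_iff_has_vector_derivative inner_commute)
    have "((\<lambda>r. exp (K * r)) has_real_derivative K * exp (K * r)) (at r)"
      by (auto intro!: derivative_eq_intros)
    from DERIV_mult[OF this 1] show ?thesis
      unfolding g_def g'_def by (simp add: algebra_simps)
  qed
  have ip: "\<bar>d r \<bullet> d' r\<bar> \<le> L * (d r \<bullet> d r)" if "r \<in> closed_segment s0 s1" for r
  proof -
    have "\<bar>d r \<bullet> d' r\<bar> \<le> norm (d r) * norm (d' r)" by (rule Cauchy_Schwarz_ineq2)
    also have "\<dots> \<le> norm (d r) * (L * norm (d r))" by (intro mult_left_mono L that) auto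
    finally show ?thesis by (simp add: dot_square_norm power2_eq_square mult_ac)
  qed
  have "g s1 \<le> g s0"
  proof (cases "s0 \<le> s1")
    case True
    then show ?thesis
    proof (rule DERIV_nonpos_imp_nonincreasing)
      fix r assume "s0 \<le> r" "r \<le> s1"
      then have r: "r \<in> closed_segment s0 s1" using True by (simp add: closed_segment_eq_real_ivl)
      have "g' r \<le> 0" using ip[OF r] True unfolding g'_def K_def by (intro mult_nonneg_nonpos) auto
      then show "\<exists>y. (g has_real_derivative y) (at r) \<and> y \<le> 0" using g[OF r] by blast
    qed
  next
    case False
    then have "s1 \<le> s0" by simp
    then show ?thesis
    proof (rule DERIV_nonneg_imp_nondecreasing)
      fix r assume "s1 \<le> r" "r \<le> s0"
      then have r: "r \<in> closed_segment s0 s1" using False by (simp add: closed_segment_eq_real_ivl)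
      have "g' r \<ge> 0" using ip[OF r] False unfolding g'_def K_def by (intro mult_nonneg_nonneg) auto
      then show "\<exists>y. (g has_real_derivative y) (at r) \<and> y \<ge> 0" using g[OF r] by blast
    qed
  qed
  then have "d s1 \<bullet> d s1 \<le> 0" using assms(3) by (simp add: g_def mult_le_0_iff)
  then show ?thesis by (metis inner_eq_zero_iff inner_ge_zero order_antisym)
qed

text \<open>\<open>H (x, y)\<close> is the mean of the derivative over the segment from
  \<open>y\<close> to \<open>x\<close>. With this exact factorization the difference of two
  solutions satisfies an exact linear equation, without a Taylor remainder.\<close>

lemma hadamard:
  fixes f :: "'a::euclidean_space \<Rightarrow> 'c::banach"
  assumes "ndiff (Suc k) UNIV f"
  obtains H where "continuous_on UNIV H" "\<And>x y. f x - f y = blinfun_apply (H (x, y)) (x - y)"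
    "\<And>x h. blinfun_apply (H (x, x)) h = partial_deriv h f x"
proof -
  define D where "D x = Blinfun (frechet_derivative f (at x))" for x
  have der: "(f has_derivative frechet_derivative f (at x)) (at x)" for x
    by (rule ndiff_has_derivative[OF assms]) simp
  have D: "blinfun_apply (D x) h = partial_deriv h f x" for x h
    unfolding D_def partial_deriv_def
    by (simp add: bounded_linear_Blinfun_apply has_derivative_bounded_linear[OF der])
  have "ndiff 0 UNIV D"
    using ndiff_continuous[OF ndiff_partial_deriv_any[OF open_UNIV assms]]
    by (intro ndiff_blinfun) (auto simp: D)
  then have cD: "continuous_on UNIV D" by simp
  define H where "H = (\<lambda>(x, y). integral (cbox 0 1) (\<lambda>\<sigma>::real. D (y + \<sigma> *\<^sub>R (x - y))))"
  have "continuous_on UNIV H"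
  proof -
    have "continuous_on UNIV (\<lambda>z. integral (cbox 0 1) (\<lambda>\<sigma>::real. D (snd z + \<sigma> *\<^sub>R (fst z - snd z))))"
    proof (rule integral_continuous_on_param)
      show "continuous_on (UNIV \<times> cbox 0 1) (\<lambda>(z, \<sigma>::real). D (snd z + \<sigma> *\<^sub>R (fst z - snd z)))"
        unfolding split_beta
        by (rule continuous_on_compose2[OF cD]) (auto intro!: continuous_intros)
    qed
    then show ?thesis by (simp add: H_def split_beta)
  qed
  moreover have "f x - f y = blinfun_apply (H (x, y)) (x - y)" for x y
  proof -
    have c: "continuous_on {0..1} (\<lambda>\<sigma>::real. D (y + \<sigma> *\<^sub>R (x - y)))"
      by (rule continuous_on_compose2[OF cD]) (auto intro!: continuous_intros)
    have "((\<lambda>\<sigma>. D (y + \<sigma> *\<^sub>R (x - y))) has_integral H (x, y)) {0..1}"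
      using integrable_integral[OF integrable_continuous_interval[OF c]] by (simp add: H_def)
    from has_integral_linear[OF this blinfun.bounded_linear_left, of "x - y"]
    have 1: "((\<lambda>\<sigma>. D (y + \<sigma> *\<^sub>R (x - y)) (x - y)) has_integral H (x, y) (x - y)) {0..1}"
      by (simp add: comp_def)
    have "((\<lambda>\<sigma>. D (y + \<sigma> *\<^sub>R (x - y)) (x - y)) has_integral
        (f (y + 1 *\<^sub>R (x - y)) - f (y + 0 *\<^sub>R (x - y)))) {0..1}"
    proof (rule fundamental_theorem_of_calculus)
      fix \<sigma> :: real
      have "((\<lambda>\<sigma>. y + \<sigma> *\<^sub>R (x - y)) has_vector_derivative (x - y)) (at \<sigma> within {0..1})"
        by (auto intro!: derivative_eq_intros)
      from vector_derivative_diff_chain_within[OF this has_derivative_at_withinI[OF der]]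
      show "((\<lambda>\<sigma>. f (y + \<sigma> *\<^sub>R (x - y))) has_vector_derivative D (y + \<sigma> *\<^sub>R (x - y)) (x - y))
          (at \<sigma> within {0..1})"
        by (simp add: comp_def D partial_deriv_def)
    qed simp
    then show ?thesis using has_integral_unique[OF 1] by simp
  qed
  moreover have "blinfun_apply (H (x, x)) h = partial_deriv h f x" for x h
    by (simp add: H_def D)
  ultimately show ?thesis using that by blast
qed

section \<open>Smooth dependence on parameters and initial values\<close>

lemma has_derivative_caratheodory:
  fixes Q :: "'a::real_normed_vector \<Rightarrow> ('a \<Rightarrow>\<^sub>L 'b::real_normed_vector)"
  assumes Q: "isCont Q z" and f: "\<And>w. f w = f z + blinfun_apply (Q w) (w - z)"
  shows "(f has_derivative blinfun_apply (Q z)) (at z)"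
proof (rule has_derivativeI_sandwich[of 1])
  show "((\<lambda>w. norm (Q w - Q z)) \<longlongrightarrow> 0) (at z)"
    using Q unfolding isCont_def by (simp add: LIM_zero tendsto_norm_zero)
  fix w assume "w \<noteq> z"
  have "f w - f z - Q z (w - z) = (Q w - Q z) (w - z)"
    by (subst f) (simp add: blinfun.diff_left)
  then have "norm (f w - f z - Q z (w - z)) \<le> norm (Q w - Q z) * norm (w - z)"
    by (simp add: norm_blinfun)
  then show "norm (f w - f z - Q z (w - z)) / norm (w - z) \<le> norm (Q w - Q z)"
    using \<open>w \<noteq> z\<close> by (simp add: divide_le_eq)
qed (auto intro: blinfun.bounded_linear_right)

text \<open>The increment is split into one in the parameter at the moving time, governed by the
  jointly continuous \<open>W\<close>, and one in time at the fixed parameter. Joint continuity of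
  \<open>W\<close> turns the two partial statements into a full derivative.\<close>

lemma joint_derivative:
  fixes X :: "real \<times> 'p::euclidean_space \<Rightarrow> 'b::real_normed_vector"
  assumes W: "continuous_on UNIV W"
    and inc: "\<And>s p p'. X (s, p') - X (s, p) = blinfun_apply (W (s, p', p)) (p' - p)"
    and ds: "((\<lambda>s. X (s, p)) has_vector_derivative x') (at s)"
  shows "(X has_derivative (\<lambda>h. blinfun_apply (W (s, p, p)) (snd h) + fst h *\<^sub>R x')) (at (s, p))"
proof -
  define Q where "Q z = W (fst z, snd z, p) o\<^sub>L Blinfun (snd :: real \<times> 'p \<Rightarrow> 'p)" for z
  have Qapp: "blinfun_apply (Q z) h = W (fst z, snd z, p) (snd h)" for z h
    by (simp add: Q_def bounded_linear_Blinfun_apply bounded_linear_snd)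
  have "continuous_on UNIV (\<lambda>z. W (fst z, snd z, p))"
    by (rule continuous_on_compose2[OF W]) (auto intro!: continuous_intros)
  then have "isCont Q (s, p)" unfolding Q_def
    by (intro continuous_intros) (auto simp: continuous_on_eq_continuous_at)
  then have 1: "((\<lambda>z. Q z (z - (s, p))) has_derivative Q (s, p)) (at (s, p))"
    by (rule has_derivative_caratheodory) (simp add: blinfun.zero_right)
  have 2: "((\<lambda>z. X (fst z, p)) has_derivative (\<lambda>h. fst h *\<^sub>R x')) (at (s, p))"
    by (rule has_derivative_compose[OF has_derivative_fst[OF has_derivative_ident]])
      (use ds in \<open>simp add: has_vector_derivative_def\<close>)
  have "((\<lambda>z. Q z (z - (s, p)) + X (fst z, p)) has_derivative
      (\<lambda>h. Q (s, p) h + fst h *\<^sub>R x')) (at (s, p))"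
    by (rule has_derivative_add[OF 1 2])
  moreover have "Q z (z - (s, p)) + X (fst z, p) = X z" for z
    using inc[of "fst z" "snd z" p] by (simp add: Qapp algebra_simps)
  ultimately show ?thesis by (simp add: Qapp)
qed

text \<open>The factor \<open>W\<close> in \<open>X (s, p') - X (s, p) = W (p' - p)\<close> can be
  constructed as the solution of a linear equation with parameters \<open>(p', p)\<close>. On the
  diagonal it is the derivative in \<open>p\<close>, and it again solves an equation of the present
  form, with one order of differentiability less in the forcing and initial term; this drives the
  induction on \<open>k\<close>.\<close>

lemma lode_smooth:
  fixes A :: "real \<times> 'p::euclidean_space \<Rightarrow> ('b::euclidean_space \<Rightarrow>\<^sub>L 'b)"
  assumes "ndiff k UNIV A" "ndiff k UNIV f" "ndiff k UNIV x0" "continuous_on UNIV X"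
    and "\<And>p. X (0, p) = x0 p"
    and "\<And>s p. ((\<lambda>s. X (s, p)) has_vector_derivative (blinfun_apply (A (s, p)) (X (s, p)) + f (s, p))) (at s)"
  shows "ndiff k UNIV X"
  using assms
proof (induction k arbitrary: f x0 X)
  case 0
  then show ?case by simp
next
  case (Suc k)
  note A = Suc.prems(1) and f = Suc.prems(2) and x0 = Suc.prems(3) and cX = Suc.prems(4)
    and X0 = Suc.prems(5) and dX = Suc.prems(6)
  obtain HA where HA: "continuous_on UNIV HA" "\<And>x y. A x - A y = blinfun_apply (HA (x, y)) (x - y)"
    "\<And>x h. blinfun_apply (HA (x, x)) h = partial_deriv h A x" using hadamard[OF A] by blast
  obtain Hf where Hf: "continuous_on UNIV Hf" "\<And>x y. f x - f y = blinfun_apply (Hf (x, y)) (x - y)"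
    "\<And>x h. blinfun_apply (Hf (x, x)) h = partial_deriv h f x" using hadamard[OF f] by blast
  obtain Hx where Hx: "continuous_on UNIV Hx" "\<And>x y. x0 x - x0 y = blinfun_apply (Hx (x, y)) (x - y)"
    "\<And>x h. blinfun_apply (Hx (x, x)) h = partial_deriv h x0 x" using hadamard[OF x0] by blast
  have cA: "continuous_on UNIV A" using ndiff_continuous[OF A] .
  \<comment> \<open>The forcing for \<open>W\<close>: applied to \<open>p' - p\<close> it equals
    (A(p') - A(p)) X(p) + f(p') - f(p), with the differences already factored by
    \<open>hadamard\<close>.\<close>
  define g :: "real \<times> 'p \<times> 'p \<Rightarrow> ('p \<Rightarrow>\<^sub>L 'b)" where
    "g = (\<lambda>(s, p', p). Blinfun (\<lambda>h. blinfun_apply (blinfun_apply (HA ((s, p'), (s, p))) (0, h)) (X (s, p))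
        + blinfun_apply (Hf ((s, p'), (s, p))) (0, h)))"
  have gapp: "blinfun_apply (g (s, p', p)) h = blinfun_apply (blinfun_apply (HA ((s, p'), (s, p))) (0, h)) (X (s, p))
        + blinfun_apply (Hf ((s, p'), (s, p))) (0, h)" for s p' p h
  proof -
    have "bounded_linear (\<lambda>h. (0::real, h::'p))"
      by (intro bounded_linear_Pair bounded_linear_zero bounded_linear_ident)
    then have "bounded_linear (\<lambda>h. blinfun_apply (blinfun_apply (HA ((s, p'), (s, p))) (0, h)) (X (s, p))
        + blinfun_apply (Hf ((s, p'), (s, p))) (0, h))"
      by (intro bounded_linear_add blinfun.bounded_linear_left[THEN bounded_linear_compose]
          blinfun.bounded_linear_right[THEN bounded_linear_compose])
    then show ?thesis by (simp add: g_def bounded_linear_Blinfun_apply)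
  qed
  have "ndiff 0 UNIV g"
  proof (rule ndiff_blinfun[OF open_UNIV])
    fix c :: 'p
    have "continuous_on UNIV (\<lambda>z. HA ((fst z, fst (snd z)), (fst z, snd (snd z :: 'p \<times> 'p))))"
      "continuous_on UNIV (\<lambda>z. Hf ((fst z, fst (snd z)), (fst z, snd (snd z :: 'p \<times> 'p))))"
      "continuous_on UNIV (\<lambda>z. X (fst z, snd (snd z :: 'p \<times> 'p)))"
      by (rule continuous_on_compose2[OF HA(1)] continuous_on_compose2[OF Hf(1)]
          continuous_on_compose2[OF cX]; (intro continuous_intros | simp))+
    then have "continuous_on UNIV (\<lambda>z. HA ((fst z, fst (snd z)), (fst z, snd (snd z))) (0, c) (X (fst z, snd (snd z)))
        + Hf ((fst z, fst (snd z)), (fst z, snd (snd z))) (0, c))"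
      by (intro continuous_intros)
    also have "(\<lambda>z. HA ((fst z, fst (snd z)), (fst z, snd (snd z))) (0, c) (X (fst z, snd (snd z)))
        + Hf ((fst z, fst (snd z)), (fst z, snd (snd z))) (0, c)) = (\<lambda>z. blinfun_apply (g z) c)"
      by (auto simp: fun_eq_iff gapp)
    finally show "ndiff 0 UNIV (\<lambda>x. blinfun_apply (g x) c)" by simp
  qed
  then have cg: "continuous_on UNIV g" by simp
  interpret W: picard "\<lambda>s q w. (A (s, fst q) o\<^sub>L w) + g (s, q)" Hx
  proof
    have 2: "continuous_on UNIV (\<lambda>z::real \<times> ('p \<times> 'p) \<times> ('p \<Rightarrow>\<^sub>L 'b). g (fst z, fst (snd z)))"
      by (rule continuous_on_compose2[OF cg]) (auto intro!: continuous_intros)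
    have 3: "continuous_on UNIV (\<lambda>z::real \<times> ('p \<times> 'p) \<times> ('p \<Rightarrow>\<^sub>L 'b). A (fst z, fst (fst (snd z))))"
      by (rule continuous_on_compose2[OF cA]) (auto intro!: continuous_intros)
    show "continuous_on UNIV (\<lambda>(s, q, w). (A (s, fst q) o\<^sub>L w) + g (s, q))"
      using 2 3 by (auto simp: split_beta intro!: continuous_intros)
    show "continuous_on UNIV Hx" by (rule Hx(1))
    fix S :: real
    have "bounded (A ` ({-S..S} \<times> cball 0 S))"
      by (intro compact_imp_bounded compact_continuous_image continuous_on_subset[OF cA] compact_Times) auto
    then obtain L where L: "\<And>z. z \<in> {-S..S} \<times> cball 0 S \<Longrightarrow> norm (A z) \<le> L"
      unfolding bounded_iff by auto
    show "\<exists>L. \<forall>s q x y. \<bar>s\<bar> \<le> S \<longrightarrow> norm q \<le> S \<longrightarrow>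
        norm (((A (s, fst q) o\<^sub>L x) + g (s, q)) - ((A (s, fst q) o\<^sub>L y) + g (s, q)))
        \<le> L * norm (x - y)"
    proof (intro exI[of _ L] allI impI)
      fix s and q :: "'p \<times> 'p" and x y :: "'p \<Rightarrow>\<^sub>L 'b" assume "\<bar>s\<bar> \<le> S" "norm q \<le> S"
      moreover obtain p' p where q: "q = (p', p)" by (cases q)
      moreover have "norm p' \<le> norm q" unfolding q by (rule norm_fst_le)
      ultimately have "norm (A (s, p')) \<le> L" by (intro L) (auto simp: abs_le_iff)
      moreover have "norm (A (s, p') o\<^sub>L (x - y)) \<le> norm (A (s, p')) * norm (x - y)"
        by (rule norm_blinfun_compose)
      ultimately have "norm (A (s, p') o\<^sub>L (x - y)) \<le> L * norm (x - y)"
        by (meson mult_right_mono norm_ge_zero order_trans)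
      moreover have "A (s, p') o\<^sub>L (x - y) = (A (s, p') o\<^sub>L x) - (A (s, p') o\<^sub>L y)"
        by (rule blinfun_eqI) (simp add: blinfun.diff_right blinfun.diff_left)
      ultimately show "norm (((A (s, fst q) o\<^sub>L x) + g (s, q))
          - ((A (s, fst q) o\<^sub>L y) + g (s, q))) \<le> L * norm (x - y)"
        by (simp add: q)
    qed
  qed
  have dW: "((\<lambda>s. W.sol (s, p', p)) has_vector_derivative
      (A (s, p') o\<^sub>L W.sol (s, p', p)) + g (s, p', p)) (at s)" for s p' p
    using W.sol_has_vector_derivative[of "(p', p)" s] by simp
  have dWh: "((\<lambda>s. blinfun_apply (W.sol (s, p', p)) h) has_vector_derivative
      (A (s, p') (W.sol (s, p', p) h) + g (s, p', p) h)) (at s)" for s p' p h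
    using bounded_linear.has_vector_derivative[OF blinfun.bounded_linear_left[of h] dW]
    by (simp add: blinfun.add_left)
  have inc: "X (s, p') - X (s, p) = W.sol (s, p', p) (p' - p)" for s p p'
  proof -
    \<comment> \<open>Both sides of the claimed identity solve the same linear equation with
      coefficient \<open>A (s, p')\<close> and agree at time 0, so their difference vanishes by
      Gronwall.\<close>
    define d where "d s = X (s, p') - X (s, p) - W.sol (s, p', p) (p' - p)" for s
    have "A (s, p') - A (s, p) = HA ((s, p'), (s, p)) (0, p' - p)" for s
      using HA(2)[of "(s, p')" "(s, p)"] by simp
    then have HA': "HA ((s, p'), (s, p)) (0, p' - p) (X (s, p)) = A (s, p') (X (s, p)) - A (s, p) (X (s, p))" for s
      by (metis blinfun.diff_left)
    have Hf': "Hf ((s, p'), (s, p)) (0, p' - p) = f (s, p') - f (s, p)" for s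
      using Hf(2)[of "(s, p')" "(s, p)"] by simp
      have "continuous_on (closed_segment 0 s) (\<lambda>r. A (r, p'))"
        by (rule continuous_on_compose2[OF cA]) (auto intro!: continuous_intros)
      then have "bounded ((\<lambda>r. A (r, p')) ` closed_segment 0 s)"
        by (intro compact_imp_bounded compact_continuous_image) auto
      then obtain L where L: "\<And>r. r \<in> closed_segment 0 s \<Longrightarrow> norm (A (r, p')) \<le> L"
        unfolding bounded_iff by auto
    have "d s = 0"
    proof (rule gronwall_zero[of 0])
      show "(d has_vector_derivative A (r, p') (d r)) (at r)" for r
      proof -
        have "(d has_vector_derivative (A (r, p') (X (r, p')) + f (r, p')) - (A (r, p) (X (r, p)) + f (r, p))
            - (A (r, p') (W.sol (r, p', p) (p' - p)) + g (r, p', p) (p' - p))) (at r)"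
          unfolding d_def by (intro has_vector_derivative_diff dX dWh)
        also have "(A (r, p') (X (r, p')) + f (r, p')) - (A (r, p) (X (r, p)) + f (r, p))
            - (A (r, p') (W.sol (r, p', p) (p' - p)) + g (r, p', p) (p' - p)) = A (r, p') (d r)"
        proof -
          have "g (r, p', p) (p' - p) = (A (r, p') (X (r, p)) - A (r, p) (X (r, p))) + (f (r, p') - f (r, p))"
            by (simp only: gapp HA' Hf')
          then show ?thesis unfolding d_def blinfun.diff_right[of "A (r, p')"] by (simp only:) simp
        qed
        finally show ?thesis .
      qed
      show "norm (A (r, p') (d r)) \<le> L * norm (d r)" if "r \<in> closed_segment 0 s" for r
        using norm_blinfun[of "A (r, p')" "d r"] L[OF that] by (meson mult_right_mono norm_ge_zero order_trans)
      show "d 0 = 0" using Hx(2)[of p' p] by (simp add: d_def X0 W.sol_0)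
    qed
    then show ?thesis by (simp add: d_def)
  qed
  have cW: "continuous_on UNIV W.sol" by (rule W.continuous_sol)
  have IHX: "ndiff k UNIV X"
    by (rule Suc.IH[OF ndiff_SucD[OF A] ndiff_SucD[OF f] ndiff_SucD[OF x0] cX X0 dX])
  have AX: "ndiff k UNIV (\<lambda>z. A z (X z) + f z)"
    by (intro ndiff_add ndiff_blinfun_apply open_UNIV IHX ndiff_SucD[OF A] ndiff_SucD[OF f])
  \<comment> \<open>The equation differentiated in direction \<open>c\<close>: same coefficient
    \<open>A\<close>, forcing built from first derivatives of \<open>A\<close> and \<open>f\<close>
    and from \<open>X\<close>, which already has order \<open>k\<close>.\<close>
  have Y: "ndiff k UNIV (\<lambda>z. W.sol (fst z, snd z, snd z) c)" for c
  proof (rule Suc.IH[OF ndiff_SucD[OF A]])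
    show "ndiff k UNIV (\<lambda>z. partial_deriv (0, c) A z (X z) + partial_deriv (0, c) f z)"
      by (intro ndiff_add ndiff_blinfun_apply open_UNIV IHX ndiff_partial_deriv_any A f)
    show "ndiff k UNIV (partial_deriv c x0)" by (intro ndiff_partial_deriv_any open_UNIV x0)
    have "continuous_on UNIV (\<lambda>z. W.sol (fst z, snd z, snd z))"
      by (rule continuous_on_compose2[OF cW]) (auto intro!: continuous_intros)
    then show "continuous_on UNIV (\<lambda>z. W.sol (fst z, snd z, snd z) c)" by (intro continuous_intros)
    show "W.sol (fst (0, p), snd (0, p), snd (0, p)) c = partial_deriv c x0 p" for p
      by (simp add: W.sol_0 Hx(3))
    show "((\<lambda>s. W.sol (fst (s, p), snd (s, p), snd (s, p)) c) has_vector_derivative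
        A (s, p) (W.sol (fst (s, p), snd (s, p), snd (s, p)) c)
        + (partial_deriv (0, c) A (s, p) (X (s, p)) + partial_deriv (0, c) f (s, p))) (at s)" for s p
      using dWh[of p p c s] by (simp add: gapp HA(3) Hf(3))
  qed
  show ?case
  proof (rule ndiff_SucI[OF open_UNIV])
    fix z :: "real \<times> 'p"
    show "(X has_derivative (\<lambda>h. W.sol (fst z, snd z, snd z) (snd h) + fst h *\<^sub>R (A z (X z) + f z))) (at z)"
      using joint_derivative[where p = "snd z" and s = "fst z", OF cW inc dX] by simp
  next
    fix b :: "real \<times> 'p"
    show "ndiff k UNIV (\<lambda>z. W.sol (fst z, snd z, snd z) (snd b) + fst b *\<^sub>R (A z (X z) + f z))"
      by (intro ndiff_add open_UNIV Y ndiff_bounded_linear[OF open_UNIV bounded_linear_scaleR_right] AX)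
  qed
qed

text \<open>Factoring \<open>V\<close> by \<open>hadamard\<close> turns the difference of two
  trajectories into a solution of a linear equation, so the scheme of \<open>lode_smooth\<close>
  applies to a nonlinear field. Then a bootstrap: if the flow has order \<open>k\<close>, so has the
  coefficient of its linearization, hence its first derivatives, hence the flow has order k+1. The
  second claim is the variational equation.\<close>

lemma flow_smooth:
  fixes V :: "'a::euclidean_space \<Rightarrow> 'a"
  assumes V: "smooth_on UNIV V" and cPsi: "continuous_on UNIV \<Psi>" and \<Psi>0: "\<And>e. \<Psi> (0, e) = e"
    and d\<Psi>: "\<And>s e. ((\<lambda>s. \<Psi> (s, e)) has_vector_derivative V (\<Psi> (s, e))) (at s)"
  shows "smooth_on UNIV \<Psi>"
    and "((\<lambda>s. partial_deriv (0, k) \<Psi> (s, e)) has_vector_derivative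
      partial_deriv (partial_deriv (0, k) \<Psi> (s, e)) V (\<Psi> (s, e))) (at s)"
proof -
  have nV: "ndiff j UNIV V" for j by (rule smooth_on_ndiff[OF open_UNIV V])
  obtain H where H: "continuous_on UNIV H" "\<And>x y. V x - V y = blinfun_apply (H (x, y)) (x - y)"
    "\<And>x h. blinfun_apply (H (x, x)) h = partial_deriv h V x" using hadamard[OF nV] by blast
  have cH: "continuous_on UNIV (\<lambda>z. H (\<Psi> (fst z, fst (snd z)), \<Psi> (fst z, snd (snd z))))"
  proof -
    have "continuous_on UNIV (\<lambda>z. \<Psi> (fst z, fst (snd z)))" "continuous_on UNIV (\<lambda>z. \<Psi> (fst z, snd (snd z)))"
      by (rule continuous_on_compose2[OF cPsi]; (intro continuous_intros | simp))+
    then show ?thesis by (intro continuous_on_compose2[OF H(1)] continuous_on_Pair) auto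
  qed
  interpret Z: picard "\<lambda>s q w. H (\<Psi> (s, fst q), \<Psi> (s, snd q)) o\<^sub>L w"
    "\<lambda>q. id_blinfun :: 'a \<Rightarrow>\<^sub>L 'a"
  proof
    have "continuous_on UNIV (\<lambda>z::real \<times> ('a \<times> 'a) \<times> ('a \<Rightarrow>\<^sub>L 'a).
        H (\<Psi> (fst z, fst (fst (snd z))), \<Psi> (fst z, snd (fst (snd z)))))"
    proof -
      have "continuous_on UNIV (\<lambda>z::real \<times> ('a \<times> 'a) \<times> ('a \<Rightarrow>\<^sub>L 'a). (fst z, fst (snd z)))"
        by (intro continuous_intros)
      from continuous_on_compose2[OF cH this] show ?thesis by simp
    qed
    then show "continuous_on UNIV (\<lambda>(s, q, w :: 'a \<Rightarrow>\<^sub>L 'a). H (\<Psi> (s, fst q), \<Psi> (s, snd q)) o\<^sub>L w)"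
      by (auto simp: split_beta intro!: continuous_intros)
    show "continuous_on UNIV (\<lambda>q. id_blinfun)" by simp
    fix S :: real
    have "bounded ((\<lambda>z. H (\<Psi> (fst z, fst (snd z)), \<Psi> (fst z, snd (snd z)))) ` ({-S..S} \<times> cball 0 S))"
      by (intro compact_imp_bounded compact_continuous_image continuous_on_subset[OF cH] compact_Times) auto
    then obtain L where L: "\<And>z. z \<in> {-S..S} \<times> cball 0 S \<Longrightarrow>
        norm (H (\<Psi> (fst z, fst (snd z)), \<Psi> (fst z, snd (snd z)))) \<le> L"
      unfolding bounded_iff by (metis (mono_tags, lifting) imageI)
    show "\<exists>L. \<forall>s q. \<forall>x y :: 'a \<Rightarrow>\<^sub>L 'a. \<bar>s\<bar> \<le> S \<longrightarrow> norm q \<le> S \<longrightarrow>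
        norm ((H (\<Psi> (s, fst q), \<Psi> (s, snd q)) o\<^sub>L x) - (H (\<Psi> (s, fst q), \<Psi> (s, snd q)) o\<^sub>L y)) \<le> L * norm (x - y)"
    proof (intro exI[of _ L] allI impI)
      fix s and q :: "'a \<times> 'a" and x y :: "'a \<Rightarrow>\<^sub>L 'a" assume "\<bar>s\<bar> \<le> S" "norm q \<le> S"
      then have "norm (H (\<Psi> (s, fst q), \<Psi> (s, snd q))) \<le> L"
        using L[of "(s, q)"] by (auto simp: abs_le_iff)
      moreover have "norm (H (\<Psi> (s, fst q), \<Psi> (s, snd q)) o\<^sub>L (x - y))
          \<le> norm (H (\<Psi> (s, fst q), \<Psi> (s, snd q))) * norm (x - y)"
        by (rule norm_blinfun_compose)
      ultimately have "norm (H (\<Psi> (s, fst q), \<Psi> (s, snd q)) o\<^sub>L (x - y)) \<le> L * norm (x - y)"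
        by (meson mult_right_mono norm_ge_zero order_trans)
      moreover have "H (\<Psi> (s, fst q), \<Psi> (s, snd q)) o\<^sub>L (x - y)
          = (H (\<Psi> (s, fst q), \<Psi> (s, snd q)) o\<^sub>L x) - (H (\<Psi> (s, fst q), \<Psi> (s, snd q)) o\<^sub>L y)"
        by (rule blinfun_eqI) (simp add: blinfun.diff_right blinfun.diff_left)
      ultimately show "norm ((H (\<Psi> (s, fst q), \<Psi> (s, snd q)) o\<^sub>L x) - (H (\<Psi> (s, fst q), \<Psi> (s, snd q)) o\<^sub>L y))
          \<le> L * norm (x - y)" by simp
    qed
  qed
  have dZ: "((\<lambda>s. Z.sol (s, q)) has_vector_derivative
      H (\<Psi> (s, fst q), \<Psi> (s, snd q)) o\<^sub>L Z.sol (s, q)) (at s)" for s q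
    by (rule Z.sol_has_vector_derivative)
  have dZh: "((\<lambda>s. blinfun_apply (Z.sol (s, q)) h) has_vector_derivative
      H (\<Psi> (s, fst q), \<Psi> (s, snd q)) (Z.sol (s, q) h)) (at s)" for s q h
    using bounded_linear.has_vector_derivative[OF blinfun.bounded_linear_left[of h] dZ] by simp
  have inc: "\<Psi> (s, e') - \<Psi> (s, e) = Z.sol (s, e', e) (e' - e)" for s e e'
  proof -
    define d where "d s = \<Psi> (s, e') - \<Psi> (s, e) - Z.sol (s, e', e) (e' - e)" for s
      have "continuous_on (closed_segment 0 s) (\<lambda>r. H (\<Psi> (r, e'), \<Psi> (r, e)))"
      proof -
        have "continuous_on (closed_segment 0 s) (\<lambda>r. (r, e', e))" by (intro continuous_intros)
        from continuous_on_compose2[OF cH this] show ?thesis by simp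
      qed
      then have "bounded ((\<lambda>r. H (\<Psi> (r, e'), \<Psi> (r, e))) ` closed_segment 0 s)"
        by (intro compact_imp_bounded compact_continuous_image) auto
      then obtain L where L: "\<And>r. r \<in> closed_segment 0 s \<Longrightarrow> norm (H (\<Psi> (r, e'), \<Psi> (r, e))) \<le> L"
        unfolding bounded_iff by auto
    have "d s = 0"
    proof (rule gronwall_zero[of 0])
      show "(d has_vector_derivative H (\<Psi> (r, e'), \<Psi> (r, e)) (d r)) (at r)" for r
      proof -
        have "(d has_vector_derivative V (\<Psi> (r, e')) - V (\<Psi> (r, e))
            - H (\<Psi> (r, e'), \<Psi> (r, e)) (Z.sol (r, e', e) (e' - e))) (at r)"
          unfolding d_def using dZh[of "(e', e)"] by (intro has_vector_derivative_diff d\<Psi>) simp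
        then show ?thesis by (simp add: H(2) d_def blinfun.diff_right)
      qed
      show "norm (H (\<Psi> (r, e'), \<Psi> (r, e)) (d r)) \<le> L * norm (d r)" if "r \<in> closed_segment 0 s" for r
        using norm_blinfun[of "H (\<Psi> (r, e'), \<Psi> (r, e))" "d r"] L[OF that]
        by (meson mult_right_mono norm_ge_zero order_trans)
      show "d 0 = 0" by (simp add: d_def \<Psi>0 Z.sol_0)
    qed
    then show ?thesis by (simp add: d_def)
  qed
  have cZ: "continuous_on UNIV Z.sol" by (rule Z.continuous_sol)
  have dPsi: "(\<Psi> has_derivative (\<lambda>h. Z.sol (fst z, snd z, snd z) (snd h) + fst h *\<^sub>R V (\<Psi> z))) (at z)" for z
    using joint_derivative[where p = "snd z" and s = "fst z", OF cZ inc d\<Psi>] by simp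
  have "ndiff k UNIV \<Psi>" for k
  proof (induction k)
    case 0
    show ?case using cPsi by simp
  next
    case (Suc k)
    have V\<Psi>: "ndiff k UNIV (\<lambda>z. V (\<Psi> z))" by (rule ndiff_compose[OF _ _ _ nV Suc]) auto
    have "ndiff k UNIV (\<lambda>x. H (x, x))"
      by (rule ndiff_blinfun) (simp_all add: H(3) ndiff_partial_deriv_any[OF open_UNIV nV])
    then have A: "ndiff k UNIV (\<lambda>z. H (\<Psi> z, \<Psi> z))"
      using ndiff_compose[OF open_UNIV open_UNIV _ _ Suc, of "\<lambda>x. H (x, x)"] by auto
    \<comment> \<open>On the diagonal the factor \<open>H\<close> is the derivative of
      \<open>V\<close>, so this is the linearized flow, whose coefficient \<open>A\<close> has order
      \<open>k\<close> by the induction hypothesis.\<close>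
    have Y: "ndiff k UNIV (\<lambda>z. Z.sol (fst z, snd z, snd z) c)" for c
    proof (rule lode_smooth[OF A ndiff_const[of k UNIV 0] ndiff_const[of k UNIV c]])
      have "continuous_on UNIV (\<lambda>z. Z.sol (fst z, snd z, snd z))"
        by (rule continuous_on_compose2[OF cZ]) (auto intro!: continuous_intros)
      then show "continuous_on UNIV (\<lambda>z. Z.sol (fst z, snd z, snd z) c)" by (intro continuous_intros)
      show "Z.sol (fst (0, p), snd (0, p), snd (0, p)) c = c" for p by (simp add: Z.sol_0)
      show "((\<lambda>s. Z.sol (fst (s, p), snd (s, p), snd (s, p)) c) has_vector_derivative
          H (\<Psi> (s, p), \<Psi> (s, p)) (Z.sol (fst (s, p), snd (s, p), snd (s, p)) c) + 0) (at s)" for s p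
        using dZh[of "(p, p)"] by simp
    qed
    show ?case
    proof (rule ndiff_SucI[OF open_UNIV])
      show "(\<Psi> has_derivative (\<lambda>h. Z.sol (fst z, snd z, snd z) (snd h) + fst h *\<^sub>R V (\<Psi> z))) (at z)" for z
        by (rule dPsi)
    next
      fix b :: "real \<times> 'a"
      show "ndiff k UNIV (\<lambda>z. Z.sol (fst z, snd z, snd z) (snd b) + fst b *\<^sub>R V (\<Psi> z))"
        by (intro ndiff_add open_UNIV Y ndiff_bounded_linear[OF open_UNIV bounded_linear_scaleR_right] V\<Psi>)
    qed
  qed
  then show "smooth_on UNIV \<Psi>" by (simp add: smooth_on_iff_ndiff)
  have "partial_deriv (0, k) \<Psi> (s, e) = Z.sol (s, e, e) k" for s
    using partial_deriv_eq[OF dPsi, of "(0, k)" "(s, e)"] by simp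
  then show "((\<lambda>s. partial_deriv (0, k) \<Psi> (s, e)) has_vector_derivative
      partial_deriv (partial_deriv (0, k) \<Psi> (s, e)) V (\<Psi> (s, e))) (at s)"
    using dZh[of "(e, e)" k s] by (simp add: H(3))
qed

section \<open>Integration of compactly supported functions\<close>

lemma integrable_compact_support:
  fixes f :: "'a::euclidean_space \<Rightarrow> 'b::{banach, second_countable_topology}"
  assumes "continuous_on UNIV f" "compact K" "\<And>x. x \<notin> K \<Longrightarrow> f x = 0"
  shows "integrable lborel f"
proof -
  have "integrable lborel (\<lambda>x. indicator K x *\<^sub>R f x)"
    by (rule borel_integrable_compact[OF assms(2) continuous_on_subset[OF assms(1)]]) auto
  also have "(\<lambda>x. indicator K x *\<^sub>R f x) = f"
    using assms(3) by (auto simp: indicator_def)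
  finally show ?thesis .
qed

lemma integral_compact_support_bound:
  fixes f :: "'a::euclidean_space \<Rightarrow> complex"
  assumes "continuous_on UNIV f" "compact K" "\<And>x. x \<notin> K \<Longrightarrow> f x = 0"
    and "\<And>x. x \<in> K \<Longrightarrow> cmod (f x) \<le> C"
  shows "cmod (LINT x|lborel. f x) \<le> C * measure lborel K"
proof -
  have K: "K \<in> sets lborel" "emeasure lborel K < \<infinity>"
    using emeasure_compact_finite[OF assms(2)] borel_compact[OF assms(2)] by simp_all
  have "cmod (LINT x|lborel. f x) \<le> (LINT x|lborel. C * indicator K x)"
  proof (rule Bochner_Integration.integral_norm_bound_integral)
    show "integrable lborel f" using assms(1-3) by (rule integrable_compact_support)
    show "integrable lborel (\<lambda>x. C * indicator K x)" using K by simp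
    show "cmod (f x) \<le> C * indicator K x" for x
      using assms(3,4)[of x] by (cases "x \<in> K") auto
  qed
  also have "\<dots> = C * measure lborel K" using K by simp
  finally show ?thesis .
qed

lemma lborel_integral_translate:
  fixes f :: "'a::euclidean_space \<Rightarrow> 'b::{banach, second_countable_topology}"
  assumes "f \<in> borel_measurable borel"
  shows "(LINT x|lborel. f (c + x)) = (LINT x|lborel. f x)"
  by (subst (2) lborel_distr_plus[symmetric, of c], subst integral_distr) (use assms in auto)

lemma integrable_translate:
  fixes f :: "'a::euclidean_space \<Rightarrow> 'b::{banach, second_countable_topology}"
  assumes "integrable lborel f"
  shows "integrable lborel (\<lambda>x. f (c + x))"
proof -
  have "integrable (distr lborel borel ((+) c)) f" using assms by (simp add: lborel_distr_plus)
  then show ?thesis by (subst (asm) integrable_distr_eq) (use borel_measurable_integrable[OF assms] in auto)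
qed

text \<open>By translation invariance of Lebesgue measure every difference quotient has integral
  zero; dominated convergence passes this on to the derivative. This is the only source of
  integration by parts in the development.\<close>

lemma integral_partial_zero:
  fixes f :: "'a::euclidean_space \<Rightarrow> complex"
  assumes f: "\<And>x. (f has_derivative f' x) (at x)" and c: "continuous_on UNIV (\<lambda>x. f' x b)"
    and K: "compact K" "\<And>x. x \<notin> K \<Longrightarrow> f x = 0"
  shows "(LINT x|lborel. f' x b) = 0"
proof -
  have cf: "continuous_on UNIV f"
    using f by (auto intro!: continuous_at_imp_continuous_on has_derivative_continuous)
  have f'0: "f' x = (\<lambda>h. 0)" if "x \<notin> K" for x
  proof -
    have "open (- K)" using K(1) by (simp add: compact_imp_closed open_Compl)
    then have "(f has_derivative (\<lambda>h. 0)) (at x)"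
      using that K(2) by (subst has_derivative_cong_open[of "- K" x f "\<lambda>x. 0"]) auto
    then show ?thesis using has_derivative_unique[OF f] by blast
  qed
  have "bounded ((\<lambda>x. f' x b) ` K)"
    by (rule compact_imp_bounded[OF compact_continuous_image[OF continuous_on_subset[OF c] K(1)]]) simp
  then obtain B where B: "\<And>x. x \<in> K \<Longrightarrow> cmod (f' x b) \<le> B" unfolding bounded_iff by auto
  define B' where "B' = \<bar>B\<bar>"
  have B': "cmod (f' x b) \<le> B'" for x
    using B[of x] f'0[of x] by (cases "x \<in> K") (auto simp: B'_def)
  obtain R where R: "\<And>x. x \<in> K \<Longrightarrow> norm x \<le> R"
    using compact_imp_bounded[OF K(1)] unfolding bounded_iff by auto
  define h :: "nat \<Rightarrow> real" where "h n = inverse (real (Suc n))" for n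
  have h: "h n > 0" "h n \<le> 1" for n by (auto simp: h_def field_simps)
  have h0: "h \<longlonglongrightarrow> 0" unfolding h_def by (rule LIMSEQ_inverse_real_of_nat)
  have dline: "((\<lambda>t. f (x + t *\<^sub>R b)) has_derivative (\<lambda>t. f' (x + s *\<^sub>R b) (t *\<^sub>R b))) (at s)" for x and s :: real
    by (rule has_derivative_compose[OF _ f]) (auto intro!: derivative_eq_intros)
  have lin: "f' x (t *\<^sub>R b) = t *\<^sub>R f' x b" for x t
    using has_derivative_linear[OF f] by (simp add: linear_cmul)
  define q where "q n x = (f (h n *\<^sub>R b + x) - f x) /\<^sub>R h n" for n x
  have "(\<lambda>n. LINT x|lborel. q n x) \<longlonglongrightarrow> (LINT x|lborel. f' x b)"
  \<comment> \<open>Since \<open>h n\<close> is at most 1, all quotients are supported in one ball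
    of radius \<open>R + norm b\<close>, and the mean value inequality bounds them by
    \<open>B'\<close>.\<close>
  proof (rule integral_dominated_convergence[where w = "\<lambda>x. B' * indicator (cball 0 (R + norm b)) x"])
    show "(\<lambda>x. f' x b) \<in> borel_measurable lborel"
      using borel_measurable_continuous_onI[OF c] by simp
    show "q n \<in> borel_measurable lborel" for n
    proof -
      have "continuous_on UNIV (\<lambda>x. f (h n *\<^sub>R b + x))"
        by (rule continuous_on_compose2[OF cf]) (auto intro!: continuous_intros)
      then have "continuous_on UNIV (q n)" unfolding q_def by (intro continuous_intros cf)
      then show ?thesis using borel_measurable_continuous_onI by simp
    qed
    show "integrable lborel (\<lambda>x::'a. B' * indicator (cball 0 (R + norm b)) x :: real)"
      using emeasure_lborel_cball_finite[of "0::'a" "R + norm b"]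
      by (intro integrable_mult_right integrable_real_indicator) (auto simp: less_top)
    show "AE x in lborel. (\<lambda>n. q n x) \<longlonglongrightarrow> f' x b"
    proof (rule AE_I2)
      fix x
      have "(\<lambda>t. norm (f (x + t *\<^sub>R b) - f x - t *\<^sub>R f' x b) / norm t) \<midarrow>0\<rightarrow> 0"
        using dline[of x 0] unfolding has_derivative_at by (simp add: lin)
      moreover have "filterlim h (at 0) sequentially"
        using h0 h(1) by (auto simp: filterlim_at less_imp_neq[symmetric])
      ultimately have "(\<lambda>n. norm (f (x + h n *\<^sub>R b) - f x - h n *\<^sub>R f' x b) / norm (h n)) \<longlonglongrightarrow> 0"
        by (rule filterlim_compose)
      also have "(\<lambda>n. norm (f (x + h n *\<^sub>R b) - f x - h n *\<^sub>R f' x b) / norm (h n)) = (\<lambda>n. norm (q n x - f' x b))"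
      proof
        fix n
        have "q n x - f' x b = (f (x + h n *\<^sub>R b) - f x - h n *\<^sub>R f' x b) /\<^sub>R h n"
          using h(1)[of n] by (simp add: q_def scaleR_diff_right add.commute)
        then show "norm (f (x + h n *\<^sub>R b) - f x - h n *\<^sub>R f' x b) / norm (h n) = norm (q n x - f' x b)"
          by (simp add: divide_inverse mult.commute)
      qed
      finally show "(\<lambda>n. q n x) \<longlonglongrightarrow> f' x b" using LIM_zero_cancel tendsto_norm_zero_iff by blast
    qed
    show "AE x in lborel. norm (q n x) \<le> B' * indicator (cball 0 (R + norm b)) x" for n
    proof (rule AE_I2)
      fix x
      show "norm (q n x) \<le> B' * indicator (cball 0 (R + norm b)) x"
      proof (cases "x \<in> cball 0 (R + norm b)")
        case True
        have "norm (f (x + h n *\<^sub>R b) - f (x + 0 *\<^sub>R b)) \<le> B' * norm (h n - 0)"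
        proof (rule differentiable_bound[of UNIV "\<lambda>t. f (x + t *\<^sub>R b)"])
          show "onorm (\<lambda>t. f' (x + s *\<^sub>R b) (t *\<^sub>R b)) \<le> B'" for s
            by (rule onorm_le) (use mult_left_mono[OF B' abs_ge_zero] in \<open>simp add: lin mult.commute[of B']\<close>)
        qed (use dline in auto)
        moreover have "norm (q n x) = norm (f (x + h n *\<^sub>R b) - f x) / h n"
          using h(1)[of n] by (simp add: q_def add.commute divide_inverse mult.commute)
        ultimately have "norm (q n x) \<le> B'" using h(1)[of n] by (simp add: pos_divide_le_eq)
        then show ?thesis using True by simp
      next
        case False
        have "x \<notin> K" "h n *\<^sub>R b + x \<notin> K"
        proof -
          have nx: "norm x > R + norm b" using False by simp
          show "x \<notin> K" using nx R[of x] norm_ge_zero[of b] by linarith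
          have "norm x \<le> norm (h n *\<^sub>R b + x) + norm (h n *\<^sub>R b)"
            using norm_triangle_ineq4[of "h n *\<^sub>R b + x" "h n *\<^sub>R b"] by simp
          moreover have "norm (h n *\<^sub>R b) \<le> norm b"
            using h[of n] by (simp add: mult_left_le_one_le)
          ultimately show "h n *\<^sub>R b + x \<notin> K" using nx R[of "h n *\<^sub>R b + x"] by linarith
        qed
        then show ?thesis using K(2) False by (simp add: q_def)
      qed
    qed
  qed
  moreover have "(LINT x|lborel. q n x) = 0" for n
  proof -
    have I: "integrable lborel f" using cf K by (rule integrable_compact_support)
    have "(LINT x|lborel. q n x) = ((LINT x|lborel. f (h n *\<^sub>R b + x)) - (LINT x|lborel. f x)) /\<^sub>R h n"
      unfolding q_def using integrable_translate[OF I] I by simp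
    then show ?thesis using borel_measurable_continuous_onI[OF cf] by (simp add: lborel_integral_translate)
  qed
  ultimately show ?thesis by (simp add: LIMSEQ_const_iff)
qed

section \<open>The Fourier transform of test functions\<close>

lemma cmod_exp_minus_ii [simp]: "cmod (exp (- (\<i> * complex_of_real r))) = 1"
  by (simp add: norm_exp_eq_Re)

lemma has_derivative_cexp_linear:
  assumes "(\<phi> has_derivative \<phi>') (at x)"
  shows "((\<lambda>x. exp (c * complex_of_real (\<phi> x))) has_derivative
    (\<lambda>h. c * complex_of_real (\<phi>' h) * exp (c * complex_of_real (\<phi> x)))) (at x)"
  using has_derivative_compose[OF has_derivative_mult_right[OF has_derivative_of_real[OF assms], of c]
      DERIV_exp[unfolded has_field_derivative_def]]
  by (simp add: mult_ac)

lemma partial_deriv_const: "partial_deriv b (\<lambda>x. c) x = 0"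
  by (rule partial_deriv_eq) (rule has_derivative_const)

lemma partial_deriv_zero_off:
  assumes "closed K" "\<And>x. x \<notin> K \<Longrightarrow> f x = 0" "x \<notin> K" shows "partial_deriv b f x = 0"
  using partial_deriv_cong_open[of "- K" x f "\<lambda>x. 0" b] assms
  by (auto simp: open_Compl partial_deriv_const)

text \<open>The derivative of the compactly supported product exp(-i x.\<xi>) f(x) has integral
  zero, and the product rule splits it into the two sides.\<close>

lemma fourier_partial:
  assumes f: "smooth_on UNIV f" and K: "compact K" "\<And>x. x \<notin> K \<Longrightarrow> f x = 0"
  shows "fourier (partial_deriv b f) \<xi> = \<i> * complex_of_real (b \<bullet> \<xi>) * fourier f \<xi>"
proof -
  let ?e = "\<lambda>x. exp (- \<i> * complex_of_real (x \<bullet> \<xi>))"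
  note df = smooth_on_has_derivative[OF f UNIV_I]
  have cf: "continuous_on UNIV f" using smooth_on_imp_continuous[OF open_UNIV f] .
  have cd: "continuous_on UNIV (partial_deriv b f)"
    by (rule smooth_on_imp_continuous[OF open_UNIV smooth_on_partial_deriv[OF open_UNIV f]])
  have d: "((\<lambda>x. ?e x * f x) has_derivative (\<lambda>h. ?e x * frechet_derivative f (at x) h
      + - \<i> * complex_of_real (h \<bullet> \<xi>) * ?e x * f x)) (at x)" for x
    by (rule has_derivative_mult[OF has_derivative_cexp_linear df]) (auto intro!: derivative_eq_intros)
  have d0: "partial_deriv b f x = 0" if "x \<notin> K" for x
    using partial_deriv_zero_off[OF compact_imp_closed[OF K(1)] K(2) that] .
  have i1: "integrable lborel (\<lambda>x. ?e x * partial_deriv b f x)"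
    by (rule integrable_compact_support[OF _ K(1)]) (use d0 in \<open>auto intro!: continuous_intros cd\<close>)
  have i2: "integrable lborel (\<lambda>x. ?e x * f x)"
    by (rule integrable_compact_support[OF _ K(1)]) (use K in \<open>auto intro!: continuous_intros cf\<close>)
  have "(LINT x|lborel. ?e x * partial_deriv b f x + - \<i> * complex_of_real (b \<bullet> \<xi>) * ?e x * f x) = 0"
    unfolding partial_deriv_def
  proof (rule integral_partial_zero[OF d _ K(1)])
    show "continuous_on UNIV (\<lambda>x. ?e x * frechet_derivative f (at x) b
        + - \<i> * complex_of_real (b \<bullet> \<xi>) * ?e x * f x)"
      using cd unfolding partial_deriv_def[abs_def] by (intro continuous_intros cf)
  qed (use K in auto)
  moreover have "(LINT x|lborel. ?e x * partial_deriv b f x + - \<i> * complex_of_real (b \<bullet> \<xi>) * ?e x * f x)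
      = fourier (partial_deriv b f) \<xi> - \<i> * complex_of_real (b \<bullet> \<xi>) * fourier f \<xi>"
  proof -
    have "(\<lambda>x. ?e x * partial_deriv b f x + - \<i> * complex_of_real (b \<bullet> \<xi>) * ?e x * f x)
        = (\<lambda>x. ?e x * partial_deriv b f x - (\<i> * complex_of_real (b \<bullet> \<xi>)) * (?e x * f x))"
      by (simp add: fun_eq_iff algebra_simps)
    then show ?thesis unfolding fourier_def using i1 i2
      by (simp only: Bochner_Integration.integral_diff[OF i1 integrable_mult_right[OF i2]] integral_mult_right_zero)
  qed
  ultimately show ?thesis by simp
qed

text \<open>Its symbol is 1 + |\<xi>|^2, which vanishes nowhere and controls all directions at once,
  so powers of this single operator give every decay estimate for the Fourier transform.\<close>

definition one_minus_laplace :: "('a::euclidean_space \<Rightarrow> complex) \<Rightarrow> 'a \<Rightarrow> complex" where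
  "one_minus_laplace f x = f x - (\<Sum>b\<in>Basis. partial_deriv b (partial_deriv b f) x)"

lemma one_minus_laplace_zero_off:
  assumes "closed K" "\<And>x. x \<notin> K \<Longrightarrow> f x = 0" "x \<notin> K" shows "one_minus_laplace f x = 0"
  unfolding one_minus_laplace_def
  using assms by (simp add: partial_deriv_zero_off[OF assms(1) partial_deriv_zero_off[OF assms(1,2)]])

lemma smooth_on_one_minus_laplace:
  "open X \<Longrightarrow> smooth_on X f \<Longrightarrow> smooth_on X (one_minus_laplace f)"
  unfolding one_minus_laplace_def[abs_def]
  by (intro smooth_on_diff smooth_on_sum smooth_on_partial_deriv)

lemma fourier_one_minus_laplace:
  assumes f: "smooth_on UNIV f" and K: "compact K" "\<And>x. x \<notin> K \<Longrightarrow> f x = 0"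
  shows "fourier (one_minus_laplace f) \<xi> = complex_of_real (1 + (norm \<xi>)\<^sup>2) * fourier f \<xi>"
proof -
  let ?e = "\<lambda>x. exp (- \<i> * complex_of_real (x \<bullet> \<xi>))"
  note cK = compact_imp_closed[OF K(1)]
  have I: "integrable lborel (\<lambda>x. ?e x * g x)" if "smooth_on UNIV g" "\<And>x. x \<notin> K \<Longrightarrow> g x = 0" for g
    by (rule integrable_compact_support[OF _ K(1)])
      (use that smooth_on_imp_continuous[OF open_UNIV that(1)] in \<open>auto intro!: continuous_intros\<close>)
  note sp = smooth_on_partial_deriv[OF open_UNIV]
  note zp = partial_deriv_zero_off[OF cK]
  have "fourier (partial_deriv b (partial_deriv b f)) \<xi> = - complex_of_real ((b \<bullet> \<xi>)\<^sup>2) * fourier f \<xi>" for b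
    using fourier_partial[OF sp[OF f] K(1) zp[OF K(2)], of b b \<xi>] fourier_partial[OF f K, of b \<xi>]
    by (simp add: power2_eq_square mult.assoc mult.left_commute)
  then have "(\<Sum>b\<in>Basis. fourier (partial_deriv b (partial_deriv b f)) \<xi>)
      = - complex_of_real (\<Sum>b\<in>Basis. (b \<bullet> \<xi>)\<^sup>2) * fourier f \<xi>"
    by (simp add: sum_distrib_right sum_negf)
  moreover have "(\<Sum>b\<in>Basis. (b \<bullet> \<xi>)\<^sup>2) = (norm \<xi>)\<^sup>2"
    unfolding power2_norm_eq_inner euclidean_inner[of \<xi> \<xi>] by (simp add: power2_eq_square inner_commute)
  moreover have "fourier (one_minus_laplace f) \<xi>
      = fourier f \<xi> - (\<Sum>b\<in>Basis. fourier (partial_deriv b (partial_deriv b f)) \<xi>)"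
  proof -
    have "fourier (one_minus_laplace f) \<xi>
        = (LINT x|lborel. ?e x * f x - (\<Sum>b\<in>Basis. ?e x * partial_deriv b (partial_deriv b f) x))"
      unfolding fourier_def one_minus_laplace_def right_diff_distrib sum_distrib_left ..
    also have "\<dots> = (LINT x|lborel. ?e x * f x)
        - (LINT x|lborel. (\<Sum>b\<in>Basis. ?e x * partial_deriv b (partial_deriv b f) x))"
      by (intro Bochner_Integration.integral_diff Bochner_Integration.integrable_sum I f sp zp[OF zp] K(2))
    also have "(LINT x|lborel. (\<Sum>b\<in>Basis. ?e x * partial_deriv b (partial_deriv b f) x))
        = (\<Sum>b\<in>Basis. LINT x|lborel. ?e x * partial_deriv b (partial_deriv b f) x)"
      by (intro Bochner_Integration.integral_sum I f sp zp[OF zp] K(2))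
    finally show ?thesis by (simp add: fourier_def)
  qed
  ultimately show ?thesis by (simp add: algebra_simps)
qed

lemma fourier_one_minus_laplace_power:
  assumes f: "smooth_on UNIV f" and K: "compact K" "\<And>x. x \<notin> K \<Longrightarrow> f x = 0"
  shows "fourier ((one_minus_laplace ^^ l) f) \<xi> = complex_of_real ((1 + (norm \<xi>)\<^sup>2) ^ l) * fourier f \<xi>"
    and "smooth_on UNIV ((one_minus_laplace ^^ l) f)" and "x \<notin> K \<Longrightarrow> (one_minus_laplace ^^ l) f x = 0"
proof -
  have "smooth_on UNIV ((one_minus_laplace ^^ l) f) \<and> (\<forall>x. x \<notin> K \<longrightarrow> (one_minus_laplace ^^ l) f x = 0) \<and>
    fourier ((one_minus_laplace ^^ l) f) \<xi> = complex_of_real ((1 + (norm \<xi>)\<^sup>2) ^ l) * fourier f \<xi>"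
  proof (induction l)
    case 0
    then show ?case using assms by simp
  next
    case (Suc l)
    then show ?case
      using fourier_one_minus_laplace[of "(one_minus_laplace ^^ l) f" K \<xi>] K(1)
      by (auto intro!: smooth_on_one_minus_laplace
          intro: one_minus_laplace_zero_off[OF compact_imp_closed[OF K(1)]])
  qed
  then show "fourier ((one_minus_laplace ^^ l) f) \<xi> = complex_of_real ((1 + (norm \<xi>)\<^sup>2) ^ l) * fourier f \<xi>"
    and "smooth_on UNIV ((one_minus_laplace ^^ l) f)" and "x \<notin> K \<Longrightarrow> (one_minus_laplace ^^ l) f x = 0"
    by auto
qed

lemma fourier_bound:
  assumes "continuous_on UNIV f" "compact K" "\<And>x. x \<notin> K \<Longrightarrow> f x = 0" "\<And>x. x \<in> K \<Longrightarrow> cmod (f x) \<le> C"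
  shows "cmod (fourier f \<xi>) \<le> C * measure lborel K"
  unfolding fourier_def
  by (rule integral_compact_support_bound[OF _ assms(2)])
    (use assms in \<open>auto simp: norm_mult intro!: continuous_intros\<close>)

lemma fourier_decay:
  assumes f: "smooth_on UNIV f" and K: "compact K" "\<And>x. x \<notin> K \<Longrightarrow> f x = 0"
    and C: "\<And>x. x \<in> K \<Longrightarrow> cmod ((one_minus_laplace ^^ l) f x) \<le> C"
  shows "(1 + (norm \<xi>)\<^sup>2) ^ l * cmod (fourier f \<xi>) \<le> C * measure lborel K"
proof -
  note * = fourier_one_minus_laplace_power[where l = l, OF f K]
  have "cmod (fourier ((one_minus_laplace ^^ l) f) \<xi>) \<le> C * measure lborel K"
    by (rule fourier_bound[OF smooth_on_imp_continuous[OF open_UNIV *(2)] K(1) *(3) C])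
  moreover have "0 \<le> (1 + (norm \<xi>)\<^sup>2) ^ l" by simp
  moreover have "fourier ((one_minus_laplace ^^ l) f) \<xi> = complex_of_real ((1 + (norm \<xi>)\<^sup>2) ^ l) * fourier f \<xi>"
    by (rule fourier_one_minus_laplace_power(1)[OF f K])
  ultimately show ?thesis by (simp only: norm_mult norm_of_real abs_of_nonneg)
qed

section \<open>Fourier inversion\<close>

lemma integrable_lborel_prod:
  fixes f :: "'a::euclidean_space \<Rightarrow> real \<Rightarrow> 'c::{real_normed_field, banach, second_countable_topology}"
  assumes "\<And>b. b \<in> Basis \<Longrightarrow> integrable lborel (f b)"
  shows "integrable lborel (\<lambda>x::'a. \<Prod>b\<in>Basis. f b (x \<bullet> b))"
    and "(LINT x|lborel. (\<Prod>b\<in>Basis. f b ((x::'a) \<bullet> b))) = (\<Prod>b\<in>Basis. LINT t|lborel. f b t)"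
proof -
  interpret product_sigma_finite "\<lambda>b::'a. lborel :: real measure" by standard
  let ?P = "\<Pi>\<^sub>M b\<in>(Basis::'a set). (lborel :: real measure)"
  let ?s = "\<lambda>g. \<Sum>b\<in>(Basis::'a set). g b *\<^sub>R b"
  have fm [measurable]: "f b \<in> borel_measurable borel" if "b \<in> Basis" for b
    using borel_measurable_integrable[OF assms[OF that]] by simp
  have m: "(\<lambda>x::'a. \<Prod>b\<in>Basis. f b (x \<bullet> b)) \<in> borel_measurable borel"
    by (intro borel_measurable_prod measurable_compose[OF _ fm]) auto
  have s: "?s \<in> measurable ?P borel" by measurable
  have eq: "(\<Prod>b\<in>Basis. f b (?s g \<bullet> b)) = (\<Prod>b\<in>Basis. f b (g b))" for g
    by (intro prod.cong refl) (simp add: inner_sum_left inner_Basis if_distrib cong: if_cong)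
  have "integrable ?P (\<lambda>g. \<Prod>b\<in>Basis. f b (g b))"
    by (rule product_integrable_prod) (use assms in auto)
  then show "integrable lborel (\<lambda>x::'a. \<Prod>b\<in>Basis. f b (x \<bullet> b))"
    unfolding lborel_eq[where 'a='a] by (subst integrable_distr_eq[OF s m]) (simp only: eq)
  have "(LINT x|lborel. (\<Prod>b\<in>Basis. f b ((x::'a) \<bullet> b))) = (LINT g|?P. (\<Prod>b\<in>Basis. f b (g b)))"
    unfolding lborel_eq[where 'a='a] by (subst integral_distr[OF s m]) (simp only: eq)
  also have "\<dots> = (\<Prod>b\<in>Basis. LINT t|lborel. f b t)"
    by (rule product_integral_prod) (use assms in auto)
  finally show "(LINT x|lborel. (\<Prod>b\<in>Basis. f b ((x::'a) \<bullet> b))) = (\<Prod>b\<in>Basis. LINT t|lborel. f b t)" .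
qed

lemma integrable_inverse_1_plus_square: "integrable lborel (\<lambda>t::real. inverse (1 + t\<^sup>2))"
proof -
  have "set_integrable lborel (einterval (-\<infinity>) \<infinity>) (\<lambda>x. inverse (1 + x^2))"
    by (rule Sinc_Integral.integrable_inverse_1_plus_square)
  then show ?thesis by (simp add: set_integrable_def)
qed

text \<open>Each coordinate satisfies 1 + x_b^2 \<le> 1 + |x|^2, so the function is dominated by a
  product of one-dimensional integrable functions. This fixes the exponent \<open>DIM('a)\<close>
  that later estimates spend on integrability.\<close>

lemma integrable_inverse_bracket:
  "integrable lborel (\<lambda>x::'a::euclidean_space. inverse ((1 + (norm x)\<^sup>2) ^ DIM('a)))"
proof (rule Bochner_Integration.integrable_bound[OF integrable_lborel_prod(1)[of "\<lambda>b t. inverse (1 + t\<^sup>2)"]])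
  show "AE x in lborel. norm (inverse ((1 + (norm x)\<^sup>2) ^ DIM('a)))
      \<le> norm (\<Prod>b\<in>(Basis::'a set). inverse (1 + (x \<bullet> b)\<^sup>2))"
  proof (rule AE_I2)
    fix x :: 'a
    have "(\<Prod>b\<in>(Basis::'a set). 1 + (x \<bullet> b)\<^sup>2) \<le> (\<Prod>b\<in>(Basis::'a set). 1 + (norm x)\<^sup>2)"
    proof (rule prod_mono)
      fix b :: 'a assume "b \<in> Basis"
      then have "\<bar>x \<bullet> b\<bar> \<le> norm x" by (rule Basis_le_norm)
      then have "\<bar>x \<bullet> b\<bar>\<^sup>2 \<le> (norm x)\<^sup>2" by (intro power_mono) auto
      then show "0 \<le> 1 + (x \<bullet> b)\<^sup>2 \<and> 1 + (x \<bullet> b)\<^sup>2 \<le> 1 + (norm x)\<^sup>2" by simp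
    qed
    then have "inverse ((1 + (norm x)\<^sup>2) ^ DIM('a)) \<le> inverse (\<Prod>b\<in>(Basis::'a set). 1 + (x \<bullet> b)\<^sup>2)"
      by (intro le_imp_inverse_le prod_pos) (auto intro: add_pos_nonneg)
    moreover have "0 \<le> (\<Prod>b\<in>(Basis::'a set). inverse (1 + (x \<bullet> b)\<^sup>2))"
      by (intro prod_nonneg) (auto intro: add_nonneg_nonneg)
    moreover have "0 \<le> inverse ((1 + (norm x)\<^sup>2) ^ DIM('a))" by (simp add: add_nonneg_nonneg)
    ultimately show "norm (inverse ((1 + (norm x)\<^sup>2) ^ DIM('a)))
        \<le> norm (\<Prod>b\<in>(Basis::'a set). inverse (1 + (x \<bullet> b)\<^sup>2))"
      by (simp only: real_norm_def abs_of_nonneg) (simp add: prod_inversef[symmetric] comp_def)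
  qed
qed (use integrable_inverse_1_plus_square in \<open>auto intro!: borel_measurable_continuous_onI continuous_intros
  simp: add_nonneg_eq_0_iff\<close>)

lemma fourier_measurable:
  assumes "f \<in> borel_measurable borel" shows "fourier f \<in> borel_measurable borel"
proof -
  have "(\<lambda>\<xi>. LINT x|lborel. exp (- \<i> * complex_of_real (x \<bullet> \<xi>)) * f x) \<in> borel_measurable borel"
  proof (rule lborel.borel_measurable_lebesgue_integral)
    have "(\<lambda>p. exp (- \<i> * complex_of_real (snd p \<bullet> fst p)) :: complex) \<in> borel_measurable (borel :: ('a \<times> 'a) measure)"
      by (intro borel_measurable_continuous_onI continuous_intros)
    then have [measurable]: "(\<lambda>p. exp (- \<i> * complex_of_real (snd p \<bullet> fst p)) :: complex)
        \<in> borel_measurable (borel \<Otimes>\<^sub>M (borel :: 'a measure))" by (simp add: borel_prod)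
    have [measurable]: "(\<lambda>p. f (snd p)) \<in> borel_measurable ((borel :: 'a measure) \<Otimes>\<^sub>M borel)"
      by (rule measurable_compose[OF measurable_snd assms])
    show "(\<lambda>(\<xi>, x). exp (- \<i> * complex_of_real (x \<bullet> \<xi>)) * f x) \<in> borel_measurable (borel \<Otimes>\<^sub>M lborel)"
      unfolding split_beta by (simp cong: measurable_cong_sets sets_pair_measure_cong) measurable
  qed
  then show ?thesis unfolding fourier_def[abs_def] .
qed

text \<open>The kernel \<open>u\<close> will be an oscillating exponential: bounded by 1, it leaves
  the product of the two integrable functions as a majorant.\<close>

lemma fubini_product:
  fixes f :: "'a::euclidean_space \<Rightarrow> complex" and g :: "'b::euclidean_space \<Rightarrow> complex"
    and u :: "'a \<times> 'b \<Rightarrow> complex"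
  assumes f: "integrable lborel f" and g: "integrable lborel g"
    and u: "continuous_on UNIV u" "\<And>z. cmod (u z) \<le> 1"
  shows "(LINT x|lborel. LINT y|lborel. f x * g y * u (x, y)) = (LINT y|lborel. LINT x|lborel. f x * g y * u (x, y))"
    and "integrable (lborel :: ('a \<times> 'b) measure) (\<lambda>z. f (fst z) * g (snd z) * u z)"
    and "integrable lborel (\<lambda>x. LINT y|lborel. f x * g y * u (x, y))"
    and "(LINT z|lborel. f (fst z) * g (snd z) * u z) = (LINT x|lborel. LINT y|lborel. f x * g y * u (x, y))"
proof -
  have [measurable]: "f \<in> borel_measurable borel" "g \<in> borel_measurable borel"
    using borel_measurable_integrable[OF f] borel_measurable_integrable[OF g] by simp_all
  have um: "u \<in> borel_measurable (borel \<Otimes>\<^sub>M borel)"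
    using borel_measurable_continuous_onI[OF u(1)] by (simp add: borel_prod)
  then have [measurable]: "u \<in> borel_measurable (lborel \<Otimes>\<^sub>M lborel)"
    by (simp cong: measurable_cong_sets sets_pair_measure_cong)
  have I: "integrable (lborel \<Otimes>\<^sub>M lborel) (\<lambda>z. f (fst z) * g (snd z) * u z)"
  proof (rule Bochner_Integration.integrable_bound)
    show "integrable (lborel \<Otimes>\<^sub>M lborel) (\<lambda>z. f (fst z) * g (snd z))"
    proof (rule lborel_pair.Fubini_integrable)
      show "integrable lborel (\<lambda>x. LINT y|lborel. norm (f (fst (x, y)) * g (snd (x, y))))"
        using f by (auto simp: norm_mult intro!: integrable_mult_left)
      show "AE x in lborel. integrable lborel (\<lambda>y. f (fst (x, y)) * g (snd (x, y)))"
        using g by (auto intro!: integrable_mult_right)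
    qed measurable
    show "AE z in lborel \<Otimes>\<^sub>M lborel. norm (f (fst z) * g (snd z) * u z) \<le> norm (f (fst z) * g (snd z))"
      using u(2) by (auto simp: norm_mult intro!: AE_I2 mult_left_le mult_nonneg_nonneg)
  qed measurable
  have I': "integrable (lborel \<Otimes>\<^sub>M lborel) (\<lambda>(x, y). f x * g y * u (x, y))"
  proof -
    have "(\<lambda>(x, y). f x * g y * u (x, y)) = (\<lambda>z. f (fst z) * g (snd z) * u z)" by auto
    then show ?thesis using I by (simp only:)
  qed
  show "(LINT x|lborel. LINT y|lborel. f x * g y * u (x, y)) = (LINT y|lborel. LINT x|lborel. f x * g y * u (x, y))"
    using lborel_pair.Fubini_integral[OF I'] by simp
  show "integrable (lborel :: ('a \<times> 'b) measure) (\<lambda>z. f (fst z) * g (snd z) * u z)"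
    using I by (simp add: lborel_prod)
  show "integrable lborel (\<lambda>x. LINT y|lborel. f x * g y * u (x, y))"
    using lborel_pair.integrable_fst'[OF I] by simp
  show "(LINT z|lborel. f (fst z) * g (snd z) * u z) = (LINT x|lborel. LINT y|lborel. f x * g y * u (x, y))"
    using lborel_pair.integral_fst'[OF I] by (simp add: lborel_prod)
qed

lemma lborel_integral_scale:
  fixes f :: "'a::euclidean_space \<Rightarrow> complex"
  assumes "c > 0" "f \<in> borel_measurable borel"
  shows "(LINT x|lborel. f x) = complex_of_real (c ^ DIM('a)) * (LINT x|lborel. f (c *\<^sub>R x))"
proof -
  have m: "(\<lambda>x. 0 + c *\<^sub>R x) \<in> measurable lborel (borel :: 'a measure)" by measurable
  have "(LINT x|lborel. f x)
      = (LINT x|density (distr lborel borel (\<lambda>x. 0 + c *\<^sub>R x)) (\<lambda>_. \<bar>c\<bar> ^ DIM('a)). f x)"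
    using lborel_affine[of c "0::'a"] assms(1) by simp
  also have "\<dots> = (LINT x|distr lborel borel (\<lambda>x. 0 + c *\<^sub>R x). (\<bar>c\<bar> ^ DIM('a)) *\<^sub>R f x)"
    by (rule integral_density) (use assms in auto)
  also have "\<dots> = (LINT x|lborel. (\<bar>c\<bar> ^ DIM('a)) *\<^sub>R f (c *\<^sub>R x))"
    by (subst integral_distr[OF m]) (use assms in auto)
  finally show ?thesis using assms(1) by (simp add: scaleR_conv_of_real)
qed

section \<open>The Gaussian and its Fourier transform\<close>

definition gauss :: "'a::euclidean_space \<Rightarrow> complex" where
  "gauss x = complex_of_real (exp (- (norm x)\<^sup>2 / 2))"

lemma gauss_eq_prod: "gauss x = (\<Prod>b\<in>Basis. complex_of_real (exp (- (x \<bullet> b)\<^sup>2 / 2)))"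
proof -
  have "(norm x)\<^sup>2 = (\<Sum>b\<in>Basis. (x \<bullet> b)\<^sup>2)"
    unfolding power2_norm_eq_inner euclidean_inner[of x x] by (simp add: power2_eq_square)
  then show ?thesis by (simp add: gauss_def exp_sum[symmetric] sum_divide_distrib sum_negf flip: of_real_prod)
qed

lemma continuous_gauss: "continuous_on S gauss"
  unfolding gauss_def by (intro continuous_intros) auto

lemma gauss_bound: "cmod (gauss x) \<le> 1"
  by (simp add: gauss_def)

text \<open>Up to the normalization sqrt(2 pi) of the density, this integral is the characteristic
  function of the standard normal distribution at \<open>- s\<close>.\<close>

lemma fourier_gauss_real:
  "integrable lborel (\<lambda>t::real. exp (- \<i> * complex_of_real (t * s)) * complex_of_real (exp (- t\<^sup>2 / 2)))"
  "(LINT t|lborel. exp (- \<i> * complex_of_real (t * s)) * complex_of_real (exp (- t\<^sup>2 / 2)))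
    = complex_of_real (sqrt (2 * pi) * exp (- s\<^sup>2 / 2))"
proof -
  have d: "std_normal_density t = exp (- t\<^sup>2 / 2) / sqrt (2 * pi)" for t
    by (simp add: std_normal_density_def)
  have "integrable lborel (\<lambda>t. sqrt (2 * pi) * std_normal_density t)"
    using integrable_std_normal_moment[of 0] by (intro integrable_mult_right) simp
  then have g: "integrable lborel (\<lambda>t. exp (- t\<^sup>2 / 2) :: real)" by (simp add: d)
  show "integrable lborel (\<lambda>t::real. exp (- \<i> * complex_of_real (t * s)) * complex_of_real (exp (- t\<^sup>2 / 2)))"
    by (rule Bochner_Integration.integrable_bound[OF g])
      (auto simp: norm_mult intro!: borel_measurable_continuous_onI continuous_intros)
  have "char std_normal_distribution (- s) = complex_of_real (exp (- s\<^sup>2 / 2))"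
    by (simp add: char_std_normal_distribution)
  also have "char std_normal_distribution (- s)
      = (LINT t|lborel. std_normal_density t *\<^sub>R iexp (- s * t))"
    unfolding char_def by (subst integral_density) (auto intro!: borel_measurable_continuous_onI continuous_intros)
  also have "\<dots> = (LINT t|lborel. complex_of_real (1 / sqrt (2 * pi))
      * (exp (- \<i> * complex_of_real (t * s)) * complex_of_real (exp (- t\<^sup>2 / 2))))"
    by (intro Bochner_Integration.integral_cong refl)
      (simp add: d scaleR_conv_of_real mult_ac of_real_divide)
  also have "\<dots> = complex_of_real (1 / sqrt (2 * pi))
      * (LINT t|lborel. exp (- \<i> * complex_of_real (t * s)) * complex_of_real (exp (- t\<^sup>2 / 2)))"
    by (rule integral_mult_right_zero)
  finally have *: "complex_of_real (1 / sqrt (2 * pi))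
      * (LINT t|lborel. exp (- \<i> * complex_of_real (t * s)) * complex_of_real (exp (- t\<^sup>2 / 2)))
      = complex_of_real (exp (- s\<^sup>2 / 2))" by simp
  have "complex_of_real (sqrt (2 * pi)) * complex_of_real (1 / sqrt (2 * pi)) = 1"
    unfolding of_real_mult[symmetric] by simp
  then show "(LINT t|lborel. exp (- \<i> * complex_of_real (t * s)) * complex_of_real (exp (- t\<^sup>2 / 2)))
    = complex_of_real (sqrt (2 * pi) * exp (- s\<^sup>2 / 2))"
    unfolding of_real_mult *[symmetric] mult.assoc[symmetric] by simp
qed

lemma fourier_gauss:
  fixes \<xi> :: "'a::euclidean_space"
  shows "fourier gauss \<xi> = complex_of_real (sqrt (2 * pi) ^ DIM('a)) * gauss \<xi>"
proof -
  have "exp (- \<i> * complex_of_real (x \<bullet> \<xi>)) * gauss x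
      = (\<Prod>b\<in>Basis. exp (- \<i> * complex_of_real ((x \<bullet> b) * (\<xi> \<bullet> b)))
          * complex_of_real (exp (- (x \<bullet> b)\<^sup>2 / 2)))" for x :: 'a
  proof -
    have "exp (- \<i> * complex_of_real (x \<bullet> \<xi>)) = (\<Prod>b\<in>Basis. exp (- \<i> * complex_of_real ((x \<bullet> b) * (\<xi> \<bullet> b))))"
      by (subst euclidean_inner) (simp add: exp_sum[symmetric] sum_distrib_left sum_negf)
    then show ?thesis by (simp add: gauss_eq_prod prod.distrib)
  qed
  then have "fourier gauss \<xi> = (LINT x|lborel. (\<Prod>b\<in>Basis.
      (\<lambda>t. exp (- \<i> * complex_of_real (t * (\<xi> \<bullet> b))) * complex_of_real (exp (- t\<^sup>2 / 2))) ((x::'a) \<bullet> b)))"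
    by (simp add: fourier_def)
  also have "\<dots> = (\<Prod>b\<in>(Basis::'a set). LINT t|lborel. exp (- \<i> * complex_of_real (t * (\<xi> \<bullet> b)))
      * complex_of_real (exp (- t\<^sup>2 / 2)))"
    by (rule integrable_lborel_prod(2)) (rule fourier_gauss_real(1))
  also have "\<dots> = (\<Prod>b\<in>(Basis::'a set). complex_of_real (sqrt (2 * pi)) * complex_of_real (exp (- (\<xi> \<bullet> b)\<^sup>2 / 2)))"
    by (intro prod.cong refl, subst fourier_gauss_real(2)) simp
  finally show ?thesis by (simp add: gauss_eq_prod prod.distrib)
qed

lemma integrable_gauss: "integrable lborel (gauss :: 'a::euclidean_space \<Rightarrow> complex)"
proof -
  have "integrable lborel (\<lambda>x::'a. \<Prod>b\<in>Basis. (\<lambda>t. complex_of_real (exp (- t\<^sup>2 / 2))) (x \<bullet> b))"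
    using fourier_gauss_real(1)[of 0] by (intro integrable_lborel_prod(1)) simp
  then show ?thesis by (simp add: gauss_eq_prod[abs_def])
qed

section \<open>The inversion formula\<close>

lemma fourier_integrable:
  fixes f :: "'a::euclidean_space \<Rightarrow> complex"
  assumes f: "smooth_on UNIV f" and K: "compact K" "\<And>x. x \<notin> K \<Longrightarrow> f x = 0"
  shows "integrable lborel (fourier f)"
proof -
  have "bounded ((one_minus_laplace ^^ DIM('a)) f ` K)"
    by (intro compact_imp_bounded compact_continuous_image K(1)
        continuous_on_subset[OF smooth_on_imp_continuous[OF open_UNIV fourier_one_minus_laplace_power(2)[OF f K]]]) auto
  then obtain C where C: "\<And>x. x \<in> K \<Longrightarrow> cmod ((one_minus_laplace ^^ DIM('a)) f x) \<le> C"
    unfolding bounded_iff by auto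
  have "cmod (fourier f \<xi>) \<le> C * measure lborel K * inverse ((1 + (norm \<xi>)\<^sup>2) ^ DIM('a))" for \<xi>
  proof -
    have "(1 + (norm \<xi>)\<^sup>2) ^ DIM('a) > 0" by (intro zero_less_power add_pos_nonneg) auto
    then show ?thesis using fourier_decay[OF f K C, of \<xi>] by (simp add: field_simps)
  qed
  then have le: "cmod (fourier f \<xi>) \<le> norm (C * measure lborel K * inverse ((1 + (norm \<xi>)\<^sup>2) ^ DIM('a)))" for \<xi>
    using order_trans[OF _ abs_ge_self] by (metis real_norm_def)
  have I: "integrable lborel (\<lambda>\<xi>::'a. C * measure lborel K * inverse ((1 + (norm \<xi>)\<^sup>2) ^ DIM('a)))"
    by (intro integrable_mult_right integrable_inverse_bracket)
  have m: "fourier f \<in> borel_measurable lborel"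
    using fourier_measurable[OF borel_measurable_continuous_onI[OF smooth_on_imp_continuous[OF open_UNIV f]]] by simp
  show ?thesis by (rule Bochner_Integration.integrable_bound[OF I m AE_I2[OF le]])
qed

text \<open>With the present normalization this is (2 pi)^d for d the dimension. Estimates derived
  from the inversion formula divide by it, hence the lemma that follows.\<close>

definition inversion_const :: "'a::euclidean_space itself \<Rightarrow> complex" where
  "inversion_const _ = (LINT x|lborel. fourier gauss (x::'a))"

lemma inversion_const_nonzero: "inversion_const TYPE('a::euclidean_space) \<noteq> 0"
proof -
  have "(LINT x|lborel. gauss (x::'a)) = fourier gauss (0::'a)" by (simp add: fourier_def)
  also have "\<dots> \<noteq> 0" by (simp add: fourier_gauss gauss_def)
  finally show ?thesis by (simp add: inversion_const_def fourier_gauss)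
qed

text \<open>Gaussian summation: insert the factor \<open>gauss (h n *\<^sub>R \<xi>)\<close>, move
  the transform from \<open>f\<close> to the Gaussian, and let \<open>h n\<close> tend to 0 on both
  sides. The left side tends to the integral sought, the right side to \<open>f 0\<close> times the
  integral of the transformed Gaussian.\<close>

lemma fourier_inversion_0:
  fixes f :: "'a::euclidean_space \<Rightarrow> complex"
  assumes f: "smooth_on UNIV f" and K: "compact K" "\<And>x. x \<notin> K \<Longrightarrow> f x = 0"
  shows "(LINT \<xi>|lborel. fourier f \<xi>) = inversion_const TYPE('a) * f 0"
proof -
  have cf: "continuous_on UNIV f" using smooth_on_imp_continuous[OF open_UNIV f] .
  have If: "integrable lborel f" using cf K by (rule integrable_compact_support)
  note Iff = fourier_integrable[OF f K]
  have fm: "f \<in> borel_measurable borel" using borel_measurable_continuous_onI[OF cf] .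
  have gm: "gauss \<in> borel_measurable (borel :: 'a measure)"
    using borel_measurable_continuous_onI[OF continuous_gauss] .
  have If': "integrable lborel (fourier gauss :: 'a \<Rightarrow> complex)"
    unfolding fourier_gauss[abs_def] by (intro integrable_mult_right integrable_gauss)
  define h :: "nat \<Rightarrow> real" where "h n = inverse (real (Suc n))" for n
  have h: "h n > 0" for n by (simp add: h_def)
  have h0: "h \<longlonglongrightarrow> 0" unfolding h_def by (rule LIMSEQ_inverse_real_of_nat)
  obtain B where B: "\<And>x. cmod (f x) \<le> B"
  proof -
    have "bounded (f ` K)"
      by (intro compact_imp_bounded compact_continuous_image K(1) continuous_on_subset[OF cf]) auto
    then obtain B where "\<And>x. x \<in> K \<Longrightarrow> cmod (f x) \<le> B" unfolding bounded_iff by auto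
    then have "cmod (f x) \<le> \<bar>B\<bar>" for x using K(2)[of x] by (cases "x \<in> K") force+
    then show ?thesis using that by blast
  qed
  have hm: "(\<lambda>x::'a. h n *\<^sub>R x) \<in> measurable borel borel" for n by measurable
  have 1: "(\<lambda>n. LINT \<xi>|lborel. fourier f \<xi> * gauss (h n *\<^sub>R \<xi>)) \<longlonglongrightarrow> (LINT \<xi>|lborel. fourier f \<xi>)"
  proof (rule integral_dominated_convergence[where w = "\<lambda>\<xi>. cmod (fourier f \<xi>)"])
    show "fourier f \<in> borel_measurable lborel" using borel_measurable_integrable[OF Iff] .
    show "(\<lambda>\<xi>. fourier f \<xi> * gauss (h n *\<^sub>R \<xi>)) \<in> borel_measurable lborel" for n
      using borel_measurable_integrable[OF Iff] measurable_compose[OF hm gm] by (intro borel_measurable_times) simp_all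
    show "AE \<xi> in lborel. (\<lambda>n. fourier f \<xi> * gauss (h n *\<^sub>R \<xi>)) \<longlonglongrightarrow> fourier f \<xi>"
    proof (rule AE_I2)
      fix \<xi> :: 'a
      have "(\<lambda>n. gauss (h n *\<^sub>R \<xi>)) \<longlonglongrightarrow> gauss (0 *\<^sub>R \<xi>)"
        using continuous_gauss[of UNIV] by (intro isCont_tendsto_compose[of _ gauss] tendsto_scaleR h0 tendsto_const)
          (auto simp: continuous_on_eq_continuous_at)
      from tendsto_mult[OF tendsto_const[of "fourier f \<xi>"] this]
      show "(\<lambda>n. fourier f \<xi> * gauss (h n *\<^sub>R \<xi>)) \<longlonglongrightarrow> fourier f \<xi>" by (simp add: gauss_def)
    qed
    show "AE \<xi> in lborel. norm (fourier f \<xi> * gauss (h n *\<^sub>R \<xi>)) \<le> cmod (fourier f \<xi>)" for n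
      by (auto simp: norm_mult gauss_bound intro!: AE_I2 mult_left_le)
    show "integrable lborel (\<lambda>\<xi>. cmod (fourier f \<xi>))" using Iff by simp
  qed
  \<comment> \<open>Fubini moves the transform, and scaling \<open>x\<close> by \<open>h n\<close>
    absorbs the dilation: the Jacobian of \<open>x\<close> is exactly what the dilated Gaussian
    needs to become \<open>fourier gauss x\<close>.\<close>
  have 2: "(LINT \<xi>|lborel. fourier f \<xi> * gauss (h n *\<^sub>R \<xi>)) = (LINT x|lborel. f (h n *\<^sub>R x) * fourier gauss x)" for n
  proof -
    let ?g = "\<lambda>\<xi>::'a. gauss (h n *\<^sub>R \<xi>)"
    let ?u = "\<lambda>z::'a \<times> 'a. exp (- \<i> * complex_of_real (fst z \<bullet> snd z))"
    have gmn: "?g \<in> borel_measurable borel" by (rule measurable_compose[OF hm gm])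
    have Ig: "integrable lborel ?g"
    proof -
      have "integrable (density (distr lborel borel (\<lambda>x. 0 + h n *\<^sub>R x)) (\<lambda>_. \<bar>h n\<bar> ^ DIM('a))) (gauss :: 'a \<Rightarrow> complex)"
        using lborel_affine[of "h n" "0::'a"] integrable_gauss h[of n] by simp
      then have "integrable (distr lborel borel (\<lambda>x. 0 + h n *\<^sub>R x)) (\<lambda>x::'a. (\<bar>h n\<bar> ^ DIM('a)) *\<^sub>R gauss x)"
        by (subst (asm) integrable_density) (use gm in auto)
      then have "integrable lborel (\<lambda>x::'a. (\<bar>h n\<bar> ^ DIM('a)) *\<^sub>R gauss (h n *\<^sub>R x))"
        by (subst (asm) integrable_distr_eq) (use gm in auto)
      from integrable_scaleR_right[OF this, of "inverse (h n ^ DIM('a))"]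
      show ?thesis using h[of n] by simp
    qed
    have cu: "continuous_on UNIV ?u" by (intro continuous_intros)
    have "(LINT \<xi>|lborel. fourier f \<xi> * ?g \<xi>) = (LINT \<xi>|lborel. LINT x|lborel. f x * ?g \<xi> * ?u (x, \<xi>))"
    proof (intro Bochner_Integration.integral_cong refl)
      fix \<xi>
      have "fourier f \<xi> * ?g \<xi> = (LINT x|lborel. exp (- \<i> * complex_of_real (x \<bullet> \<xi>)) * f x * ?g \<xi>)"
        unfolding fourier_def by (rule integral_mult_left_zero[symmetric])
      also have "\<dots> = (LINT x|lborel. f x * ?g \<xi> * ?u (x, \<xi>))"
        by (intro Bochner_Integration.integral_cong refl) simp
      finally show "fourier f \<xi> * ?g \<xi> = (LINT x|lborel. f x * ?g \<xi> * ?u (x, \<xi>))" .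
    qed
    also have "\<dots> = (LINT x|lborel. LINT \<xi>|lborel. f x * ?g \<xi> * ?u (x, \<xi>))"
      by (rule fubini_product(1)[OF If Ig cu, symmetric]) simp
    also have "\<dots> = (LINT x|lborel. f x * (LINT \<xi>|lborel. ?g \<xi> * ?u (x, \<xi>)))"
      by (simp add: mult.assoc)
    also have "\<dots> = complex_of_real (h n ^ DIM('a))
        * (LINT x|lborel. f (h n *\<^sub>R x) * (LINT \<xi>|lborel. ?g \<xi> * ?u (h n *\<^sub>R x, \<xi>)))"
    proof (rule lborel_integral_scale[OF h])
      have "(\<lambda>x. f x * (LINT \<xi>|lborel. ?g \<xi> * ?u (x, \<xi>))) = (\<lambda>x. f x * fourier ?g x)"
        by (simp add: fourier_def mult_ac inner_commute)
      then show "(\<lambda>x. f x * (LINT \<xi>|lborel. ?g \<xi> * ?u (x, \<xi>))) \<in> borel_measurable borel"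
        using fourier_measurable[OF gmn] fm by simp
    qed
    also have "\<dots> = (LINT x|lborel. f (h n *\<^sub>R x) * (complex_of_real (h n ^ DIM('a)) * (LINT \<xi>|lborel. ?g \<xi> * ?u (h n *\<^sub>R x, \<xi>))))"
      by (simp add: mult_ac flip: integral_mult_right_zero)
    also have "\<dots> = (LINT x|lborel. f (h n *\<^sub>R x) * fourier gauss x)"
    proof (intro Bochner_Integration.integral_cong refl arg_cong2[where f = "(*)"])
      fix x :: 'a
      have "fourier gauss x = (LINT \<xi>|lborel. gauss \<xi> * exp (- \<i> * complex_of_real (x \<bullet> \<xi>)))"
        by (simp add: fourier_def mult_ac inner_commute)
      also have "\<dots> = complex_of_real (h n ^ DIM('a)) * (LINT \<xi>|lborel. ?g \<xi> * exp (- \<i> * complex_of_real (x \<bullet> (h n *\<^sub>R \<xi>))))"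
        by (rule lborel_integral_scale[OF h])
          (intro borel_measurable_times gm borel_measurable_continuous_onI continuous_intros)
      finally show "complex_of_real (h n ^ DIM('a)) * (LINT \<xi>|lborel. ?g \<xi> * ?u (h n *\<^sub>R x, \<xi>)) = fourier gauss x"
        by simp
    qed
    finally show ?thesis .
  qed
  have 3: "(\<lambda>n. LINT x|lborel. f (h n *\<^sub>R x) * fourier gauss x) \<longlonglongrightarrow> (LINT x|lborel. f 0 * fourier gauss (x::'a))"
  proof (rule integral_dominated_convergence[where w = "\<lambda>x. B * cmod (fourier gauss x)"])
    show "(\<lambda>x::'a. f 0 * fourier gauss x) \<in> borel_measurable lborel"
      using borel_measurable_integrable[OF If'] by simp
    show "(\<lambda>x. f (h n *\<^sub>R x) * fourier gauss x) \<in> borel_measurable lborel" for n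
      using borel_measurable_integrable[OF If'] measurable_compose[OF hm fm] by (intro borel_measurable_times) simp_all
    show "AE x in lborel. (\<lambda>n. f (h n *\<^sub>R x) * fourier gauss x) \<longlonglongrightarrow> f 0 * fourier gauss x"
    proof (rule AE_I2)
      fix x :: 'a
      have "(\<lambda>n. f (h n *\<^sub>R x)) \<longlonglongrightarrow> f (0 *\<^sub>R x)"
        using cf by (intro isCont_tendsto_compose[of _ f] tendsto_scaleR h0 tendsto_const)
          (auto simp: continuous_on_eq_continuous_at)
      from tendsto_mult[OF this tendsto_const]
      show "(\<lambda>n. f (h n *\<^sub>R x) * fourier gauss x) \<longlonglongrightarrow> f 0 * fourier gauss x" by simp
    qed
    show "AE x in lborel. norm (f (h n *\<^sub>R x) * fourier gauss x) \<le> B * cmod (fourier gauss x)" for n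
      using B by (auto simp: norm_mult intro!: AE_I2 mult_right_mono)
    show "integrable lborel (\<lambda>x::'a. B * cmod (fourier gauss x))" using If' by (intro integrable_mult_right) simp
  qed
  have "(LINT \<xi>|lborel. fourier f \<xi>) = (LINT x|lborel. f 0 * fourier gauss (x::'a))"
    using LIMSEQ_unique[OF 1[unfolded 2] 3] .
  then show ?thesis by (simp add: inversion_const_def)
qed

theorem fourier_inversion:
  fixes f :: "'a::euclidean_space \<Rightarrow> complex"
  assumes f: "smooth_on UNIV f" and K: "compact K" "\<And>x. x \<notin> K \<Longrightarrow> f x = 0"
  shows "(LINT \<xi>|lborel. fourier f \<xi> * exp (\<i> * complex_of_real (x \<bullet> \<xi>))) = inversion_const TYPE('a) * f x"
proof -
  \<comment> \<open>Translating by \<open>x\<close> multiplies the transform by exp(i x.\<xi>),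
    which reduces inversion at \<open>x\<close> to inversion at 0.\<close>
  define g where "g y = f (x + y)" for y
  have fm: "f \<in> borel_measurable borel"
    using borel_measurable_continuous_onI[OF smooth_on_imp_continuous[OF open_UNIV f]] .
  have "fourier g \<xi> = fourier f \<xi> * exp (\<i> * complex_of_real (x \<bullet> \<xi>))" for \<xi>
  proof -
    have "fourier f \<xi> = (LINT y|lborel. exp (- \<i> * complex_of_real ((x + y) \<bullet> \<xi>)) * f (x + y))"
      unfolding fourier_def
      by (rule lborel_integral_translate[symmetric])
        (intro borel_measurable_times fm borel_measurable_continuous_onI continuous_intros)
    also have "\<dots> = (LINT y|lborel. exp (- \<i> * complex_of_real (x \<bullet> \<xi>)) * (exp (- \<i> * complex_of_real (y \<bullet> \<xi>)) * g y))"
      by (simp add: g_def inner_add_left exp_add[symmetric] algebra_simps)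
    also have "\<dots> = exp (- \<i> * complex_of_real (x \<bullet> \<xi>)) * fourier g \<xi>"
      unfolding fourier_def by (rule integral_mult_right_zero)
    finally show ?thesis by (simp add: exp_minus field_simps)
  qed
  moreover have "(LINT \<xi>|lborel. fourier g \<xi>) = inversion_const TYPE('a) * g 0"
  proof (rule fourier_inversion_0)
    show "smooth_on UNIV g" unfolding g_def
      by (rule smooth_on_compose[OF open_UNIV open_UNIV f])
        (auto intro!: smooth_on_add smooth_on_const smooth_on_ident)
    show "compact ((\<lambda>y. - x + y) ` K)" using K(1) by (rule compact_translation)
    show "g y = 0" if "y \<notin> (\<lambda>y. - x + y) ` K" for y
      using that K(2)[of "x + y"] by (force simp: g_def)
  qed
  ultimately show ?thesis by (simp add: g_def)
qed

section \<open>Bump functions\<close>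

text \<open>The functions x^(-k) exp(-1/x), continued by 0. The powers are included because
  differentiating \<open>flat k\<close> gives a combination of \<open>flat (k + 2)\<close> and
  \<open>flat (k + 1)\<close>, so smoothness of the whole family follows by one induction.\<close>

definition flat :: "nat \<Rightarrow> real \<Rightarrow> real" where
  "flat k x = (if x > 0 then (1 / x) ^ k * exp (- (1 / x)) else 0)"

lemma flat_tendsto_0: "((\<lambda>x. (1 / x) ^ k * exp (- (1 / x))) \<longlongrightarrow> 0) (at_right (0::real))"
proof -
  have "((\<lambda>y. y ^ k / exp y) \<longlongrightarrow> 0) (at_top :: real filter)"
    by (rule tendsto_power_div_exp_0)
  from filterlim_compose[OF this filterlim_inverse_at_top_right]
  show ?thesis by (simp add: exp_minus divide_inverse)
qed

lemma has_derivative_flat: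
  "(flat k has_real_derivative (flat (k + 2) x - real k * flat (k + 1) x)) (at x)"
proof -
  consider "x > 0" | "x < 0" | "x = 0" by linarith
  then show ?thesis
  proof cases
    case 1
    have "((\<lambda>x. (1 / x) ^ k * exp (- (1 / x))) has_real_derivative
        (flat (k + 2) x - real k * flat (k + 1) x)) (at x)"
    proof (cases k)
      case 0
      then show ?thesis using 1
        by (auto intro!: derivative_eq_intros simp: flat_def power2_eq_square divide_simps)
    next
      case (Suc j)
      then show ?thesis using 1
        by (auto intro!: derivative_eq_intros simp: flat_def power2_eq_square divide_simps)
          (cases j; simp add: algebra_simps)
    qed
    then show ?thesis
      by (rule DERIV_cong_ev[THEN iffD1, rotated 3])
        (auto simp: flat_def eventually_nhds intro!: exI[of _ "{0<..}"] 1)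
  next
    case 2
    have "((\<lambda>x. 0) has_real_derivative (flat (k + 2) x - real k * flat (k + 1) x)) (at x)"
      using 2 by (simp add: flat_def)
    then show ?thesis
      by (rule DERIV_cong_ev[THEN iffD1, rotated 3])
        (auto simp: flat_def eventually_nhds intro!: exI[of _ "{..<0}"] 2)
  next
    case 3
    \<comment> \<open>For positive \<open>h\<close> the difference quotient at 0 is
      \<open>flat (Suc k) h\<close>.\<close>
    have "((\<lambda>h. (flat k (0 + h) - flat k 0) / h) \<longlongrightarrow> 0) (at_right 0)"
    proof (rule Lim_transform_eventually[OF flat_tendsto_0[of "Suc k"]])
      show "\<forall>\<^sub>F h in at_right 0. (1 / h) ^ Suc k * exp (- (1 / h)) = (flat k (0 + h) - flat k 0) / h"
        unfolding eventually_at_right_field by (intro exI[of _ 1]) (auto simp: flat_def)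
    qed
    moreover have "((\<lambda>h. (flat k (0 + h) - flat k 0) / h) \<longlongrightarrow> 0) (at_left 0)"
    proof (rule Lim_transform_eventually[OF tendsto_const])
      show "\<forall>\<^sub>F h in at_left 0. 0 = (flat k (0 + h) - flat k 0) / h"
        unfolding eventually_at_left_field by (intro exI[of _ "-1"]) (auto simp: flat_def)
    qed
    ultimately have "((\<lambda>h. (flat k (0 + h) - flat k 0) / h) \<longlongrightarrow> 0) (at 0)"
      using filterlim_split_at by blast
    then show ?thesis using 3 by (simp add: DERIV_def flat_def)
  qed
qed

lemma smooth_on_flat: "smooth_on UNIV (flat k)"
proof -
  have "ndiff j UNIV (flat k)" for j k
  proof (induction j arbitrary: k)
    case 0
    show ?case using DERIV_isCont[OF has_derivative_flat] by (simp add: continuous_at_imp_continuous_on)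
  next
    case (Suc j)
    show ?case
    proof (rule ndiff_SucI[OF open_UNIV])
      show "(flat k has_derivative (\<lambda>h. (flat (k + 2) x - real k * flat (k + 1) x) * h)) (at x)" for x
        using has_derivative_flat[of k x] by (simp add: has_field_derivative_def)
      show "ndiff j UNIV (\<lambda>x. (flat (k + 2) x - real k * flat (k + 1) x) * b)" for b
        by (intro ndiff_mult ndiff_diff ndiff_const Suc open_UNIV)
    qed
  qed
  then show ?thesis by (simp add: smooth_on_iff_ndiff)
qed

lemma bump_exists:
  fixes x0 :: "'a::euclidean_space"
  assumes "r > 0"
  obtains \<phi> :: "'a \<Rightarrow> real" where "smooth_on UNIV \<phi>" "\<phi> x0 = 1" "\<And>x. \<phi> x \<ge> 0"
    "\<And>x. x \<notin> cball x0 r \<Longrightarrow> \<phi> x = 0"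
proof
  let ?q = "\<lambda>x::'a. r\<^sup>2 - (x - x0) \<bullet> (x - x0)"
  let ?\<phi> = "\<lambda>x. flat 0 (?q x) * inverse (flat 0 (r\<^sup>2))"
  have fp: "flat 0 (r\<^sup>2) > 0" using assms by (simp add: flat_def)
  show "smooth_on UNIV ?\<phi>"
    by (intro smooth_on_mult smooth_on_const smooth_on_compose[OF open_UNIV open_UNIV smooth_on_flat]
        smooth_on_diff smooth_on_inner smooth_on_ident open_UNIV UNIV_I)
  show "?\<phi> x0 = 1" using fp by simp
  show "?\<phi> x \<ge> 0" for x using fp by (simp add: flat_def)
  show "?\<phi> x = 0" if "x \<notin> cball x0 r" for x
  proof -
    have "r < norm (x - x0)" using that by (simp add: dist_norm norm_minus_commute)
    then have "r\<^sup>2 < (norm (x - x0))\<^sup>2" using assms by (intro power_strict_mono) auto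
    then show ?thesis by (simp add: flat_def power2_norm_eq_inner)
  qed
qed

section \<open>Non-stationary phase\<close>

text \<open>The phase that appears in the transform of \<open>A z * f (F z)\<close> at \<zeta> once
  \<open>f\<close> is written by Fourier inversion with frequency \<eta>. Both frequencies are kept
  as variables so that bounds can be made uniform in them by compactness.\<close>

definition phase :: "('a::euclidean_space \<Rightarrow> 'b::euclidean_space) \<Rightarrow> 'a \<times> 'b \<times> 'a \<Rightarrow> real" where
  "phase F = (\<lambda>(z, \<eta>, \<zeta>). F z \<bullet> \<eta> - z \<bullet> \<zeta>)"

definition dphase :: "('a::euclidean_space \<Rightarrow> 'b::euclidean_space) \<Rightarrow> 'a \<Rightarrow> 'a \<times> 'b \<times> 'a \<Rightarrow> real" where
  "dphase F b = (\<lambda>(z, \<eta>, \<zeta>). partial_deriv b F z \<bullet> \<eta> - b \<bullet> \<zeta>)"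

text \<open>The squared length of the gradient of the phase in \<open>z\<close>, that is, of the
  vector DF^T \<eta> - \<zeta>.\<close>

definition dphase2 :: "('a::euclidean_space \<Rightarrow> 'b::euclidean_space) \<Rightarrow> 'a \<times> 'b \<times> 'a \<Rightarrow> real" where
  "dphase2 F p = (\<Sum>b\<in>Basis. (dphase F b p)\<^sup>2)"

text \<open>The divergence in \<open>z\<close> of the field (gradient / |gradient|^2) times
  \<open>B\<close>. Up to sign this is the transpose of the first-order operator that reproduces
  exp(i t phase) up to the factor i t.\<close>

definition phase_op :: "('a::euclidean_space \<Rightarrow> 'b::euclidean_space) \<Rightarrow>
    ('a \<times> 'b \<times> 'a \<Rightarrow> complex) \<Rightarrow> 'a \<times> 'b \<times> 'a \<Rightarrow> complex" where
  "phase_op F B p = (\<Sum>b\<in>Basis. partial_deriv (b, 0)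
     (\<lambda>p. (dphase F b p * inverse (dphase2 F p)) *\<^sub>R B p) p)"

lemma smooth_on_fst: "open X \<Longrightarrow> smooth_on X fst"
  using smooth_on_bounded_linear[OF _ bounded_linear_fst smooth_on_ident] by blast

lemma smooth_on_snd: "open X \<Longrightarrow> smooth_on X snd"
  using smooth_on_bounded_linear[OF _ bounded_linear_snd smooth_on_ident] by blast

lemma smooth_on_snd_comp:
  "open X \<Longrightarrow> smooth_on X f \<Longrightarrow> smooth_on X (\<lambda>x. snd (f x))"
  by (rule smooth_on_bounded_linear[OF _ bounded_linear_snd])

lemma smooth_on_fst_comp:
  "open X \<Longrightarrow> smooth_on X f \<Longrightarrow> smooth_on X (\<lambda>x. fst (f x))"
  by (rule smooth_on_bounded_linear[OF _ bounded_linear_fst])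

context
  fixes F :: "'a::euclidean_space \<Rightarrow> 'b::euclidean_space"
  assumes F: "smooth_on UNIV F"
begin

lemma smooth_dphase: "open X \<Longrightarrow> smooth_on X (dphase F b)"
  unfolding dphase_def split_beta
  by (intro smooth_on_diff smooth_on_inner smooth_on_const smooth_on_fst_comp smooth_on_snd_comp
      smooth_on_ident smooth_on_compose[OF _ open_UNIV smooth_on_partial_deriv[OF open_UNIV F]] UNIV_I)

lemma smooth_dphase2: "open X \<Longrightarrow> smooth_on X (dphase2 F)"
  unfolding dphase2_def[abs_def] power2_eq_square
  by (intro smooth_on_sum smooth_on_mult smooth_dphase)

lemma open_nonstationary: "open {p. dphase2 F p \<noteq> 0}"
  by (intro open_Collect_neq smooth_on_imp_continuous[OF open_UNIV smooth_dphase2] continuous_on_const open_UNIV)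

lemma smooth_phase_field:
  assumes "smooth_on {p. dphase2 F p \<noteq> 0} B"
  shows "smooth_on {p. dphase2 F p \<noteq> 0} (\<lambda>p. (dphase F b p * inverse (dphase2 F p)) *\<^sub>R B p)"
  using assms
  by (intro smooth_on_scaleR smooth_on_mult smooth_on_inverse smooth_dphase smooth_dphase2 open_nonstationary) auto

lemma smooth_phase_op:
  assumes "smooth_on {p. dphase2 F p \<noteq> 0} B" shows "smooth_on {p. dphase2 F p \<noteq> 0} (phase_op F B)"
  unfolding phase_op_def[abs_def]
  by (intro smooth_on_sum smooth_on_partial_deriv smooth_phase_field assms open_nonstationary)

lemma phase_op_zero_off:
  assumes "closed K" "\<And>z \<omega>. z \<notin> K \<Longrightarrow> B (z, \<omega>) = 0" "z \<notin> K"
  shows "phase_op F B (z, \<omega>) = 0"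
  unfolding phase_op_def
  by (rule sum.neutral, rule ballI, rule partial_deriv_zero_off[of "K \<times> UNIV"])
    (use assms in \<open>auto intro: closed_Times\<close>)

text \<open>The divergence of \<open>v\<close> times the exponential integrates to zero. By the
  product rule it equals \<open>phase_op F B\<close> times the exponential plus i t times the
  pairing of \<open>v\<close> with the gradient, and that pairing is \<open>B\<close>.\<close>

lemma phase_integration_by_parts:
  fixes \<eta> :: 'b and \<zeta> :: 'a
  assumes B: "smooth_on {p. dphase2 F p \<noteq> 0} B"
    and K: "compact K" "\<And>z \<omega>. z \<notin> K \<Longrightarrow> B (z, \<omega>) = 0"
    and ns: "\<And>z. z \<in> K \<Longrightarrow> dphase2 F (z, \<eta>, \<zeta>) \<noteq> 0"
  shows "(LINT z|lborel. phase_op F B (z, \<eta>, \<zeta>) * exp (\<i> * complex_of_real (t * phase F (z, \<eta>, \<zeta>))))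
    = - (\<i> * complex_of_real t) * (LINT z|lborel. B (z, \<eta>, \<zeta>) * exp (\<i> * complex_of_real (t * phase F (z, \<eta>, \<zeta>))))"
proof -
  let ?e = "\<lambda>z. exp (\<i> * complex_of_real (t * phase F (z, \<eta>, \<zeta>)))"
  define v where "v b z = (dphase F b (z, \<eta>, \<zeta>) * inverse (dphase2 F (z, \<eta>, \<zeta>))) *\<^sub>R B (z, \<eta>, \<zeta>)" for b z
  define U where "U = {z. dphase2 F (z, \<eta>, \<zeta>) \<noteq> 0}"
  have U: "open U"
  proof -
    have "continuous_on UNIV (\<lambda>z. dphase2 F (z, \<eta>, \<zeta>))"
      by (rule continuous_on_compose2[OF smooth_on_imp_continuous[OF open_UNIV smooth_dphase2]])
        (auto intro!: continuous_intros)
    then show ?thesis unfolding U_def by (intro open_Collect_neq) auto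
  qed
  have KU: "K \<subseteq> U" using ns by (auto simp: U_def)
  have cK: "closed K" using K(1) by (rule compact_imp_closed)
  have v0: "v b z = 0" if "z \<notin> K" for b z using K(2)[OF that] by (simp add: v_def)
  have pair: "smooth_on X (\<lambda>z. (z, \<eta>, \<zeta>))" if "open X" for X
    using that by (intro smooth_on_Pair smooth_on_const smooth_on_ident)
  have v: "smooth_on UNIV (v b)" for b
  proof (rule smooth_on_zero_extension[OF U cK KU _ v0])
    show "smooth_on U (v b)" unfolding v_def
      by (rule smooth_on_compose[OF U open_nonstationary smooth_phase_field[OF B] pair[OF U]]) (auto simp: U_def)
  qed
  have sth: "smooth_on UNIV (\<lambda>z. t * phase F (z, \<eta>, \<zeta>))"
    unfolding phase_def
    by (simp, intro smooth_on_mult smooth_on_const smooth_on_diff smooth_on_inner F smooth_on_ident open_UNIV)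
  have e: "smooth_on UNIV ?e"
    by (intro smooth_on_cexp smooth_on_mult smooth_on_const smooth_on_of_real sth open_UNIV)
  have dth: "((\<lambda>z. t * phase F (z, \<eta>, \<zeta>)) has_derivative
      (\<lambda>h. t * (frechet_derivative F (at z) h \<bullet> \<eta> - h \<bullet> \<zeta>))) (at z)" for z
    unfolding phase_def
    by (auto intro!: derivative_eq_intros smooth_on_has_derivative[OF F UNIV_I])
  have de: "(?e has_derivative (\<lambda>h. \<i> * complex_of_real (t * (frechet_derivative F (at z) h \<bullet> \<eta> - h \<bullet> \<zeta>)) * ?e z)) (at z)" for z
    by (rule has_derivative_cexp_linear[OF dth])
  have pd: "partial_deriv b (\<lambda>z. v b z * ?e z) z
      = partial_deriv b (v b) z * ?e z + \<i> * complex_of_real t * (complex_of_real (dphase F b (z, \<eta>, \<zeta>)) * v b z) * ?e z" for b z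
    by (subst partial_deriv_eq[OF has_derivative_mult[OF smooth_on_has_derivative[OF v UNIV_I] de]])
      (simp add: partial_deriv_def dphase_def algebra_simps)
  have ve: "smooth_on UNIV (\<lambda>z. v b z * ?e z)" for b by (intro smooth_on_mult v e open_UNIV)
  have ci: "continuous_on UNIV (partial_deriv b (\<lambda>z. v b z * ?e z))" for b
    by (rule smooth_on_imp_continuous[OF open_UNIV smooth_on_partial_deriv[OF open_UNIV ve]])
  have "(LINT z|lborel. partial_deriv b (\<lambda>z. v b z * ?e z) z) = 0" for b
    unfolding partial_deriv_def
    by (rule integral_partial_zero[OF smooth_on_has_derivative[OF ve UNIV_I] ci[unfolded partial_deriv_def[abs_def]] K(1)])
      (simp add: v0)
  then have "0 = (\<Sum>b\<in>Basis. LINT z|lborel. partial_deriv b (\<lambda>z. v b z * ?e z) z)" by simp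
  also have "\<dots> = (LINT z|lborel. (\<Sum>b\<in>Basis. partial_deriv b (\<lambda>z. v b z * ?e z) z))"
    by (rule Bochner_Integration.integral_sum[symmetric])
      (rule integrable_compact_support[OF ci K(1)], rule partial_deriv_zero_off[OF cK], simp_all add: v0)
  also have "(\<lambda>z. \<Sum>b\<in>Basis. partial_deriv b (\<lambda>z. v b z * ?e z) z)
      = (\<lambda>z. phase_op F B (z, \<eta>, \<zeta>) * ?e z + \<i> * complex_of_real t * (B (z, \<eta>, \<zeta>) * ?e z))"
  proof
    fix z
    have 1: "(\<Sum>b\<in>Basis. partial_deriv b (v b) z) = phase_op F B (z, \<eta>, \<zeta>)"
    proof (cases "z \<in> K")
      case True
      have "partial_deriv b (v b) z = partial_deriv (b, 0)
          (\<lambda>p. (dphase F b p * inverse (dphase2 F p)) *\<^sub>R B p) (z, \<eta>, \<zeta>)" for b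
      proof -
        have "((\<lambda>z. (z, \<eta>, \<zeta>)) has_derivative (\<lambda>h. (h, 0))) (at z)"
          by (auto intro!: derivative_eq_intros simp: zero_prod_def)
        moreover have "(z, \<eta>, \<zeta>) \<in> {p. dphase2 F p \<noteq> 0}" using ns[OF True] by simp
        ultimately have "((\<lambda>z. (dphase F b (z, \<eta>, \<zeta>) * inverse (dphase2 F (z, \<eta>, \<zeta>))) *\<^sub>R B (z, \<eta>, \<zeta>)) has_derivative
            (\<lambda>h. frechet_derivative (\<lambda>p. (dphase F b p * inverse (dphase2 F p)) *\<^sub>R B p) (at (z, \<eta>, \<zeta>)) (h, 0))) (at z)"
          by (rule has_derivative_compose[OF _ smooth_on_has_derivative[OF smooth_phase_field[OF B]]])
        from partial_deriv_eq[OF this, of b] show ?thesis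
          by (simp add: partial_deriv_def v_def[abs_def])
      qed
      then show ?thesis by (simp add: phase_op_def)
    next
      case False
      then show ?thesis using phase_op_zero_off[of K B, OF cK K(2) False] partial_deriv_zero_off[OF cK v0 False]
        by simp
    qed
    \<comment> \<open>The division by \<open>dphase2\<close> in \<open>v\<close> is made for this
      identity.\<close>
    have 2: "(\<Sum>b\<in>Basis. complex_of_real (dphase F b (z, \<eta>, \<zeta>)) * v b z) = B (z, \<eta>, \<zeta>)"
    proof (cases "z \<in> K")
      case True
      have "(\<Sum>b\<in>Basis. complex_of_real (dphase F b (z, \<eta>, \<zeta>)) * v b z)
          = (\<Sum>b\<in>Basis. complex_of_real ((dphase F b (z, \<eta>, \<zeta>))\<^sup>2) * (complex_of_real (inverse (dphase2 F (z, \<eta>, \<zeta>))) * B (z, \<eta>, \<zeta>)))"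
        by (simp add: v_def scaleR_conv_of_real power2_eq_square mult_ac)
      also have "\<dots> = complex_of_real (dphase2 F (z, \<eta>, \<zeta>)) * (complex_of_real (inverse (dphase2 F (z, \<eta>, \<zeta>))) * B (z, \<eta>, \<zeta>))"
        by (simp add: dphase2_def sum_distrib_right)
      finally show ?thesis using ns[OF True] by (simp add: field_simps)
    qed (simp add: v0 K(2))
    have "(\<Sum>b\<in>Basis. partial_deriv b (\<lambda>z. v b z * ?e z) z)
        = (\<Sum>b\<in>Basis. partial_deriv b (v b) z) * ?e z
          + \<i> * complex_of_real t * (\<Sum>b\<in>Basis. complex_of_real (dphase F b (z, \<eta>, \<zeta>)) * v b z) * ?e z"
      by (simp only: pd sum.distrib sum_distrib_right sum_distrib_left)
    then show "(\<Sum>b\<in>Basis. partial_deriv b (\<lambda>z. v b z * ?e z) z)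
        = phase_op F B (z, \<eta>, \<zeta>) * ?e z + \<i> * complex_of_real t * (B (z, \<eta>, \<zeta>) * ?e z)"
      unfolding 1 2 by (simp only: mult.assoc)
  qed
  also have "(LINT z|lborel. phase_op F B (z, \<eta>, \<zeta>) * ?e z + \<i> * complex_of_real t * (B (z, \<eta>, \<zeta>) * ?e z))
      = (LINT z|lborel. phase_op F B (z, \<eta>, \<zeta>) * ?e z) + \<i> * complex_of_real t * (LINT z|lborel. B (z, \<eta>, \<zeta>) * ?e z)"
  proof -
    have "smooth_on U (\<lambda>z. B (z, \<eta>, \<zeta>))" "smooth_on U (\<lambda>z. phase_op F B (z, \<eta>, \<zeta>))"
      by (rule smooth_on_compose[OF U open_nonstationary _ pair[OF U]]; use B smooth_phase_op[OF B] in \<open>auto simp: U_def\<close>)+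
    then have "smooth_on UNIV (\<lambda>z. B (z, \<eta>, \<zeta>))" "smooth_on UNIV (\<lambda>z. phase_op F B (z, \<eta>, \<zeta>))"
      by (auto intro!: smooth_on_zero_extension[OF U cK KU] simp: K(2) phase_op_zero_off[of K B, OF cK K(2)])
    then have "integrable lborel (\<lambda>z. B (z, \<eta>, \<zeta>) * ?e z)" "integrable lborel (\<lambda>z. phase_op F B (z, \<eta>, \<zeta>) * ?e z)"
      by (intro integrable_compact_support[OF smooth_on_imp_continuous[OF open_UNIV smooth_on_mult[OF open_UNIV _ e]] K(1)];
          simp add: K(2) phase_op_zero_off[of K B, OF cK K(2)])+
    then show ?thesis by (simp only: Bochner_Integration.integral_add integrable_mult_right integral_mult_right_zero)
  qed
  finally show ?thesis by (simp add: eq_neg_iff_add_eq_0)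
qed

end

context
  fixes F :: "'a::euclidean_space \<Rightarrow> 'b::euclidean_space"
  assumes F: "smooth_on UNIV F"
begin

lemmas smooth_dphase2' = smooth_dphase2[OF F] and open_nonstationary' = open_nonstationary[OF F]
  and smooth_phase_op' = smooth_phase_op[OF F] and phase_op_zero_off' = phase_op_zero_off[OF F]
  and phase_integration_by_parts' = phase_integration_by_parts[OF F]

text \<open>The phase is homogeneous of degree one in (\<eta>, \<zeta>). Dividing by the norm
  \<open>t\<close> puts the frequencies on the unit sphere, each of \<open>l\<close> integrations by
  parts gains 1/t, and the resulting amplitude is bounded on a compact set, which makes the constant
  uniform.\<close>

lemma nonstationary_phase_homogeneous:
  assumes A: "smooth_on UNIV A" and K: "compact K" "\<And>z. z \<notin> K \<Longrightarrow> A z = 0" and \<mu>: "\<mu> > 0"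
  shows "\<exists>C. \<forall>\<eta> \<zeta>. (\<eta>, \<zeta>) \<noteq> 0 \<longrightarrow> (\<forall>z\<in>K. dphase2 F (z, \<eta>, \<zeta>) \<ge> (\<mu> * norm (\<eta>, \<zeta>))\<^sup>2) \<longrightarrow>
    norm (\<eta>, \<zeta>) ^ l * cmod (LINT z|lborel. A z * exp (\<i> * complex_of_real (phase F (z, \<eta>, \<zeta>)))) \<le> C"
proof -
  define B where "B j = (phase_op F ^^ j) (\<lambda>p. A (fst p))" for j
  have cK: "closed K" using K(1) by (rule compact_imp_closed)
  have B: "smooth_on {p. dphase2 F p \<noteq> 0} (B j) \<and> (\<forall>z \<omega>. z \<notin> K \<longrightarrow> B j (z, \<omega>) = 0)" for j
  proof (induction j)
    case 0
    show ?case using K(2) unfolding B_def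
      by (auto intro!: smooth_on_compose[OF open_nonstationary' open_UNIV A] smooth_on_fst open_nonstationary')
  next
    case (Suc j)
    then show ?case using smooth_phase_op' phase_op_zero_off'[OF cK] by (auto simp: B_def)
  qed
  \<comment> \<open>All normalized points that satisfy the lower bound on the gradient;
    \<open>Q\<close> is compact and stays inside the open set where the iterated amplitudes are
    smooth.\<close>
  define Q where "Q = (K \<times> sphere (0 :: 'b \<times> 'a) 1) \<inter> {p. \<mu>\<^sup>2 \<le> dphase2 F p}"
  have Q: "compact Q" unfolding Q_def
    by (intro compact_Int_closed compact_Times K compact_sphere closed_Collect_le continuous_on_const
        smooth_on_imp_continuous[OF open_UNIV smooth_dphase2'] open_UNIV)
  have "Q \<subseteq> {p. dphase2 F p \<noteq> 0}" using \<mu> by (auto simp: Q_def)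
  then have "bounded (B l ` Q)"
    using B[of l] smooth_on_imp_continuous[OF open_nonstationary']
    by (intro compact_imp_bounded compact_continuous_image Q) (blast intro: continuous_on_subset)
  then obtain C where C: "\<And>p. p \<in> Q \<Longrightarrow> cmod (B l p) \<le> C" unfolding bounded_iff by auto
  show ?thesis
  proof (intro exI[of _ "C * measure lborel K"] allI impI)
    fix \<eta> \<zeta> assume nz: "(\<eta>, \<zeta>) \<noteq> (0 :: 'b \<times> 'a)"
      and ns: "\<forall>z\<in>K. dphase2 F (z, \<eta>, \<zeta>) \<ge> (\<mu> * norm (\<eta>, \<zeta>))\<^sup>2"
    define t where "t = norm (\<eta>, \<zeta>)"
    have t: "t > 0" unfolding t_def zero_less_norm_iff by (rule nz)
    define \<eta>' \<zeta>' where "\<eta>' = \<eta> /\<^sub>R t" and "\<zeta>' = \<zeta> /\<^sub>R t"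
    have n1: "norm (\<eta>', \<zeta>') = 1"
    proof -
      have "(\<eta>', \<zeta>') = (\<eta>, \<zeta>) /\<^sub>R t" by (simp add: \<eta>'_def \<zeta>'_def)
      then have "norm (\<eta>', \<zeta>') = inverse t * norm (\<eta>, \<zeta>)" using t by (simp only: norm_scaleR) simp
      then show ?thesis using t by (simp add: t_def)
    qed
    have th: "t * phase F (z, \<eta>', \<zeta>') = phase F (z, \<eta>, \<zeta>)" for z
      using t by (simp add: phase_def \<eta>'_def \<zeta>'_def field_simps)
    have dth: "dphase F b (z, \<eta>', \<zeta>') = dphase F b (z, \<eta>, \<zeta>) / t" for b z
      using t by (simp add: dphase_def \<eta>'_def \<zeta>'_def field_simps)
    have dth2: "dphase2 F (z, \<eta>', \<zeta>') = dphase2 F (z, \<eta>, \<zeta>) / t\<^sup>2" for z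
      unfolding dphase2_def dth by (simp add: power_divide sum_divide_distrib)
    have ns': "dphase2 F (z, \<eta>', \<zeta>') \<ge> \<mu>\<^sup>2" if "z \<in> K" for z
      using bspec[OF ns that] t by (simp add: dth2 pos_le_divide_eq power_mult_distrib t_def)
    define I where "I j = (LINT z|lborel. B j (z, \<eta>', \<zeta>') * exp (\<i> * complex_of_real (t * phase F (z, \<eta>', \<zeta>'))))" for j
    have nz: "dphase2 F (z, \<eta>', \<zeta>') \<noteq> 0" if "z \<in> K" for z
      using ns'[OF that] \<mu> by (metis linorder_not_less zero_less_power)
    have I_Suc: "I (Suc j) = - (\<i> * complex_of_real t) * I j" for j
    proof -
      have Bj: "B (Suc j) = phase_op F (B j)" by (simp add: B_def)
      have z: "B j (z, \<omega>) = 0" if "z \<notin> K" for z \<omega> using conjunct2[OF B[of j]] that by blast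
      show ?thesis unfolding Bj I_def
        by (rule phase_integration_by_parts'[of "B j" K \<eta>' \<zeta>' t, OF conjunct1[OF B[of j]] K(1) z nz])
    qed
    have Ij: "cmod (I j) = t ^ j * cmod (I 0)" for j
      by (induction j) (use t in \<open>auto simp: I_Suc norm_mult\<close>)
    then have "t ^ l * cmod (I 0) = cmod (I l)" by (rule sym)
    also have "\<dots> \<le> C * measure lborel K"
      unfolding I_def
    proof (rule integral_compact_support_bound[OF _ K(1)])
      define U where "U = {z. dphase2 F (z, \<eta>', \<zeta>') \<noteq> 0}"
      have cd: "continuous_on UNIV (\<lambda>z. dphase2 F (z, \<eta>', \<zeta>'))"
        by (rule continuous_on_compose2[OF smooth_on_imp_continuous[OF open_UNIV smooth_dphase2']])
          (auto intro!: continuous_intros)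
      have U: "open U" unfolding U_def using cd by (intro open_Collect_neq) auto
      have "0 < \<mu>\<^sup>2" using \<mu> by simp
      then have "K \<subseteq> U" unfolding U_def using ns' by fastforce
      moreover have "smooth_on U (\<lambda>z. B l (z, \<eta>', \<zeta>'))"
      proof (rule smooth_on_compose[OF U open_nonstationary' conjunct1[OF B[of l]]])
        show "smooth_on U (\<lambda>z. (z, \<eta>', \<zeta>'))" by (intro smooth_on_Pair smooth_on_const smooth_on_ident U)
      qed (simp add: U_def)
      ultimately have "smooth_on UNIV (\<lambda>z. B l (z, \<eta>', \<zeta>'))"
        using B[of l] by (intro smooth_on_zero_extension[OF U cK]) auto
      then have "continuous_on UNIV (\<lambda>z. B l (z, \<eta>', \<zeta>'))" by (rule smooth_on_imp_continuous[OF open_UNIV])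
      moreover have "continuous_on UNIV (\<lambda>z. phase F (z, \<eta>', \<zeta>'))"
        unfolding phase_def using smooth_on_imp_continuous[OF open_UNIV F] by (auto intro!: continuous_intros)
      ultimately show "continuous_on UNIV (\<lambda>z. B l (z, \<eta>', \<zeta>') * exp (\<i> * complex_of_real (t * phase F (z, \<eta>', \<zeta>'))))"
        by (intro continuous_intros)
      show "B l (z, \<eta>', \<zeta>') * exp (\<i> * complex_of_real (t * phase F (z, \<eta>', \<zeta>'))) = 0" if "z \<notin> K" for z
        using B[of l] that by simp
      show "cmod (B l (z, \<eta>', \<zeta>') * exp (\<i> * complex_of_real (t * phase F (z, \<eta>', \<zeta>')))) \<le> C" if "z \<in> K" for z
        using C[of "(z, \<eta>', \<zeta>')"] ns'[OF that] that n1 by (simp add: norm_mult Q_def)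
    qed
    finally show "norm (\<eta>, \<zeta>) ^ l * cmod (LINT z|lborel. A z * exp (\<i> * complex_of_real (phase F (z, \<eta>, \<zeta>))))
        \<le> C * measure lborel K"
      unfolding I_def th t_def[symmetric] by (simp add: B_def)
  qed
qed

text \<open>The inhomogeneous weight follows by treating norm at most 1 with the trivial bound. That
  bound is also recorded for arbitrary frequencies, for the region where the phase may be stationary
  and the decay has to come from the other factor.\<close>

lemma nonstationary_phase:
  assumes A: "smooth_on UNIV A" and K: "compact K" "\<And>z. z \<notin> K \<Longrightarrow> A z = 0" and \<mu>: "\<mu> > 0"
  shows "\<exists>C\<ge>0. \<forall>\<eta> \<zeta>. cmod (LINT z|lborel. A z * exp (\<i> * complex_of_real (phase F (z, \<eta>, \<zeta>)))) \<le> C \<and>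
    ((\<forall>z\<in>K. dphase2 F (z, \<eta>, \<zeta>) \<ge> (\<mu> * norm (\<eta>, \<zeta>))\<^sup>2) \<longrightarrow>
    (1 + (norm (\<eta>, \<zeta>))\<^sup>2) ^ l * cmod (LINT z|lborel. A z * exp (\<i> * complex_of_real (phase F (z, \<eta>, \<zeta>)))) \<le> C)"
proof -
  let ?I = "\<lambda>\<eta> \<zeta>. cmod (LINT z|lborel. A z * exp (\<i> * complex_of_real (phase F (z, \<eta>, \<zeta>))))"
  obtain C1 where C1: "\<And>\<eta> \<zeta>. (\<eta>, \<zeta>) \<noteq> 0 \<Longrightarrow> \<forall>z\<in>K. dphase2 F (z, \<eta>, \<zeta>) \<ge> (\<mu> * norm (\<eta>, \<zeta>))\<^sup>2 \<Longrightarrow>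
      norm (\<eta>, \<zeta>) ^ (2 * l) * ?I \<eta> \<zeta> \<le> C1"
    using nonstationary_phase_homogeneous[OF A K \<mu>, of "2 * l"] by blast
  have cA: "continuous_on UNIV A" using smooth_on_imp_continuous[OF open_UNIV A] .
  have "bounded (A ` K)" by (intro compact_imp_bounded compact_continuous_image K continuous_on_subset[OF cA]) auto
  then obtain C2 where C2: "\<And>z. z \<in> K \<Longrightarrow> cmod (A z) \<le> C2" unfolding bounded_iff by auto
  have C0: "?I \<eta> \<zeta> \<le> C2 * measure lborel K" for \<eta> \<zeta>
  proof (rule integral_compact_support_bound[OF _ K(1)])
    have "continuous_on UNIV (\<lambda>z. phase F (z, \<eta>, \<zeta>))"
      unfolding phase_def using smooth_on_imp_continuous[OF open_UNIV F] by (auto intro!: continuous_intros)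
    then show "continuous_on UNIV (\<lambda>z. A z * exp (\<i> * complex_of_real (phase F (z, \<eta>, \<zeta>))))"
      by (intro continuous_intros cA)
  qed (use K C2 in \<open>auto simp: norm_mult\<close>)
  define C0 where "C0 = \<bar>C2 * measure lborel K\<bar>"
  have C0': "?I \<eta> \<zeta> \<le> C0" for \<eta> \<zeta> using C0[of \<eta> \<zeta>] by (simp add: C0_def)
  define C where "C = 2 ^ l * (C0 + \<bar>C1\<bar>)"
  have "C0 \<ge> 0" by (simp add: C0_def)
  have "C \<ge> C0" using \<open>C0 \<ge> 0\<close> mult_mono[of 1 "2 ^ l" C0 "C0 + \<bar>C1\<bar>"] by (simp add: C_def)
  show ?thesis
  proof (intro exI[of _ C] conjI allI impI)
    show "0 \<le> C" using \<open>C \<ge> C0\<close> \<open>C0 \<ge> 0\<close> by simp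
    show "?I \<eta> \<zeta> \<le> C" for \<eta> \<zeta> using C0'[of \<eta> \<zeta>] \<open>C \<ge> C0\<close> by linarith
    fix \<eta> \<zeta> assume ns: "\<forall>z\<in>K. dphase2 F (z, \<eta>, \<zeta>) \<ge> (\<mu> * norm (\<eta>, \<zeta>))\<^sup>2"
    define t where "t = norm (\<eta>, \<zeta>)"
    have "t \<ge> 0" by (simp add: t_def)
    show "(1 + (norm (\<eta>, \<zeta>))\<^sup>2) ^ l * ?I \<eta> \<zeta> \<le> C"
      unfolding t_def[symmetric]
    proof (cases "t \<le> 1")
      case True
      then have "(1 + t\<^sup>2) ^ l \<le> 2 ^ l"
        using power_mono[OF True \<open>t \<ge> 0\<close>, of 2] by (intro power_mono) auto
      then have "(1 + t\<^sup>2) ^ l * ?I \<eta> \<zeta> \<le> 2 ^ l * C0" using C0'[of \<eta> \<zeta>] by (intro mult_mono) auto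
      also have "\<dots> \<le> C" by (simp add: C_def)
      finally show "(1 + t\<^sup>2) ^ l * ?I \<eta> \<zeta> \<le> C" .
    next
      case False
      then have "1 \<le> t\<^sup>2" using power_mono[of 1 t 2] by simp
      then have "(1 + t\<^sup>2) ^ l \<le> (2 * t\<^sup>2) ^ l" by (intro power_mono) auto
      also have "\<dots> = 2 ^ l * t ^ (2 * l)" by (simp add: power_mult_distrib power_mult)
      finally have "(1 + t\<^sup>2) ^ l * ?I \<eta> \<zeta> \<le> 2 ^ l * t ^ (2 * l) * ?I \<eta> \<zeta>" by (intro mult_right_mono) auto
      also have "\<dots> \<le> 2 ^ l * C1"
      proof -
        have "(\<eta>, \<zeta>) \<noteq> 0" using False by (metis norm_zero t_def zero_le_one)
        from C1[OF this ns] show ?thesis by (simp add: t_def mult.assoc)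
      qed
      also have "\<dots> \<le> C" using \<open>C0 \<ge> 0\<close> abs_ge_self[of C1] by (simp add: C_def del: abs_ge_self)
      finally show "(1 + t\<^sup>2) ^ l * ?I \<eta> \<zeta> \<le> C" .
    qed
  qed
qed

text \<open>By inversion the transform at \<zeta> is, up to the constant \<open>c\<close>, the
  integral over \<eta> of \<open>fourier f \<eta> * ?J \<eta> \<zeta>\<close>. For each \<eta>
  either the oscillatory integral \<open>?J\<close> decays, or \<open>fourier f\<close> decays and
  |\<eta>| dominates |\<zeta>|. \<open>C\<close> and \<open>m\<close> are fixed before
  \<open>f\<close>, and the bound is linear in \<open>M\<close>: applied to a net, only
  \<open>M\<close> carries powers of \<epsilon>.\<close>

lemma pullback_fourier_decay:
  assumes A: "smooth_on UNIV A" and K: "compact K" "\<And>z. z \<notin> K \<Longrightarrow> A z = 0"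
    and \<mu>: "\<mu> > 0" and \<delta>: "\<delta> > 0"
    and split: "\<And>\<eta> \<zeta>. \<zeta> \<in> \<Gamma>' \<Longrightarrow> (\<forall>z\<in>K. dphase2 F (z, \<eta>, \<zeta>) \<ge> (\<mu> * norm (\<eta>, \<zeta>))\<^sup>2) \<or>
      (\<eta> \<in> \<Gamma> \<and> \<delta> * norm \<zeta> \<le> norm \<eta>)"
  obtains C m where "C \<ge> 0" "\<And>f Kf M \<zeta>. \<lbrakk> smooth_on UNIV f; compact Kf; \<And>y. y \<notin> Kf \<Longrightarrow> f y = 0;
      \<And>\<eta>. cmod (fourier f \<eta>) \<le> M; \<And>\<eta>. \<eta> \<in> \<Gamma> \<Longrightarrow> (1 + (norm \<eta>)\<^sup>2) ^ m * cmod (fourier f \<eta>) \<le> M; \<zeta> \<in> \<Gamma>' \<rbrakk> \<Longrightarrow>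
      (1 + (norm \<zeta>)\<^sup>2) ^ l * cmod (fourier (\<lambda>z. A z * f (F z)) \<zeta>) \<le> C * M"
proof -
  let ?J = "\<lambda>\<eta> \<zeta>. LINT z|lborel. A z * exp (\<i> * complex_of_real (phase F (z, \<eta>, \<zeta>)))"
  define d where "d = DIM('b)"
  \<comment> \<open>The \<open>l\<close> powers become decay in \<zeta>, the other \<open>d\<close>
    make the integral over \<eta> converge.\<close>
  define m where "m = l + d"
  have "\<exists>C\<ge>0. \<forall>\<eta> \<zeta>. cmod (?J \<eta> \<zeta>) \<le> C \<and>
      ((\<forall>z\<in>K. dphase2 F (z, \<eta>, \<zeta>) \<ge> (\<mu> * norm (\<eta>, \<zeta>))\<^sup>2) \<longrightarrow>
      (1 + (norm (\<eta>, \<zeta>))\<^sup>2) ^ m * cmod (?J \<eta> \<zeta>) \<le> C)"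
    by (rule nonstationary_phase[OF A K(1) _ \<mu>]) (rule K(2))
  then obtain C where C0: "C \<ge> 0" and CC: "\<forall>\<eta> \<zeta>. cmod (?J \<eta> \<zeta>) \<le> C \<and>
      ((\<forall>z\<in>K. dphase2 F (z, \<eta>, \<zeta>) \<ge> (\<mu> * norm (\<eta>, \<zeta>))\<^sup>2) \<longrightarrow>
      (1 + (norm (\<eta>, \<zeta>))\<^sup>2) ^ m * cmod (?J \<eta> \<zeta>) \<le> C)"
    by (elim exE conjE)
  note C = C0 conjunct1[OF spec[OF spec[OF CC]]] mp[OF conjunct2[OF spec[OF spec[OF CC]]]]
  \<comment> \<open>If \<delta> |\<zeta>| \<le> |\<eta>|, then k (1 + |\<zeta>|^2) \<le> 1 +
    |\<eta>|^2, the minimum with 1 taking care of the constant term. The loss \<open>k ^ l\<close>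
    is absorbed in \<open>C'\<close>.\<close>
  define k where "k = min 1 (\<delta>\<^sup>2)"
  have k: "k > 0" "k \<le> 1" using \<delta> by (auto simp: k_def)
  define C' where "C' = inverse (k ^ l) * C"
  have "1 \<le> inverse (k ^ l)" using k by (simp add: one_le_inverse power_le_one)
  then have C': "C \<le> C'" "0 \<le> C'" using C(1) mult_right_mono[of 1 "inverse (k ^ l)" C] by (auto simp: C'_def)
  define V where "V = (LINT \<eta>::'b|lborel. inverse ((1 + (norm \<eta>)\<^sup>2) ^ d))"
  have V: "V \<ge> 0" unfolding V_def by (intro Bochner_Integration.integral_nonneg) simp
  define c where "c = inversion_const TYPE('b)"
  have c: "c \<noteq> 0" unfolding c_def by (rule inversion_const_nonzero)
  show ?thesis
  proof (rule that[of "C' * V / cmod c" m])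
    show "0 \<le> C' * V / cmod c" using C' V by simp
    fix f Kf M \<zeta> assume f: "smooth_on UNIV f" and Kf: "compact Kf" "\<And>y. y \<notin> Kf \<Longrightarrow> f y = 0"
      and M: "\<And>\<eta>. cmod (fourier f \<eta>) \<le> M"
      and M': "\<And>\<eta>. \<eta> \<in> \<Gamma> \<Longrightarrow> (1 + (norm \<eta>)\<^sup>2) ^ m * cmod (fourier f \<eta>) \<le> M" and \<zeta>: "\<zeta> \<in> \<Gamma>'"
    have M0: "M \<ge> 0" using M[of 0] norm_ge_zero order_trans by blast
    have cA: "continuous_on UNIV A" using smooth_on_imp_continuous[OF open_UNIV A] .
    have IA: "integrable lborel A" using cA K by (rule integrable_compact_support)
    have If: "integrable lborel (fourier f)" using f Kf by (rule fourier_integrable)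
    let ?u = "\<lambda>p. exp (\<i> * complex_of_real (phase F (fst p, snd p, \<zeta>)))"
    have cu: "continuous_on UNIV ?u" unfolding phase_def
      using continuous_on_compose2[OF smooth_on_imp_continuous[OF open_UNIV F] continuous_on_fst[OF continuous_on_id]]
      by (auto intro!: continuous_intros)
    have inv: "c * (A z * f (F z) * exp (- \<i> * complex_of_real (z \<bullet> \<zeta>)))
        = (LINT \<eta>|lborel. A z * fourier f \<eta> * ?u (z, \<eta>))" for z
    proof -
      have "c * (A z * f (F z) * exp (- \<i> * complex_of_real (z \<bullet> \<zeta>)))
          = (A z * exp (- \<i> * complex_of_real (z \<bullet> \<zeta>))) * (c * f (F z))" by (simp add: mult_ac)
      also have "c * f (F z) = (LINT \<eta>|lborel. fourier f \<eta> * exp (\<i> * complex_of_real (F z \<bullet> \<eta>)))"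
        using fourier_inversion[OF f Kf, of "F z"] by (simp add: c_def)
      also have "(A z * exp (- \<i> * complex_of_real (z \<bullet> \<zeta>))) * \<dots> = (LINT \<eta>|lborel. (A z * exp (- \<i> * complex_of_real (z \<bullet> \<zeta>))) * (fourier f \<eta> * exp (\<i> * complex_of_real (F z \<bullet> \<eta>))))"
        by (rule integral_mult_right_zero[symmetric])
      also have "\<dots> = (LINT \<eta>|lborel. A z * fourier f \<eta> * ?u (z, \<eta>))"
        by (intro Bochner_Integration.integral_cong refl) (simp add: phase_def exp_diff exp_minus right_diff_distrib field_simps)
      finally show ?thesis .
    qed
    have "c * fourier (\<lambda>z. A z * f (F z)) \<zeta> = (LINT z|lborel. c * (A z * f (F z) * exp (- \<i> * complex_of_real (z \<bullet> \<zeta>))))"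
      unfolding fourier_def by (simp add: mult_ac)
    also have "\<dots> = (LINT z|lborel. LINT \<eta>|lborel. A z * fourier f \<eta> * ?u (z, \<eta>))" by (simp only: inv)
    also have "\<dots> = (LINT \<eta>|lborel. LINT z|lborel. A z * fourier f \<eta> * ?u (z, \<eta>))"
      by (rule fubini_product(1)[OF IA If cu]) (simp add: norm_exp_eq_Re)
    also have "\<dots> = (LINT \<eta>|lborel. fourier f \<eta> * ?J \<eta> \<zeta>)"
    proof (intro Bochner_Integration.integral_cong refl)
      fix \<eta>
      have "(LINT z|lborel. A z * fourier f \<eta> * ?u (z, \<eta>)) = (LINT z|lborel. fourier f \<eta> * (A z * exp (\<i> * complex_of_real (phase F (z, \<eta>, \<zeta>)))))"
        by (intro Bochner_Integration.integral_cong refl) (simp add: mult_ac)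
      then show "(LINT z|lborel. A z * fourier f \<eta> * ?u (z, \<eta>)) = fourier f \<eta> * ?J \<eta> \<zeta>"
        by (simp only: integral_mult_right_zero)
    qed
    finally have eq: "c * fourier (\<lambda>z. A z * f (F z)) \<zeta> = (LINT \<eta>|lborel. fourier f \<eta> * ?J \<eta> \<zeta>)" .
    let ?Z = "1 + (norm \<zeta>)\<^sup>2"
    have Z: "?Z > 0" by (simp add: add_pos_nonneg)
    have pw: "?Z ^ l * (1 + (norm \<eta>)\<^sup>2) ^ d * cmod (fourier f \<eta> * ?J \<eta> \<zeta>) \<le> C' * M" for \<eta>
    proof (cases "\<forall>z\<in>K. dphase2 F (z, \<eta>, \<zeta>) \<ge> (\<mu> * norm (\<eta>, \<zeta>))\<^sup>2")
      case True
      have "(norm (\<eta>, \<zeta>))\<^sup>2 = (norm \<eta>)\<^sup>2 + (norm \<zeta>)\<^sup>2" by (simp add: norm_Pair)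
      then have "?Z ^ l * (1 + (norm \<eta>)\<^sup>2) ^ d \<le> (1 + (norm (\<eta>, \<zeta>))\<^sup>2) ^ l * (1 + (norm (\<eta>, \<zeta>))\<^sup>2) ^ d"
        by (intro mult_mono power_mono) auto
      also have "\<dots> = (1 + (norm (\<eta>, \<zeta>))\<^sup>2) ^ m" by (simp add: m_def power_add)
      finally have "?Z ^ l * (1 + (norm \<eta>)\<^sup>2) ^ d * cmod (?J \<eta> \<zeta>) \<le> (1 + (norm (\<eta>, \<zeta>))\<^sup>2) ^ m * cmod (?J \<eta> \<zeta>)"
        by (intro mult_right_mono) auto
      also have "\<dots> \<le> C'" using C(3)[OF True] C' by linarith
      finally have "(?Z ^ l * (1 + (norm \<eta>)\<^sup>2) ^ d * cmod (?J \<eta> \<zeta>)) * cmod (fourier f \<eta>) \<le> C' * M"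
        using M[of \<eta>] C' by (intro mult_mono) auto
      then show ?thesis by (simp add: norm_mult mult_ac)
    next
      case False
      then have \<eta>: "\<eta> \<in> \<Gamma>" "\<delta> * norm \<zeta> \<le> norm \<eta>" using split[OF \<zeta>] by blast+
      have "k * ?Z \<le> 1 + (norm \<eta>)\<^sup>2"
      proof -
        have "(\<delta> * norm \<zeta>)\<^sup>2 \<le> (norm \<eta>)\<^sup>2" using \<eta>(2) \<delta> by (intro power_mono) auto
        moreover have "k * (norm \<zeta>)\<^sup>2 \<le> \<delta>\<^sup>2 * (norm \<zeta>)\<^sup>2" by (intro mult_right_mono) (auto simp: k_def)
        ultimately show ?thesis using k(2) by (simp add: power_mult_distrib algebra_simps)
      qed
      then have "(k * ?Z) ^ l \<le> (1 + (norm \<eta>)\<^sup>2) ^ l" using k Z by (intro power_mono) auto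
      then have "k ^ l * ?Z ^ l * (1 + (norm \<eta>)\<^sup>2) ^ d \<le> (1 + (norm \<eta>)\<^sup>2) ^ l * (1 + (norm \<eta>)\<^sup>2) ^ d"
        by (intro mult_right_mono) (auto simp: power_mult_distrib)
      also have "\<dots> = (1 + (norm \<eta>)\<^sup>2) ^ m" by (simp add: m_def power_add)
      finally have "k ^ l * ?Z ^ l * (1 + (norm \<eta>)\<^sup>2) ^ d * cmod (fourier f \<eta>) \<le> (1 + (norm \<eta>)\<^sup>2) ^ m * cmod (fourier f \<eta>)"
        by (intro mult_right_mono) auto
      also have "\<dots> \<le> M" by (rule M'[OF \<eta>(1)])
      finally have "(k ^ l * ?Z ^ l * (1 + (norm \<eta>)\<^sup>2) ^ d * cmod (fourier f \<eta>)) * cmod (?J \<eta> \<zeta>) \<le> M * C"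
        using C(1,2) M0 by (intro mult_mono) auto
      then have "k ^ l * (?Z ^ l * (1 + (norm \<eta>)\<^sup>2) ^ d * cmod (fourier f \<eta> * ?J \<eta> \<zeta>)) \<le> k ^ l * (C' * M)"
        using k by (simp add: C'_def norm_mult mult_ac)
      then show ?thesis using k by (simp only: mult_le_cancel_left_pos zero_less_power)
    qed
    have "?Z ^ l * cmod (LINT \<eta>|lborel. fourier f \<eta> * ?J \<eta> \<zeta>) = cmod (LINT \<eta>|lborel. complex_of_real (?Z ^ l) * (fourier f \<eta> * ?J \<eta> \<zeta>))"
      by (simp only: integral_mult_right_zero norm_mult norm_of_real) (use Z in simp)
    also have "\<dots> \<le> (LINT \<eta>::'b|lborel. C' * M * inverse ((1 + (norm \<eta>)\<^sup>2) ^ d))"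
    proof (rule Bochner_Integration.integral_norm_bound_integral)
      show I: "integrable lborel (\<lambda>\<eta>::'b. C' * M * inverse ((1 + (norm \<eta>)\<^sup>2) ^ d))"
        unfolding d_def by (intro integrable_mult_right integrable_inverse_bracket)
      have le: "norm (complex_of_real (?Z ^ l) * (fourier f \<eta> * ?J \<eta> \<zeta>)) \<le> C' * M * inverse ((1 + (norm \<eta>)\<^sup>2) ^ d)" for \<eta>
      proof -
        have "(1 + (norm \<eta>)\<^sup>2) ^ d > 0" by (intro zero_less_power add_pos_nonneg) auto
        moreover have "norm (complex_of_real (?Z ^ l) * (fourier f \<eta> * ?J \<eta> \<zeta>)) = ?Z ^ l * cmod (fourier f \<eta> * ?J \<eta> \<zeta>)"
          using Z by (simp only: norm_mult norm_of_real) simp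
        ultimately show ?thesis using pw[of \<eta>] by (simp add: field_simps)
      qed
      show "norm (complex_of_real (?Z ^ l) * (fourier f \<eta> * ?J \<eta> \<zeta>)) \<le> C' * M * inverse ((1 + (norm \<eta>)\<^sup>2) ^ d)" for \<eta>
        by (rule le)
      have "?J \<eta> \<zeta> = (LINT z|lborel. 1 * A z * ?u (z, \<eta>))" for \<eta> by simp
      have "(\<lambda>\<eta>. fourier f \<eta> * ?J \<eta> \<zeta>) = (\<lambda>\<eta>. LINT z|lborel. fourier f \<eta> * A z * (\<lambda>p. ?u (snd p, fst p)) (\<eta>, z))"
        by (simp add: mult.assoc)
      moreover have "continuous_on UNIV (\<lambda>p. ?u (snd p, fst p))"
      proof -
        have sw: "continuous_on UNIV (\<lambda>p::'b \<times> 'a. (snd p, fst p))" by (intro continuous_intros)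
        from continuous_on_compose2[OF cu sw] show ?thesis by simp
      qed
      from fubini_product(3)[OF If IA this]
      have "integrable lborel (\<lambda>\<eta>. LINT z|lborel. fourier f \<eta> * A z * (\<lambda>p. ?u (snd p, fst p)) (\<eta>, z))"
        by (simp add: norm_exp_eq_Re)
      ultimately show "integrable lborel (\<lambda>\<eta>. complex_of_real (?Z ^ l) * (fourier f \<eta> * ?J \<eta> \<zeta>))"
        by (simp only: integrable_mult_right)
    qed
    also have "\<dots> = C' * M * V" by (simp add: V_def)
    finally have "?Z ^ l * (cmod c * cmod (fourier (\<lambda>z. A z * f (F z)) \<zeta>)) \<le> C' * M * V"
      unfolding eq[symmetric] norm_mult .
    then show "?Z ^ l * cmod (fourier (\<lambda>z. A z * f (F z)) \<zeta>) \<le> C' * V / cmod c * M"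
      using c by (simp add: field_simps)
  qed
qed

section \<open>Separating stationary from nonstationary frequencies\<close>

lemma norm_sum_Basis_le:
  fixes g :: "'a \<Rightarrow> real"
  shows "norm (\<Sum>b\<in>Basis. g b *\<^sub>R b) \<le> (\<Sum>b\<in>(Basis::'a set). \<bar>g b\<bar>)"
  by (rule order_trans[OF norm_sum]) simp

lemma dphase2_eq_norm:
  "dphase2 F (z, \<eta>, \<zeta>) = (norm ((\<Sum>b\<in>Basis. (partial_deriv b F z \<bullet> \<eta>) *\<^sub>R b) - \<zeta>))\<^sup>2"
proof -
  let ?v = "(\<Sum>b\<in>Basis. (partial_deriv b F z \<bullet> \<eta>) *\<^sub>R b) - \<zeta>"
  have "?v \<bullet> b = dphase F b (z, \<eta>, \<zeta>)" if "b \<in> Basis" for b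
    using that by (simp add: dphase_def inner_diff_left inner_sum_left_Basis inner_commute[of \<zeta> b])
  then show ?thesis
    unfolding power2_norm_eq_inner euclidean_inner[of ?v ?v] dphase2_def by (simp add: power2_eq_square)
qed

text \<open>At \<open>z0\<close> and in the exact direction of \<open>\<zeta>0\<close>, the vector
  DF^T \<eta> - c u cannot vanish for \<eta> outside the cone and \<open>c \<ge> 0\<close>, unless
  both are zero: \<open>c = 0\<close> is excluded by \<open>inj\<close>, \<open>c > 0\<close> by
  \<open>dir\<close>. Compactness gives a lower bound, which survives small changes of
  \<open>z\<close> and of the direction of \<zeta>. For \<eta> inside the cone but small against
  \<zeta> the gradient is bounded below because \<zeta> dominates.\<close>

lemma conic_split:
  assumes \<Gamma>: "open \<Gamma>" "\<And>\<eta> t. \<eta> \<in> \<Gamma> \<Longrightarrow> t > 0 \<Longrightarrow> t *\<^sub>R \<eta> \<in> \<Gamma>"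
    and \<zeta>0: "\<zeta>0 \<noteq> 0"
    and inj: "\<And>\<eta>. (\<And>k. frechet_derivative F (at z0) k \<bullet> \<eta> = 0) \<Longrightarrow> \<eta> = 0"
    and dir: "\<And>\<eta>. (\<And>k. frechet_derivative F (at z0) k \<bullet> \<eta> = k \<bullet> \<zeta>0) \<Longrightarrow> \<eta> \<in> \<Gamma>"
  obtains r \<mu> \<delta> \<Gamma>' where "r > 0" "\<mu> > 0" "\<delta> > 0" "conic_nbhd \<zeta>0 \<Gamma>'"
    "\<And>\<eta> \<zeta>. \<zeta> \<in> \<Gamma>' \<Longrightarrow> (\<forall>z\<in>cball z0 r. dphase2 F (z, \<eta>, \<zeta>) \<ge> (\<mu> * norm (\<eta>, \<zeta>))\<^sup>2) \<or>
      (\<eta> \<in> \<Gamma> \<and> \<delta> * norm \<zeta> \<le> norm \<eta>)"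
proof -
  define D where "D z \<eta> = (\<Sum>b\<in>Basis. (partial_deriv b F z \<bullet> \<eta>) *\<^sub>R b)" for z \<eta>
  define u where "u = \<zeta>0 /\<^sub>R norm \<zeta>0"
  have u: "norm u = 1" using \<zeta>0 by (simp add: u_def)
  have Dk: "k \<bullet> D z \<eta> = frechet_derivative F (at z) k \<bullet> \<eta>" for k z \<eta>
    by (subst has_derivative_sum_Basis[OF smooth_on_has_derivative[OF F UNIV_I]])
      (simp add: D_def inner_sum_right inner_sum_left partial_deriv_def mult.commute)
  have Dscale: "D z (t *\<^sub>R \<eta>) = t *\<^sub>R D z \<eta>" for z t \<eta> by (simp add: D_def scaleR_sum_right)
  \<comment> \<open>The scalar \<open>c \<ge> 0\<close> stands for |\<zeta>| along the fixed unit
    direction \<open>u\<close>, so one compact set covers all ratios of |\<eta>| to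
    |\<zeta>|.\<close>
  define S where "S = {(\<eta>, c). \<eta> \<notin> \<Gamma> \<and> 0 \<le> (c::real)} \<inter> sphere 0 1"
  have "closed {(\<eta>, c). \<eta> \<notin> \<Gamma> \<and> 0 \<le> (c::real)}"
  proof -
    have "{(\<eta>, c). \<eta> \<notin> \<Gamma> \<and> 0 \<le> (c::real)} = (- \<Gamma>) \<times> {0..}" by auto
    then show ?thesis using \<Gamma>(1) by (simp add: closed_Times closed_Compl)
  qed
  then have S: "compact S" unfolding S_def by (intro closed_Int_compact) auto
  let ?f = "\<lambda>(\<eta>, c::real). norm (D z0 \<eta> - c *\<^sub>R u)"
  have cf: "continuous_on S ?f" unfolding D_def split_beta by (intro continuous_intros)
  have pos: "?f p > 0" if p: "p \<in> S" for p
  proof (rule ccontr)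
    obtain \<eta> c where p': "p = (\<eta>, c)" by (cases p)
    assume "\<not> ?f p > 0"
    then have eq: "D z0 \<eta> = c *\<^sub>R u" by (simp add: p')
    have \<eta>: "\<eta> \<notin> \<Gamma>" "0 \<le> c" "norm (\<eta>, c) = 1" using p by (auto simp: p' S_def)
    show False
    proof (cases "c = 0")
      case True
      then have "\<eta> = 0" using eq Dk[of _ z0 \<eta>] by (intro inj) (metis inner_zero_right scaleR_zero_left)
      then show False using True \<eta>(3) by simp
    next
      case False
      then have c: "c > 0" using \<eta>(2) by simp
      define t where "t = norm \<zeta>0 / c"
      have t: "t > 0" using c \<zeta>0 by (simp add: t_def)
      have "D z0 (t *\<^sub>R \<eta>) = \<zeta>0" using c \<zeta>0 by (simp add: Dscale eq t_def u_def)
      then have "t *\<^sub>R \<eta> \<in> \<Gamma>" by (intro dir) (metis Dk)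
      from \<Gamma>(2)[OF this, of "inverse t"] have "inverse t *\<^sub>R (t *\<^sub>R \<eta>) \<in> \<Gamma>" using t by simp
      then show False using t \<eta>(1) by simp
    qed
  qed
  obtain \<mu>1 where \<mu>1: "\<mu>1 > 0" "\<And>p. p \<in> S \<Longrightarrow> ?f p \<ge> \<mu>1"
  proof (cases "S = {}")
    case True
    then show ?thesis using that[of 1] by simp
  next
    case False
    obtain p where p: "p \<in> S" "\<forall>q\<in>S. ?f p \<le> ?f q" using continuous_attains_inf[OF S False cf] by blast
    then show ?thesis using that[of "?f p"] pos[OF p(1)] by blast
  qed
  have low: "norm (D z0 \<eta> - c *\<^sub>R u) \<ge> \<mu>1 * norm (\<eta>, c)" if \<eta>: "\<eta> \<notin> \<Gamma>" and c: "c \<ge> 0" for \<eta> c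
  proof (cases "(\<eta>, c) = 0")
    case False
    define t where "t = norm (\<eta>, c)"
    have t: "t > 0" unfolding t_def zero_less_norm_iff by (rule False)
    have "\<eta> /\<^sub>R t \<notin> \<Gamma>"
    proof
      assume "\<eta> /\<^sub>R t \<in> \<Gamma>"
      from \<Gamma>(2)[OF this t] show False using t \<eta> by simp
    qed
    moreover have "norm (\<eta> /\<^sub>R t, c / t) = 1"
    proof -
      have "(\<eta> /\<^sub>R t, c / t) = (\<eta>, c) /\<^sub>R t" by (simp add: divide_inverse mult.commute)
      then have "norm (\<eta> /\<^sub>R t, c / t) = inverse t * norm (\<eta>, c)" using t by (simp only: norm_scaleR) simp
      then show ?thesis using t by (simp add: t_def)
    qed
    ultimately have "(\<eta> /\<^sub>R t, c / t) \<in> S" using c t by (simp add: S_def)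
    from \<mu>1(2)[OF this] have "\<mu>1 \<le> norm (D z0 (\<eta> /\<^sub>R t) - (c / t) *\<^sub>R u)" by simp
    also have "D z0 (\<eta> /\<^sub>R t) - (c / t) *\<^sub>R u = (D z0 \<eta> - c *\<^sub>R u) /\<^sub>R t"
      by (simp add: Dscale scaleR_diff_right divide_inverse mult.commute)
    finally have "\<mu>1 \<le> norm ((D z0 \<eta> - c *\<^sub>R u) /\<^sub>R t)" .
    also have "\<dots> = norm (D z0 \<eta> - c *\<^sub>R u) / t" using t by (simp only: norm_scaleR) (simp add: divide_inverse)
    finally show ?thesis using t by (simp add: t_def[symmetric] pos_le_divide_eq)
  qed (auto simp: zero_prod_def)
  \<comment> \<open>Replacing \<open>z0\<close> by \<open>z\<close> and the multiple of
    \<open>u\<close> by \<zeta> costs at most \<rho> times the norm each, so half of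
    \<open>\<mu>1\<close> remains.\<close>
  define \<rho> where "\<rho> = \<mu>1 / 4"
  have \<rho>: "\<rho> > 0" using \<mu>1 by (simp add: \<rho>_def)
  let ?g = "\<lambda>z. \<Sum>b\<in>Basis. norm (partial_deriv b F z - partial_deriv b F z0)"
  have "continuous_on UNIV ?g"
    by (intro continuous_intros smooth_on_imp_continuous[OF open_UNIV] smooth_on_partial_deriv F open_UNIV)
  then have "isCont ?g z0" by (simp add: continuous_on_eq_continuous_at)
  then have "\<forall>\<^sub>F z in at z0. dist (?g z) (?g z0) < \<rho>" unfolding isCont_def using \<rho> by (rule tendstoD)
  then obtain r0 where r0: "r0 > 0" and r0': "\<And>z. z \<noteq> z0 \<Longrightarrow> dist z z0 < r0 \<Longrightarrow> dist (?g z) (?g z0) < \<rho>"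
    unfolding eventually_at by blast
  define r where "r = r0 / 2"
  have r: "r > 0" using r0 by (simp add: r_def)
  have near: "norm (D z \<eta> - D z0 \<eta>) \<le> \<rho> * norm \<eta>" if "z \<in> cball z0 r" for z \<eta>
  proof -
    have gz: "?g z \<le> \<rho>"
    proof (cases "z = z0")
      case False
      have "dist z z0 < r0" using that r0 by (simp add: r_def dist_commute)
      from r0'[OF False this] show ?thesis by (simp add: dist_real_def)
    qed (use \<rho> in simp)
    have "D z \<eta> - D z0 \<eta> = (\<Sum>b\<in>Basis. ((partial_deriv b F z - partial_deriv b F z0) \<bullet> \<eta>) *\<^sub>R b)"
      by (simp add: D_def sum_subtractf[symmetric] inner_diff_left scaleR_diff_left)
    also have "norm \<dots> \<le> (\<Sum>b\<in>Basis. \<bar>(partial_deriv b F z - partial_deriv b F z0) \<bullet> \<eta>\<bar>)" by (rule norm_sum_Basis_le)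
    also have "\<dots> \<le> (\<Sum>b\<in>Basis. norm (partial_deriv b F z - partial_deriv b F z0) * norm \<eta>)"
      by (intro sum_mono Cauchy_Schwarz_ineq2)
    also have "\<dots> = ?g z * norm \<eta>" by (simp add: sum_distrib_right)
    also have "\<dots> \<le> \<rho> * norm \<eta>" by (intro mult_right_mono gz) auto
    finally show ?thesis .
  qed
  define \<Lambda> where "\<Lambda> = (\<Sum>b\<in>Basis. norm (partial_deriv b F z0)) + \<rho>"
  have \<Lambda>: "\<Lambda> > 0" using \<rho> unfolding \<Lambda>_def by (intro add_nonneg_pos sum_nonneg) auto
  have up: "norm (D z \<eta>) \<le> \<Lambda> * norm \<eta>" if "z \<in> cball z0 r" for z \<eta>
  proof -
    have "norm (D z0 \<eta>) \<le> (\<Sum>b\<in>Basis. \<bar>partial_deriv b F z0 \<bullet> \<eta>\<bar>)" unfolding D_def by (rule norm_sum_Basis_le)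
    also have "\<dots> \<le> (\<Sum>b\<in>Basis. norm (partial_deriv b F z0) * norm \<eta>)" by (intro sum_mono Cauchy_Schwarz_ineq2)
    finally have "norm (D z0 \<eta>) \<le> (\<Sum>b\<in>Basis. norm (partial_deriv b F z0)) * norm \<eta>" by (simp add: sum_distrib_right)
    then show ?thesis using near[OF that, of \<eta>] norm_triangle_sub[of "D z \<eta>" "D z0 \<eta>"]
      unfolding \<Lambda>_def distrib_right by linarith
  qed
  \<comment> \<open>If |\<eta>| < \<delta> |\<zeta>|, then
    \<open>\<Lambda> * \<delta> \<le> 1 / 2\<close> leaves a gradient of size at least |\<zeta>|/2,
    and \<open>\<delta> \<le> 1\<close> gives |(\<eta>, \<zeta>)| \<le> 2 |\<zeta>|. Together this
    is the 1/4 in the definition of \<mu>.\<close>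
  define \<delta> where "\<delta> = 1 / (2 * (\<Lambda> + 1))"
  have \<delta>: "\<delta> > 0" "\<Lambda> * \<delta> \<le> 1 / 2" "\<delta> \<le> 1" using \<Lambda> by (simp_all add: \<delta>_def pos_divide_le_eq)
  define \<mu> where "\<mu> = min (\<mu>1 / 2) (1 / 4)"
  have \<mu>: "\<mu> > 0" using \<mu>1 by (simp add: \<mu>_def)
  define \<Gamma>' where "\<Gamma>' = {\<zeta>. \<zeta> \<noteq> 0 \<and> norm (\<zeta> /\<^sub>R norm \<zeta> - u) < \<rho>}"
  have con: "conic_nbhd \<zeta>0 \<Gamma>'"
    unfolding conic_nbhd_def
  proof (intro conjI ballI allI impI)
    have "continuous_on (- {0::'a}) (\<lambda>\<zeta>. norm (\<zeta> /\<^sub>R norm \<zeta> - u))" by (auto intro!: continuous_intros)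
    then have "open (- {0} \<inter> (\<lambda>\<zeta>. norm (\<zeta> /\<^sub>R norm \<zeta> - u)) -` {..<\<rho>})"
      by (rule continuous_open_preimage) auto
    moreover have "\<Gamma>' = - {0} \<inter> (\<lambda>\<zeta>. norm (\<zeta> /\<^sub>R norm \<zeta> - u)) -` {..<\<rho>}" by (auto simp: \<Gamma>'_def)
    ultimately show "open \<Gamma>'" by simp
    show "\<zeta>0 \<in> \<Gamma>'" using \<zeta>0 \<rho> by (simp add: \<Gamma>'_def u_def)
    show "0 \<notin> \<Gamma>'" by (simp add: \<Gamma>'_def)
    show "t *\<^sub>R \<zeta> \<in> \<Gamma>'" if "\<zeta> \<in> \<Gamma>'" "t > 0" for \<zeta> t
    proof -
      have "(t *\<^sub>R \<zeta>) /\<^sub>R norm (t *\<^sub>R \<zeta>) = \<zeta> /\<^sub>R norm \<zeta>" using that(2) by simp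
      then show ?thesis using that unfolding \<Gamma>'_def mem_Collect_eq by (simp only:) simp
    qed
  qed
  show ?thesis
  proof (rule that[OF r \<mu> \<delta>(1) con])
    fix \<eta> \<zeta> assume \<zeta>: "\<zeta> \<in> \<Gamma>'"
    have \<zeta>n: "norm (\<zeta> - norm \<zeta> *\<^sub>R u) \<le> \<rho> * norm \<zeta>"
    proof -
      have "\<zeta> - norm \<zeta> *\<^sub>R u = norm \<zeta> *\<^sub>R (\<zeta> /\<^sub>R norm \<zeta> - u)" using \<zeta> by (simp add: \<Gamma>'_def scaleR_diff_right)
      then have "norm (\<zeta> - norm \<zeta> *\<^sub>R u) = norm \<zeta> * norm (\<zeta> /\<^sub>R norm \<zeta> - u)" by (simp only: norm_scaleR) simp
      also have "\<dots> \<le> norm \<zeta> * \<rho>" using \<zeta> by (intro mult_left_mono) (auto simp: \<Gamma>'_def)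
      finally show ?thesis by (simp add: mult.commute)
    qed
    have suff: "dphase2 F (z, \<eta>, \<zeta>) \<ge> (\<mu> * norm (\<eta>, \<zeta>))\<^sup>2" if "norm (D z \<eta> - \<zeta>) \<ge> \<mu> * norm (\<eta>, \<zeta>)" for z
      unfolding dphase2_eq_norm D_def[symmetric] using that \<mu> by (intro power_mono) auto
    show "(\<forall>z\<in>cball z0 r. dphase2 F (z, \<eta>, \<zeta>) \<ge> (\<mu> * norm (\<eta>, \<zeta>))\<^sup>2) \<or> (\<eta> \<in> \<Gamma> \<and> \<delta> * norm \<zeta> \<le> norm \<eta>)"
    proof (cases "\<eta> \<in> \<Gamma>")
      case False
      have "norm (D z \<eta> - \<zeta>) \<ge> \<mu> * norm (\<eta>, \<zeta>)" if z: "z \<in> cball z0 r" for z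
      proof -
        have "norm (D z0 \<eta> - norm \<zeta> *\<^sub>R u) \<le> norm (D z \<eta> - \<zeta>) + norm (D z \<eta> - D z0 \<eta>) + norm (\<zeta> - norm \<zeta> *\<^sub>R u)"
          using norm_triangle_ineq[of "(D z \<eta> - \<zeta>) - (D z \<eta> - D z0 \<eta>)" "\<zeta> - norm \<zeta> *\<^sub>R u"]
            norm_triangle_ineq4[of "D z \<eta> - \<zeta>" "D z \<eta> - D z0 \<eta>"] by (simp add: algebra_simps)
        moreover have "\<mu>1 * norm (\<eta>, \<zeta>) \<le> norm (D z0 \<eta> - norm \<zeta> *\<^sub>R u)"
          using low[OF False, of "norm \<zeta>"] by (simp add: norm_Pair)
        moreover have "\<rho> * norm \<eta> \<le> \<rho> * norm (\<eta>, \<zeta>)" "\<rho> * norm \<zeta> \<le> \<rho> * norm (\<eta>, \<zeta>)"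
          using \<rho> norm_fst_le[of \<eta> \<zeta>] norm_snd_le[of \<zeta> \<eta>] by (auto intro!: mult_left_mono)
        moreover have "\<mu>1 * norm (\<eta>, \<zeta>) = 4 * (\<rho> * norm (\<eta>, \<zeta>))" by (simp add: \<rho>_def)
        moreover have "\<mu> * norm (\<eta>, \<zeta>) \<le> (2 * \<rho>) * norm (\<eta>, \<zeta>)" by (intro mult_right_mono) (auto simp: \<mu>_def \<rho>_def)
        ultimately show ?thesis using near[OF z, of \<eta>] \<zeta>n by linarith
      qed
      then show ?thesis using suff by blast
    next
      case True
      show ?thesis
      proof (cases "\<delta> * norm \<zeta> \<le> norm \<eta>")
        case False
        have "norm (D z \<eta> - \<zeta>) \<ge> \<mu> * norm (\<eta>, \<zeta>)" if z: "z \<in> cball z0 r" for z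
        proof -
          have "\<Lambda> * norm \<eta> \<le> \<Lambda> * (\<delta> * norm \<zeta>)" using False \<Lambda> by (intro mult_left_mono) auto
          also have "\<dots> \<le> (1 / 2) * norm \<zeta>" unfolding mult.assoc[symmetric] by (intro mult_right_mono \<delta>) auto
          finally have "norm (D z \<eta>) \<le> (1 / 2) * norm \<zeta>" using up[OF z, of \<eta>] by linarith
          then have 1: "norm (D z \<eta> - \<zeta>) \<ge> (1 / 2) * norm \<zeta>"
            using norm_triangle_ineq2[of \<zeta> "D z \<eta>"] by (simp add: norm_minus_commute)
          have "\<delta> * norm \<zeta> \<le> norm \<zeta>" using \<delta>(3) by (simp add: mult_left_le_one_le \<delta>(1) less_imp_le)
          then have "norm (\<eta>, \<zeta>) \<le> 2 * norm \<zeta>" using False norm_Pair_le[of \<eta> \<zeta>] by linarith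
          moreover have "\<mu> * norm (\<eta>, \<zeta>) \<le> (1 / 4) * norm (\<eta>, \<zeta>)" by (intro mult_right_mono) (auto simp: \<mu>_def)
          ultimately show ?thesis using 1 by linarith
        qed
        then show ?thesis using suff by blast
      qed (use True in simp)
    qed
  qed
qed

end

section \<open>Nets\<close>

lemma eventually_unit_interval: "\<forall>\<^sub>F \<epsilon> in at_right (0::real). \<epsilon> \<in> {0<..1}"
  unfolding eventually_at_right_field by (intro exI[of _ 1]) auto

lemma powr_antimono_exponent:
  assumes "0 < \<epsilon>" "\<epsilon> \<le> 1" "r \<le> s" shows "\<epsilon> powr s \<le> \<epsilon> powr (r::real)"
proof -
  have "ln \<epsilon> \<le> 0" using assms by simp
  then have "s * ln \<epsilon> \<le> r * ln \<epsilon>" using assms(3) by (rule mult_right_mono_neg[rotated])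
  then show ?thesis using assms(1) by (simp add: powr_def)
qed

text \<open>Normal form for all later uses: a nonnegative constant, and \<epsilon> already in the
  range where powers are monotone in the exponent.\<close>

lemma sup_bigoE:
  assumes "sup_bigo S F r"
  obtains C where "C \<ge> 0" "\<forall>\<^sub>F \<epsilon> in at_right 0. \<epsilon> \<in> {0<..1} \<and> (\<forall>x\<in>S. F \<epsilon> x \<le> C * \<epsilon> powr r)"
proof -
  obtain C where C: "\<forall>\<^sub>F \<epsilon> in at_right 0. \<forall>x\<in>S. F \<epsilon> x \<le> C * \<epsilon> powr r"
    using assms unfolding sup_bigo_def by blast
  have "\<forall>\<^sub>F \<epsilon> in at_right 0. \<epsilon> \<in> {0<..1} \<and> (\<forall>x\<in>S. F \<epsilon> x \<le> \<bar>C\<bar> * \<epsilon> powr r)"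
    using C eventually_unit_interval
  proof eventually_elim
    case (elim \<epsilon>)
    have le: "C * \<epsilon> powr r \<le> \<bar>C\<bar> * \<epsilon> powr r" by (intro mult_right_mono) auto
    show ?case
    proof (intro conjI ballI)
      show "\<epsilon> \<in> {0<..1}" using elim by blast
      fix x assume "x \<in> S"
      then have "F \<epsilon> x \<le> C * \<epsilon> powr r" using elim by blast
      then show "F \<epsilon> x \<le> \<bar>C\<bar> * \<epsilon> powr r" using le by linarith
    qed
  qed
  then show ?thesis using that[of "\<bar>C\<bar>"] by simp
qed

text \<open>The comparison point \<open>y\<close> may depend on \<epsilon> and \<open>x\<close>, so
  estimates can be moved along maps, for instance from the image of a compact set or from a larger
  frequency space.\<close>

lemma sup_bigo_bound:
  assumes "sup_bigo S F r" "r' \<le> r" "c \<ge> 0"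
    and "\<And>\<epsilon> x. \<epsilon> \<in> {0<..1} \<Longrightarrow> x \<in> T \<Longrightarrow> \<exists>y\<in>S. G \<epsilon> x \<le> c * F \<epsilon> y"
  shows "sup_bigo T G r'"
proof -
  obtain C where C: "C \<ge> 0" "\<forall>\<^sub>F \<epsilon> in at_right 0. \<epsilon> \<in> {0<..1} \<and> (\<forall>x\<in>S. F \<epsilon> x \<le> C * \<epsilon> powr r)"
    using sup_bigoE[OF assms(1)] .
  have "\<forall>\<^sub>F \<epsilon> in at_right 0. \<forall>x\<in>T. G \<epsilon> x \<le> (c * C) * \<epsilon> powr r'"
    using C(2)
  proof eventually_elim
    case (elim \<epsilon>)
    show ?case
    proof
      fix x assume "x \<in> T"
      then obtain y where y: "y \<in> S" "G \<epsilon> x \<le> c * F \<epsilon> y" using assms(4) elim by blast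
      have "F \<epsilon> y \<le> C * \<epsilon> powr r" using y(1) elim by blast
      also have "\<dots> \<le> C * \<epsilon> powr r'"
        using elim C(1) assms(2) by (intro mult_left_mono powr_antimono_exponent) auto
      finally have "c * F \<epsilon> y \<le> c * (C * \<epsilon> powr r')" using assms(3) by (rule mult_left_mono)
      then show "G \<epsilon> x \<le> (c * C) * \<epsilon> powr r'" using y(2) by (simp add: mult.assoc)
    qed
  qed
  then show ?thesis unfolding sup_bigo_def by blast
qed

lemma sup_bigo_le:
  assumes "sup_bigo S F r" "r' \<le> r" "T \<subseteq> S"
    and "\<And>\<epsilon> x. \<epsilon> \<in> {0<..1} \<Longrightarrow> x \<in> T \<Longrightarrow> G \<epsilon> x \<le> F \<epsilon> x"
  shows "sup_bigo T G r'"
  by (rule sup_bigo_bound[OF assms(1,2), of 1]) (use assms(3,4) in auto)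

lemma sup_bigo_add:
  assumes "sup_bigo S F r" "sup_bigo S G r" "\<And>\<epsilon> x. \<epsilon> \<in> {0<..1} \<Longrightarrow> x \<in> S \<Longrightarrow> H \<epsilon> x \<le> F \<epsilon> x + G \<epsilon> x"
  shows "sup_bigo S H r"
proof -
  obtain C where C: "\<forall>\<^sub>F \<epsilon> in at_right 0. \<epsilon> \<in> {0<..1} \<and> (\<forall>x\<in>S. F \<epsilon> x \<le> C * \<epsilon> powr r)"
    using sup_bigoE[OF assms(1)] .
  obtain D where D: "\<forall>\<^sub>F \<epsilon> in at_right 0. \<epsilon> \<in> {0<..1} \<and> (\<forall>x\<in>S. G \<epsilon> x \<le> D * \<epsilon> powr r)"
    using sup_bigoE[OF assms(2)] .
  have "\<forall>\<^sub>F \<epsilon> in at_right 0. \<forall>x\<in>S. H \<epsilon> x \<le> (C + D) * \<epsilon> powr r"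
    using C D
  proof eventually_elim
    case (elim \<epsilon>)
    show ?case
    proof
      fix x assume "x \<in> S"
      then have "F \<epsilon> x \<le> C * \<epsilon> powr r" "G \<epsilon> x \<le> D * \<epsilon> powr r" "H \<epsilon> x \<le> F \<epsilon> x + G \<epsilon> x"
        using elim assms(3) by blast+
      then show "H \<epsilon> x \<le> (C + D) * \<epsilon> powr r" by (simp add: distrib_right)
    qed
  qed
  then show ?thesis unfolding sup_bigo_def by blast
qed

lemma sup_bigo_mult:
  assumes "sup_bigo S F r" "sup_bigo S G s"
    "\<And>\<epsilon> x. \<epsilon> \<in> {0<..1} \<Longrightarrow> x \<in> S \<Longrightarrow> 0 \<le> F \<epsilon> x \<and> 0 \<le> G \<epsilon> x \<and> H \<epsilon> x \<le> F \<epsilon> x * G \<epsilon> x"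
  shows "sup_bigo S H (r + s)"
proof -
  obtain C where C: "C \<ge> 0" "\<forall>\<^sub>F \<epsilon> in at_right 0. \<epsilon> \<in> {0<..1} \<and> (\<forall>x\<in>S. F \<epsilon> x \<le> C * \<epsilon> powr r)"
    using sup_bigoE[OF assms(1)] .
  obtain D where D: "D \<ge> 0" "\<forall>\<^sub>F \<epsilon> in at_right 0. \<epsilon> \<in> {0<..1} \<and> (\<forall>x\<in>S. G \<epsilon> x \<le> D * \<epsilon> powr s)"
    using sup_bigoE[OF assms(2)] .
  have "\<forall>\<^sub>F \<epsilon> in at_right 0. \<forall>x\<in>S. H \<epsilon> x \<le> (C * D) * \<epsilon> powr (r + s)"
    using C(2) D(2)
  proof eventually_elim
    case (elim \<epsilon>)
    show ?case
    proof
      fix x assume x: "x \<in> S"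
      have "F \<epsilon> x * G \<epsilon> x \<le> (C * \<epsilon> powr r) * (D * \<epsilon> powr s)"
        using elim x assms(3) C(1) by (intro mult_mono) auto
      then show "H \<epsilon> x \<le> (C * D) * \<epsilon> powr (r + s)" using assms(3)[of \<epsilon> x] elim x
        by (auto simp: powr_add mult_ac intro: order_trans)
    qed
  qed
  then show ?thesis unfolding sup_bigo_def by blast
qed

lemma sup_bigo_const: "(\<And>\<epsilon> x. \<epsilon> \<in> {0<..1} \<Longrightarrow> x \<in> S \<Longrightarrow> F \<epsilon> x \<le> C) \<Longrightarrow> sup_bigo S F 0"
  unfolding sup_bigo_def using eventually_unit_interval
  by (intro exI[of _ C]) (auto elim!: eventually_mono)

definition mod_bounded :: "'a::euclidean_space set \<Rightarrow> 'a net \<Rightarrow> bool" where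
  "mod_bounded X u \<longleftrightarrow> (\<forall>K. compact K \<and> K \<subseteq> X \<longrightarrow> (\<exists>p. sup_bigo K (\<lambda>\<epsilon> x. cmod (u \<epsilon> x)) (- p)))"

text \<open>The counterpart of \<open>ndiff\<close> for growth in \<epsilon>: an order on which sum
  and product rules can be proved by induction, \<open>mod_bounded\<close> being order zero.\<close>

primrec modk :: "nat \<Rightarrow> 'a::euclidean_space set \<Rightarrow> 'a net \<Rightarrow> bool" where
  "modk 0 X u \<longleftrightarrow> mod_bounded X u"
| "modk (Suc k) X u \<longleftrightarrow> mod_bounded X u \<and> (\<forall>b\<in>Basis. modk k X (\<lambda>\<epsilon>. partial_deriv b (u \<epsilon>)))"

section \<open>Algebra of moderate nets\<close>

lemma mod_bounded_add:
  assumes "mod_bounded X u" "mod_bounded X v" shows "mod_bounded X (\<lambda>\<epsilon> x. u \<epsilon> x + v \<epsilon> x)"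
  unfolding mod_bounded_def
proof (intro allI impI)
  fix K assume "compact K \<and> K \<subseteq> X"
  then obtain p q where "sup_bigo K (\<lambda>\<epsilon> x. cmod (u \<epsilon> x)) (- p)" "sup_bigo K (\<lambda>\<epsilon> x. cmod (v \<epsilon> x)) (- q)"
    using assms unfolding mod_bounded_def by blast
  then have "sup_bigo K (\<lambda>\<epsilon> x. cmod (u \<epsilon> x)) (- max p q)" "sup_bigo K (\<lambda>\<epsilon> x. cmod (v \<epsilon> x)) (- max p q)"
    using sup_bigo_le[of K _ _ "- max p q" K] by auto
  then have "sup_bigo K (\<lambda>\<epsilon> x. cmod (u \<epsilon> x + v \<epsilon> x)) (- max p q)"
    by (rule sup_bigo_add) (rule norm_triangle_ineq)
  then show "\<exists>p. sup_bigo K (\<lambda>\<epsilon> x. cmod (u \<epsilon> x + v \<epsilon> x)) (- p)" by blast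
qed

lemma mod_bounded_mult:
  assumes "mod_bounded X u" "mod_bounded X v" shows "mod_bounded X (\<lambda>\<epsilon> x. u \<epsilon> x * v \<epsilon> x)"
  unfolding mod_bounded_def
proof (intro allI impI)
  fix K assume "compact K \<and> K \<subseteq> X"
  then obtain p q where "sup_bigo K (\<lambda>\<epsilon> x. cmod (u \<epsilon> x)) (- p)" "sup_bigo K (\<lambda>\<epsilon> x. cmod (v \<epsilon> x)) (- q)"
    using assms unfolding mod_bounded_def by blast
  then have "sup_bigo K (\<lambda>\<epsilon> x. cmod (u \<epsilon> x * v \<epsilon> x)) (- p + - q)"
    by (rule sup_bigo_mult) (simp add: norm_mult)
  then show "\<exists>p. sup_bigo K (\<lambda>\<epsilon> x. cmod (u \<epsilon> x * v \<epsilon> x)) (- p)" by (intro exI[of _ "p + q"]) simp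
qed

definition smooth_net :: "'a::euclidean_space set \<Rightarrow> 'a net \<Rightarrow> bool" where
  "smooth_net X u \<longleftrightarrow> (\<forall>\<epsilon>\<in>{0<..1}. smooth_on X (u \<epsilon>))"

lemma modk_Suc_imp: "modk (Suc k) X u \<Longrightarrow> modk k X u"
  by (induction k arbitrary: u) auto

lemma mod_bounded_cong:
  assumes "\<And>\<epsilon> x. \<epsilon> \<in> {0<..1} \<Longrightarrow> x \<in> X \<Longrightarrow> u \<epsilon> x = v \<epsilon> x" "mod_bounded X u" shows "mod_bounded X v"
  unfolding mod_bounded_def
proof (intro allI impI)
  fix K assume K: "compact K \<and> K \<subseteq> X"
  then obtain p where "sup_bigo K (\<lambda>\<epsilon> x. cmod (u \<epsilon> x)) (- p)" using assms(2) unfolding mod_bounded_def by blast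
  then have "sup_bigo K (\<lambda>\<epsilon> x. cmod (v \<epsilon> x)) (- p)"
    by (rule sup_bigo_le) (use assms(1) K in auto)
  then show "\<exists>p. sup_bigo K (\<lambda>\<epsilon> x. cmod (v \<epsilon> x)) (- p)" by blast
qed

lemma modk_cong:
  assumes "open X" "\<And>\<epsilon> x. \<epsilon> \<in> {0<..1} \<Longrightarrow> x \<in> X \<Longrightarrow> u \<epsilon> x = v \<epsilon> x" "modk k X u"
  shows "modk k X v"
  using assms(2,3)
proof (induction k arbitrary: u v)
  case 0
  then show ?case using mod_bounded_cong[of X u v] by simp
next
  case (Suc k)
  have "modk k X (\<lambda>\<epsilon>. partial_deriv b (v \<epsilon>))" if "b \<in> Basis" for b
  proof (rule Suc.IH[of "\<lambda>\<epsilon>. partial_deriv b (u \<epsilon>)"])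
    show "partial_deriv b (u \<epsilon>) x = partial_deriv b (v \<epsilon>) x" if "\<epsilon> \<in> {0<..1}" "x \<in> X" for \<epsilon> x
      by (rule partial_deriv_cong_open[OF assms(1) that(2)]) (rule Suc.prems(1)[OF that(1)])
  qed (use Suc.prems(2) that in simp)
  then show ?case using Suc.prems mod_bounded_cong[of X u v] by auto
qed

lemma moderate_nets_iff:
  "u \<in> moderate_nets X \<longleftrightarrow> smooth_net X u \<and> (\<forall>k. modk k X u)"
proof -
  let ?M = "\<lambda>u. \<forall>K bs. compact K \<and> K \<subseteq> X \<and> set bs \<subseteq> Basis \<longrightarrow>
            (\<exists>p. sup_bigo K (\<lambda>\<epsilon> x. cmod (iter_partial bs (u \<epsilon>) x)) (- p))"
  have 1: "modk k X u" if "?M u" for k u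
    using that
  proof (induction k arbitrary: u)
    case 0
    show ?case unfolding modk.simps mod_bounded_def using 0[rule_format, of _ "[]"] by simp
  next
    case (Suc k)
    have "?M (\<lambda>\<epsilon>. partial_deriv b (u \<epsilon>))" if b: "b \<in> Basis" for b
    proof (intro allI impI)
      fix K :: "'a set" and bs :: "'a list" assume "compact K \<and> K \<subseteq> X \<and> set bs \<subseteq> Basis"
      then show "\<exists>p. sup_bigo K (\<lambda>\<epsilon> x. cmod (iter_partial bs (partial_deriv b (u \<epsilon>)) x)) (- p)"
        using Suc.prems[rule_format, of K "bs @ [b]"] b by (simp add: iter_partial_append)
    qed
    moreover have "mod_bounded X u" unfolding mod_bounded_def using Suc.prems[rule_format, of _ "[]"] by simp
    ultimately show ?case using Suc.IH by simp
  qed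
  have 2: "\<exists>p. sup_bigo K (\<lambda>\<epsilon> x. cmod (iter_partial bs (u \<epsilon>) x)) (- p)"
    if "modk (length bs) X u" "compact K" "K \<subseteq> X" "set bs \<subseteq> Basis" for K bs u
    using that
  proof (induction bs arbitrary: u rule: rev_induct)
    case (snoc b bs)
    then show ?case using snoc.IH[of "\<lambda>\<epsilon>. partial_deriv b (u \<epsilon>)"] by (simp add: iter_partial_append)
  qed (simp add: mod_bounded_def)
  show ?thesis unfolding moderate_nets_def smooth_net_def using 1 2 by blast
qed

lemma modk_add:
  assumes "open X" "smooth_net X u" "smooth_net X v" "modk k X u" "modk k X v"
  shows "modk k X (\<lambda>\<epsilon> x. u \<epsilon> x + v \<epsilon> x)"
  using assms(2-)
proof (induction k arbitrary: u v)
  case 0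
  then show ?case by (simp add: mod_bounded_add)
next
  case (Suc k)
  have "mod_bounded X (\<lambda>\<epsilon> x. u \<epsilon> x + v \<epsilon> x)" using Suc.prems by (simp add: mod_bounded_add)
  moreover have "modk k X (\<lambda>\<epsilon>. partial_deriv b (\<lambda>x. u \<epsilon> x + v \<epsilon> x))" if b: "b \<in> Basis" for b
  proof (rule modk_cong[OF assms(1)])
    show "modk k X (\<lambda>\<epsilon> x. partial_deriv b (u \<epsilon>) x + partial_deriv b (v \<epsilon>) x)"
      using Suc.prems b by (intro Suc.IH) (auto simp: smooth_net_def intro: smooth_on_partial_deriv[OF assms(1)])
    fix \<epsilon> x assume "\<epsilon> \<in> {0<..(1::real)}" "x \<in> X"
    then have "(u \<epsilon> has_derivative frechet_derivative (u \<epsilon>) (at x)) (at x)"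
      "(v \<epsilon> has_derivative frechet_derivative (v \<epsilon>) (at x)) (at x)"
      using Suc.prems smooth_on_has_derivative unfolding smooth_net_def by blast+
    from partial_deriv_eq[OF has_derivative_add[OF this]]
    show "partial_deriv b (u \<epsilon>) x + partial_deriv b (v \<epsilon>) x = partial_deriv b (\<lambda>x. u \<epsilon> x + v \<epsilon> x) x"
      by (simp add: partial_deriv_def)
  qed
  ultimately show ?case by simp
qed

lemma modk_mult:
  assumes "open X" "smooth_net X u" "smooth_net X v" "modk k X u" "modk k X v"
  shows "modk k X (\<lambda>\<epsilon> x. u \<epsilon> x * v \<epsilon> x)"
  using assms(2-)
proof (induction k arbitrary: u v)
  case 0
  then show ?case by (simp add: mod_bounded_mult)
next
  case (Suc k)
  have "mod_bounded X (\<lambda>\<epsilon> x. u \<epsilon> x * v \<epsilon> x)" using Suc.prems by (simp add: mod_bounded_mult)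
  moreover have "modk k X (\<lambda>\<epsilon>. partial_deriv b (\<lambda>x. u \<epsilon> x * v \<epsilon> x))" if b: "b \<in> Basis" for b
  proof (rule modk_cong[OF assms(1)])
    have s: "smooth_net X (\<lambda>\<epsilon>. partial_deriv b (u \<epsilon>))" "smooth_net X (\<lambda>\<epsilon>. partial_deriv b (v \<epsilon>))"
      using Suc.prems by (auto simp: smooth_net_def intro: smooth_on_partial_deriv[OF assms(1)])
    show "modk k X (\<lambda>\<epsilon> x. u \<epsilon> x * partial_deriv b (v \<epsilon>) x + partial_deriv b (u \<epsilon>) x * v \<epsilon> x)"
    proof (rule modk_add[OF assms(1)])
      show "modk k X (\<lambda>\<epsilon> x. u \<epsilon> x * partial_deriv b (v \<epsilon>) x)" "modk k X (\<lambda>\<epsilon> x. partial_deriv b (u \<epsilon>) x * v \<epsilon> x)"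
        using Suc.prems b s modk_Suc_imp[OF Suc.prems(3)] modk_Suc_imp[OF Suc.prems(4)]
        by (auto intro!: Suc.IH)
    qed (use s Suc.prems in \<open>auto simp: smooth_net_def intro!: smooth_on_mult[OF assms(1)]\<close>)
    fix \<epsilon> x assume "\<epsilon> \<in> {0<..(1::real)}" "x \<in> X"
    then have "(u \<epsilon> has_derivative frechet_derivative (u \<epsilon>) (at x)) (at x)"
      "(v \<epsilon> has_derivative frechet_derivative (v \<epsilon>) (at x)) (at x)"
      using Suc.prems smooth_on_has_derivative unfolding smooth_net_def by blast+
    from partial_deriv_eq[OF has_derivative_mult[OF this]]
    show "u \<epsilon> x * partial_deriv b (v \<epsilon>) x + partial_deriv b (u \<epsilon>) x * v \<epsilon> x = partial_deriv b (\<lambda>x. u \<epsilon> x * v \<epsilon> x) x"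
      by (simp add: partial_deriv_def)
  qed
  ultimately show ?case by simp
qed

lemma modk_smooth:
  assumes "open X" "smooth_on X f" shows "modk k X (\<lambda>\<epsilon>. f)"
proof -
  have b: "mod_bounded X (\<lambda>\<epsilon>. f)" if f: "smooth_on X f" for f
    unfolding mod_bounded_def
  proof (intro allI impI)
    fix K assume K: "compact K \<and> K \<subseteq> X"
    then have "bounded (f ` K)"
      using continuous_on_subset[OF smooth_on_imp_continuous[OF assms(1) f]]
      by (intro compact_imp_bounded compact_continuous_image) auto
    then obtain C where "\<And>x. x \<in> K \<Longrightarrow> cmod (f x) \<le> C" unfolding bounded_iff by auto
    then have "sup_bigo K (\<lambda>\<epsilon> x. cmod (f x)) (- 0)" using sup_bigo_const[of K "\<lambda>\<epsilon> x. cmod (f x)" C] by simp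
    then show "\<exists>p. sup_bigo K (\<lambda>\<epsilon> x. cmod (f x)) (- p)" by blast
  qed
  show ?thesis using assms(2)
    by (induction k arbitrary: f) (auto intro: b smooth_on_partial_deriv[OF assms(1)])
qed

context
  fixes X :: "'a::euclidean_space set"
  assumes X: "open X"
begin

lemma moderate_add:
  "u \<in> moderate_nets X \<Longrightarrow> v \<in> moderate_nets X \<Longrightarrow> (\<lambda>\<epsilon> x. u \<epsilon> x + v \<epsilon> x) \<in> moderate_nets X"
  unfolding moderate_nets_iff using modk_add[OF X] smooth_on_add[OF X] unfolding smooth_net_def by blast

lemma moderate_smooth: "smooth_on X f \<Longrightarrow> (\<lambda>\<epsilon>. f) \<in> moderate_nets X"
  unfolding moderate_nets_iff smooth_net_def using modk_smooth[OF X] by blast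

lemma moderate_mult:
  "u \<in> moderate_nets X \<Longrightarrow> v \<in> moderate_nets X \<Longrightarrow> (\<lambda>\<epsilon> x. u \<epsilon> x * v \<epsilon> x) \<in> moderate_nets X"
  unfolding moderate_nets_iff using modk_mult[OF X] smooth_on_mult[OF X] unfolding smooth_net_def by blast

lemma moderate_uminus: "u \<in> moderate_nets X \<Longrightarrow> (\<lambda>\<epsilon> x. - u \<epsilon> x) \<in> moderate_nets X"
  using moderate_mult[OF moderate_smooth[OF smooth_on_const[OF X, of "-1"]]] by simp

lemma moderate_diff:
  "u \<in> moderate_nets X \<Longrightarrow> v \<in> moderate_nets X \<Longrightarrow> (\<lambda>\<epsilon> x. u \<epsilon> x - v \<epsilon> x) \<in> moderate_nets X"
  using moderate_add[OF _ moderate_uminus] by simp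

lemma moderate_partial:
  assumes "u \<in> moderate_nets X" "b \<in> Basis" shows "(\<lambda>\<epsilon>. partial_deriv b (u \<epsilon>)) \<in> moderate_nets X"
proof -
  have "modk (Suc k) X u" for k using assms moderate_nets_iff by blast
  then have "modk k X (\<lambda>\<epsilon>. partial_deriv b (u \<epsilon>))" for k using assms(2) by simp
  then show ?thesis using assms unfolding moderate_nets_iff smooth_net_def
    by (auto intro: smooth_on_partial_deriv[OF X])
qed

lemma moderate_sum:
  "finite I \<Longrightarrow> (\<And>i. i \<in> I \<Longrightarrow> u i \<in> moderate_nets X) \<Longrightarrow> (\<lambda>\<epsilon> x. \<Sum>i\<in>I. u i \<epsilon> x) \<in> moderate_nets X"
  by (induction I rule: finite_induct) (auto intro: moderate_add moderate_smooth[OF smooth_on_const[OF X]])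

lemma moderate_one_minus_laplace:
  assumes "u \<in> moderate_nets X" shows "(\<lambda>\<epsilon>. one_minus_laplace (u \<epsilon>)) \<in> moderate_nets X"
  unfolding one_minus_laplace_def[abs_def]
  by (intro moderate_diff moderate_sum moderate_partial assms finite_Basis)

lemma moderate_one_minus_laplace_power:
  "u \<in> moderate_nets X \<Longrightarrow> (\<lambda>\<epsilon>. (one_minus_laplace ^^ l) (u \<epsilon>)) \<in> moderate_nets X"
  by (induction l) (auto intro: moderate_one_minus_laplace)

lemma moderate_bound:
  assumes "u \<in> moderate_nets X" "compact K" "K \<subseteq> X"
  obtains p :: nat where "sup_bigo K (\<lambda>\<epsilon> x. cmod (u \<epsilon> x)) (- real p)"
proof -
  have "modk 0 X u" using assms(1) moderate_nets_iff by blast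
  then obtain p where p: "sup_bigo K (\<lambda>\<epsilon> x. cmod (u \<epsilon> x)) (- p)"
    using assms(2,3) unfolding modk.simps mod_bounded_def by blast
  have "sup_bigo K (\<lambda>\<epsilon> x. cmod (u \<epsilon> x)) (- real (nat \<lceil>p\<rceil>))"
    by (rule sup_bigo_le[OF p]) (auto, linarith)
  then show ?thesis using that by blast
qed

section \<open>Negligible nets and equality of classes\<close>

lemma negligible_add:
  "u \<in> negligible_nets X \<Longrightarrow> v \<in> negligible_nets X \<Longrightarrow> (\<lambda>\<epsilon> x. u \<epsilon> x + v \<epsilon> x) \<in> negligible_nets X"
  unfolding negligible_nets_def mem_Collect_eq
  by (intro conjI allI impI moderate_add)
    (blast, blast, rule sup_bigo_add[OF _ _ norm_triangle_ineq], blast+)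

lemma negligible_uminus: "u \<in> negligible_nets X \<Longrightarrow> (\<lambda>\<epsilon> x. - u \<epsilon> x) \<in> negligible_nets X"
  unfolding negligible_nets_def mem_Collect_eq norm_minus_cancel by (intro conjI moderate_uminus) blast+

lemma negligible_diff:
  "u \<in> negligible_nets X \<Longrightarrow> v \<in> negligible_nets X \<Longrightarrow> (\<lambda>\<epsilon> x. u \<epsilon> x - v \<epsilon> x) \<in> negligible_nets X"
  using negligible_add[OF _ negligible_uminus] by simp

lemma colombeau_rel_add_negligible:
  assumes "n \<in> negligible_nets X"
  shows "(\<lambda>\<epsilon> x. u \<epsilon> x + n \<epsilon> x, v) \<in> colombeau_rel X \<longleftrightarrow> (u, v) \<in> colombeau_rel X"
proof -
  have n: "n \<in> moderate_nets X" using assms by (simp add: negligible_nets_def)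
  have "(\<lambda>\<epsilon> x. u \<epsilon> x + n \<epsilon> x) \<in> moderate_nets X \<longleftrightarrow> u \<in> moderate_nets X"
    using moderate_add[OF _ n, of u] moderate_diff[OF _ n, of "\<lambda>\<epsilon> x. u \<epsilon> x + n \<epsilon> x"] by auto
  moreover have "(\<lambda>\<epsilon> x. (u \<epsilon> x + n \<epsilon> x) - v \<epsilon> x) \<in> negligible_nets X \<longleftrightarrow> (\<lambda>\<epsilon> x. u \<epsilon> x - v \<epsilon> x) \<in> negligible_nets X"
    using negligible_add[OF _ assms, of "\<lambda>\<epsilon> x. u \<epsilon> x - v \<epsilon> x"]
      negligible_diff[OF _ assms, of "\<lambda>\<epsilon> x. (u \<epsilon> x + n \<epsilon> x) - v \<epsilon> x"] by (auto simp: algebra_simps)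
  ultimately show ?thesis unfolding colombeau_rel_def by simp
qed

lemma moderate_cong:
  assumes uv: "\<And>\<epsilon> x. \<epsilon> \<in> {0<..1} \<Longrightarrow> x \<in> X \<Longrightarrow> u \<epsilon> x = v \<epsilon> x" and u: "u \<in> moderate_nets X"
  shows "v \<in> moderate_nets X"
  unfolding moderate_nets_iff
proof (intro conjI allI)
  have "smooth_net X u" "modk k X u" for k using u by (simp_all add: moderate_nets_iff)
  show "modk k X v" for k by (rule modk_cong[OF X uv \<open>modk k X u\<close>])
  show "smooth_net X v" unfolding smooth_net_def
  proof
    fix \<epsilon> :: real assume \<epsilon>: "\<epsilon> \<in> {0<..1}"
    then have "smooth_on X (u \<epsilon>)" using \<open>smooth_net X u\<close> by (simp add: smooth_net_def)
    then show "smooth_on X (v \<epsilon>)" using smooth_on_cong[of X "u \<epsilon>" "v \<epsilon>"] X uv[OF \<epsilon>] by blast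
  qed
qed

lemma negligible_cong:
  assumes uv: "\<And>\<epsilon> x. \<epsilon> \<in> {0<..1} \<Longrightarrow> x \<in> X \<Longrightarrow> u \<epsilon> x = v \<epsilon> x" and u: "u \<in> negligible_nets X"
  shows "v \<in> negligible_nets X"
  unfolding negligible_nets_def mem_Collect_eq
proof (intro conjI allI impI)
  show "v \<in> moderate_nets X" using moderate_cong[OF uv] u by (simp add: negligible_nets_def)
  fix K q assume K: "compact K \<and> K \<subseteq> X"
  then have "sup_bigo K (\<lambda>\<epsilon> x. cmod (u \<epsilon> x)) q" using u by (simp add: negligible_nets_def)
  then show "sup_bigo K (\<lambda>\<epsilon> x. cmod (v \<epsilon> x)) q" by (rule sup_bigo_le) (use uv K in auto)
qed

text \<open>Members of nets are total functions, and operators such as \<open>evolution_op\<close>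
  are controlled only at points of the open set; a class does not see the remaining values.\<close>

lemma colombeau_class_cong:
  assumes "\<And>\<epsilon> x. \<epsilon> \<in> {0<..1} \<Longrightarrow> x \<in> X \<Longrightarrow> u \<epsilon> x = v \<epsilon> x"
  shows "colombeau_class X u = colombeau_class X v"
proof -
  have "(u, w) \<in> colombeau_rel X \<longleftrightarrow> (v, w) \<in> colombeau_rel X" for w
  proof -
    have "u \<in> moderate_nets X \<longleftrightarrow> v \<in> moderate_nets X"
      by (rule iffI; rule moderate_cong; simp add: assms)
    moreover have "(\<lambda>\<epsilon> x. u \<epsilon> x - w \<epsilon> x) \<in> negligible_nets X \<longleftrightarrow> (\<lambda>\<epsilon> x. v \<epsilon> x - w \<epsilon> x) \<in> negligible_nets X"
      by (rule iffI; rule negligible_cong; simp add: assms)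
    ultimately show ?thesis unfolding colombeau_rel_def by simp
  qed
  then show ?thesis unfolding colombeau_class_def by auto
qed

lemma negligible_zero: "(\<lambda>\<epsilon> x. 0) \<in> negligible_nets X"
  unfolding negligible_nets_def sup_bigo_def
  by (auto intro!: moderate_smooth smooth_on_const[OF X] exI[of _ 0])

lemma colombeau_memD:
  assumes "U \<in> colombeau X" "u \<in> U" "v \<in> U"
  shows "u \<in> moderate_nets X" "(\<lambda>\<epsilon> x. u \<epsilon> x - v \<epsilon> x) \<in> negligible_nets X"
proof -
  obtain w where U: "U = colombeau_rel X `` {w}"
    using assms(1) unfolding colombeau_def quotient_def by auto
  have "u \<in> moderate_nets X" "(\<lambda>\<epsilon> x. w \<epsilon> x - u \<epsilon> x) \<in> negligible_nets X" "(\<lambda>\<epsilon> x. w \<epsilon> x - v \<epsilon> x) \<in> negligible_nets X"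
    using assms(2,3) unfolding U colombeau_rel_def by auto
  then show "u \<in> moderate_nets X" "(\<lambda>\<epsilon> x. u \<epsilon> x - v \<epsilon> x) \<in> negligible_nets X"
    using negligible_diff[of "\<lambda>\<epsilon> x. w \<epsilon> x - v \<epsilon> x" "\<lambda>\<epsilon> x. w \<epsilon> x - u \<epsilon> x"] by (auto simp: algebra_simps)
qed

lemma colombeau_nonempty: "U \<in> colombeau X \<Longrightarrow> U \<noteq> {}"
  unfolding colombeau_def quotient_def colombeau_rel_def using negligible_zero by auto

end

section \<open>Microlocal estimates for nets\<close>

lemma japanese_bracket_ge_1: "japanese_bracket \<xi> \<ge> 1"
  by (simp add: japanese_bracket_def)

lemma japanese_bracket_power_even: "japanese_bracket \<xi> ^ (2 * l) = (1 + (norm \<xi>)\<^sup>2) ^ l"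
  by (simp add: japanese_bracket_def power_mult add_nonneg_nonneg)

lemma japanese_bracket_power_le: "japanese_bracket \<xi> ^ l \<le> (1 + (norm \<xi>)\<^sup>2) ^ l"
  using power_increasing[of l "2 * l" "japanese_bracket \<xi>"] japanese_bracket_ge_1[of \<xi>]
  by (simp add: japanese_bracket_power_even)

lemma test_function_product:
  assumes "open X" "test_function X \<phi>" "smooth_on X f"
  shows "smooth_on UNIV (\<lambda>x. \<phi> x * f x)"
proof (rule smooth_on_zero_extension[OF assms(1)])
  show "closed (closure {x. \<phi> x \<noteq> 0})" "closure {x. \<phi> x \<noteq> 0} \<subseteq> X"
    using assms(2) by (auto simp: test_function_def)
  show "smooth_on X (\<lambda>x. \<phi> x * f x)"
    using assms smooth_on_subset[of UNIV \<phi> X] by (auto simp: test_function_def intro!: smooth_on_mult)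
  show "\<phi> x * f x = 0" if "x \<notin> closure {x. \<phi> x \<noteq> 0}" for x
    using that closure_subset[of "{x. \<phi> x \<noteq> 0}"] by auto
qed

text \<open>The weight is traded for derivatives of the net, so the exponent \<open>p\<close>
  depends on \<open>l\<close>; regularity asks for an exponent that does not.\<close>

lemma fourier_moderate:
  assumes X: "open X" and \<phi>: "test_function X \<phi>" and u: "u \<in> moderate_nets X"
  obtains p :: nat where
    "sup_bigo UNIV (\<lambda>\<epsilon> \<xi>. japanese_bracket \<xi> ^ l * cmod (fourier (\<lambda>x. \<phi> x * u \<epsilon> x) \<xi>)) (- real p)"
proof -
  define K where "K = closure {x. \<phi> x \<noteq> 0}"
  have K: "compact K" "K \<subseteq> X" using \<phi> by (auto simp: test_function_def K_def)
  have z: "\<phi> x * u \<epsilon> x = 0" if "x \<notin> K" for \<epsilon> x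
    using that closure_subset[of "{x. \<phi> x \<noteq> 0}"] by (auto simp: K_def)
  have sm: "smooth_on X (u \<epsilon>)" if "\<epsilon> \<in> {0<..1}" for \<epsilon> using u that by (auto simp: moderate_nets_def)
  have "(\<lambda>\<epsilon>. \<phi>) \<in> moderate_nets X"
    using \<phi> smooth_on_subset[of UNIV \<phi> X] by (intro moderate_smooth X) (auto simp: test_function_def)
  then have "(\<lambda>\<epsilon>. (one_minus_laplace ^^ l) (\<lambda>x. \<phi> x * u \<epsilon> x)) \<in> moderate_nets X"
    using moderate_mult[OF X _ u] by (intro moderate_one_minus_laplace_power X) auto
  from moderate_bound[OF X this K] obtain p :: nat where
    p: "sup_bigo K (\<lambda>\<epsilon> x. cmod ((one_minus_laplace ^^ l) (\<lambda>x. \<phi> x * u \<epsilon> x) x)) (- real p)" .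
  then obtain C where C: "C \<ge> 0" "\<forall>\<^sub>F \<epsilon> in at_right 0. \<epsilon> \<in> {0<..1} \<and>
      (\<forall>x\<in>K. cmod ((one_minus_laplace ^^ l) (\<lambda>x. \<phi> x * u \<epsilon> x) x) \<le> C * \<epsilon> powr (- real p))"
    by (rule sup_bigoE)
  have "\<forall>\<^sub>F \<epsilon> in at_right 0. \<forall>\<xi>\<in>UNIV. japanese_bracket \<xi> ^ l * cmod (fourier (\<lambda>x. \<phi> x * u \<epsilon> x) \<xi>)
      \<le> (C * measure lborel K) * \<epsilon> powr (- real p)"
    using C(2)
  proof eventually_elim
    case (elim \<epsilon>)
    show ?case
    proof
      fix \<xi> :: 'a
      have "japanese_bracket \<xi> ^ l * cmod (fourier (\<lambda>x. \<phi> x * u \<epsilon> x) \<xi>)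
          \<le> (1 + (norm \<xi>)\<^sup>2) ^ l * cmod (fourier (\<lambda>x. \<phi> x * u \<epsilon> x) \<xi>)"
        by (intro mult_right_mono japanese_bracket_power_le) auto
      also have "\<dots> \<le> C * \<epsilon> powr (- real p) * measure lborel K"
        by (rule fourier_decay[OF test_function_product[OF X \<phi> sm] K(1) z]) (use elim in auto)
      finally show "japanese_bracket \<xi> ^ l * cmod (fourier (\<lambda>x. \<phi> x * u \<epsilon> x) \<xi>)
          \<le> (C * measure lborel K) * \<epsilon> powr (- real p)" by (simp add: mult_ac)
    qed
  qed
  then have "sup_bigo UNIV (\<lambda>\<epsilon> \<xi>. japanese_bracket \<xi> ^ l * cmod (fourier (\<lambda>x. \<phi> x * u \<epsilon> x) \<xi>)) (- real p)"
    unfolding sup_bigo_def by blast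
  then show ?thesis by (rule that)
qed

text \<open>
  Where \<open>\<langle>\<xi>\<rangle>\<^sup>l\<close> is at most a power of \<open>1/\<epsilon>\<close> the negligible error is harmless; elsewhere the
  moderate bound with \<open>2 l\<close> instead of \<open>l\<close> gains that power.
\<close>

lemma rapid_decay_perturbation:
  assumes A: "\<And>l. \<exists>p::nat. sup_bigo \<Gamma> (\<lambda>\<epsilon> \<xi>. japanese_bracket \<xi> ^ l * cmod (A \<epsilon> \<xi>)) (- real p)"
    and AB: "\<And>q. sup_bigo \<Gamma> (\<lambda>\<epsilon> \<xi>. cmod (A \<epsilon> \<xi> - B \<epsilon> \<xi>)) q"
    and B: "\<And>l. sup_bigo \<Gamma> (\<lambda>\<epsilon> \<xi>. japanese_bracket \<xi> ^ l * cmod (B \<epsilon> \<xi>)) (- real N)"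
  shows "sup_bigo \<Gamma> (\<lambda>\<epsilon> \<xi>. japanese_bracket \<xi> ^ l * cmod (A \<epsilon> \<xi>)) (- real N)"
proof -
  obtain p :: nat where p: "sup_bigo \<Gamma> (\<lambda>\<epsilon> \<xi>. japanese_bracket \<xi> ^ (2 * l) * cmod (A \<epsilon> \<xi>)) (- real p)"
    using A by blast
  obtain C1 where C1: "C1 \<ge> 0" "\<forall>\<^sub>F \<epsilon> in at_right 0. \<epsilon> \<in> {0<..1} \<and> (\<forall>\<xi>\<in>\<Gamma>. japanese_bracket \<xi> ^ (2 * l) * cmod (A \<epsilon> \<xi>) \<le> C1 * \<epsilon> powr (- real p))"
    using sup_bigoE[OF p] .
  obtain C2 where C2: "C2 \<ge> 0" "\<forall>\<^sub>F \<epsilon> in at_right 0. \<epsilon> \<in> {0<..1} \<and> (\<forall>\<xi>\<in>\<Gamma>. cmod (A \<epsilon> \<xi> - B \<epsilon> \<xi>) \<le> C2 * \<epsilon> powr real p)"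
    using sup_bigoE[OF AB[of "real p"]] .
  obtain C3 where C3: "C3 \<ge> 0" "\<forall>\<^sub>F \<epsilon> in at_right 0. \<epsilon> \<in> {0<..1} \<and> (\<forall>\<xi>\<in>\<Gamma>. japanese_bracket \<xi> ^ l * cmod (B \<epsilon> \<xi>) \<le> C3 * \<epsilon> powr (- real N))"
    using sup_bigoE[OF B[of l]] .
  have "\<forall>\<^sub>F \<epsilon> in at_right 0. \<forall>\<xi>\<in>\<Gamma>. japanese_bracket \<xi> ^ l * cmod (A \<epsilon> \<xi>) \<le> (C1 + C2 + C3) * \<epsilon> powr (- real N)"
    using C1(2) C2(2) C3(2)
  proof eventually_elim
    case (elim \<epsilon>)
    then have \<epsilon>: "0 < \<epsilon>" "\<epsilon> \<le> 1" by auto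
    have eN: "1 \<le> \<epsilon> powr (- real N)" using powr_antimono_exponent[OF \<epsilon>, of "- real N" 0] \<epsilon> by simp
    have pp: "\<epsilon> powr (- real p) * \<epsilon> powr real p = 1" using \<epsilon> by (simp flip: powr_add)
    show ?case
    proof
      fix \<xi> assume \<xi>: "\<xi> \<in> \<Gamma>"
      let ?j = "japanese_bracket \<xi> ^ l"
      have j: "?j > 0" using japanese_bracket_ge_1[of \<xi>] by (intro zero_less_power) simp
      show "?j * cmod (A \<epsilon> \<xi>) \<le> (C1 + C2 + C3) * \<epsilon> powr (- real N)"
      proof (cases "?j \<le> \<epsilon> powr (- real p)")
        case True
        have "cmod (A \<epsilon> \<xi>) \<le> cmod (B \<epsilon> \<xi>) + cmod (A \<epsilon> \<xi> - B \<epsilon> \<xi>)" by (rule norm_triangle_sub)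
        then have "?j * cmod (A \<epsilon> \<xi>) \<le> ?j * cmod (B \<epsilon> \<xi>) + ?j * cmod (A \<epsilon> \<xi> - B \<epsilon> \<xi>)"
          using j by (simp flip: distrib_left)
        also have "?j * cmod (A \<epsilon> \<xi> - B \<epsilon> \<xi>) \<le> \<epsilon> powr (- real p) * (C2 * \<epsilon> powr real p)"
          using True elim \<xi> j by (intro mult_mono) auto
        also have "\<dots> = C2 * 1" unfolding pp[symmetric] by (simp only: mult_ac)
        also have "\<dots> \<le> C2 * \<epsilon> powr (- real N)" using C2(1) eN by (intro mult_left_mono) auto
        also have "?j * cmod (B \<epsilon> \<xi>) \<le> C3 * \<epsilon> powr (- real N)" using elim \<xi> by blast
        finally have "?j * cmod (A \<epsilon> \<xi>) \<le> C3 * \<epsilon> powr (- real N) + C2 * \<epsilon> powr (- real N)" by simp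
        moreover have "0 \<le> C1 * \<epsilon> powr (- real N)" using C1(1) by simp
        ultimately show ?thesis by (simp add: distrib_right)
      next
        case False
        have "?j * (?j * cmod (A \<epsilon> \<xi>)) \<le> C1 * \<epsilon> powr (- real p)"
          using elim \<xi> by (simp add: power_mult power2_eq_square power_mult_distrib mult.assoc flip: power_add)
            (metis mult_2 power_add mult.assoc)
        also have "\<dots> \<le> C1 * ?j" using False C1(1) by (intro mult_left_mono) auto
        finally have "?j * cmod (A \<epsilon> \<xi>) \<le> C1 * 1" using j by (simp add: mult.commute[of C1])
        also have "\<dots> \<le> C1 * \<epsilon> powr (- real N)" using C1(1) eN by (intro mult_left_mono) auto
        also have "\<dots> \<le> (C1 + C2 + C3) * \<epsilon> powr (- real N)" using C2(1) C3(1) by (intro mult_right_mono) auto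
        finally show ?thesis .
      qed
    qed
  qed
  then show ?thesis unfolding sup_bigo_def by blast
qed

text \<open>Near \<open>z0\<close> the factor \<open>\<psi> (F z)\<close> is invertible and can be
  divided out of the amplitude, so that \<open>pullback_fourier_decay\<close> applies to the
  localized net \<psi> w. The radius, the cone and the order \<open>N'\<close> are chosen before
  \<open>A\<close> and \<open>l\<close>; later uses rely on choosing the amplitude
  afterwards.\<close>

lemma pullback_regular:
  fixes F :: "'a::euclidean_space \<Rightarrow> 'b::euclidean_space"
  assumes F: "smooth_on UNIV F" and Y: "open Y" and w: "w \<in> moderate_nets Y"
    and \<psi>: "test_function Y \<psi>" "\<psi> (F z0) \<noteq> 0"
    and \<Gamma>: "open \<Gamma>" "\<And>\<eta> t. \<eta> \<in> \<Gamma> \<Longrightarrow> t > 0 \<Longrightarrow> t *\<^sub>R \<eta> \<in> \<Gamma>"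
    and N: "\<And>l. sup_bigo \<Gamma> (\<lambda>\<epsilon> \<eta>. japanese_bracket \<eta> ^ l * cmod (fourier (\<lambda>y. \<psi> y * w \<epsilon> y) \<eta>)) (- real N)"
    and \<zeta>0: "\<zeta>0 \<noteq> 0"
    and inj: "\<And>\<eta>. (\<And>k. frechet_derivative F (at z0) k \<bullet> \<eta> = 0) \<Longrightarrow> \<eta> = 0"
    and dir: "\<And>\<eta>. (\<And>k. frechet_derivative F (at z0) k \<bullet> \<eta> = k \<bullet> \<zeta>0) \<Longrightarrow> \<eta> \<in> \<Gamma>"
  obtains r \<Gamma>' and N' :: nat where "r > 0" "conic_nbhd \<zeta>0 \<Gamma>'"
    "\<And>A l. smooth_on UNIV A \<Longrightarrow> (\<And>z. z \<notin> cball z0 r \<Longrightarrow> A z = 0) \<Longrightarrow>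
      sup_bigo \<Gamma>' (\<lambda>\<epsilon> \<zeta>. japanese_bracket \<zeta> ^ l * cmod (fourier (\<lambda>z. A z * w \<epsilon> (F z)) \<zeta>)) (- real N')"
proof -
  obtain r0 \<mu> \<delta> \<Gamma>' where r0: "r0 > 0" and \<mu>: "\<mu> > 0" and \<delta>: "\<delta> > 0" and con: "conic_nbhd \<zeta>0 \<Gamma>'"
    and split: "\<And>\<eta> \<zeta>. \<zeta> \<in> \<Gamma>' \<Longrightarrow> (\<forall>z\<in>cball z0 r0. dphase2 F (z, \<eta>, \<zeta>) \<ge> (\<mu> * norm (\<eta>, \<zeta>))\<^sup>2) \<or>
      (\<eta> \<in> \<Gamma> \<and> \<delta> * norm \<zeta> \<le> norm \<eta>)"
  proof -
    have "\<exists>r0 \<mu> \<delta> \<Gamma>'. r0 > 0 \<and> \<mu> > 0 \<and> \<delta> > 0 \<and> conic_nbhd \<zeta>0 \<Gamma>' \<and>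
      (\<forall>\<eta> \<zeta>. \<zeta> \<in> \<Gamma>' \<longrightarrow> (\<forall>z\<in>cball z0 r0. dphase2 F (z, \<eta>, \<zeta>) \<ge> (\<mu> * norm (\<eta>, \<zeta>))\<^sup>2) \<or>
      (\<eta> \<in> \<Gamma> \<and> \<delta> * norm \<zeta> \<le> norm \<eta>))"
    proof (rule conic_split[where F = F and \<Gamma> = \<Gamma> and ?\<zeta>0.0 = \<zeta>0 and ?z0.0 = z0])
      show "t *\<^sub>R \<eta> \<in> \<Gamma>" if "\<eta> \<in> \<Gamma>" "t > 0" for \<eta> t using that by (rule \<Gamma>(2))
      show "\<eta> = 0" if "\<And>k. frechet_derivative F (at z0) k \<bullet> \<eta> = 0" for \<eta> using that by (rule inj)
      show "\<eta> \<in> \<Gamma>" if "\<And>k. frechet_derivative F (at z0) k \<bullet> \<eta> = k \<bullet> \<zeta>0" for \<eta> using that by (rule dir)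
    qed (use F \<Gamma>(1) \<zeta>0 in blast)+
    then show ?thesis using that by blast
  qed
  have s\<psi>: "smooth_on UNIV \<psi>" using \<psi> by (simp add: test_function_def)
  have s\<psi>F: "smooth_on UNIV (\<lambda>z. \<psi> (F z))" by (rule smooth_on_compose[OF open_UNIV open_UNIV s\<psi> F]) simp
  define U where "U = {z. \<psi> (F z) \<noteq> 0}"
  have U: "open U" unfolding U_def
    by (intro open_Collect_neq smooth_on_imp_continuous[OF open_UNIV s\<psi>F] continuous_on_const)
  obtain r1 where r1: "r1 > 0" "cball z0 r1 \<subseteq> U"
    using U \<psi>(2) open_contains_cball[of U] unfolding U_def by blast
  define r where "r = min r0 r1"
  have r: "r > 0" "cball z0 r \<subseteq> U" "cball z0 r \<subseteq> cball z0 r0" using r0 r1 by (auto simp: r_def)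
  define Kf where "Kf = closure {y. \<psi> y \<noteq> 0}"
  have Kf: "compact Kf" "Kf \<subseteq> Y" using \<psi> by (auto simp: test_function_def Kf_def)
  have zf: "\<psi> y * w \<epsilon> y = 0" if "y \<notin> Kf" for \<epsilon> y
    using that closure_subset[of "{y. \<psi> y \<noteq> 0}"] by (auto simp: Kf_def)
  have sw: "smooth_on Y (w \<epsilon>)" if "\<epsilon> \<in> {0<..1}" for \<epsilon> using w that by (auto simp: moderate_nets_def)
  obtain p :: nat where p: "sup_bigo UNIV (\<lambda>\<epsilon> \<eta>. japanese_bracket \<eta> ^ 0 * cmod (fourier (\<lambda>y. \<psi> y * w \<epsilon> y) \<eta>)) (- real p)"
    using fourier_moderate[OF Y \<psi>(1) w] .
  \<comment> \<open>\<open>N\<close> bounds the transform on the cone for every weight,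
    \<open>p\<close> bounds it everywhere with weight zero; neither depends on
    \<open>l\<close>.\<close>
  define N' where "N' = max N p"
  show ?thesis
  proof (rule that[OF r(1) con, where N' = N'])
    fix A :: "'a \<Rightarrow> complex" and l assume A: "smooth_on UNIV A" and A0: "\<And>z. z \<notin> cball z0 r \<Longrightarrow> A z = 0"
    \<comment> \<open>Supported in a ball on which \<open>\<psi> (F z)\<close> is nonzero, so the
      inverse is smooth wherever it matters.\<close>
    define A' where "A' z = A z * inverse (\<psi> (F z))" for z
    have A'0: "A' z = 0" if "z \<notin> cball z0 r" for z using A0[OF that] by (simp add: A'_def)
    have sA': "smooth_on UNIV A'"
    proof (rule smooth_on_zero_extension[OF U _ r(2) _ A'0])
      show "smooth_on U A'" unfolding A'_def[abs_def]
        by (intro smooth_on_mult smooth_on_inverse U smooth_on_subset[OF A] smooth_on_subset[OF s\<psi>F]) (auto simp: U_def)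
    qed auto
    have eq: "A z * w \<epsilon> (F z) = A' z * (\<psi> (F z) * w \<epsilon> (F z))" for \<epsilon> z
    proof (cases "z \<in> cball z0 r")
      case True
      then have "\<psi> (F z) \<noteq> 0" using r(2) by (auto simp: U_def)
      then show ?thesis by (simp add: A'_def)
    qed (simp add: A0 A'0)
    have split': "(\<forall>z\<in>cball z0 r. dphase2 F (z, \<eta>, \<zeta>) \<ge> (\<mu> * norm (\<eta>, \<zeta>))\<^sup>2) \<or> (\<eta> \<in> \<Gamma> \<and> \<delta> * norm \<zeta> \<le> norm \<eta>)"
      if "\<zeta> \<in> \<Gamma>'" for \<eta> \<zeta> using split[OF that, of \<eta>] r(3) by blast
    have "\<exists>C m. C \<ge> 0 \<and> (\<forall>f Kf M \<zeta>. smooth_on UNIV f \<longrightarrow> compact Kf \<longrightarrow> (\<forall>y. y \<notin> Kf \<longrightarrow> f y = 0) \<longrightarrow>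
      (\<forall>\<eta>. cmod (fourier f \<eta>) \<le> M) \<longrightarrow> (\<forall>\<eta>\<in>\<Gamma>. (1 + (norm \<eta>)\<^sup>2) ^ m * cmod (fourier f \<eta>) \<le> M) \<longrightarrow> \<zeta> \<in> \<Gamma>' \<longrightarrow>
      (1 + (norm \<zeta>)\<^sup>2) ^ l * cmod (fourier (\<lambda>z. A' z * f (F z)) \<zeta>) \<le> C * M)"
    proof (rule pullback_fourier_decay[where F = F and A = A' and K = "cball z0 r" and \<mu> = \<mu> and \<delta> = \<delta>
          and \<Gamma> = \<Gamma> and \<Gamma>' = \<Gamma>' and l = l])
      show "A' z = 0" if "z \<notin> cball z0 r" for z using that by (rule A'0)
      show "(\<forall>z\<in>cball z0 r. dphase2 F (z, \<eta>, \<zeta>) \<ge> (\<mu> * norm (\<eta>, \<zeta>))\<^sup>2) \<or> (\<eta> \<in> \<Gamma> \<and> \<delta> * norm \<zeta> \<le> norm \<eta>)"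
        if "\<zeta> \<in> \<Gamma>'" for \<eta> \<zeta> using that by (rule split')
      fix C m assume "C \<ge> 0" and est: "\<And>f Kf M \<zeta>. \<lbrakk> smooth_on UNIV f; compact Kf; \<And>y. y \<notin> Kf \<Longrightarrow> f y = 0;
        \<And>\<eta>. cmod (fourier f \<eta>) \<le> M; \<And>\<eta>. \<eta> \<in> \<Gamma> \<Longrightarrow> (1 + (norm \<eta>)\<^sup>2) ^ m * cmod (fourier f \<eta>) \<le> M; \<zeta> \<in> \<Gamma>' \<rbrakk> \<Longrightarrow>
        (1 + (norm \<zeta>)\<^sup>2) ^ l * cmod (fourier (\<lambda>z. A' z * f (F z)) \<zeta>) \<le> C * M"
      show ?thesis
        by (intro exI[of _ C] exI[of _ m] conjI allI impI \<open>C \<ge> 0\<close>, rule est) auto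
    qed (use F sA' \<mu> \<delta> in auto)
    then obtain C m where C: "C \<ge> 0" and est0: "\<forall>f Kf M \<zeta>. smooth_on UNIV f \<longrightarrow> compact Kf \<longrightarrow> (\<forall>y. y \<notin> Kf \<longrightarrow> f y = 0) \<longrightarrow>
      (\<forall>\<eta>. cmod (fourier f \<eta>) \<le> M) \<longrightarrow> (\<forall>\<eta>\<in>\<Gamma>. (1 + (norm \<eta>)\<^sup>2) ^ m * cmod (fourier f \<eta>) \<le> M) \<longrightarrow> \<zeta> \<in> \<Gamma>' \<longrightarrow>
      (1 + (norm \<zeta>)\<^sup>2) ^ l * cmod (fourier (\<lambda>z. A' z * f (F z)) \<zeta>) \<le> C * M" by (elim exE conjE)
    obtain C1 where C1: "C1 \<ge> 0" "\<forall>\<^sub>F \<epsilon> in at_right 0. \<epsilon> \<in> {0<..1} \<and>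
        (\<forall>\<eta>\<in>UNIV. japanese_bracket \<eta> ^ 0 * cmod (fourier (\<lambda>y. \<psi> y * w \<epsilon> y) \<eta>) \<le> C1 * \<epsilon> powr (- real p))"
      using sup_bigoE[OF p] .
    obtain C2 where C2: "C2 \<ge> 0" "\<forall>\<^sub>F \<epsilon> in at_right 0. \<epsilon> \<in> {0<..1} \<and>
        (\<forall>\<eta>\<in>\<Gamma>. japanese_bracket \<eta> ^ (2 * m) * cmod (fourier (\<lambda>y. \<psi> y * w \<epsilon> y) \<eta>) \<le> C2 * \<epsilon> powr (- real N))"
      using sup_bigoE[OF N[of "2 * m"]] .
    have "\<forall>\<^sub>F \<epsilon> in at_right 0. \<forall>\<zeta>\<in>\<Gamma>'. japanese_bracket \<zeta> ^ l * cmod (fourier (\<lambda>z. A z * w \<epsilon> (F z)) \<zeta>)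
        \<le> (C * (C1 + C2)) * \<epsilon> powr (- real N')"
      using C1(2) C2(2)
    proof eventually_elim
      case (elim \<epsilon>)
      then have \<epsilon>: "0 < \<epsilon>" "\<epsilon> \<le> 1" by auto
      define M where "M = (C1 + C2) * \<epsilon> powr (- real N')"
      have e1: "\<epsilon> powr (- real p) \<le> \<epsilon> powr (- real N')" "\<epsilon> powr (- real N) \<le> \<epsilon> powr (- real N')"
        by (rule powr_antimono_exponent[OF \<epsilon>], simp add: N'_def)+
      have "C1 * \<epsilon> powr (- real p) \<le> (C1 + C2) * \<epsilon> powr (- real N')"
        using C1(1) C2(1) e1(1) by (intro mult_mono) auto
      moreover have "C2 * \<epsilon> powr (- real N) \<le> (C1 + C2) * \<epsilon> powr (- real N')"
        using C1(1) C2(1) e1(2) by (intro mult_mono) auto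
      ultimately have M: "C1 * \<epsilon> powr (- real p) \<le> M" "C2 * \<epsilon> powr (- real N) \<le> M" by (simp_all add: M_def)
      show ?case
      proof
        fix \<zeta> assume \<zeta>: "\<zeta> \<in> \<Gamma>'"
        have "japanese_bracket \<zeta> ^ l * cmod (fourier (\<lambda>z. A z * w \<epsilon> (F z)) \<zeta>)
            \<le> (1 + (norm \<zeta>)\<^sup>2) ^ l * cmod (fourier (\<lambda>z. A' z * (\<psi> (F z) * w \<epsilon> (F z))) \<zeta>)"
          unfolding eq by (intro mult_right_mono japanese_bracket_power_le) auto
        also have "\<dots> \<le> C * M"
        proof (rule est0[rule_format])
          have "\<epsilon> \<in> {0<..1}" using elim by blast
          then show "smooth_on UNIV (\<lambda>y. \<psi> y * w \<epsilon> y)" by (rule test_function_product[OF Y \<psi>(1) sw])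
          show "compact Kf" by (rule Kf(1))
          show "\<psi> y * w \<epsilon> y = 0" if "y \<notin> Kf" for y using that by (rule zf)
          show "cmod (fourier (\<lambda>y. \<psi> y * w \<epsilon> y) \<eta>) \<le> M" for \<eta>
          proof -
            have "cmod (fourier (\<lambda>y. \<psi> y * w \<epsilon> y) \<eta>) \<le> C1 * \<epsilon> powr (- real p)" using elim by simp
            then show ?thesis using M(1) by linarith
          qed
          show "(1 + (norm \<eta>)\<^sup>2) ^ m * cmod (fourier (\<lambda>y. \<psi> y * w \<epsilon> y) \<eta>) \<le> M" if "\<eta> \<in> \<Gamma>" for \<eta>
          proof -
            have "(1 + (norm \<eta>)\<^sup>2) ^ m * cmod (fourier (\<lambda>y. \<psi> y * w \<epsilon> y) \<eta>) \<le> C2 * \<epsilon> powr (- real N)"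
              using elim that unfolding japanese_bracket_power_even by blast
            then show ?thesis using M(2) by linarith
          qed
        qed (rule \<zeta>)
        finally show "japanese_bracket \<zeta> ^ l * cmod (fourier (\<lambda>z. A z * w \<epsilon> (F z)) \<zeta>)
            \<le> (C * (C1 + C2)) * \<epsilon> powr (- real N')" by (simp add: M_def mult.assoc)
      qed
    qed
    then show "sup_bigo \<Gamma>' (\<lambda>\<epsilon> \<zeta>. japanese_bracket \<zeta> ^ l * cmod (fourier (\<lambda>z. A z * w \<epsilon> (F z)) \<zeta>)) (- real N')"
      unfolding sup_bigo_def by blast
  qed
qed

section \<open>The flow of the characteristic field\<close>

text \<open>The factor from \<open>hadamard\<close> is bounded along the two given curves over a
  compact time interval, so Gronwall applies without a global Lipschitz bound.\<close>

lemma ode_unique: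
  fixes V :: "'a::euclidean_space \<Rightarrow> 'a"
  assumes V: "smooth_on UNIV V"
    and y: "\<And>r. r \<in> closed_segment s0 s1 \<Longrightarrow> (y has_vector_derivative V (y r)) (at r)"
    and z: "\<And>r. r \<in> closed_segment s0 s1 \<Longrightarrow> (z has_vector_derivative V (z r)) (at r)"
    and eq: "y s0 = z s0"
  shows "y s1 = z s1"
proof -
  have nV: "ndiff (Suc 0) UNIV V" by (rule smooth_on_ndiff[OF open_UNIV V])
  obtain H where H: "continuous_on UNIV H" "\<And>x y. V x - V y = blinfun_apply (H (x, y)) (x - y)"
    "\<And>x h. blinfun_apply (H (x, x)) h = partial_deriv h V x"
    using hadamard[OF nV] by blast
  have "isCont y r" "isCont z r" if "r \<in> closed_segment s0 s1" for r
    using has_vector_derivative_continuous[OF y[OF that]] has_vector_derivative_continuous[OF z[OF that]] by simp_all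
  then have cy: "continuous_on (closed_segment s0 s1) y" "continuous_on (closed_segment s0 s1) z"
    using continuous_at_imp_continuous_on by blast+
  have "continuous_on (closed_segment s0 s1) (\<lambda>r. H (y r, z r))"
    by (rule continuous_on_compose2[OF H(1) continuous_on_Pair[OF cy]]) auto
  then have "bounded ((\<lambda>r. H (y r, z r)) ` closed_segment s0 s1)"
    by (intro compact_imp_bounded compact_continuous_image) auto
  then obtain L where L: "\<And>r. r \<in> closed_segment s0 s1 \<Longrightarrow> norm (H (y r, z r)) \<le> L"
    unfolding bounded_iff by auto
  have "y s1 - z s1 = 0"
  proof (rule gronwall_zero[of s0 s1 "\<lambda>r. y r - z r" "\<lambda>r. V (y r) - V (z r)"])
    show "((\<lambda>r. y r - z r) has_vector_derivative V (y r) - V (z r)) (at r)" if "r \<in> closed_segment s0 s1" for r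
      using that by (intro has_vector_derivative_diff y z)
    show "norm (V (y r) - V (z r)) \<le> L * norm (y r - z r)" if "r \<in> closed_segment s0 s1" for r
    proof -
      have "norm (V (y r) - V (z r)) \<le> norm (H (y r, z r)) * norm (y r - z r)"
        by (subst H(2)) (rule norm_blinfun)
      also have "\<dots> \<le> L * norm (y r - z r)" by (rule mult_right_mono[OF L[OF that]]) simp
      finally show ?thesis .
    qed
  qed (simp add: eq)
  then show ?thesis by simp
qed

text \<open>On \<Omega> minus \<open>K\<close> the coefficient is one constant, and filling in that
  constant outside \<Omega> gives a function that is smooth on two open sets covering everything.
  The arguments change from (t, x) to (x, t) here.\<close>

lemma smooth_coefficient_extension:
  fixes f :: "real \<times> (real^'n::finite) \<Rightarrow> complex"
  assumes \<Omega>: "open \<Omega>" and f: "smooth_on (UNIV \<times> \<Omega>) f" and c: "constant_outside_compact \<Omega> f"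
  shows "\<exists>f' K c. smooth_on UNIV f' \<and> compact K \<and> K \<subseteq> \<Omega> \<and> (\<forall>x t. x \<in> \<Omega> \<longrightarrow> f' (x, t) = f (t, x)) \<and>
    (\<forall>x t. x \<notin> K \<longrightarrow> f' (x, t) = c)"
proof -
  obtain K where K: "compact K" "K \<subseteq> \<Omega>" and "f constant_on (UNIV \<times> (\<Omega> - K))"
    using c unfolding constant_outside_compact_def by blast
  then obtain c where c: "\<forall>p\<in>UNIV \<times> (\<Omega> - K). f p = c" unfolding constant_on_def by blast
  define f' where "f' = (\<lambda>(x, t). if x \<in> \<Omega> then f (t, x) else c)"
  have "smooth_on (\<Omega> \<times> UNIV) f'"
  proof -
    have "smooth_on (\<Omega> \<times> UNIV) (\<lambda>z. f (snd z, fst z))"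
      using \<Omega> by (intro smooth_on_compose[OF _ _ f] smooth_on_Pair smooth_on_fst smooth_on_snd open_Times) auto
    then show ?thesis using smooth_on_cong[of "\<Omega> \<times> UNIV" f' "\<lambda>z. f (snd z, fst z)"] \<Omega>
      by (auto simp: f'_def open_Times)
  qed
  moreover have "smooth_on ((- K) \<times> UNIV) f'"
  proof -
    have o: "open ((- K) \<times> (UNIV :: real set))" using K(1) by (intro open_Times) (auto simp: compact_imp_closed)
    then show ?thesis using smooth_on_cong[OF o, of f' "\<lambda>z. c"] smooth_on_const[OF o, of c] c
      by (auto simp: f'_def)
  qed
  ultimately have "smooth_on ((\<Omega> \<times> UNIV) \<union> ((- K) \<times> UNIV)) f'" by (rule smooth_on_Un)
  moreover have "(\<Omega> \<times> UNIV) \<union> ((- K) \<times> UNIV) = (UNIV :: ((real^'n) \<times> real) set)" using K(2) by auto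
  ultimately have "smooth_on UNIV f'" by simp
  then show ?thesis using K c by (intro exI[of _ f'] exI[of _ K] exI[of _ c]) (auto simp: f'_def)
qed

locale characteristic_field =
  fixes av :: "'a::euclidean_space \<times> real \<Rightarrow> 'a" and K :: "'a set" and c :: 'a
  assumes av: "smooth_on UNIV av" and K: "compact K" and av_const: "\<And>x t. x \<notin> K \<Longrightarrow> av (x, t) = c"
begin

definition V :: "'a \<times> real \<Rightarrow> 'a \<times> real" where "V z = (av z, 1)"

lemma smooth_V: "smooth_on UNIV V"
  unfolding V_def[abs_def] by (intro smooth_on_Pair av smooth_on_const open_UNIV)

text \<open>Off \<open>K\<close> the field is constant and its derivative vanishes, so bounding the
  derivative on the compact set \<open>K \<times> {-S..S}\<close> is enough.\<close>

lemma av_lipschitz: "\<exists>L. \<forall>t x y. \<bar>t\<bar> \<le> S \<longrightarrow> norm (av (x, t) - av (y, t)) \<le> L * norm (x - y)"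
proof -
  let ?g = "\<lambda>z. \<Sum>b\<in>(Basis::'a set). norm (partial_deriv (b, 0::real) av z)"
  have cg: "continuous_on UNIV ?g"
    by (intro continuous_intros smooth_on_imp_continuous[OF open_UNIV] smooth_on_partial_deriv av open_UNIV)
  have "bounded (?g ` (K \<times> {-S..S}))"
    by (intro compact_imp_bounded compact_continuous_image continuous_on_subset[OF cg] compact_Times K) auto
  then obtain L where L: "\<And>z. z \<in> K \<times> {-S..S} \<Longrightarrow> norm (?g z) \<le> L" unfolding bounded_iff by auto
  have g: "?g (x, t) \<le> \<bar>L\<bar>" if "\<bar>t\<bar> \<le> S" for x t
  proof (cases "x \<in> K")
    case True
    have "?g (x, t) \<le> norm (?g (x, t))" by simp
    also have "\<dots> \<le> L" by (rule L) (use True that in auto)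
    finally show ?thesis by linarith
  next
    case False
    have o: "open ((- K) \<times> (UNIV::real set))" using K by (intro open_Times) (auto simp: compact_imp_closed)
    have "partial_deriv b av (x, t) = partial_deriv b (\<lambda>z. c) (x, t)" for b
      by (rule partial_deriv_cong_open[OF o]) (use False av_const in auto)
    then show ?thesis by (simp add: partial_deriv_const)
  qed
  have "norm (av (x, t) - av (y, t)) \<le> \<bar>L\<bar> * norm (x - y)" if t: "\<bar>t\<bar> \<le> S" for t x y
  proof (rule differentiable_bound[of UNIV "\<lambda>x. av (x, t)"])
    fix x :: 'a
    have "((\<lambda>x. (x, t)) has_derivative (\<lambda>h. (h, 0))) (at x)" by (auto intro!: derivative_eq_intros)
    from has_derivative_compose[OF this smooth_on_has_derivative[OF av UNIV_I]]
    show d: "((\<lambda>x. av (x, t)) has_derivative (\<lambda>h. frechet_derivative av (at (x, t)) (h, 0))) (at x)" .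
    show "onorm (\<lambda>h. frechet_derivative av (at (x, t)) (h, 0)) \<le> \<bar>L\<bar>"
    proof (rule onorm_le)
      fix h :: 'a
      have "frechet_derivative av (at (x, t)) (h, 0) = (\<Sum>b\<in>Basis. (h \<bullet> b) *\<^sub>R frechet_derivative av (at (x, t)) (b, 0))"
        by (rule has_derivative_sum_Basis[OF d])
      also have "norm \<dots> \<le> (\<Sum>b\<in>Basis. norm h * norm (partial_deriv (b, 0) av (x, t)))"
        by (rule sum_norm_le) (simp add: partial_deriv_def Basis_le_norm mult_right_mono)
      also have "\<dots> = norm h * ?g (x, t)" by (simp add: sum_distrib_left)
      also have "\<dots> \<le> norm h * \<bar>L\<bar>" by (intro mult_left_mono g t) auto
      finally show "norm (frechet_derivative av (at (x, t)) (h, 0)) \<le> \<bar>L\<bar> * norm h" by (simp add: mult.commute)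
    qed
  qed auto
  then show ?thesis by blast
qed

text \<open>The time argument is supplied as \<open>snd e + s\<close> instead of being read off the
  unknown \<open>w\<close>: the Lipschitz constant in \<open>x\<close> is uniform only for bounded
  times. \<open>snd_\<Psi>\<close> then shows that the time component of the solution is
  \<open>snd e + s\<close>, so the autonomous field \<open>V\<close> is solved. The bound
  \<open>2 * S\<close> arises from adding the starting time and the elapsed time.\<close>

sublocale flow: picard "\<lambda>s e w. (av (fst w, snd e + s), 1 :: real)" "\<lambda>e :: 'a \<times> real. e"
proof
  have "continuous_on UNIV (\<lambda>p :: real \<times> ('a \<times> real) \<times> ('a \<times> real). av (fst (snd (snd p)), snd (fst (snd p)) + fst p))"
    by (rule continuous_on_compose2[OF smooth_on_imp_continuous[OF open_UNIV av]]) (auto intro!: continuous_intros)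
  then show "continuous_on UNIV (\<lambda>(s, e :: 'a \<times> real, w :: 'a \<times> real). (av (fst w, snd e + s), 1 :: real))"
    unfolding split_beta by (intro continuous_on_Pair continuous_on_const)
  show "continuous_on UNIV (\<lambda>e :: 'a \<times> real. e)" by simp
  fix S :: real
  obtain L where L: "\<And>t x y. \<bar>t\<bar> \<le> 2 * S \<Longrightarrow> norm (av (x, t) - av (y, t)) \<le> L * norm (x - y)"
    using av_lipschitz[of "2 * S"] by blast
  show "\<exists>L. \<forall>s (e :: 'a \<times> real) (x :: 'a \<times> real) y. \<bar>s\<bar> \<le> S \<longrightarrow> norm e \<le> S \<longrightarrow>
      norm ((av (fst x, snd e + s), 1 :: real) - (av (fst y, snd e + s), 1)) \<le> L * norm (x - y)"
  proof (intro exI[of _ "\<bar>L\<bar>"] allI impI)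
    fix s :: real and e x y :: "'a \<times> real" assume s: "\<bar>s\<bar> \<le> S" and e: "norm e \<le> S"
    have "\<bar>snd e\<bar> \<le> norm e" using norm_snd_le[of "snd e" "fst e"] by simp
    then have t: "\<bar>snd e + s\<bar> \<le> 2 * S" using s e by linarith
    have "norm ((av (fst x, snd e + s), 1 :: real) - (av (fst y, snd e + s), 1)) = norm (av (fst x, snd e + s) - av (fst y, snd e + s))"
      by (simp add: norm_Pair)
    also have "\<dots> \<le> L * norm (fst x - fst y)" by (rule L[OF t])
    also have "\<dots> \<le> \<bar>L\<bar> * norm (x - y)"
      using norm_fst_le[of "fst x - fst y" "snd x - snd y"] by (intro mult_mono) (auto simp: minus_prod_def norm_fst_le)
    finally show "norm ((av (fst x, snd e + s), 1 :: real) - (av (fst y, snd e + s), 1)) \<le> \<bar>L\<bar> * norm (x - y)" .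
  qed
qed

definition \<Psi> :: "real \<times> 'a \<times> real \<Rightarrow> 'a \<times> real" where "\<Psi> = flow.sol"

lemma \<Psi>_0 [simp]: "\<Psi> (0, e) = e"
  by (simp add: \<Psi>_def flow.sol_0)

lemma snd_\<Psi>: "snd (\<Psi> (s, e)) = snd e + s"
proof -
  have "snd (\<Psi> (s, e)) - (snd e + s) = 0"
  proof (rule gronwall_zero[of 0 s "\<lambda>s. snd (\<Psi> (s, e)) - (snd e + s)" "\<lambda>s. 0" 0])
    fix r
    have "((\<lambda>s. snd (\<Psi> (s, e))) has_vector_derivative 1) (at r)"
      using bounded_linear.has_vector_derivative[OF bounded_linear_snd flow.sol_has_vector_derivative[of e r]]
      by (simp add: \<Psi>_def)
    moreover have "((\<lambda>s. snd e + s) has_vector_derivative 1) (at r)" by (auto intro!: derivative_eq_intros)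
    ultimately show "((\<lambda>s. snd (\<Psi> (s, e)) - (snd e + s)) has_vector_derivative 0) (at r)"
      using has_vector_derivative_diff by fastforce
  qed simp_all
  then show ?thesis by simp
qed

lemma \<Psi>_has_vector_derivative: "((\<lambda>s. \<Psi> (s, e)) has_vector_derivative V (\<Psi> (s, e))) (at s)"
proof -
  have "(av (fst (\<Psi> (s, e)), snd e + s), 1) = V (\<Psi> (s, e))"
    using snd_\<Psi>[of s e] by (metis V_def prod.collapse)
  then show ?thesis using flow.sol_has_vector_derivative[of e s] by (simp add: \<Psi>_def)
qed

lemma smooth_\<Psi>: "smooth_on UNIV \<Psi>"
  by (rule flow_smooth(1)[OF smooth_V _ _ \<Psi>_has_vector_derivative])
    (simp_all add: \<Psi>_def flow.continuous_sol flow.sol_0)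

lemma continuous_\<Psi>: "continuous_on UNIV \<Psi>"
  by (rule smooth_on_imp_continuous[OF open_UNIV smooth_\<Psi>])

lemma variational_equation:
  "((\<lambda>s. partial_deriv (0, k) \<Psi> (s, e)) has_vector_derivative
    partial_deriv (partial_deriv (0, k) \<Psi> (s, e)) V (\<Psi> (s, e))) (at s)"
  by (rule flow_smooth(2)[OF smooth_V continuous_\<Psi> \<Psi>_0 \<Psi>_has_vector_derivative])

lemma \<Psi>_unique:
  assumes "\<And>r. r \<in> closed_segment s0 s1 \<Longrightarrow> (y has_vector_derivative V (y r)) (at r)"
  shows "y s1 = \<Psi> (s1 - s0, y s0)"
proof (rule ode_unique[OF smooth_V, of s0 s1 y "\<lambda>r. \<Psi> (r - s0, y s0)"])
  show "((\<lambda>r. \<Psi> (r - s0, y s0)) has_vector_derivative V (\<Psi> (r - s0, y s0))) (at r)" for r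
  proof -
    have "((\<lambda>r. r - s0) has_vector_derivative 1) (at r)" by (auto intro!: derivative_eq_intros)
    from vector_diff_chain_at[OF this \<Psi>_has_vector_derivative] show ?thesis by (simp add: comp_def)
  qed
qed (use assms in auto)

lemma \<Psi>_add: "\<Psi> (s + r, e) = \<Psi> (s, \<Psi> (r, e))"
proof -
  have "((\<lambda>s. \<Psi> (s, e)) has_vector_derivative V (\<Psi> (q, e))) (at q)" for q
    by (rule \<Psi>_has_vector_derivative)
  from \<Psi>_unique[of r "s + r" "\<lambda>s. \<Psi> (s, e)", OF this] show ?thesis by simp
qed

text \<open>The foot at time 0 of the characteristic through \<open>z\<close>.\<close>

definition F :: "'a \<times> real \<Rightarrow> 'a" where "F z = fst (\<Psi> (- snd z, z))"

text \<open>The point reached at time \<open>snd z\<close> on the characteristic that starts at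
  \<open>fst z\<close> at time 0.\<close>

definition G :: "'a \<times> real \<Rightarrow> 'a \<times> real" where "G z = \<Psi> (snd z, (fst z, 0))"

lemma smooth_F: "smooth_on UNIV F"
  unfolding F_def[abs_def]
  by (intro smooth_on_fst_comp open_UNIV smooth_on_compose[OF _ _ smooth_\<Psi>] smooth_on_Pair smooth_on_minus
      smooth_on_snd smooth_on_ident UNIV_I)

lemma smooth_G: "smooth_on UNIV G"
  unfolding G_def[abs_def]
  by (rule smooth_on_compose[OF open_UNIV open_UNIV smooth_\<Psi>])
    (intro smooth_on_Pair smooth_on_snd smooth_on_fst smooth_on_const open_UNIV UNIV_I)+

lemma continuous_F: "continuous_on S F" and continuous_G: "continuous_on S G"
  using smooth_on_imp_continuous[OF open_UNIV smooth_F] smooth_on_imp_continuous[OF open_UNIV smooth_G]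
  by (auto intro: continuous_on_subset)

lemma snd_G [simp]: "snd (G z) = snd z"
  by (simp add: G_def snd_\<Psi>)

lemma G_zero [simp]: "G (y, 0) = (y, 0)"
  by (simp add: G_def)

lemma F_zero [simp]: "F (x, 0) = x"
  by (simp add: F_def)

lemma G_F: "G (F z, snd z) = z"
proof -
  have "(F z, 0) = \<Psi> (- snd z, z)" by (rule prod_eqI) (simp_all add: F_def snd_\<Psi>)
  then show ?thesis unfolding G_def using \<Psi>_add[of "snd z" "- snd z" z] by simp
qed

lemma F_G [simp]: "F (G z) = fst z"
proof -
  have "\<Psi> (- snd z, \<Psi> (snd z, (fst z, 0))) = (fst z, 0)" using \<Psi>_add[of "- snd z" "snd z" "(fst z, 0)"] by simp
  then show ?thesis by (simp add: F_def G_def snd_\<Psi>)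
qed

lemma F_\<Psi>: "F (\<Psi> (s, z)) = F z"
  using \<Psi>_add[of "- (snd z + s)" s z] by (simp add: F_def snd_\<Psi>)

lemma \<Psi>_G: "\<Psi> (s, G (y, t)) = G (y, t + s)"
  using \<Psi>_add[of s t "(y, 0)"] by (simp add: G_def add.commute)

lemma G_has_vector_derivative: "((\<lambda>t. G (y, t)) has_vector_derivative V (G (y, t))) (at t)"
  unfolding G_def using \<Psi>_has_vector_derivative[of "(y, 0)" t] by simp

abbreviation DF :: "'a \<times> real \<Rightarrow> 'a \<times> real \<Rightarrow> 'a" where "DF z \<equiv> frechet_derivative F (at z)"

lemma DF: "(F has_derivative DF z) (at z)"
  by (rule smooth_on_has_derivative[OF smooth_F UNIV_I])

lemma DG: "(G has_derivative frechet_derivative G (at z)) (at z)"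
  by (rule smooth_on_has_derivative[OF smooth_G UNIV_I])

lemma DF_DG: "DF (G z) (frechet_derivative G (at z) k) = fst k"
proof -
  have "((\<lambda>z. F (G z)) has_derivative (\<lambda>k. DF (G z) (frechet_derivative G (at z) k))) (at z)"
    by (rule has_derivative_compose[OF DG DF])
  moreover have "((\<lambda>z. F (G z)) has_derivative fst) (at z)"
    by (simp add: has_derivative_fst[OF has_derivative_ident])
  ultimately have "(\<lambda>k. DF (G z) (frechet_derivative G (at z) k)) = fst" by (rule has_derivative_unique)
  then show ?thesis by (rule fun_cong)
qed

lemma DG_DF: "frechet_derivative G (at (F z, snd z)) (DF z k, snd k) = k"
proof -
  have "((\<lambda>z. (F z, snd z)) has_derivative (\<lambda>k. (DF z k, snd k))) (at z)"
    by (intro has_derivative_Pair DF has_derivative_snd has_derivative_ident)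
  from has_derivative_compose[OF this DG]
  have "((\<lambda>z. z) has_derivative (\<lambda>k. frechet_derivative G (at (F z, snd z)) (DF z k, snd k))) (at z)"
    by (simp add: G_F)
  from has_derivative_unique[OF this has_derivative_ident] show ?thesis by (rule fun_cong)
qed

text \<open>\<open>F\<close> is constant along characteristics.\<close>

lemma DF_V: "DF z (V z) = 0"
proof -
  have "((\<lambda>s. F (\<Psi> (s, z))) has_vector_derivative DF z (V z)) (at 0)"
    using vector_derivative_diff_chain_within[OF \<Psi>_has_vector_derivative[of z 0] has_derivative_at_withinI[OF DF]]
    by (simp add: comp_def)
  moreover have "((\<lambda>s. F (\<Psi> (s, z))) has_vector_derivative 0) (at 0)" by (simp add: F_\<Psi>)
  ultimately show ?thesis using vector_derivative_unique_at by blast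
qed

text \<open>\<open>DF z\<close> is onto, with preimages supplied by the derivative of
  \<open>G\<close>, hence its transpose is injective. This is the hypothesis \<open>inj\<close> of
  \<open>pullback_regular\<close>.\<close>

lemma DF_adjoint_inj:
  assumes "\<And>k. DF z k \<bullet> \<eta> = 0" shows "\<eta> = 0"
proof -
  have "DF (G (F z, snd z)) (frechet_derivative G (at (F z, snd z)) (\<eta>, 0)) = \<eta>" by (simp add: DF_DG)
  then have "\<eta> \<bullet> \<eta> = 0" using assms unfolding G_F by metis
  then show ?thesis by simp
qed

lemma DG_adjoint_inj:
  assumes "\<And>k. frechet_derivative G (at (F z, snd z)) k \<bullet> \<zeta> = 0" shows "\<zeta> = 0"
  using assms DG_DF[of z \<zeta>] by (metis inner_eq_zero_iff)

end

locale transport_equation = characteristic_field av K c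
  for av :: "'a::euclidean_space \<times> real \<Rightarrow> 'a" and K c +
  fixes bb :: "'a \<times> real \<Rightarrow> complex"
  assumes bb: "smooth_on UNIV bb"
begin

definition \<beta> :: "'a \<times> real \<Rightarrow> complex" where "\<beta> z = line_int (\<lambda>s. bb (G (fst z, s))) (snd z)"

lemma continuous_bb_G: "continuous_on UNIV (\<lambda>s. bb (G (y, s)))"
proof -
  have "continuous_on UNIV (\<lambda>s. G (y, s))"
    by (rule continuous_on_compose2[OF continuous_G[of UNIV]]) (auto intro!: continuous_intros)
  then show ?thesis by (rule continuous_on_compose2[OF smooth_on_imp_continuous[OF open_UNIV bb]]) auto
qed

lemma \<beta>_has_vector_derivative: "((\<lambda>t. \<beta> (y, t)) has_vector_derivative bb (G (y, t))) (at t)"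
  using has_vector_derivative_line_int[OF continuous_bb_G] by (simp add: \<beta>_def)

lemma \<beta>_zero [simp]: "\<beta> (y, 0) = 0"
  by (simp add: \<beta>_def line_int_zero)

lemma smooth_\<beta>: "smooth_on UNIV \<beta>"
proof -
  define X where "X = (\<lambda>(s, y). \<beta> (y, s))"
  define f where "f = (\<lambda>(s, y). bb (G (y, s)))"
  have sw': "smooth_on UNIV (\<lambda>p. (snd p, fst p) :: 'a \<times> real)"
    by (intro smooth_on_Pair smooth_on_fst smooth_on_snd open_UNIV)
  have sw: "smooth_on UNIV (\<lambda>p::'a \<times> real. (snd p, fst p))"
    by (intro smooth_on_Pair smooth_on_fst smooth_on_snd open_UNIV)
  have "f = (\<lambda>p. bb (G (snd p, fst p)))" by (auto simp: f_def)
  then have f: "smooth_on UNIV f"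
    using smooth_on_compose[OF open_UNIV open_UNIV bb smooth_on_compose[OF open_UNIV open_UNIV smooth_G sw']]
    by simp
  have "continuous_on UNIV (\<lambda>(r, p). (\<lambda>r p. bb (G (p, r))) r p)"
    using smooth_on_imp_continuous[OF open_UNIV f] by (simp add: f_def)
  from continuous_on_line_int_param[OF this] have cX: "continuous_on UNIV X"
    by (simp add: X_def \<beta>_def split_beta)
  have "ndiff k UNIV X" for k
  \<comment> \<open>\<beta> solves a linear equation with zero coefficient and smooth forcing, once
    time is put in front of the parameter.\<close>
  proof (rule lode_smooth[where A = "\<lambda>p. 0" and f = f and ?x0.0 = "\<lambda>p. 0"])
    show "X (0, p) = 0" for p by (simp add: X_def)
    show "((\<lambda>s. X (s, p)) has_vector_derivative blinfun_apply 0 (X (s, p)) + f (s, p)) (at s)" for s p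
      using \<beta>_has_vector_derivative[of p s] by (simp add: X_def f_def)
  qed (use cX smooth_on_ndiff[OF open_UNIV f] in \<open>auto intro: ndiff_const\<close>)
  then have "smooth_on UNIV X" by (simp add: smooth_on_iff_ndiff)
  from smooth_on_compose[OF open_UNIV open_UNIV this sw] have "smooth_on UNIV (\<lambda>p. X (snd p, fst p))" by simp
  then show ?thesis by (simp add: X_def)
qed

text \<open>exp(i \<beta>) is the integrating factor: it turns the transport operator with its
  zeroth-order term into a plain derivative in \<open>t\<close>.\<close>

lemma along_characteristic:
  assumes "(v has_derivative D) (at (G (y, t)))"
  shows "((\<lambda>t. exp (\<i> * \<beta> (y, t)) * v (G (y, t))) has_vector_derivative
    exp (\<i> * \<beta> (y, t)) * (D (V (G (y, t))) + \<i> * bb (G (y, t)) * v (G (y, t)))) (at t)"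
proof -
  have 1: "((\<lambda>t. v (G (y, t))) has_vector_derivative D (V (G (y, t)))) (at t)"
    using vector_derivative_diff_chain_within[OF G_has_vector_derivative has_derivative_at_withinI[OF assms]]
    by (simp add: comp_def)
  have "((\<lambda>t. \<i> * \<beta> (y, t)) has_vector_derivative \<i> * bb (G (y, t))) (at t)"
    by (rule bounded_linear.has_vector_derivative[OF bounded_linear_mult_right \<beta>_has_vector_derivative])
  from field_vector_diff_chain_at[OF this DERIV_exp]
  have 2: "((\<lambda>t. exp (\<i> * \<beta> (y, t))) has_vector_derivative \<i> * bb (G (y, t)) * exp (\<i> * \<beta> (y, t))) (at t)"
    by (simp add: comp_def)
  from has_vector_derivative_mult[OF 2 1] show ?thesis by (simp add: algebra_simps)
qed

end

section \<open>Solutions of the Cauchy problem along the flow\<close>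

lemma test_function_bump:
  assumes "smooth_on UNIV \<phi>" "\<And>x. x \<notin> cball x0 r \<Longrightarrow> \<phi> x = (0::complex)" "cball x0 r \<subseteq> X"
  shows "test_function X \<phi>"
proof -
  have "closure {x. \<phi> x \<noteq> 0} \<subseteq> cball x0 r"
  proof (rule closure_minimal)
    show "{x. \<phi> x \<noteq> 0} \<subseteq> cball x0 r" using assms(2) by blast
  qed simp
  moreover from this have "compact (closure {x. \<phi> x \<noteq> 0})"
    by (simp add: compact_eq_bounded_closed bounded_subset[OF bounded_cball])
  ultimately show ?thesis unfolding test_function_def using assms(1,3) by blast
qed

lemma norm_triangle_le_diff_split: "norm (x - z) \<le> norm (x - y) + norm (y - z)"
  for x y z :: "'a::real_normed_vector"
  using norm_triangle_ineq[of "x - y" "y - z"] by simp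

locale cauchy = transport_equation av K c bb
  for av :: "(real^'n::finite) \<times> real \<Rightarrow> real^'n" and K c bb +
  fixes \<Omega> :: "(real^'n) set" and a :: "'n \<Rightarrow> real \<times> (real^'n) \<Rightarrow> complex"
    and b :: "real \<times> (real^'n) \<Rightarrow> complex"
  assumes \<Omega>: "open \<Omega>" and K\<Omega>: "K \<subseteq> \<Omega>"
    and a_eq: "\<And>j x t. x \<in> \<Omega> \<Longrightarrow> a j (t, x) = complex_of_real (av (x, t) $ j)"
    and b_eq: "\<And>x t. x \<in> \<Omega> \<Longrightarrow> b (t, x) = bb (x, t)"
begin

abbreviation XX :: "((real^'n) \<times> real) set" where "XX \<equiv> \<Omega> \<times> UNIV"

lemma open_XX: "open XX"
  using \<Omega> by (intro open_Times) auto

text \<open>The factors i and -i cancel, so over \<Omega> the operator is the derivative along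
  \<open>V\<close> plus i times \<open>bb\<close>.\<close>

lemma evolution_op_eq:
  assumes z: "z \<in> XX" and v: "(v has_derivative D) (at z)"
  shows "evolution_op a b v z = D (V z) + \<i> * bb z * v z"
proof -
  obtain x t where zt: "z = (x, t)" by (cases z)
  have x: "x \<in> \<Omega>" using z zt by simp
  have lin: "linear D" using v by (rule has_derivative_linear)
  have "V z = (\<Sum>j\<in>UNIV. (av z $ j) *\<^sub>R (axis j 1, 0)) + (0, 1)"
  proof -
    have "av z = (\<Sum>j\<in>UNIV. (av z $ j) *\<^sub>R axis j 1)"
      using basis_expansion[of "av z"] by (simp add: scalar_mult_eq_scaleR)
    moreover have "(\<Sum>j\<in>UNIV. (av z $ j) *\<^sub>R (axis j 1 :: real^'n, 0 :: real)) = (\<Sum>j\<in>UNIV. (av z $ j) *\<^sub>R axis j 1, 0)"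
      by (simp add: sum_prod)
    ultimately show ?thesis by (simp add: V_def)
  qed
  then have "D (V z) = (\<Sum>j\<in>UNIV. (av z $ j) *\<^sub>R D (axis j 1, 0)) + D (0, 1)"
    by (simp only: linear_add[OF lin] linear_sum[OF lin] linear_cmul[OF lin])
  moreover have "\<i> * (\<Sum>j\<in>UNIV. a j (t, x) * (- \<i> * D (axis j 1, 0))) = (\<Sum>j\<in>UNIV. (av z $ j) *\<^sub>R D (axis j 1, 0))"
    unfolding sum_distrib_left
  proof (intro sum.cong refl)
    fix j
    have "\<i> * (A * (- \<i> * X)) = A * X" for A X :: complex by (simp add: complex_eq_iff)
    then show "\<i> * (a j (t, x) * (- \<i> * D (axis j 1, 0))) = (av z $ j) *\<^sub>R D (axis j 1, 0)"
      by (simp only: a_eq[OF x] zt scaleR_conv_of_real)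
  qed
  ultimately show ?thesis
    by (simp add: evolution_op_def first_order_op_def zt partial_deriv_eq[OF v[unfolded zt]] b_eq[OF x] distrib_left)
qed

lemma smooth_exp_\<beta>: "smooth_on UNIV (\<lambda>z. exp (k * \<beta> z))"
  by (intro smooth_on_cexp smooth_on_mult smooth_on_const smooth_\<beta> open_UNIV)

lemma continuous_exp_\<beta>: "continuous_on S (\<lambda>z. exp (k * \<beta> z))"
  using smooth_on_imp_continuous[OF open_UNIV smooth_exp_\<beta>] continuous_on_subset by blast

text \<open>The time derivative of exp(i \<beta>) v along a characteristic is exp(i \<beta>) times
  the operator applied to \<open>v\<close>, which is negligible; the mean value inequality from 0 to
  \<open>t\<close> bounds the change.\<close>

lemma characteristic_estimate:
  assumes inv: "\<And>y t. y \<in> \<Omega> \<Longrightarrow> G (y, t) \<in> XX"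
    and v: "smooth_net XX v"
    and n: "\<And>K q. compact K \<Longrightarrow> K \<subseteq> XX \<Longrightarrow> sup_bigo K (\<lambda>\<epsilon> z. cmod (evolution_op a b (v \<epsilon>) z)) q"
    and C: "compact C" "C \<subseteq> XX"
  shows "sup_bigo C (\<lambda>\<epsilon> z. cmod (v \<epsilon> (G z) - exp (- \<i> * \<beta> z) * v \<epsilon> (fst z, 0))) q"
proof -
  \<comment> \<open>All points on the vertical segments from time 0 to the points of
    \<open>C\<close>: the bound for the operator is needed on the whole arc of
    characteristic.\<close>
  define C' where "C' = (\<lambda>(z, \<sigma>). (fst z, \<sigma> * snd z)) ` (C \<times> {0..1::real})"
  have C': "compact C'" unfolding C'_def split_beta
    by (intro compact_continuous_image compact_Times C continuous_intros) auto
  have C'mem: "(fst z, \<sigma> * snd z) \<in> C'" if "z \<in> C" "\<sigma> \<in> {0..1}" for z \<sigma>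
    unfolding C'_def using that by force
  have "G ` C' \<subseteq> XX"
  proof
    fix p assume "p \<in> G ` C'"
    then obtain z \<sigma> where z: "z \<in> C" and p: "p = G (fst z, \<sigma> * snd z)" unfolding C'_def by auto
    have "fst z \<in> \<Omega>" using z C(2) by auto
    then show "p \<in> XX" unfolding p by (rule inv)
  qed
  moreover have "compact (G ` C')" by (intro compact_continuous_image continuous_G C')
  ultimately have "sup_bigo (G ` C') (\<lambda>\<epsilon> z. cmod (evolution_op a b (v \<epsilon>) z)) q" using n by blast
  then obtain N where N: "N \<ge> 0" "\<forall>\<^sub>F \<epsilon> in at_right 0. \<epsilon> \<in> {0<..1} \<and>
      (\<forall>z\<in>G ` C'. cmod (evolution_op a b (v \<epsilon>) z) \<le> N * \<epsilon> powr q)"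
    by (rule sup_bigoE)
  have "bounded ((\<lambda>z. exp (\<i> * \<beta> z)) ` C')" "bounded ((\<lambda>z. exp (- \<i> * \<beta> z)) ` C)"
    by (rule compact_imp_bounded[OF compact_continuous_image[OF continuous_exp_\<beta>]], rule C' C(1))+
  moreover have "bounded (snd ` C)"
    by (rule bounded_snd[OF compact_imp_bounded[OF C(1)]])
  ultimately obtain M1 M2 M3 where "\<forall>x\<in>(\<lambda>z. exp (\<i> * \<beta> z)) ` C'. norm x \<le> M1"
      "\<forall>x\<in>(\<lambda>z. exp (- \<i> * \<beta> z)) ` C. norm x \<le> M2" "\<forall>x\<in>snd ` C. norm x \<le> M3"
    unfolding bounded_iff by (elim exE)
  then have M: "\<And>z. z \<in> C' \<Longrightarrow> cmod (exp (\<i> * \<beta> z)) \<le> M1"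
      "\<And>z. z \<in> C \<Longrightarrow> cmod (exp (- \<i> * \<beta> z)) \<le> M2" "\<And>z. z \<in> C \<Longrightarrow> norm (snd z) \<le> M3"
    by auto
  have "\<forall>\<^sub>F \<epsilon> in at_right 0. \<forall>z\<in>C. cmod (v \<epsilon> (G z) - exp (- \<i> * \<beta> z) * v \<epsilon> (fst z, 0))
      \<le> (\<bar>M2\<bar> * (\<bar>M1\<bar> * N * \<bar>M3\<bar>)) * \<epsilon> powr q"
    using N(2)
  proof eventually_elim
    case (elim \<epsilon>)
    show ?case
    proof
      fix z assume z: "z \<in> C"
      obtain y t where yt: "z = (y, t)" by (cases z)
      have y: "y \<in> \<Omega>" using z C(2) yt by auto
      define f where "f r = exp (\<i> * \<beta> (y, r)) * v \<epsilon> (G (y, r))" for r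
      have f: "(f has_vector_derivative exp (\<i> * \<beta> (y, r)) * evolution_op a b (v \<epsilon>) (G (y, r))) (at r)" for r
      proof -
        have "(v \<epsilon> has_derivative frechet_derivative (v \<epsilon>) (at (G (y, r)))) (at (G (y, r)))"
          using v elim inv[OF y] by (intro smooth_on_has_derivative[of XX]) (auto simp: smooth_net_def)
        from along_characteristic[OF this] evolution_op_eq[OF inv[OF y] this] show ?thesis unfolding f_def by simp
      qed
      have "norm (f t - f 0) \<le> (\<bar>M1\<bar> * (N * \<epsilon> powr q)) * norm (t - 0)"
      proof (rule differentiable_bound[of "closed_segment 0 t" f])
        fix r assume r: "r \<in> closed_segment 0 t"
        then obtain \<sigma> where \<sigma>: "\<sigma> \<in> {0..1}" "r = \<sigma> * t" by (auto simp: in_segment)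
        have m: "(y, r) \<in> C'" using C'mem[OF z \<sigma>(1)] yt \<sigma>(2) by simp
        show "(f has_derivative (\<lambda>h. h *\<^sub>R (exp (\<i> * \<beta> (y, r)) * evolution_op a b (v \<epsilon>) (G (y, r))))) (at r within closed_segment 0 t)"
          using f[of r] by (simp add: has_vector_derivative_def has_derivative_at_withinI)
        have "cmod (exp (\<i> * \<beta> (y, r)) * evolution_op a b (v \<epsilon>) (G (y, r))) \<le> \<bar>M1\<bar> * (N * \<epsilon> powr q)"
          unfolding norm_mult using M(1)[OF m] elim m N(1) by (intro mult_mono) auto
        then show "onorm (\<lambda>h. h *\<^sub>R (exp (\<i> * \<beta> (y, r)) * evolution_op a b (v \<epsilon>) (G (y, r)))) \<le> \<bar>M1\<bar> * (N * \<epsilon> powr q)"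
        proof (intro onorm_le)
          fix h :: real
          assume le: "cmod (exp (\<i> * \<beta> (y, r)) * evolution_op a b (v \<epsilon>) (G (y, r))) \<le> \<bar>M1\<bar> * (N * \<epsilon> powr q)"
          show "norm (h *\<^sub>R (exp (\<i> * \<beta> (y, r)) * evolution_op a b (v \<epsilon>) (G (y, r)))) \<le> \<bar>M1\<bar> * (N * \<epsilon> powr q) * norm h"
            unfolding norm_scaleR using mult_left_mono[OF le abs_ge_zero[of h]] by (simp add: mult.commute)
        qed
      qed auto
      also have "\<dots> \<le> (\<bar>M1\<bar> * (N * \<epsilon> powr q)) * \<bar>M3\<bar>"
        using M(3)[OF z] N(1) by (intro mult_left_mono) (auto simp: yt)
      finally have 1: "norm (f t - f 0) \<le> \<bar>M1\<bar> * (N * \<epsilon> powr q) * \<bar>M3\<bar>" .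
      have "v \<epsilon> (G z) - exp (- \<i> * \<beta> z) * v \<epsilon> (fst z, 0) = exp (- \<i> * \<beta> z) * (f t - f 0)"
      proof -
        have "exp (- \<i> * \<beta> z) * (exp (\<i> * \<beta> z) * w) = w" for w
          by (simp add: mult.assoc[symmetric] exp_add[symmetric])
        then show ?thesis by (simp add: f_def yt right_diff_distrib)
      qed
      also have "cmod \<dots> \<le> \<bar>M2\<bar> * (\<bar>M1\<bar> * (N * \<epsilon> powr q) * \<bar>M3\<bar>)"
        unfolding norm_mult using M(2)[OF z] 1 by (intro mult_mono) auto
      finally show "cmod (v \<epsilon> (G z) - exp (- \<i> * \<beta> z) * v \<epsilon> (fst z, 0)) \<le> (\<bar>M2\<bar> * (\<bar>M1\<bar> * N * \<bar>M3\<bar>)) * \<epsilon> powr q"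
        by (simp add: mult_ac)
    qed
  qed
  then show ?thesis unfolding sup_bigo_def by blast
qed

text \<open>A lifted operation is a union over representatives, so membership of the zero net and of
  \<open>g'\<close> each yields some representative of \<open>u\<close>, but nothing makes
  \<open>v\<close> and \<open>w\<close> the same.\<close>

lemma cauchy_representatives:
  assumes "cauchy_solution \<Omega> a b g u" "g \<in> colombeau \<Omega>" "g' \<in> g"
  obtains v w where "v \<in> u" "evolution_op a b \<circ> v \<in> negligible_nets XX"
    "w \<in> u" "(\<lambda>\<epsilon> x. w \<epsilon> (x, 0) - g' \<epsilon> x) \<in> negligible_nets \<Omega>"
proof -
  have lift: "colombeau_lift XX (evolution_op a b) u = colombeau_class XX (\<lambda>\<epsilon> z. 0)"
    and slice: "time_slice \<Omega> 0 u = g" using assms(1) by (auto simp: cauchy_solution_def)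
  have "(\<lambda>\<epsilon> z. 0) \<in> colombeau_class XX (\<lambda>\<epsilon> z. 0)"
  proof -
    have "(\<lambda>\<epsilon> z. 0) \<in> negligible_nets XX" by (rule negligible_zero[OF open_XX])
    moreover from this have "(\<lambda>\<epsilon> z. 0) \<in> moderate_nets XX" unfolding negligible_nets_def by blast
    ultimately show ?thesis by (simp add: colombeau_class_def colombeau_rel_def)
  qed
  then obtain v where v: "v \<in> u" "(\<lambda>\<epsilon> z. 0) \<in> colombeau_class XX (\<lambda>\<epsilon>. evolution_op a b (v \<epsilon>))"
    unfolding lift[symmetric] colombeau_lift_def by blast
  have "evolution_op a b \<circ> v \<in> negligible_nets XX"
    using v(2) by (simp add: colombeau_class_def colombeau_rel_def comp_def)
  moreover obtain w where "w \<in> u" "g' \<in> colombeau_class \<Omega> (\<lambda>\<epsilon> x. w \<epsilon> (x, 0))"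
    using assms(3) unfolding slice[symmetric] time_slice_def colombeau_lift_def by blast
  ultimately show ?thesis using that[OF v(1)] by (auto simp: colombeau_class_def colombeau_rel_def)
qed

text \<open>A chain of four replacements, each with negligible error on compact sets:
  \<open>u'\<close> by \<open>v\<close>, \<open>v\<close> by its initial value transported along the
  characteristic, that initial value by the one of \<open>w\<close>, and finally by
  \<open>g'\<close>.\<close>

lemma representative_estimate:
  assumes inv: "\<And>y t. y \<in> \<Omega> \<Longrightarrow> G (y, t) \<in> XX"
    and sol: "cauchy_solution \<Omega> a b g u" and g: "g \<in> colombeau \<Omega>" "g' \<in> g" and u': "u' \<in> u"
    and C: "compact C" "C \<subseteq> XX"
  shows "sup_bigo C (\<lambda>\<epsilon> z. cmod (u' \<epsilon> (G z) - exp (- \<i> * \<beta> z) * g' \<epsilon> (fst z))) q"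
proof -
  have u: "u \<in> colombeau XX" using sol by (simp add: cauchy_solution_def)
  obtain v w where v: "v \<in> u" "evolution_op a b \<circ> v \<in> negligible_nets XX"
    and w: "w \<in> u" "(\<lambda>\<epsilon> x. w \<epsilon> (x, 0) - g' \<epsilon> x) \<in> negligible_nets \<Omega>"
    by (rule cauchy_representatives[OF sol g])
  have vm: "v \<in> moderate_nets XX" by (rule colombeau_memD(1)[OF open_XX u v(1) v(1)])
  then have sv: "smooth_net XX v" by (simp add: moderate_nets_iff)
  have GC: "compact (G ` C)" "G ` C \<subseteq> XX"
  proof -
    show "compact (G ` C)" by (intro compact_continuous_image continuous_G C)
    have "G z \<in> XX" if "z \<in> C" for z
      using inv[of "fst z" "snd z"] that C(2) by (cases z) auto
    then show "G ` C \<subseteq> XX" by blast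
  qed
  have C0: "compact ((\<lambda>z. (fst z, 0::real)) ` C)" "(\<lambda>z. (fst z, 0::real)) ` C \<subseteq> XX"
    using C by (auto intro!: compact_continuous_image continuous_intros)
  have fC: "compact (fst ` C)" "fst ` C \<subseteq> \<Omega>"
    using C by (auto intro!: compact_continuous_image continuous_intros)
  have "bounded ((\<lambda>z. exp (- \<i> * \<beta> z)) ` C)"
    by (intro compact_imp_bounded compact_continuous_image continuous_exp_\<beta> C)
  then obtain M where M: "\<And>z. z \<in> C \<Longrightarrow> cmod (exp (- \<i> * \<beta> z)) \<le> M" unfolding bounded_iff by auto
  have 1: "sup_bigo C (\<lambda>\<epsilon> z. cmod (u' \<epsilon> (G z) - v \<epsilon> (G z))) q"
  proof (rule sup_bigo_bound[where c = 1 and r = q])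
    show "sup_bigo (G ` C) (\<lambda>\<epsilon> z. cmod (u' \<epsilon> z - v \<epsilon> z)) q"
      using colombeau_memD(2)[OF open_XX u u' v(1)] GC by (simp add: negligible_nets_def)
  qed auto
  have 2: "sup_bigo C (\<lambda>\<epsilon> z. cmod (v \<epsilon> (G z) - exp (- \<i> * \<beta> z) * v \<epsilon> (fst z, 0))) q"
    by (rule characteristic_estimate[OF inv sv _ C])
      (use v(2) in \<open>simp add: negligible_nets_def comp_def\<close>)+
  have 3: "sup_bigo C (\<lambda>\<epsilon> z. cmod (exp (- \<i> * \<beta> z) * (v \<epsilon> (fst z, 0) - w \<epsilon> (fst z, 0)))) q"
  proof (rule sup_bigo_bound[where c = "\<bar>M\<bar>" and r = q])
    show "sup_bigo ((\<lambda>z. (fst z, 0::real)) ` C) (\<lambda>\<epsilon> z. cmod (v \<epsilon> z - w \<epsilon> z)) q"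
      using colombeau_memD(2)[OF open_XX u v(1) w(1)] C0 by (simp add: negligible_nets_def)
    show "\<exists>y\<in>(\<lambda>z. (fst z, 0::real)) ` C. cmod (exp (- \<i> * \<beta> z) * (v \<epsilon> (fst z, 0) - w \<epsilon> (fst z, 0)))
        \<le> \<bar>M\<bar> * cmod (v \<epsilon> y - w \<epsilon> y)" if "z \<in> C" for \<epsilon> z
      unfolding norm_mult using that M[OF that] by (intro bexI[of _ "(fst z, 0)"] mult_right_mono) auto
  qed auto
  have 4: "sup_bigo C (\<lambda>\<epsilon> z. cmod (exp (- \<i> * \<beta> z) * (w \<epsilon> (fst z, 0) - g' \<epsilon> (fst z)))) q"
  proof (rule sup_bigo_bound[where c = "\<bar>M\<bar>" and r = q])
    show "sup_bigo (fst ` C) (\<lambda>\<epsilon> x. cmod (w \<epsilon> (x, 0) - g' \<epsilon> x)) q"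
      using w(2) fC by (simp add: negligible_nets_def)
    show "\<exists>x\<in>fst ` C. cmod (exp (- \<i> * \<beta> z) * (w \<epsilon> (fst z, 0) - g' \<epsilon> (fst z))) \<le> \<bar>M\<bar> * cmod (w \<epsilon> (x, 0) - g' \<epsilon> x)"
      if "z \<in> C" for \<epsilon> z
      unfolding norm_mult using that M[OF that] by (intro bexI[of _ "fst z"] mult_right_mono) auto
  qed auto
  have 12: "sup_bigo C (\<lambda>\<epsilon> z. cmod (u' \<epsilon> (G z) - exp (- \<i> * \<beta> z) * v \<epsilon> (fst z, 0))) q"
  proof (rule sup_bigo_add[OF 1 2])
    fix \<epsilon> z
    show "cmod (u' \<epsilon> (G z) - exp (- \<i> * \<beta> z) * v \<epsilon> (fst z, 0))
        \<le> cmod (u' \<epsilon> (G z) - v \<epsilon> (G z)) + cmod (v \<epsilon> (G z) - exp (- \<i> * \<beta> z) * v \<epsilon> (fst z, 0))"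
      by (rule norm_triangle_le_diff_split)
  qed
  have 34: "sup_bigo C (\<lambda>\<epsilon> z. cmod (exp (- \<i> * \<beta> z) * (v \<epsilon> (fst z, 0) - g' \<epsilon> (fst z)))) q"
  proof (rule sup_bigo_add[OF 3 4])
    fix \<epsilon> z
    have "exp (- \<i> * \<beta> z) * (v \<epsilon> (fst z, 0) - g' \<epsilon> (fst z))
        = exp (- \<i> * \<beta> z) * (v \<epsilon> (fst z, 0) - w \<epsilon> (fst z, 0)) + exp (- \<i> * \<beta> z) * (w \<epsilon> (fst z, 0) - g' \<epsilon> (fst z))"
      by (simp add: right_diff_distrib)
    then show "cmod (exp (- \<i> * \<beta> z) * (v \<epsilon> (fst z, 0) - g' \<epsilon> (fst z)))
        \<le> cmod (exp (- \<i> * \<beta> z) * (v \<epsilon> (fst z, 0) - w \<epsilon> (fst z, 0))) + cmod (exp (- \<i> * \<beta> z) * (w \<epsilon> (fst z, 0) - g' \<epsilon> (fst z)))"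
      by (simp only: norm_triangle_ineq)
  qed
  show ?thesis
  proof (rule sup_bigo_add[OF 12 34])
    fix \<epsilon> z
    have "u' \<epsilon> (G z) - exp (- \<i> * \<beta> z) * g' \<epsilon> (fst z)
        = (u' \<epsilon> (G z) - exp (- \<i> * \<beta> z) * v \<epsilon> (fst z, 0)) + exp (- \<i> * \<beta> z) * (v \<epsilon> (fst z, 0) - g' \<epsilon> (fst z))"
      by (simp add: right_diff_distrib)
    then show "cmod (u' \<epsilon> (G z) - exp (- \<i> * \<beta> z) * g' \<epsilon> (fst z))
        \<le> cmod (u' \<epsilon> (G z) - exp (- \<i> * \<beta> z) * v \<epsilon> (fst z, 0)) + cmod (exp (- \<i> * \<beta> z) * (v \<epsilon> (fst z, 0) - g' \<epsilon> (fst z)))"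
      by (simp only: norm_triangle_ineq)
  qed
qed

end

section \<open>Uniqueness and invariance of the domain\<close>

lemma mod_bounded_gaussian:
  assumes X: "open X" and h: "smooth_on X h" and q: "\<And>z. z \<in> X \<Longrightarrow> q z \<ge> (0::real)"
  shows "mod_bounded X (\<lambda>\<epsilon> z. complex_of_real (inverse \<epsilon> ^ j) * h z * exp (- complex_of_real (inverse \<epsilon>) * complex_of_real (q z)))"
    unfolding mod_bounded_def
  proof (intro allI impI)
    fix K assume K: "compact K \<and> K \<subseteq> X"
    then have "bounded (h ` K)"
      using continuous_on_subset[OF smooth_on_imp_continuous[OF X h]]
      by (intro compact_imp_bounded compact_continuous_image) auto
    then obtain C where C: "\<And>z. z \<in> K \<Longrightarrow> cmod (h z) \<le> C" unfolding bounded_iff by auto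
    have "\<forall>\<^sub>F \<epsilon> in at_right 0. \<forall>z\<in>K. cmod (complex_of_real (inverse \<epsilon> ^ j) * h z
        * exp (- complex_of_real (inverse \<epsilon>) * complex_of_real (q z))) \<le> \<bar>C\<bar> * \<epsilon> powr (- real j)"
      using eventually_unit_interval
    proof eventually_elim
      case (elim \<epsilon>)
      show ?case
      proof
        fix z assume z: "z \<in> K"
        have "0 \<le> inverse \<epsilon> * q z" using elim z K q[of z] by (intro mult_nonneg_nonneg) auto
        then have e: "cmod (exp (- complex_of_real (inverse \<epsilon>) * complex_of_real (q z))) \<le> 1"
        proof -
          have eq: "- complex_of_real (inverse \<epsilon>) * complex_of_real (q z) = complex_of_real (- (inverse \<epsilon> * q z))"
            by (simp only: of_real_minus of_real_mult minus_mult_left)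
          show ?thesis using \<open>0 \<le> inverse \<epsilon> * q z\<close> unfolding eq norm_exp_eq_Re Re_complex_of_real by simp
        qed
        have p: "\<epsilon> powr (- real j) = inverse \<epsilon> ^ j"
          using elim by (simp add: powr_minus powr_realpow power_inverse)
        have "cmod (complex_of_real (inverse \<epsilon> ^ j)) = inverse \<epsilon> ^ j" using elim by (simp add: norm_power norm_inverse)
        then have "cmod (complex_of_real (inverse \<epsilon> ^ j) * h z * exp (- complex_of_real (inverse \<epsilon>) * complex_of_real (q z)))
            = inverse \<epsilon> ^ j * cmod (h z) * cmod (exp (- complex_of_real (inverse \<epsilon>) * complex_of_real (q z)))"
          by (simp only: norm_mult)
        also have "\<dots> \<le> inverse \<epsilon> ^ j * \<bar>C\<bar> * 1"
          using C[OF z] e elim by (intro mult_mono) auto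
        finally show "cmod (complex_of_real (inverse \<epsilon> ^ j) * h z
            * exp (- complex_of_real (inverse \<epsilon>) * complex_of_real (q z))) \<le> \<bar>C\<bar> * \<epsilon> powr (- real j)"
          unfolding p by (simp add: mult.commute)
      qed
    qed
    then show "\<exists>p. sup_bigo K (\<lambda>\<epsilon> z. cmod (complex_of_real (inverse \<epsilon> ^ j) * h z
        * exp (- complex_of_real (inverse \<epsilon>) * complex_of_real (q z)))) (- p)" unfolding sup_bigo_def by blast
  qed

text \<open>A derivative that hits the exponential brings down a factor 1/\<epsilon>. With the power
  \<open>j\<close> and the amplitude \<open>h\<close> left free, the family reproduces itself under
  differentiation.\<close>

lemma modk_gaussian:
  assumes X: "open X" and h: "smooth_on X h" and q: "smooth_on X q" "\<And>z. z \<in> X \<Longrightarrow> q z \<ge> (0::real)"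
  shows "modk k X (\<lambda>\<epsilon> z. complex_of_real (inverse \<epsilon> ^ j) * h z * exp (- complex_of_real (inverse \<epsilon>) * complex_of_real (q z)))"
  using h
proof (induction k arbitrary: h j)
  case 0
    then show ?case using mod_bounded_gaussian[OF X 0 q(2)] by simp
  next
    case (Suc k)
    let ?e = "\<lambda>\<epsilon> z. exp (- complex_of_real (inverse \<epsilon>) * complex_of_real (q z))"
    have se: "smooth_on X (\<lambda>z. complex_of_real (inverse \<epsilon> ^ j) * h z * ?e \<epsilon> z)" if "smooth_on X h" for h j \<epsilon>
      using that q(1) by (intro smooth_on_mult smooth_on_const smooth_on_cexp smooth_on_of_real X)
    have "modk k X (\<lambda>\<epsilon>. partial_deriv d (\<lambda>z. complex_of_real (inverse \<epsilon> ^ j) * h z * ?e \<epsilon> z))" for d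
    proof (rule modk_cong[OF X])
      let ?h1 = "partial_deriv d h" and ?h2 = "\<lambda>z. - complex_of_real (partial_deriv d q z) * h z"
      have s: "smooth_on X ?h1" "smooth_on X ?h2"
        by (rule smooth_on_partial_deriv[OF X Suc.prems],
            intro smooth_on_mult smooth_on_minus smooth_on_of_real smooth_on_partial_deriv X Suc.prems q(1))
      show "modk k X (\<lambda>\<epsilon> z. complex_of_real (inverse \<epsilon> ^ j) * ?h1 z * ?e \<epsilon> z + complex_of_real (inverse \<epsilon> ^ Suc j) * ?h2 z * ?e \<epsilon> z)"
      proof (rule modk_add[OF X])
        show "smooth_net X (\<lambda>\<epsilon> z. complex_of_real (inverse \<epsilon> ^ j) * ?h1 z * ?e \<epsilon> z)"
          unfolding smooth_net_def by (intro ballI se s)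
        show "smooth_net X (\<lambda>\<epsilon> z. complex_of_real (inverse \<epsilon> ^ Suc j) * ?h2 z * ?e \<epsilon> z)"
          unfolding smooth_net_def by (intro ballI se s)
        show "modk k X (\<lambda>\<epsilon> z. complex_of_real (inverse \<epsilon> ^ j) * ?h1 z * ?e \<epsilon> z)" by (rule Suc.IH[OF s(1)])
        show "modk k X (\<lambda>\<epsilon> z. complex_of_real (inverse \<epsilon> ^ Suc j) * ?h2 z * ?e \<epsilon> z)" by (rule Suc.IH[OF s(2)])
      qed
      fix \<epsilon> :: real and z assume z: "z \<in> X"
      note dh = smooth_on_has_derivative[OF Suc.prems z] and dq = smooth_on_has_derivative[OF q(1) z]
      show "complex_of_real (inverse \<epsilon> ^ j) * ?h1 z * ?e \<epsilon> z + complex_of_real (inverse \<epsilon> ^ Suc j) * ?h2 z * ?e \<epsilon> z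
          = partial_deriv d (\<lambda>z. complex_of_real (inverse \<epsilon> ^ j) * h z * ?e \<epsilon> z) z"
        by (subst partial_deriv_eq[OF has_derivative_mult[OF has_derivative_mult_right[OF dh]
            has_derivative_cexp_linear[OF dq]]]) (simp add: partial_deriv_def algebra_simps)
    qed
    then show ?case using mod_bounded_gaussian[OF X Suc.prems q(2)] by simp
qed

lemma moderate_gaussian:
  assumes "open X" "smooth_on X h" "smooth_on X q" "\<And>z. z \<in> X \<Longrightarrow> q z \<ge> (0::real)"
  shows "(\<lambda>\<epsilon> z. h z * exp (- complex_of_real (inverse \<epsilon>) * complex_of_real (q z))) \<in> moderate_nets X"
proof -
  have "modk k X (\<lambda>\<epsilon> z. h z * exp (- complex_of_real (inverse \<epsilon>) * complex_of_real (q z)))" for k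
    using modk_gaussian[OF assms, of k 0] by simp
  then show ?thesis unfolding moderate_nets_iff smooth_net_def
    using assms by (auto intro!: smooth_on_mult smooth_on_cexp smooth_on_const smooth_on_minus smooth_on_of_real)
qed

text \<open>The limit \<open>flat_tendsto_0\<close> at the point \<epsilon>/d, with the exponent
  rounded up to an integer.\<close>

lemma exp_inverse_negligible:
  assumes d: "d > (0::real)"
  shows "\<forall>\<^sub>F \<epsilon> in at_right 0. exp (- (inverse \<epsilon> * d)) \<le> inverse (d ^ nat \<lceil>q\<rceil>) * \<epsilon> powr q"
proof -
  define k where "k = nat \<lceil>q\<rceil>"
  have "\<forall>\<^sub>F x in at_right (0::real). (1 / x) ^ k * exp (- (1 / x)) < 1"
    by (rule order_tendstoD(2)[OF flat_tendsto_0]) simp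
  moreover have "filterlim (\<lambda>\<epsilon>. inverse d * \<epsilon>) (at_right 0) (at_right (0::real))"
    using d by (intro filterlim_times_pos[OF filterlim_ident]) auto
  ultimately have "\<forall>\<^sub>F \<epsilon> in at_right (0::real). (1 / (inverse d * \<epsilon>)) ^ k * exp (- (1 / (inverse d * \<epsilon>))) < 1"
    by (rule eventually_compose_filterlim)
  then show ?thesis using eventually_unit_interval
  proof eventually_elim
    case (elim \<epsilon>)
    define y where "y = inverse \<epsilon> * d"
    have y: "y > 0" using elim d by (simp add: y_def)
    have "1 / (inverse d * \<epsilon>) = y" using d elim by (simp add: y_def divide_inverse)
    then have "y ^ k * exp (- y) \<le> 1" using elim by simp
    then have "inverse (y ^ k) * (y ^ k * exp (- y)) \<le> inverse (y ^ k) * 1"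
      using y by (intro mult_left_mono) auto
    then have "exp (- y) \<le> inverse (y ^ k)" using y by (simp add: mult.assoc[symmetric])
    also have "inverse (y ^ k) = inverse (d ^ k) * \<epsilon> ^ k"
      by (simp add: y_def power_mult_distrib power_inverse)
    also have "\<epsilon> ^ k = \<epsilon> powr real k" using elim by (simp add: powr_realpow)
    also have "inverse (d ^ k) * \<epsilon> powr real k \<le> inverse (d ^ k) * \<epsilon> powr q"
    proof (rule mult_left_mono, rule powr_antimono_exponent)
      show "q \<le> real k" unfolding k_def by (rule real_nat_ceiling_ge)
    qed (use elim d in auto)
    finally show ?case unfolding y_def k_def .
  qed
qed

context cauchy
begin

text \<open>The class of \<open>u + w\<close> solves the same Cauchy problem, so uniqueness
  identifies it with the class of \<open>u\<close>, and then \<open>w\<close> is a difference of two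
  representatives.\<close>

lemma negligible_of_null_solution:
  assumes uniq: "\<And>v. cauchy_solution \<Omega> a b g v \<Longrightarrow> v = u" and sol: "cauchy_solution \<Omega> a b g u"
    and w: "w \<in> moderate_nets XX" "\<And>\<epsilon> z. \<epsilon> \<in> {0<..1} \<Longrightarrow> z \<in> XX \<Longrightarrow> evolution_op a b (w \<epsilon>) z = 0"
      "(\<lambda>\<epsilon> x. w \<epsilon> (x, 0)) \<in> negligible_nets \<Omega>"
  shows "w \<in> negligible_nets XX"
proof -
  have u: "u \<in> colombeau XX" and lift: "colombeau_lift XX (evolution_op a b) u = colombeau_class XX (\<lambda>\<epsilon> z. 0)"
    and slice: "time_slice \<Omega> 0 u = g" using sol by (auto simp: cauchy_solution_def)
  obtain u0 where u0: "u0 \<in> moderate_nets XX" "u = colombeau_rel XX `` {u0}"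
    using u unfolding colombeau_def quotient_def by auto
  define n where "n \<epsilon> z = u0 \<epsilon> z + w \<epsilon> z" for \<epsilon> z
  define u' where "u' = colombeau_rel XX `` {n}"
  have n: "n \<in> moderate_nets XX" unfolding n_def[abs_def] by (rule moderate_add[OF open_XX u0(1) w(1)])
  \<comment> \<open>Subtracting \<open>w\<close> maps the representatives of the new class
    bijectively to those of \<open>u\<close>; \<open>UN\<close> then compares the unions that define
    the lifted operations term by term.\<close>
  have shift: "v \<in> u' \<longleftrightarrow> (\<lambda>\<epsilon> z. v \<epsilon> z - w \<epsilon> z) \<in> u" for v
  proof -
    have "v \<in> moderate_nets XX \<longleftrightarrow> (\<lambda>\<epsilon> z. v \<epsilon> z - w \<epsilon> z) \<in> moderate_nets XX"
      using moderate_diff[OF open_XX _ w(1), of v] moderate_add[OF open_XX _ w(1), of "\<lambda>\<epsilon> z. v \<epsilon> z - w \<epsilon> z"] by auto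
    moreover have "(\<lambda>\<epsilon> z. n \<epsilon> z - v \<epsilon> z) = (\<lambda>\<epsilon> z. u0 \<epsilon> z - (v \<epsilon> z - w \<epsilon> z))"
      by (simp add: n_def fun_eq_iff)
    ultimately show ?thesis using u0 n by (simp add: u'_def colombeau_rel_def)
  qed
  have UN: "(\<Union>v\<in>u'. A v) = (\<Union>v\<in>u. A v)" if A: "\<And>v. v \<in> u' \<Longrightarrow> A v = A (\<lambda>\<epsilon> z. v \<epsilon> z - w \<epsilon> z)" for A :: "_ \<Rightarrow> 'z set"
  proof (intro equalityI subsetI)
    fix x assume "x \<in> (\<Union>v\<in>u'. A v)"
    then obtain v where "v \<in> u'" "x \<in> A v" by blast
    then show "x \<in> (\<Union>v\<in>u. A v)" using A[of v] shift[of v] by blast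
  next
    fix x assume "x \<in> (\<Union>v\<in>u. A v)"
    then obtain v where v: "v \<in> u" "x \<in> A v" by blast
    let ?v = "\<lambda>\<epsilon> z. v \<epsilon> z + w \<epsilon> z"
    have eq: "(\<lambda>\<epsilon> z. ?v \<epsilon> z - w \<epsilon> z) = v" by (simp add: fun_eq_iff)
    have "?v \<in> u'" using v(1) shift[of ?v] unfolding eq by blast
    then show "x \<in> (\<Union>v\<in>u'. A v)" using A[of ?v] v(2) unfolding eq by blast
  qed
  have "cauchy_solution \<Omega> a b g u'"
    unfolding cauchy_solution_def
  proof (intro conjI)
    show u': "u' \<in> colombeau XX" unfolding u'_def colombeau_def using n by (rule quotientI)
    show "colombeau_lift XX (evolution_op a b) u' = colombeau_class XX (\<lambda>\<epsilon> z. 0)"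
      unfolding lift[symmetric] colombeau_lift_def
    proof (rule UN, rule colombeau_class_cong[OF open_XX])
      fix v \<epsilon> z assume v: "v \<in> u'" and \<epsilon>: "\<epsilon> \<in> {0<..1::real}" and z: "z \<in> XX"
      have "smooth_on XX (v \<epsilon>)" "smooth_on XX (w \<epsilon>)"
        using colombeau_memD(1)[OF open_XX u' v v] w(1) \<epsilon> by (auto simp: moderate_nets_def)
      note d = this[THEN smooth_on_has_derivative, OF z]
      show "evolution_op a b (v \<epsilon>) z = evolution_op a b (\<lambda>z. v \<epsilon> z - w \<epsilon> z) z"
        using w(2)[OF \<epsilon> z] evolution_op_eq[OF z d(1)] evolution_op_eq[OF z d(2)]
          evolution_op_eq[OF z has_derivative_diff[OF d]] by (simp add: algebra_simps)
    qed
    show "time_slice \<Omega> 0 u' = g"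
      unfolding slice[symmetric] time_slice_def colombeau_lift_def
    proof (rule UN)
      fix v
      have "(\<lambda>\<epsilon> x. v \<epsilon> (x, 0)) = (\<lambda>\<epsilon> x. (v \<epsilon> (x, 0) - w \<epsilon> (x, 0)) + w \<epsilon> (x, 0))" by simp
      then show "colombeau_class \<Omega> (\<lambda>\<epsilon> x. v \<epsilon> (x, 0)) = colombeau_class \<Omega> (\<lambda>\<epsilon> x. v \<epsilon> (x, 0) - w \<epsilon> (x, 0))"
        unfolding colombeau_class_def
        using colombeau_rel_add_negligible[OF \<Omega> w(3), of "\<lambda>\<epsilon> x. v \<epsilon> (x, 0) - w \<epsilon> (x, 0)"] by auto
    qed
  qed
  then have "u' = u" by (rule uniq)
  moreover have "n \<in> u'" "u0 \<in> u"
    using n u0 negligible_zero[OF open_XX] by (auto simp: u'_def colombeau_rel_def)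
  ultimately have "(\<lambda>\<epsilon> x. n \<epsilon> x - u0 \<epsilon> x) \<in> negligible_nets XX" using colombeau_memD(2)[OF open_XX u] by blast
  then show ?thesis by (simp add: n_def)
qed

text \<open>If a characteristic entered \<open>\<Omega>\<close> from a point \<open>y\<close> outside, a Gaussian of width \<open>\<surd>\<epsilon>\<close> centred
  at \<open>y\<close>, transported along the characteristics, would be a nontrivial solution with negligible initial data.\<close>

lemma F_mem:
  assumes uniq: "\<And>v. cauchy_solution \<Omega> a b g v \<Longrightarrow> v = u" and sol: "cauchy_solution \<Omega> a b g u"
    and z1: "z1 \<in> XX"
  shows "F z1 \<in> \<Omega>"
proof (rule ccontr)
  define y where "y = F z1"
  assume "F z1 \<notin> \<Omega>"
  then have y: "y \<notin> \<Omega>" by (simp add: y_def)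
  define h where "h z = exp (- \<i> * \<beta> (F z, snd z))" for z
  define q where "q z = (F z - y) \<bullet> (F z - y)" for z
  define w where "w \<epsilon> z = h z * exp (- complex_of_real (inverse \<epsilon>) * complex_of_real (q z))" for \<epsilon> z
  have h: "smooth_on UNIV h" unfolding h_def[abs_def]
    by (rule smooth_on_compose[OF open_UNIV open_UNIV smooth_exp_\<beta>])
      (intro smooth_on_Pair smooth_F smooth_on_snd open_UNIV UNIV_I)+
  have q: "smooth_on UNIV q" unfolding q_def[abs_def]
    by (intro smooth_on_inner smooth_on_diff smooth_F smooth_on_const open_UNIV)
  have q0: "q z \<ge> 0" for z by (simp add: q_def)
  have sw: "smooth_on UNIV (w \<epsilon>)" for \<epsilon> unfolding w_def[abs_def]
    by (intro smooth_on_mult smooth_on_cexp smooth_on_const smooth_on_minus smooth_on_of_real h q open_UNIV)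
  have "w \<in> negligible_nets XX"
  proof (rule negligible_of_null_solution[OF uniq sol])
    show "w \<in> moderate_nets XX" unfolding w_def[abs_def]
      by (rule moderate_gaussian[OF open_XX smooth_on_subset[OF h] smooth_on_subset[OF q] q0]) auto
    show "evolution_op a b (w \<epsilon>) z = 0" if "z \<in> XX" for \<epsilon> z
    proof -
      define x where "x = F z"
      have Gz: "G (x, snd z) = z" unfolding x_def by (rule G_F)
      note D = smooth_on_has_derivative[OF sw UNIV_I, of \<epsilon> z]
      \<comment> \<open>In characteristic coordinates the right side does not contain
        \<open>t\<close>, so \<open>w\<close> solves the equation exactly for each
        \<epsilon>.\<close>
      have "exp (\<i> * \<beta> (x, t)) * w \<epsilon> (G (x, t)) = exp (- complex_of_real (inverse \<epsilon>) * complex_of_real ((x - y) \<bullet> (x - y)))" for t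
        by (simp add: w_def h_def q_def mult.assoc[symmetric] exp_add[symmetric])
      then have "((\<lambda>t. exp (\<i> * \<beta> (x, t)) * w \<epsilon> (G (x, t))) has_vector_derivative 0) (at (snd z))" by simp
      with along_characteristic[of "w \<epsilon>" _ x "snd z", unfolded Gz, OF D]
      have "exp (\<i> * \<beta> (x, snd z)) * (frechet_derivative (w \<epsilon>) (at z) (V z) + \<i> * bb z * w \<epsilon> z) = 0"
        by (rule vector_derivative_unique_at)
      then show ?thesis using evolution_op_eq[OF that D] by simp
    qed
    show "(\<lambda>\<epsilon> x. w \<epsilon> (x, 0)) \<in> negligible_nets \<Omega>"
      unfolding negligible_nets_def mem_Collect_eq
    proof (intro conjI allI impI)
      have eq: "w \<epsilon> (x, 0) = 1 * exp (- complex_of_real (inverse \<epsilon>) * complex_of_real ((x - y) \<bullet> (x - y)))" for \<epsilon> x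
        by (simp add: w_def h_def q_def)
      show "(\<lambda>\<epsilon> x. w \<epsilon> (x, 0)) \<in> moderate_nets \<Omega>" unfolding eq
        by (rule moderate_gaussian[OF \<Omega>]) (auto intro!: smooth_on_const smooth_on_inner smooth_on_diff smooth_on_ident \<Omega>)
      fix K' :: "(real^'n) set" and r :: real assume K': "compact K' \<and> K' \<subseteq> \<Omega>"
      then obtain d where d: "d > 0" "\<And>x. x \<in> K' \<Longrightarrow> d \<le> dist y x"
        using separate_point_closed[of K' y] y compact_imp_closed by blast
      have "\<forall>\<^sub>F \<epsilon> in at_right 0. exp (- (inverse \<epsilon> * d\<^sup>2)) \<le> inverse ((d\<^sup>2) ^ nat \<lceil>r\<rceil>) * \<epsilon> powr r"
        using d(1) by (intro exp_inverse_negligible) simp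
      then have "\<forall>\<^sub>F \<epsilon> in at_right 0. \<forall>x\<in>K'. cmod (w \<epsilon> (x, 0)) \<le> inverse ((d\<^sup>2) ^ nat \<lceil>r\<rceil>) * \<epsilon> powr r"
        using eventually_unit_interval
      proof eventually_elim
        case (elim \<epsilon>)
        show ?case
        proof
          fix x assume "x \<in> K'"
          then have "d \<le> norm (x - y)" using d(2) by (simp add: dist_norm norm_minus_commute)
          then have "d\<^sup>2 \<le> (x - y) \<bullet> (x - y)" using d(1) by (simp add: dot_square_norm power_mono)
          then have "exp (- (inverse \<epsilon> * ((x - y) \<bullet> (x - y)))) \<le> exp (- (inverse \<epsilon> * d\<^sup>2))"
            using elim by (simp add: mult_left_mono)
          moreover have "cmod (w \<epsilon> (x, 0)) = exp (- (inverse \<epsilon> * ((x - y) \<bullet> (x - y))))"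
            unfolding eq by (simp add: norm_exp_eq_Re flip: of_real_inverse)
          ultimately show "cmod (w \<epsilon> (x, 0)) \<le> inverse ((d\<^sup>2) ^ nat \<lceil>r\<rceil>) * \<epsilon> powr r" using elim by linarith
        qed
      qed
      then show "sup_bigo K' (\<lambda>\<epsilon> x. cmod (w \<epsilon> (x, 0))) r" unfolding sup_bigo_def by blast
    qed
  qed
  \<comment> \<open>The quadratic function \<open>q\<close> vanishes at \<open>z1\<close>, so |w|
    equals the positive number |h z1| there for every \<epsilon>, against a bound of order
    \<epsilon>.\<close>
  then have "sup_bigo {z1} (\<lambda>\<epsilon> z. cmod (w \<epsilon> z)) 1" using z1 by (simp add: negligible_nets_def)
  then obtain C where C: "C \<ge> 0" "\<forall>\<^sub>F \<epsilon> in at_right 0. \<epsilon> \<in> {0<..1} \<and> (\<forall>x\<in>{z1}. cmod (w \<epsilon> x) \<le> C * \<epsilon> powr 1)"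
    by (rule sup_bigoE)
  have "((\<lambda>\<epsilon>. C * \<epsilon>) \<longlongrightarrow> C * 0) (at_right (0::real))" by (intro tendsto_intros)
  then have "\<forall>\<^sub>F \<epsilon> in at_right 0. C * \<epsilon> < cmod (h z1)"
    by (rule order_tendstoD(2)) (simp add: h_def)
  with C(2) have "\<forall>\<^sub>F \<epsilon> in at_right (0::real). False"
  proof eventually_elim
    case (elim \<epsilon>)
    have "w \<epsilon> z1 = h z1" by (simp add: w_def q_def y_def)
    moreover have "\<epsilon> > 0" "cmod (w \<epsilon> z1) \<le> C * \<epsilon> powr 1" "C * \<epsilon> < cmod (h z1)" using elim by auto
    ultimately show ?case by (simp add: powr_one)
  qed
  then show False by simp
qed

text \<open>Suppose a characteristic from \<open>y\<close> leaves \<Omega>, and let \<open>p\<close>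
  be its first point outside. Near \<open>p\<close> it runs off \<open>K\<close>, where the field is
  the constant \<open>c\<close> at all times, so it is a straight line there. Shifted in time so
  that it passes \<open>p\<close> at time 0, the line is still a characteristic, and it joins a
  point over \<Omega> to the foot \<open>p\<close> outside \<Omega>, contrary to
  \<open>inv\<close>.\<close>

lemma G_mem:
  assumes inv: "\<And>z. z \<in> XX \<Longrightarrow> F z \<in> \<Omega>" and y: "y \<in> \<Omega>"
  shows "G (y, t) \<in> XX"
proof (rule ccontr)
  assume not: "G (y, t) \<notin> XX"
  define \<phi> where "\<phi> r = fst (G (y, r * t))" for r
  have G_eq: "G (y, r * t) = (\<phi> r, r * t)" for r by (simp add: \<phi>_def prod_eq_iff)
  have c\<phi>: "continuous_on UNIV \<phi>" unfolding \<phi>_def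
    by (intro continuous_on_fst continuous_on_compose2[OF continuous_G[of UNIV]] continuous_intros) auto
  have "compact ({0..1} \<inter> \<phi> -` (- \<Omega>))"
    using \<Omega> by (intro compact_Int_closed compact_Icc continuous_closed_vimage) (use c\<phi> in \<open>auto simp: continuous_on_eq_continuous_at\<close>)
  moreover have "1 \<in> {0..1} \<inter> \<phi> -` (- \<Omega>)" using not G_eq[of 1] by simp
  ultimately obtain r0 where "r0 \<in> {0..1} \<inter> \<phi> -` (- \<Omega>)" "\<forall>r\<in>{0..1} \<inter> \<phi> -` (- \<Omega>). r0 \<le> r"
    using compact_attains_inf[of "{0..1} \<inter> \<phi> -` (- \<Omega>)"] by blast
  then have r0: "r0 \<in> {0..1}" "\<phi> r0 \<notin> \<Omega>" "\<And>r. r \<in> {0..1} \<Longrightarrow> \<phi> r \<notin> \<Omega> \<Longrightarrow> r0 \<le> r" by auto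
  have "\<phi> 0 = y" by (simp add: \<phi>_def)
  then have "r0 \<noteq> 0" using r0(2) y by auto
  then have pos: "r0 > 0" using r0(1) by auto
  define p where "p = \<phi> r0"
  have p: "p \<notin> \<Omega>" using r0(2) by (simp add: p_def)
  have "open (\<phi> -` (- K))" using compact_imp_closed[OF K] c\<phi>
    by (intro open_vimage) auto
  moreover have "r0 \<in> \<phi> -` (- K)" using p K\<Omega> by (auto simp: p_def)
  ultimately obtain \<delta> where \<delta>: "\<delta> > 0" "\<And>r. dist r r0 < \<delta> \<Longrightarrow> \<phi> r \<notin> K"
    unfolding open_dist by (metis vimageD ComplD)
  define r1 where "r1 = r0 - min (\<delta> / 2) r0"
  have r1: "r1 < r0" "r1 \<in> {0..1}" using pos \<delta>(1) r0(1) by (auto simp: r1_def)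
  have offK: "\<phi> r \<notin> K" if "r \<in> {r1..r0}" for r
    using \<delta>(1) that by (intro \<delta>(2)) (auto simp: r1_def dist_real_def)
  have d\<phi>: "(\<phi> has_vector_derivative t *\<^sub>R av (G (y, r * t))) (at r)" for r
  proof -
    have "((\<lambda>r. r * t) has_vector_derivative t) (at r)" by (auto intro!: derivative_eq_intros)
    from vector_diff_chain_at[OF this G_has_vector_derivative]
    have "((\<lambda>r. G (y, r * t)) has_vector_derivative t *\<^sub>R V (G (y, r * t))) (at r)" by (simp add: comp_def)
    from bounded_linear.has_vector_derivative[OF bounded_linear_fst this]
    show ?thesis by (simp add: \<phi>_def[abs_def] V_def)
  qed
  have line: "\<phi> r = p + ((r - r0) * t) *\<^sub>R c" if r: "r \<in> {r1..r0}" for r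
  proof -
    have "\<phi> r - p - ((r - r0) * t) *\<^sub>R c = 0"
    proof (rule gronwall_zero[where ?s0.0 = r0 and ?s1.0 = r and L = 0 and d = "\<lambda>r. \<phi> r - p - ((r - r0) * t) *\<^sub>R c" and d' = "\<lambda>s. t *\<^sub>R av (G (y, s * t)) - 0 - t *\<^sub>R c"])
      fix s assume "s \<in> closed_segment r0 r"
      then have "s \<in> {r1..r0}" using r by (auto simp: closed_segment_eq_real_ivl split: if_splits)
      then show "norm (t *\<^sub>R av (G (y, s * t)) - 0 - t *\<^sub>R c) \<le> 0 * norm (\<phi> s - p - ((s - r0) * t) *\<^sub>R c)"
        using av_const[OF offK] by (simp add: G_eq)
      show "((\<lambda>s. \<phi> s - p - ((s - r0) * t) *\<^sub>R c) has_vector_derivative t *\<^sub>R av (G (y, s * t)) - 0 - t *\<^sub>R c) (at s)"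
      proof -
        have "((\<lambda>s. (s - r0) * t) has_vector_derivative t) (at s)" by (auto intro!: derivative_eq_intros)
        from bounded_linear.has_vector_derivative[OF bounded_linear_scaleR_left this]
        show ?thesis by (intro has_vector_derivative_diff d\<phi> has_vector_derivative_const)
      qed
    qed (simp add: p_def)
    then show ?thesis by (simp add: algebra_simps)
  qed
  \<comment> \<open>The time of the point \<open>\<phi> r1\<close> after the shift that moves the
    exit to time 0; \<gamma> is the shifted line.\<close>
  define \<tau> where "\<tau> = (r1 - r0) * t"
  define \<gamma> where "\<gamma> s = (p + s *\<^sub>R c, s)" for s
  have "\<gamma> 0 = \<Psi> (0 - \<tau>, \<gamma> \<tau>)"
  proof (rule \<Psi>_unique)
    fix s assume "s \<in> closed_segment \<tau> 0"
    then obtain \<sigma> where \<sigma>: "0 \<le> \<sigma>" "\<sigma> \<le> 1" "s = (1 - \<sigma>) * \<tau>" by (auto simp: in_segment)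
    define r where "r = r0 + (1 - \<sigma>) * (r1 - r0)"
    have "(1 - \<sigma>) * (r1 - r0) \<le> 0" "(1 - \<sigma>) * (r1 - r0) \<ge> r1 - r0"
      using \<sigma> r1(1) mult_right_mono_neg[of "1 - \<sigma>" 1 "r1 - r0"] by (simp_all add: mult_nonneg_nonpos)
    then have r: "r \<in> {r1..r0}" by (simp add: r_def)
    have "p + s *\<^sub>R c = \<phi> r" using line[OF r] \<sigma>(3) by (simp add: r_def \<tau>_def mult.assoc)
    then have "V (\<gamma> s) = (c, 1)" using av_const[OF offK[OF r]] by (simp add: V_def \<gamma>_def)
    moreover have "(\<gamma> has_vector_derivative (c, 1)) (at s)" unfolding \<gamma>_def[abs_def] has_vector_derivative_def
      by (auto intro!: derivative_eq_intros simp: fun_eq_iff)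
    ultimately show "(\<gamma> has_vector_derivative V (\<gamma> s)) (at s)" by simp
  qed
  moreover have g\<tau>: "\<gamma> \<tau> = (\<phi> r1, \<tau>)" using line[of r1] r1(1) by (simp add: \<gamma>_def \<tau>_def)
  ultimately have "fst (\<gamma> 0) = fst (\<Psi> (0 - \<tau>, (\<phi> r1, \<tau>)))" by (simp only:)
  then have "F (\<phi> r1, \<tau>) = p" by (simp add: F_def \<gamma>_def)
  moreover have "\<phi> r1 \<in> \<Omega>" using r0(3)[OF r1(2)] r1(1) by force
  ultimately show False using inv[of "(\<phi> r1, \<tau>)"] p by simp
qed

end

section \<open>The bicharacteristic curves\<close>

context characteristic_field
begin

text \<open>The transpose of \<open>DF z\<close> applied to \<xi>, written out in the basis;
  \<open>covector_inner\<close> states its defining property.\<close>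

definition covector :: "'a \<Rightarrow> 'a \<times> real \<Rightarrow> 'a \<times> real" where
  "covector \<xi> z = (\<Sum>b\<in>Basis. (DF z b \<bullet> \<xi>) *\<^sub>R b)"

lemma covector_inner: "covector \<xi> z \<bullet> k = DF z k \<bullet> \<xi>"
proof -
  have lin: "linear (DF z)" using DF by (rule has_derivative_linear)
  have "DF z k = (\<Sum>b\<in>Basis. (k \<bullet> b) *\<^sub>R DF z b)"
    using linear_sum[OF lin, of "\<lambda>b. (k \<bullet> b) *\<^sub>R b" Basis] by (simp add: euclidean_representation linear_cmul[OF lin])
  then show ?thesis
    by (simp add: covector_def inner_sum_left inner_commute[of k] mult.commute)
qed

lemma covector_nonzero: "\<xi> \<noteq> 0 \<Longrightarrow> covector \<xi> z \<noteq> 0"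
  using DF_adjoint_inj[of z \<xi>] covector_inner[of \<xi> z] by auto

lemma covector_V: "V z \<bullet> covector \<xi> z = 0"
  using covector_inner[of \<xi> z "V z"] by (simp add: DF_V inner_commute)

lemma smooth_covector: "smooth_on UNIV (covector \<xi>)"
proof -
  have "covector \<xi> = (\<lambda>z. \<Sum>b\<in>Basis. (partial_deriv b F z \<bullet> \<xi>) *\<^sub>R b)"
    by (simp add: covector_def partial_deriv_def fun_eq_iff)
  then show ?thesis
    by (simp only:) (intro smooth_on_sum smooth_on_scaleR smooth_on_inner smooth_on_partial_deriv smooth_F
        smooth_on_const open_UNIV finite_Basis; assumption)
qed

text \<open>At time 0 the derivative of \<open>F\<close> is the identity on spatial vectors and
  annihilates \<open>V = (av, 1)\<close>, which determines it on all vectors.\<close>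

lemma covector_initial: "covector \<xi> (x, 0) = (\<xi>, - (av (x, 0) \<bullet> \<xi>))"
proof -
  have lin: "linear (DF (x, 0))" using DF by (rule has_derivative_linear)
  have "((\<lambda>x. F (x, 0)) has_derivative (\<lambda>k. DF (x, 0) (k, 0))) (at x)"
    by (rule has_derivative_compose[OF _ DF]) (auto intro!: derivative_eq_intros)
  moreover have "((\<lambda>x. F (x, 0)) has_derivative (\<lambda>k. k)) (at x)" by simp
  ultimately have 1: "(\<lambda>k. DF (x, 0) (k, 0)) = (\<lambda>k. k)" by (rule has_derivative_unique)
  have "DF (x, 0) (k, \<kappa>) = k - \<kappa> *\<^sub>R av (x, 0)" for k \<kappa>
  proof -
    have "(k, \<kappa>) = (k - \<kappa> *\<^sub>R av (x, 0), 0) + \<kappa> *\<^sub>R V (x, 0)" by (simp add: V_def)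
    then have "DF (x, 0) (k, \<kappa>) = DF (x, 0) (k - \<kappa> *\<^sub>R av (x, 0), 0) + \<kappa> *\<^sub>R DF (x, 0) (V (x, 0))"
      by (simp only: linear_add[OF lin] linear_cmul[OF lin])
    then show ?thesis using fun_cong[OF 1] by (simp add: DF_V)
  qed
  then have "covector \<xi> (x, 0) \<bullet> p = (\<xi>, - (av (x, 0) \<bullet> \<xi>)) \<bullet> p" for p
    by (simp only: covector_inner, cases p) (simp add: inner_diff_left inner_diff_right inner_commute)
  then have "\<forall>p. covector \<xi> (x, 0) \<bullet> p = (\<xi>, - (av (x, 0) \<bullet> \<xi>)) \<bullet> p" by (rule allI)
  then show ?thesis unfolding vector_eq_rdot .
qed

text \<open>The Hamilton field of (z, \<zeta>) \<mapsto> V z . \<zeta>. In contrast to the field of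
  \<open>char_function a\<close> it is smooth on the whole space, so \<open>ode_unique\<close>
  applies to it.\<close>

definition hamilton_lift :: "('a \<times> real) \<times> ('a \<times> real) \<Rightarrow> ('a \<times> real) \<times> ('a \<times> real)" where
  "hamilton_lift w = (V (fst w), - (\<Sum>b\<in>Basis. (partial_deriv b V (fst w) \<bullet> snd w) *\<^sub>R b))"

lemma smooth_hamilton_lift: "smooth_on UNIV hamilton_lift"
proof -
  have "smooth_on UNIV (\<lambda>w :: ('a \<times> real) \<times> ('a \<times> real). f (fst w))" if "smooth_on UNIV f"
    for f :: "'a \<times> real \<Rightarrow> 'a \<times> real"
    by (rule smooth_on_compose[OF open_UNIV open_UNIV that smooth_on_fst[OF open_UNIV] UNIV_I])
  note c = this[OF smooth_V] this[OF smooth_on_partial_deriv[OF open_UNIV smooth_V]]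
  show ?thesis unfolding hamilton_lift_def[abs_def]
    by (intro smooth_on_Pair c smooth_on_minus smooth_on_sum smooth_on_scaleR smooth_on_inner
        smooth_on_snd smooth_on_const open_UNIV finite_Basis; assumption)
qed

text \<open>As \<open>F\<close> is invariant under the flow, \<open>covector \<xi> (\<Psi> (r, z))\<close> paired with the linearized flow is
  constant in \<open>r\<close>; differentiating at \<open>r = 0\<close> gives the equation for the covector.\<close>

lemma covector_has_vector_derivative_0:
  "((\<lambda>r. covector \<xi> (\<Psi> (r, z))) has_vector_derivative snd (hamilton_lift (z, covector \<xi> z))) (at 0)"
proof -
  let ?D = "frechet_derivative (covector \<xi>) (at z) (V z)"
  note d\<Psi> = \<Psi>_has_vector_derivative[of z 0, simplified]
  have "(covector \<xi> has_derivative frechet_derivative (covector \<xi>) (at z)) (at (\<Psi> (0, z)))"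
    using smooth_on_has_derivative[OF smooth_covector UNIV_I] by simp
  from vector_derivative_diff_chain_within[OF d\<Psi> has_derivative_at_withinI[OF this]]
  have D: "((\<lambda>r. covector \<xi> (\<Psi> (r, z))) has_vector_derivative ?D) (at 0)" by (simp add: comp_def)
  have comp: "?D \<bullet> b = - (partial_deriv b V z \<bullet> covector \<xi> z)" for b
  proof -
    let ?J = "\<lambda>r. partial_deriv (0, b) \<Psi> (r, z)"
    have chain: "((\<lambda>z. \<Psi> (r, z)) has_derivative (\<lambda>k. frechet_derivative \<Psi> (at (r, z)) (0, k))) (at z)" for r
      by (rule has_derivative_compose[OF _ smooth_on_has_derivative[OF smooth_\<Psi> UNIV_I]])
        (auto intro!: derivative_eq_intros)
    have J0: "?J 0 = b"
    proof -
      have "((\<lambda>z. \<Psi> (0, z)) has_derivative (\<lambda>k. k)) (at z)" by simp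
      from fun_cong[OF has_derivative_unique[OF chain this], of b] show ?thesis by (simp only: partial_deriv_def)
    qed
    have "covector \<xi> (\<Psi> (r, z)) \<bullet> ?J r = DF z b \<bullet> \<xi>" for r
    proof -
      have "((\<lambda>z. F (\<Psi> (r, z))) has_derivative (\<lambda>k. DF (\<Psi> (r, z)) (frechet_derivative \<Psi> (at (r, z)) (0, k)))) (at z)"
        by (rule has_derivative_compose[OF chain DF])
      moreover have "((\<lambda>z. F (\<Psi> (r, z))) has_derivative DF z) (at z)" using DF by (simp add: F_\<Psi>)
      ultimately have "(\<lambda>k. DF (\<Psi> (r, z)) (frechet_derivative \<Psi> (at (r, z)) (0, k))) = DF z"
        by (rule has_derivative_unique)
      from fun_cong[OF this, of b] show ?thesis by (simp only: covector_inner partial_deriv_def)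
    qed
    then have "((\<lambda>r. covector \<xi> (\<Psi> (r, z)) \<bullet> ?J r) has_vector_derivative 0) (at 0)" by simp
    moreover have "((\<lambda>r. covector \<xi> (\<Psi> (r, z)) \<bullet> ?J r) has_vector_derivative
        covector \<xi> (\<Psi> (0, z)) \<bullet> partial_deriv (?J 0) V (\<Psi> (0, z)) + ?D \<bullet> ?J 0) (at 0)"
      by (rule bounded_bilinear.has_vector_derivative[OF bounded_bilinear_inner D variational_equation])
    ultimately have "0 = covector \<xi> (\<Psi> (0, z)) \<bullet> partial_deriv (?J 0) V (\<Psi> (0, z)) + ?D \<bullet> ?J 0"
      by (rule vector_derivative_unique_at)
    then have "?D \<bullet> b = - (covector \<xi> z \<bullet> partial_deriv b V z)" unfolding J0 \<Psi>_0 by linarith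
    then show ?thesis by (simp only: inner_commute)
  qed
  have "?D = (\<Sum>b\<in>Basis. (?D \<bullet> b) *\<^sub>R b)" by (simp add: euclidean_representation)
  also have "\<dots> = snd (hamilton_lift (z, covector \<xi> z))"
    unfolding comp by (simp add: hamilton_lift_def sum_negf)
  finally show ?thesis using D by simp
qed

text \<open>The derivative at time 0 moves to time \<open>s\<close> by the flow property
  \<open>\<Psi>_G\<close>.\<close>

lemma lifted_curve:
  "((\<lambda>s. (G (x, s), covector \<xi> (G (x, s)))) has_vector_derivative
    hamilton_lift (G (x, s), covector \<xi> (G (x, s)))) (at s)"
proof -
  let ?z = "G (x, s)"
  have "((\<lambda>r. r - s) has_vector_derivative 1) (at s)" by (auto intro!: derivative_eq_intros)
  moreover have "((\<lambda>r. covector \<xi> (\<Psi> (r, ?z))) has_vector_derivative snd (hamilton_lift (?z, covector \<xi> ?z))) (at (s - s))"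
    using covector_has_vector_derivative_0 by simp
  ultimately have "((\<lambda>r. covector \<xi> (\<Psi> (r, ?z))) \<circ> (\<lambda>r. r - s) has_vector_derivative
      1 *\<^sub>R snd (hamilton_lift (?z, covector \<xi> ?z))) (at s)"
    by (rule vector_diff_chain_at)
  then have "((\<lambda>r. covector \<xi> (\<Psi> (r - s, ?z))) has_vector_derivative snd (hamilton_lift (?z, covector \<xi> ?z))) (at s)"
    by (simp only: comp_def scaleR_one)
  then have "((\<lambda>r. covector \<xi> (G (x, r))) has_vector_derivative snd (hamilton_lift (?z, covector \<xi> ?z))) (at s)"
    by (simp add: \<Psi>_G)
  from has_vector_derivative_Pair[OF G_has_vector_derivative this]
  show ?thesis by (simp add: hamilton_lift_def)
qed

end

context cauchy
begin

lemma Re_principal_symbol: "x \<in> \<Omega> \<Longrightarrow> Re (principal_symbol a t x \<xi>) = av (x, t) \<bullet> \<xi>"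
  by (simp add: principal_symbol_def a_eq inner_vec_def)

lemma char_function_eq: "z \<in> XX \<Longrightarrow> char_function a (z, \<zeta>) = V z \<bullet> \<zeta>"
  by (cases z; cases \<zeta>) (simp add: char_function_def Re_principal_symbol V_def)

lemma hamilton_field_eq:
  assumes z: "z \<in> XX" shows "hamilton_field (char_function a) (z, \<zeta>) = hamilton_lift (z, \<zeta>)"
proof -
  have dV: "(V has_derivative frechet_derivative V (at z)) (at z)"
    by (rule smooth_on_has_derivative[OF smooth_V UNIV_I])
  have "((\<lambda>w. V (fst w) \<bullet> snd w) has_derivative
      (\<lambda>k. V z \<bullet> snd k + frechet_derivative V (at z) (fst k) \<bullet> \<zeta>)) (at (z, \<zeta>))"
  proof -
    have "((\<lambda>w. V (fst w)) has_derivative (\<lambda>k. frechet_derivative V (at z) (fst k))) (at (z, \<zeta>))"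
      by (rule has_derivative_compose[OF has_derivative_fst[OF has_derivative_ident]]) (simp add: dV)
    from has_derivative_inner[OF this has_derivative_snd[OF has_derivative_ident]] show ?thesis by simp
  qed
  moreover have "open (XX \<times> (UNIV :: ((real^'n) \<times> real) set))" by (intro open_Times open_XX open_UNIV)
  moreover have "(z, \<zeta>) \<in> XX \<times> UNIV" using z by simp
  moreover have "V (fst w) \<bullet> snd w = char_function a w" if "w \<in> XX \<times> UNIV" for w
    using char_function_eq[of "fst w" "snd w"] that by auto
  ultimately have "(char_function a has_derivative
      (\<lambda>k. V z \<bullet> snd k + frechet_derivative V (at z) (fst k) \<bullet> \<zeta>)) (at (z, \<zeta>))"
    by (rule has_derivative_transform_within_open)
  note p = partial_deriv_eq[OF this]
  have 0: "frechet_derivative V (at z) 0 = 0" using has_derivative_linear[OF dV] by (rule linear_0)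
  show ?thesis
    unfolding hamilton_field_def p hamilton_lift_def
    by (simp add: 0 partial_deriv_def euclidean_representation)
qed

text \<open>The lifted curve exists for all times and stays over \<Omega>, so it is maximal. Any
  other maximal curve through the same point agrees with a time shift of it by uniqueness for
  \<open>hamilton_lift\<close>, and has the same image.\<close>

lemma bichar_curve_eq:
  assumes inv: "\<And>y t. y \<in> \<Omega> \<Longrightarrow> G (y, t) \<in> XX" and x: "x \<in> \<Omega>" and \<xi>: "\<xi> \<noteq> 0"
  shows "bichar_curve \<Omega> a x \<xi> = range (\<lambda>s. (G (x, s), covector \<xi> (G (x, s))))"
proof -
  define \<gamma> where "\<gamma> s = (G (x, s), covector \<xi> (G (x, s)))" for s
  have d: "((\<lambda>s. \<gamma> (s - r)) has_vector_derivative hamilton_lift (\<gamma> (s - r))) (at s)" for s r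
  proof -
    have "((\<lambda>s. s - r) has_vector_derivative 1) (at s)" by (auto intro!: derivative_eq_intros)
    from vector_diff_chain_at[OF this lifted_curve[of x \<xi> "s - r"]]
    show ?thesis by (simp add: \<gamma>_def[abs_def] comp_def)
  qed
  have bi: "bicharacteristic XX (char_function a) UNIV (\<lambda>s. \<gamma> (s - r))" for r
    unfolding bicharacteristic_def
  proof (intro conjI ballI)
    fix s
    have m: "G (x, s - r) \<in> XX" by (rule inv[OF x])
    show "\<gamma> (s - r) \<in> cotangent_minus_zero XX"
      using m covector_nonzero[OF \<xi>] by (simp add: \<gamma>_def cotangent_minus_zero_def)
    show "char_function a (\<gamma> (s - r)) = 0" by (simp add: \<gamma>_def char_function_eq[OF m] covector_V)
    show "((\<lambda>s. \<gamma> (s - r)) has_vector_derivative hamilton_field (char_function a) (\<gamma> (s - r))) (at s)"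
      using d[of r s] by (simp add: \<gamma>_def hamilton_field_eq[OF m])
  qed auto
  have \<gamma>0: "\<gamma> 0 = ((x, 0), (\<xi>, - Re (principal_symbol a 0 x \<xi>)))"
    by (simp add: \<gamma>_def covector_initial Re_principal_symbol[OF x])
  have "bicharacteristic_through XX (char_function a) (\<gamma> 0) = range \<gamma>"
    unfolding bicharacteristic_through_def
  proof (rule the_equality)
    have "maximal_bicharacteristic XX (char_function a) UNIV \<gamma>"
      using bi[of 0] by (auto simp: maximal_bicharacteristic_def)
    then show "\<gamma> 0 \<in> range \<gamma> \<and> (\<exists>I c. maximal_bicharacteristic XX (char_function a) I c \<and> range \<gamma> = c ` I)" by blast
  next
    fix C assume "\<gamma> 0 \<in> C \<and> (\<exists>I c. maximal_bicharacteristic XX (char_function a) I c \<and> C = c ` I)"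
    then obtain I e where C: "\<gamma> 0 \<in> C" "C = e ` I" and max: "maximal_bicharacteristic XX (char_function a) I e"
      by blast
    obtain r where r: "r \<in> I" "e r = \<gamma> 0" using C by force
    have b: "bicharacteristic XX (char_function a) I e" using max by (simp add: maximal_bicharacteristic_def)
    have eq: "e s = \<gamma> (s - r)" if s: "s \<in> I" for s
    proof (rule ode_unique[OF smooth_hamilton_lift, of r s e "\<lambda>s. \<gamma> (s - r)"])
      fix q assume "q \<in> closed_segment r s"
      moreover have "closed_segment r s \<subseteq> I"
        using b r(1) s by (intro closed_segment_subset) (auto simp: bicharacteristic_def is_interval_convex)
      ultimately have q: "q \<in> I" by blast
      then have "e q \<in> cotangent_minus_zero XX"
        and e: "(e has_vector_derivative hamilton_field (char_function a) (e q)) (at q)"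
        using b by (auto simp: bicharacteristic_def)
      then have "fst (e q) \<in> XX" by (auto simp: cotangent_minus_zero_def)
      from hamilton_field_eq[OF this, of "snd (e q)"] e
      show "(e has_vector_derivative hamilton_lift (e q)) (at q)" by simp
    qed (use d r(2) in auto)
    \<comment> \<open>The shifted curve extends \<open>e\<close> to the whole line, so maximality of
      \<open>e\<close> forces its interval to be everything.\<close>
    have "bicharacteristic XX (char_function a) UNIV (\<lambda>s. \<gamma> (s - r)) \<and> I \<subseteq> UNIV \<and> (\<forall>s\<in>I. \<gamma> (s - r) = e s)
        \<longrightarrow> UNIV = I"
      using max unfolding maximal_bicharacteristic_def by (elim conjE allE)
    then have I: "I = UNIV" using bi[of r] eq by simp
    have "e ` I = range (\<lambda>s. \<gamma> (s - r))"
      by (intro image_cong I) (simp add: eq I)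
    also have "\<dots> = range \<gamma>"
    proof (intro equalityI subsetI)
      fix w assume "w \<in> range \<gamma>"
      then obtain s where "w = \<gamma> (s + r - r)" by auto
      then show "w \<in> range (\<lambda>s. \<gamma> (s - r))" by (rule image_eqI) simp
    qed auto
    finally show "C = range \<gamma>" using C(2) by simp
  qed
  then show ?thesis unfolding bichar_curve_def \<gamma>0 by (simp add: \<gamma>_def[abs_def])
qed

end

section \<open>Propagation of regularity\<close>

lemma fourier_net_perturbation:
  fixes f h :: "'a::euclidean_space net"
  assumes f: "\<And>\<epsilon>. \<epsilon> \<in> {0<..1} \<Longrightarrow> continuous_on UNIV (f \<epsilon>)" "\<And>\<epsilon>. \<epsilon> \<in> {0<..1} \<Longrightarrow> continuous_on UNIV (h \<epsilon>)"
    and C: "compact C" "\<And>\<epsilon> x. x \<notin> C \<Longrightarrow> f \<epsilon> x = 0" "\<And>\<epsilon> x. x \<notin> C \<Longrightarrow> h \<epsilon> x = 0"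
    and b: "sup_bigo C (\<lambda>\<epsilon> x. cmod (f \<epsilon> x - h \<epsilon> x)) q"
  shows "sup_bigo UNIV (\<lambda>\<epsilon> \<xi>. cmod (fourier (f \<epsilon>) \<xi> - fourier (h \<epsilon>) \<xi>)) q"
proof -
  obtain M where M: "M \<ge> 0" "\<forall>\<^sub>F \<epsilon> in at_right 0. \<epsilon> \<in> {0<..1} \<and> (\<forall>x\<in>C. cmod (f \<epsilon> x - h \<epsilon> x) \<le> M * \<epsilon> powr q)"
    using b by (rule sup_bigoE)
  have "\<forall>\<^sub>F \<epsilon> in at_right 0. \<forall>\<xi>\<in>UNIV. cmod (fourier (f \<epsilon>) \<xi> - fourier (h \<epsilon>) \<xi>) \<le> (M * measure lborel C) * \<epsilon> powr q"
    using M(2)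
  proof eventually_elim
    case (elim \<epsilon>)
    then have \<epsilon>: "\<epsilon> \<in> {0<..1}" and le: "\<And>x. x \<in> C \<Longrightarrow> cmod (f \<epsilon> x - h \<epsilon> x) \<le> M * \<epsilon> powr q" by auto
    show ?case
    proof
      fix \<xi> :: 'a
      let ?e = "\<lambda>x. exp (- \<i> * complex_of_real (x \<bullet> \<xi>))"
      have ce: "continuous_on UNIV ?e" by (intro continuous_intros)
      note c = continuous_on_mult[OF ce f(1)[OF \<epsilon>]] continuous_on_mult[OF ce f(2)[OF \<epsilon>]]
      have "integrable lborel (\<lambda>x. ?e x * f \<epsilon> x)" "integrable lborel (\<lambda>x. ?e x * h \<epsilon> x)"
        by (rule integrable_compact_support[OF c(1) C(1)], simp add: C(2),
            rule integrable_compact_support[OF c(2) C(1)], simp add: C(3))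
      then have "fourier (f \<epsilon>) \<xi> - fourier (h \<epsilon>) \<xi> = (LINT x|lborel. ?e x * f \<epsilon> x - ?e x * h \<epsilon> x)"
        unfolding fourier_def by (rule Bochner_Integration.integral_diff[symmetric])
      also have "cmod \<dots> \<le> M * \<epsilon> powr q * measure lborel C"
      proof (rule integral_compact_support_bound[OF continuous_on_diff[OF c] C(1)])
        show "cmod (?e x * f \<epsilon> x - ?e x * h \<epsilon> x) \<le> M * \<epsilon> powr q" if "x \<in> C" for x
          using le[OF that] by (simp add: right_diff_distrib[symmetric] norm_mult cmod_exp_minus_ii)
      qed (simp add: C)
      finally show "cmod (fourier (f \<epsilon>) \<xi> - fourier (h \<epsilon>) \<xi>) \<le> (M * measure lborel C) * \<epsilon> powr q"
        by (simp add: mult_ac)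
    qed
  qed
  then show ?thesis unfolding sup_bigo_def by blast
qed

lemma fourier_of_product_at_zero:
  fixes f :: "'a::euclidean_space \<Rightarrow> complex" and \<kappa> :: "'b::euclidean_space \<Rightarrow> complex"
  assumes "integrable lborel f" "integrable lborel \<kappa>"
  shows "fourier (\<lambda>z. f (fst z) * \<kappa> (snd z)) (\<eta>, 0) = (LINT t|lborel. \<kappa> t) * fourier f \<eta>"
proof -
  let ?e = "\<lambda>x. exp (- \<i> * complex_of_real (x \<bullet> \<eta>))"
  have "fourier (\<lambda>z. f (fst z) * \<kappa> (snd z)) (\<eta>, 0) = (LINT z|lborel. f (fst z) * \<kappa> (snd z) * ?e (fst z))"
    unfolding fourier_def by (simp add: inner_prod_def mult.commute)
  also have "\<dots> = (LINT x|lborel. LINT t|lborel. f x * \<kappa> t * ?e (fst (x, t)))"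
    by (rule fubini_product(4)[OF assms]) (simp_all add: cmod_exp_minus_ii continuous_intros)
  also have "\<dots> = (LINT x|lborel. LINT t|lborel. (?e x * f x) * \<kappa> t)"
    by (simp only: fst_conv mult_ac)
  also have "\<dots> = (LINT x|lborel. (?e x * f x) * (LINT t|lborel. \<kappa> t))"
    by (simp only: integral_mult_right_zero)
  also have "\<dots> = fourier f \<eta> * (LINT t|lborel. \<kappa> t)"
    unfolding fourier_def by (simp only: integral_mult_left_zero)
  finally show ?thesis by (simp only: mult.commute)
qed

lemma bump_integral_pos:
  fixes \<kappa> :: "real \<Rightarrow> real"
  assumes c: "continuous_on UNIV \<kappa>" and i: "integrable lborel \<kappa>" and \<kappa>: "\<And>t. \<kappa> t \<ge> 0" "\<kappa> t0 = 1"
  shows "(LINT t|lborel. \<kappa> t) > 0"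
proof -
  obtain d where d: "d > 0" "\<And>t. dist t t0 < d \<Longrightarrow> dist (\<kappa> t) (\<kappa> t0) < 1/2"
    using c[unfolded continuous_on_iff, rule_format, of t0 "1/2"] by auto
  let ?S = "{t0 - d/2..t0 + d/2}"
  have "integrable lborel (\<lambda>t. indicator ?S t * (1/2 :: real))"
    by (intro integrable_mult_left integrable_real_indicator) (auto simp: emeasure_lborel_Icc_eq)
  then have "(LINT t|lborel. indicator ?S t * (1/2)) \<le> (LINT t|lborel. \<kappa> t)"
  proof (rule integral_mono[OF _ i])
    fix t
    show "indicator ?S t * (1/2) \<le> \<kappa> t"
    proof (cases "t \<in> ?S")
      case True
      then have "dist t t0 < d" using d(1) by (auto simp: dist_real_def)
      from d(2)[OF this] have "\<bar>\<kappa> t - 1\<bar> < 1/2" by (simp only: \<kappa>(2) dist_real_def)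
      then have "\<kappa> t > 1/2" by linarith
      then show ?thesis using True by simp
    qed (simp add: \<kappa>)
  qed
  moreover have "(LINT t|lborel. indicator ?S t * (1/2)) = d/2" using d(1) by simp
  ultimately show ?thesis using d(1) by linarith
qed

lemma microlocally_regularE:
  assumes "microlocally_regular X U x0 \<xi>0"
  obtains u \<phi> \<Gamma> and N :: nat where "u \<in> U" "test_function X \<phi>" "\<phi> x0 = 1" "open \<Gamma>" "\<xi>0 \<in> \<Gamma>"
    "\<And>\<eta> t. \<eta> \<in> \<Gamma> \<Longrightarrow> t > 0 \<Longrightarrow> t *\<^sub>R \<eta> \<in> \<Gamma>"
    "\<And>l. sup_bigo \<Gamma> (\<lambda>\<epsilon> \<xi>. japanese_bracket \<xi> ^ l * cmod (fourier (\<lambda>x. \<phi> x * u \<epsilon> x) \<xi>)) (- real N)"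
  using assms unfolding microlocally_regular_def conic_nbhd_def by (elim bexE exE conjE) blast

context cauchy
begin

text \<open>Up to negligible errors \<open>u\<close> is \<open>h\<close> times g pulled back by
  \<open>F\<close>. If \<zeta>0 is the image of some \<eta> under the transpose of
  \<open>DF z0\<close>, that \<eta> is unique, and regularity of \<open>g\<close> there provides the
  cone; the factor \<open>h\<close> goes into the amplitude.\<close>

lemma regular_solution:
  assumes finv: "\<And>z. z \<in> XX \<Longrightarrow> F z \<in> \<Omega>" and inv: "\<And>y t. y \<in> \<Omega> \<Longrightarrow> G (y, t) \<in> XX"
    and sol: "cauchy_solution \<Omega> a b g u" and g: "g \<in> colombeau \<Omega>"
    and z0: "z0 \<in> XX" and \<zeta>0: "\<zeta>0 \<noteq> 0"
    and reg: "\<And>\<eta>. \<eta> \<noteq> 0 \<Longrightarrow> (\<And>k. DF z0 k \<bullet> \<eta> = k \<bullet> \<zeta>0) \<Longrightarrow> microlocally_regular \<Omega> g (F z0) \<eta>"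
  shows "microlocally_regular XX u z0 \<zeta>0"
proof -
  obtain g' \<psi> \<Gamma> and N :: nat where g': "g' \<in> g" and \<psi>: "test_function \<Omega> \<psi>" "\<psi> (F z0) = 1"
    and \<Gamma>: "open \<Gamma>" "\<And>\<eta> t. \<eta> \<in> \<Gamma> \<Longrightarrow> t > 0 \<Longrightarrow> t *\<^sub>R \<eta> \<in> \<Gamma>"
    and N: "\<And>l. sup_bigo \<Gamma> (\<lambda>\<epsilon> \<xi>. japanese_bracket \<xi> ^ l * cmod (fourier (\<lambda>x. \<psi> x * g' \<epsilon> x) \<xi>)) (- real N)"
    and dir: "\<And>\<eta>. (\<And>k. DF z0 k \<bullet> \<eta> = k \<bullet> \<zeta>0) \<Longrightarrow> \<eta> \<in> \<Gamma>"
  proof (cases "\<exists>\<eta>. \<forall>k. DF z0 k \<bullet> \<eta> = k \<bullet> \<zeta>0")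
    case True
    then obtain \<eta> where \<eta>: "\<And>k. DF z0 k \<bullet> \<eta> = k \<bullet> \<zeta>0" by blast
    have "\<eta> \<noteq> 0" using \<eta>[of \<zeta>0] \<zeta>0 by auto
    from reg[OF this \<eta>] obtain g' \<psi> \<Gamma> and N :: nat where *: "g' \<in> g" "test_function \<Omega> \<psi>" "\<psi> (F z0) = 1"
      "open \<Gamma>" "\<eta> \<in> \<Gamma>" "\<And>\<eta> t. \<eta> \<in> \<Gamma> \<Longrightarrow> t > 0 \<Longrightarrow> t *\<^sub>R \<eta> \<in> \<Gamma>"
      "\<And>l. sup_bigo \<Gamma> (\<lambda>\<epsilon> \<xi>. japanese_bracket \<xi> ^ l * cmod (fourier (\<lambda>x. \<psi> x * g' \<epsilon> x) \<xi>)) (- real N)"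
      by (rule microlocally_regularE) (rule that; assumption)
    have "\<eta>' = \<eta>" if "\<And>k. DF z0 k \<bullet> \<eta>' = k \<bullet> \<zeta>0" for \<eta>'
      using DF_adjoint_inj[of z0 "\<eta>' - \<eta>"] that \<eta> by (simp add: inner_diff_right)
    then show ?thesis using that[OF *(1-4) *(6,7)] *(5) by blast
  next
    \<comment> \<open>No \<eta> corresponds to \<open>\<zeta>0\<close>, so \<open>dir\<close> is
      vacuous and the empty cone with any cut-off serves: non-stationary phase alone yields the
      decay.\<close>
    case False
    obtain g' where g': "g' \<in> g" using colombeau_nonempty[OF \<Omega> g] by blast
    obtain r where r: "r > 0" "cball (F z0) r \<subseteq> \<Omega>" using \<Omega> finv[OF z0] open_contains_cball by blast
    obtain \<phi> :: "real^'n \<Rightarrow> real" where \<phi>: "smooth_on UNIV \<phi>" "\<phi> (F z0) = 1" "\<And>x. x \<notin> cball (F z0) r \<Longrightarrow> \<phi> x = 0"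
      using bump_exists[OF r(1), of "F z0"] by metis
    have t: "test_function \<Omega> (\<lambda>x. complex_of_real (\<phi> x))"
      by (rule test_function_bump[OF smooth_on_of_real[OF open_UNIV \<phi>(1)] _ r(2)]) (simp add: \<phi>(3))
    show ?thesis
    proof (rule that[of g' "\<lambda>x. complex_of_real (\<phi> x)" "{}" 0])
      show "\<eta> \<in> {}" if "\<And>k. DF z0 k \<bullet> \<eta> = k \<bullet> \<zeta>0" for \<eta>
        using False that by blast
    qed (use g' t \<phi>(2) in \<open>simp_all add: sup_bigo_def\<close>)
  qed
  have gm: "g' \<in> moderate_nets \<Omega>" by (rule colombeau_memD(1)[OF \<Omega> g g' g'])
  obtain r \<Gamma>' and N' :: nat where r: "r > 0" and \<Gamma>': "conic_nbhd \<zeta>0 \<Gamma>'"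
    and N': "\<And>A l. smooth_on UNIV A \<Longrightarrow> (\<And>z. z \<notin> cball z0 r \<Longrightarrow> A z = 0) \<Longrightarrow>
      sup_bigo \<Gamma>' (\<lambda>\<epsilon> \<zeta>. japanese_bracket \<zeta> ^ l * cmod (fourier (\<lambda>z. A z * g' \<epsilon> (F z)) \<zeta>)) (- real N')"
  proof (rule pullback_regular[OF smooth_F \<Omega> gm \<psi>(1) _ \<Gamma> N \<zeta>0 DF_adjoint_inj dir])
    show "\<psi> (F z0) \<noteq> 0" using \<psi>(2) by simp
    fix r \<Gamma>' and N' :: nat
    assume H: "r > 0" "conic_nbhd \<zeta>0 \<Gamma>'" "\<And>A l. smooth_on UNIV A \<Longrightarrow> (\<And>z. z \<notin> cball z0 r \<Longrightarrow> A z = 0) \<Longrightarrow>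
      sup_bigo \<Gamma>' (\<lambda>\<epsilon> \<zeta>. japanese_bracket \<zeta> ^ l * cmod (fourier (\<lambda>z. A z * g' \<epsilon> (F z)) \<zeta>)) (- real N')"
    show thesis
    proof (rule that[OF H(1,2)])
      fix A l assume A: "smooth_on UNIV A" "\<And>z. z \<notin> cball z0 r \<Longrightarrow> A z = (0::complex)"
      show "sup_bigo \<Gamma>' (\<lambda>\<epsilon> \<zeta>. japanese_bracket \<zeta> ^ l * cmod (fourier (\<lambda>z. A z * g' \<epsilon> (F z)) \<zeta>)) (- real N')"
        by (rule H(3)[OF A(1)]) (rule A(2))
    qed
  qed assumption+
  obtain R where R: "R > 0" "cball z0 R \<subseteq> XX" using open_XX z0 open_contains_cball by blast
  define C where "C = cball z0 (min r R)"
  have C: "compact C" "C \<subseteq> XX" "C \<subseteq> cball z0 r" using R(2) by (auto simp: C_def)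
  obtain \<phi>' :: "(real^'n) \<times> real \<Rightarrow> real" where \<phi>': "smooth_on UNIV \<phi>'" "\<phi>' z0 = 1" "\<And>z. z \<notin> C \<Longrightarrow> \<phi>' z = 0"
    unfolding C_def using bump_exists[of "min r R" z0] r R(1) by (metis min_less_iff_conj)
  define \<phi> where "\<phi> z = complex_of_real (\<phi>' z)" for z
  have \<phi>: "smooth_on UNIV \<phi>" "\<phi> z0 = 1" "\<And>z. z \<notin> C \<Longrightarrow> \<phi> z = 0"
    unfolding \<phi>_def[abs_def] using \<phi>' by (auto intro!: smooth_on_of_real)
  have t\<phi>: "test_function XX \<phi>"
    by (rule test_function_bump[of _ z0 "min r R", OF \<phi>(1)]) (use \<phi>(3) C(2) in \<open>auto simp: C_def\<close>)
  define h where "h z = exp (- \<i> * \<beta> (F z, snd z))" for z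
  have h: "smooth_on UNIV h" unfolding h_def[abs_def]
    by (rule smooth_on_compose[OF open_UNIV open_UNIV smooth_exp_\<beta>])
      (intro smooth_on_Pair smooth_F smooth_on_snd open_UNIV UNIV_I)+
  have u: "u \<in> colombeau XX" using sol by (simp add: cauchy_solution_def)
  obtain u' where u': "u' \<in> u" using colombeau_nonempty[OF open_XX u] by blast
  have um: "u' \<in> moderate_nets XX" by (rule colombeau_memD(1)[OF open_XX u u' u'])
  show ?thesis
    unfolding microlocally_regular_def
  proof (intro bexI[OF _ u'] exI conjI allI)
    fix l
    show "sup_bigo \<Gamma>' (\<lambda>\<epsilon> \<xi>. japanese_bracket \<xi> ^ l * cmod (fourier (\<lambda>x. \<phi> x * u' \<epsilon> x) \<xi>)) (- real N')"
    \<comment> \<open>The comparison net is the exact pullback with amplitude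
      \<open>\<phi> z * h z\<close>, to which \<open>N'\<close> applies for every
      \<open>l\<close>.\<close>
    proof (rule rapid_decay_perturbation[where B = "\<lambda>\<epsilon>. fourier (\<lambda>z. (\<phi> z * h z) * g' \<epsilon> (F z))"])
      show "\<exists>p::nat. sup_bigo \<Gamma>' (\<lambda>\<epsilon> \<xi>. japanese_bracket \<xi> ^ l * cmod (fourier (\<lambda>x. \<phi> x * u' \<epsilon> x) \<xi>)) (- real p)" for l
      proof -
        obtain p :: nat where "sup_bigo UNIV (\<lambda>\<epsilon> \<xi>. japanese_bracket \<xi> ^ l * cmod (fourier (\<lambda>x. \<phi> x * u' \<epsilon> x) \<xi>)) (- real p)"
          by (rule fourier_moderate[OF open_XX t\<phi> um])
        then show ?thesis by (intro exI) (rule sup_bigo_le, auto)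
      qed
      show "sup_bigo \<Gamma>' (\<lambda>\<epsilon> \<zeta>. japanese_bracket \<zeta> ^ l * cmod (fourier (\<lambda>z. (\<phi> z * h z) * g' \<epsilon> (F z)) \<zeta>)) (- real N')" for l
        by (rule N', rule smooth_on_mult[OF open_UNIV \<phi>(1) h]) (use \<phi>(3) C(3) in \<open>metis mult_eq_0_iff subsetD\<close>)
      fix q
      have "sup_bigo UNIV (\<lambda>\<epsilon> \<xi>. cmod (fourier (\<lambda>x. \<phi> x * u' \<epsilon> x) \<xi> - fourier (\<lambda>z. (\<phi> z * h z) * g' \<epsilon> (F z)) \<xi>)) q"
      proof (rule fourier_net_perturbation[OF _ _ C(1)])
        fix \<epsilon> :: real assume \<epsilon>: "\<epsilon> \<in> {0<..1}"
        have su: "smooth_on XX (u' \<epsilon>)" and sg: "smooth_on \<Omega> (g' \<epsilon>)"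
          using um gm \<epsilon> by (simp_all add: moderate_nets_def)
        show "continuous_on UNIV (\<lambda>x. \<phi> x * u' \<epsilon> x)"
          by (rule smooth_on_imp_continuous[OF open_UNIV test_function_product[OF open_XX t\<phi> su]])
        have gF: "smooth_on XX (\<lambda>z. g' \<epsilon> (F z))"
          by (rule smooth_on_compose[OF open_XX \<Omega> sg smooth_on_subset[OF smooth_F]]) (auto intro: finv)
        have "smooth_on XX (\<lambda>z. \<phi> z * h z)"
          by (rule smooth_on_subset[OF smooth_on_mult[OF open_UNIV \<phi>(1) h]]) simp
        from smooth_on_mult[OF open_XX this gF]
        have "smooth_on UNIV (\<lambda>z. (\<phi> z * h z) * g' \<epsilon> (F z))"
          by (rule smooth_on_zero_extension[OF open_XX compact_imp_closed[OF C(1)] C(2)]) (simp add: \<phi>(3))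
        then show "continuous_on UNIV (\<lambda>z. (\<phi> z * h z) * g' \<epsilon> (F z))"
          by (rule smooth_on_imp_continuous[OF open_UNIV])
      next
        let ?H = "\<lambda>z. (F z, snd z)"
        have "bounded (\<phi> ` C)" by (rule compact_imp_bounded[OF compact_continuous_image[OF
            continuous_on_subset[OF smooth_on_imp_continuous[OF open_UNIV \<phi>(1)]] C(1)]]) simp
        then obtain M where M: "\<And>z. z \<in> C \<Longrightarrow> cmod (\<phi> z) \<le> M" unfolding bounded_iff by auto
        have HC: "compact (?H ` C)" "?H ` C \<subseteq> XX"
          using C(2) finv by (auto intro!: compact_continuous_image[OF _ C(1)] continuous_intros continuous_F)
        show "sup_bigo C (\<lambda>\<epsilon> z. cmod (\<phi> z * u' \<epsilon> z - (\<phi> z * h z) * g' \<epsilon> (F z))) q"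
        proof (rule sup_bigo_bound[where c = "\<bar>M\<bar>", OF representative_estimate[OF inv sol g g' u' HC, of q]])
          fix \<epsilon> z assume z: "z \<in> C"
          have "\<phi> z * u' \<epsilon> z - (\<phi> z * h z) * g' \<epsilon> (F z)
              = \<phi> z * (u' \<epsilon> (G (?H z)) - exp (- \<i> * \<beta> (?H z)) * g' \<epsilon> (fst (?H z)))"
            by (simp add: G_F h_def right_diff_distrib mult.assoc)
          then have "cmod (\<phi> z * u' \<epsilon> z - (\<phi> z * h z) * g' \<epsilon> (F z))
              \<le> \<bar>M\<bar> * cmod (u' \<epsilon> (G (?H z)) - exp (- \<i> * \<beta> (?H z)) * g' \<epsilon> (fst (?H z)))"
            using M[OF z] by (simp only: norm_mult) (intro mult_right_mono; simp)
          then show "\<exists>y\<in>?H ` C. cmod (\<phi> z * u' \<epsilon> z - (\<phi> z * h z) * g' \<epsilon> (F z))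
              \<le> \<bar>M\<bar> * cmod (u' \<epsilon> (G y) - exp (- \<i> * \<beta> y) * g' \<epsilon> (fst y))"
            using z by (intro bexI[of _ "?H z"]) auto
        qed auto
      qed (simp_all add: \<phi>(3))
      then show "sup_bigo \<Gamma>' (\<lambda>\<epsilon> \<xi>. cmod (fourier (\<lambda>x. \<phi> x * u' \<epsilon> x) \<xi> - fourier (\<lambda>z. (\<phi> z * h z) * g' \<epsilon> (F z)) \<xi>)) q"
        by (rule sup_bigo_le) auto
    qed
  qed (use t\<phi> \<phi>(2) \<Gamma>' in auto)
qed

text \<open>Testing \<open>u\<close> at frequencies \<open>(\<eta>, 0)\<close> in the coordinates \<open>(y, t)\<close> integrates the transported data
  against a cut-off \<open>\<kappa>\<close> in \<open>t\<close> and so recovers the Fourier transform of \<open>g\<close>.\<close>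

lemma regular_data:
  assumes inv: "\<And>y t. y \<in> \<Omega> \<Longrightarrow> G (y, t) \<in> XX"
    and sol: "cauchy_solution \<Omega> a b g u" and g: "g \<in> colombeau \<Omega>"
    and y0: "y0 \<in> \<Omega>" and \<eta>0: "\<eta>0 \<noteq> 0"
    and reg: "microlocally_regular XX u (G (y0, t0)) (covector \<eta>0 (G (y0, t0)))"
  shows "microlocally_regular \<Omega> g y0 \<eta>0"
proof -
  let ?DG = "frechet_derivative G (at (y0, t0))"
  obtain u' \<psi> \<Gamma> and N :: nat where u': "u' \<in> u" and \<psi>: "test_function XX \<psi>" "\<psi> (G (y0, t0)) = 1"
    and \<Gamma>: "open \<Gamma>" "covector \<eta>0 (G (y0, t0)) \<in> \<Gamma>" "\<And>\<eta> t. \<eta> \<in> \<Gamma> \<Longrightarrow> t > 0 \<Longrightarrow> t *\<^sub>R \<eta> \<in> \<Gamma>"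
    and N: "\<And>l. sup_bigo \<Gamma> (\<lambda>\<epsilon> \<xi>. japanese_bracket \<xi> ^ l * cmod (fourier (\<lambda>x. \<psi> x * u' \<epsilon> x) \<xi>)) (- real N)"
    using reg by (rule microlocally_regularE) (rule that; assumption)
  have u: "u \<in> colombeau XX" using sol by (simp add: cauchy_solution_def)
  have um: "u' \<in> moderate_nets XX" by (rule colombeau_memD(1)[OF open_XX u u' u'])
  have inj: "\<zeta> = 0" if "\<And>k. ?DG k \<bullet> \<zeta> = 0" for \<zeta>
    using DG_adjoint_inj[of "G (y0, t0)" \<zeta>] that by simp
  \<comment> \<open>The covector at \<open>G (y0, t0)\<close> is sent to (\<eta>0, 0) by the
    transpose of the derivative of \<open>G\<close>, and by injectivity nothing else is.\<close>
  have dir: "\<zeta> \<in> \<Gamma>" if "\<And>k. ?DG k \<bullet> \<zeta> = k \<bullet> (\<eta>0, 0)" for \<zeta>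
  proof -
    have "?DG k \<bullet> covector \<eta>0 (G (y0, t0)) = k \<bullet> (\<eta>0, 0)" for k
      using covector_inner[of \<eta>0 "G (y0, t0)" "?DG k"] by (simp add: DF_DG inner_commute inner_prod_def)
    then have "\<zeta> - covector \<eta>0 (G (y0, t0)) = 0" using that by (intro inj) (simp add: inner_diff_right)
    then show ?thesis using \<Gamma>(2) by simp
  qed
  obtain r \<Gamma>' and N' :: nat where r: "r > 0" and \<Gamma>': "conic_nbhd (\<eta>0, 0::real) \<Gamma>'"
    and N': "\<And>A l. smooth_on UNIV A \<Longrightarrow> (\<And>z. z \<notin> cball (y0, t0) r \<Longrightarrow> A z = 0) \<Longrightarrow>
      sup_bigo \<Gamma>' (\<lambda>\<epsilon> \<zeta>. japanese_bracket \<zeta> ^ l * cmod (fourier (\<lambda>z. A z * u' \<epsilon> (G z)) \<zeta>)) (- real N')"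
  proof (rule pullback_regular[OF smooth_G open_XX um \<psi>(1) _ \<Gamma>(1) \<Gamma>(3) N _ inj dir])
    show "\<psi> (G (y0, t0)) \<noteq> 0" using \<psi>(2) by simp
    show "(\<eta>0, 0::real) \<noteq> 0" using \<eta>0 by (simp add: zero_prod_def)
    fix r \<Gamma>' and N' :: nat
    assume H: "r > 0" "conic_nbhd (\<eta>0, 0::real) \<Gamma>'" "\<And>A l. smooth_on UNIV A \<Longrightarrow> (\<And>z. z \<notin> cball (y0, t0) r \<Longrightarrow> A z = 0) \<Longrightarrow>
      sup_bigo \<Gamma>' (\<lambda>\<epsilon> \<zeta>. japanese_bracket \<zeta> ^ l * cmod (fourier (\<lambda>z. A z * u' \<epsilon> (G z)) \<zeta>)) (- real N')"
    show thesis
    proof (rule that[OF H(1,2)])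
      fix A l assume A: "smooth_on UNIV A" "\<And>z. z \<notin> cball (y0, t0) r \<Longrightarrow> A z = (0::complex)"
      show "sup_bigo \<Gamma>' (\<lambda>\<epsilon> \<zeta>. japanese_bracket \<zeta> ^ l * cmod (fourier (\<lambda>z. A z * u' \<epsilon> (G z)) \<zeta>)) (- real N')"
        by (rule H(3)[OF A(1)]) (rule A(2))
    qed
  qed assumption+
  obtain R where R: "R > 0" "cball y0 R \<subseteq> \<Omega>" using \<Omega> y0 open_contains_cball by blast
  \<comment> \<open>At most half of \<open>r\<close>, so that the product with the time interval of
    radius \<open>r/2\<close> fits into the ball of radius \<open>r\<close>.\<close>
  define \<rho> where "\<rho> = min R (r/2)"
  have \<rho>: "\<rho> > 0" "\<rho> \<le> r/2" "cball y0 \<rho> \<subseteq> \<Omega>" using R r by (auto simp: \<rho>_def)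
  define C where "C = cball y0 \<rho> \<times> cball t0 (r/2)"
  have C: "compact C" "C \<subseteq> XX" "C \<subseteq> cball (y0, t0) r"
  proof -
    show "compact C" "C \<subseteq> XX" using \<rho>(3) by (auto simp: C_def intro!: compact_Times)
    have "dist (y0, t0) (y, t) \<le> r" if "dist y0 y \<le> \<rho>" "dist t0 t \<le> r/2" for y t
      using that \<rho>(2) sqrt_sum_squares_le_sum[of "dist y0 y" "dist t0 t"] by (simp add: dist_Pair_Pair)
    then show "C \<subseteq> cball (y0, t0) r" by (auto simp: C_def)
  qed
  obtain \<phi>' :: "real^'n \<Rightarrow> real" where \<phi>': "smooth_on UNIV \<phi>'" "\<phi>' y0 = 1" "\<And>x. x \<notin> cball y0 \<rho> \<Longrightarrow> \<phi>' x = 0"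
    using bump_exists[OF \<rho>(1), of y0] by metis
  have r2: "r/2 > 0" using r by simp
  obtain \<kappa>' :: "real \<Rightarrow> real" where \<kappa>': "smooth_on UNIV \<kappa>'" "\<kappa>' t0 = 1" "\<And>t. \<kappa>' t \<ge> 0"
      "\<And>t. t \<notin> cball t0 (r/2) \<Longrightarrow> \<kappa>' t = 0"
    using bump_exists[OF r2, of t0] by metis
  define \<phi> where "\<phi> x = complex_of_real (\<phi>' x)" for x
  define \<kappa> where "\<kappa> t = complex_of_real (\<kappa>' t)" for t
  have \<phi>: "smooth_on UNIV \<phi>" "\<phi> y0 = 1" "\<And>x. x \<notin> cball y0 \<rho> \<Longrightarrow> \<phi> x = 0"
    unfolding \<phi>_def[abs_def] using \<phi>' by (auto intro!: smooth_on_of_real)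
  have \<kappa>: "smooth_on UNIV \<kappa>" "\<And>t. t \<notin> cball t0 (r/2) \<Longrightarrow> \<kappa> t = 0"
    unfolding \<kappa>_def[abs_def] using \<kappa>' by (auto intro!: smooth_on_of_real)
  have t\<phi>: "test_function \<Omega> \<phi>" by (rule test_function_bump[OF \<phi>(1,3) \<rho>(3)])
  note c\<kappa> = smooth_on_imp_continuous[OF open_UNIV \<kappa>(1)] smooth_on_imp_continuous[OF open_UNIV \<kappa>'(1)]
  have i\<kappa>: "integrable lborel \<kappa>" "integrable lborel \<kappa>'"
    by (rule integrable_compact_support[OF c\<kappa>(1) compact_cball[of t0 "r/2"]], erule \<kappa>(2),
        rule integrable_compact_support[OF c\<kappa>(2) compact_cball[of t0 "r/2"]], erule \<kappa>'(4))
  define I where "I = (LINT t|lborel. \<kappa> t)"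
  have "I = complex_of_real (LINT t|lborel. \<kappa>' t)" by (simp add: I_def \<kappa>_def)
  then have I: "I \<noteq> 0" using bump_integral_pos[OF c\<kappa>(2) i\<kappa>(2) \<kappa>'(3,2)] by simp
  obtain g' where g': "g' \<in> g" using colombeau_nonempty[OF \<Omega> g] by blast
  have gm: "g' \<in> moderate_nets \<Omega>" by (rule colombeau_memD(1)[OF \<Omega> g g' g'])
  \<comment> \<open>The factor exp(i \<beta>) cancels the phase acquired in transport, so
    \<open>A z * u' \<epsilon> (G z)\<close> differs negligibly from the product of \<phi> g' in
    \<open>y\<close> and \<kappa> in \<open>t\<close>.\<close>
  define A where "A z = \<phi> (fst z) * \<kappa> (snd z) * exp (\<i> * \<beta> z)" for z
  have A: "smooth_on UNIV A" "\<And>z. z \<notin> C \<Longrightarrow> A z = 0"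
  proof -
    have "smooth_on UNIV (\<lambda>z::(real^'n) \<times> real. \<phi> (fst z))"
      by (rule smooth_on_compose[OF open_UNIV open_UNIV \<phi>(1) smooth_on_fst[OF open_UNIV] UNIV_I])
    moreover have "smooth_on UNIV (\<lambda>z::(real^'n) \<times> real. \<kappa> (snd z))"
      by (rule smooth_on_compose[OF open_UNIV open_UNIV \<kappa>(1) smooth_on_snd[OF open_UNIV] UNIV_I])
    ultimately show "smooth_on UNIV A" unfolding A_def[abs_def] by (intro smooth_on_mult smooth_exp_\<beta> open_UNIV)
    show "A z = 0" if "z \<notin> C" for z
      using that \<phi>(3)[of "fst z"] \<kappa>(2)[of "snd z"] by (cases z) (auto simp: A_def C_def)
  qed
  \<comment> \<open>The slice of the cone at zero time frequency; it is again open and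
    conic.\<close>
  define \<Gamma>'' where "\<Gamma>'' = (\<lambda>\<eta>. (\<eta>, 0::real)) -` \<Gamma>'"
  have \<Gamma>'': "conic_nbhd \<eta>0 \<Gamma>''"
    unfolding conic_nbhd_def
  proof (intro conjI ballI allI impI)
    show "open \<Gamma>''" unfolding \<Gamma>''_def
      using \<Gamma>' by (intro open_vimage continuous_intros) (simp add: conic_nbhd_def)
    show "c *\<^sub>R \<xi> \<in> \<Gamma>''" if "\<xi> \<in> \<Gamma>''" "c > 0" for \<xi> c
    proof -
      have "c *\<^sub>R (\<xi>, 0::real) \<in> \<Gamma>'" using \<Gamma>' that unfolding conic_nbhd_def \<Gamma>''_def by blast
      then show ?thesis by (simp add: \<Gamma>''_def)
    qed
  qed (use \<Gamma>' in \<open>auto simp: conic_nbhd_def \<Gamma>''_def zero_prod_def\<close>)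
  show ?thesis
    unfolding microlocally_regular_def
  proof (intro bexI[OF _ g'] exI conjI allI)
    fix l
    show "sup_bigo \<Gamma>'' (\<lambda>\<epsilon> \<xi>. japanese_bracket \<xi> ^ l * cmod (fourier (\<lambda>x. \<phi> x * g' \<epsilon> x) \<xi>)) (- real N')"
    \<comment> \<open>At (\<eta>, 0) the transform of the product is \<open>I\<close> times that of
      \<phi> g', so dividing by the nonzero \<open>I\<close> gives the comparison function.\<close>
    proof (rule rapid_decay_perturbation[where B = "\<lambda>\<epsilon> \<eta>. inverse I * fourier (\<lambda>z. A z * u' \<epsilon> (G z)) (\<eta>, 0)"])
      show "\<exists>p::nat. sup_bigo \<Gamma>'' (\<lambda>\<epsilon> \<xi>. japanese_bracket \<xi> ^ l * cmod (fourier (\<lambda>x. \<phi> x * g' \<epsilon> x) \<xi>)) (- real p)" for l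
      proof -
        obtain p :: nat where "sup_bigo UNIV (\<lambda>\<epsilon> \<xi>. japanese_bracket \<xi> ^ l * cmod (fourier (\<lambda>x. \<phi> x * g' \<epsilon> x) \<xi>)) (- real p)"
          by (rule fourier_moderate[OF \<Omega> t\<phi> gm])
        then show ?thesis by (intro exI) (rule sup_bigo_le, auto)
      qed
      show "sup_bigo \<Gamma>'' (\<lambda>\<epsilon> \<eta>. japanese_bracket \<eta> ^ l * cmod (inverse I * fourier (\<lambda>z. A z * u' \<epsilon> (G z)) (\<eta>, 0))) (- real N')" for l
      proof (rule sup_bigo_bound[where c = "cmod (inverse I)" and r = "- real N'"])
        show "sup_bigo \<Gamma>' (\<lambda>\<epsilon> \<zeta>. japanese_bracket \<zeta> ^ l * cmod (fourier (\<lambda>z. A z * u' \<epsilon> (G z)) \<zeta>)) (- real N')"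
          by (rule N'[OF A(1)]) (use A(2) C(3) in blast)
        show "\<exists>\<zeta>\<in>\<Gamma>'. japanese_bracket \<eta> ^ l * cmod (inverse I * fourier (\<lambda>z. A z * u' \<epsilon> (G z)) (\<eta>, 0))
            \<le> cmod (inverse I) * (japanese_bracket \<zeta> ^ l * cmod (fourier (\<lambda>z. A z * u' \<epsilon> (G z)) \<zeta>))"
          if "\<eta> \<in> \<Gamma>''" for \<epsilon> \<eta>
        proof (rule bexI[of _ "(\<eta>, 0)"])
          have "japanese_bracket (\<eta>, 0::real) = japanese_bracket \<eta>" by (simp add: japanese_bracket_def norm_Pair)
          then show "japanese_bracket \<eta> ^ l * cmod (inverse I * fourier (\<lambda>z. A z * u' \<epsilon> (G z)) (\<eta>, 0))
              \<le> cmod (inverse I) * (japanese_bracket (\<eta>, 0::real) ^ l * cmod (fourier (\<lambda>z. A z * u' \<epsilon> (G z)) (\<eta>, 0)))"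
            by (simp add: norm_mult mult_ac)
        qed (use that in \<open>simp add: \<Gamma>''_def\<close>)
      qed auto
      fix q
      let ?P = "\<lambda>\<epsilon> z. (\<phi> (fst z) * g' \<epsilon> (fst z)) * \<kappa> (snd z)"
      have "sup_bigo UNIV (\<lambda>\<epsilon> \<zeta>. cmod (fourier (?P \<epsilon>) \<zeta> - fourier (\<lambda>z. A z * u' \<epsilon> (G z)) \<zeta>)) q"
      proof (rule fourier_net_perturbation[OF _ _ C(1)])
        fix \<epsilon> :: real assume \<epsilon>: "\<epsilon> \<in> {0<..1}"
        have su: "smooth_on XX (u' \<epsilon>)" and sg: "smooth_on \<Omega> (g' \<epsilon>)"
          using um gm \<epsilon> by (simp_all add: moderate_nets_def)
        note cg = smooth_on_imp_continuous[OF open_UNIV test_function_product[OF \<Omega> t\<phi> sg]]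
        show "continuous_on UNIV (?P \<epsilon>)"
          by (rule continuous_on_mult[OF continuous_on_compose2[OF cg continuous_on_fst[OF continuous_on_id]]
              continuous_on_compose2[OF c\<kappa>(1) continuous_on_snd[OF continuous_on_id]]]) auto
        have uG: "smooth_on XX (\<lambda>z. u' \<epsilon> (G z))"
          by (rule smooth_on_compose[OF open_XX open_XX su smooth_on_subset[OF smooth_G]]) (use inv in auto)
        have "smooth_on XX A" by (rule smooth_on_subset[OF A(1)]) simp
        from smooth_on_mult[OF open_XX this uG]
        have "smooth_on UNIV (\<lambda>z. A z * u' \<epsilon> (G z))"
          by (rule smooth_on_zero_extension[OF open_XX compact_imp_closed[OF C(1)] C(2)]) (simp add: A(2))
        then show "continuous_on UNIV (\<lambda>z. A z * u' \<epsilon> (G z))"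
          by (rule smooth_on_imp_continuous[OF open_UNIV])
      next
        have "bounded (A ` C)" by (rule compact_imp_bounded[OF compact_continuous_image[OF
            continuous_on_subset[OF smooth_on_imp_continuous[OF open_UNIV A(1)]] C(1)]]) simp
        then obtain M where M: "\<And>z. z \<in> C \<Longrightarrow> cmod (A z) \<le> M" unfolding bounded_iff by auto
        show "sup_bigo C (\<lambda>\<epsilon> z. cmod (?P \<epsilon> z - A z * u' \<epsilon> (G z))) q"
        proof (rule sup_bigo_bound[where c = "\<bar>M\<bar>", OF representative_estimate[OF inv sol g g' u' C(1,2), of q]])
          fix \<epsilon> z assume z: "z \<in> C"
          have "exp (\<i> * \<beta> z) * (exp (- \<i> * \<beta> z) * x) = x" for x
            by (simp add: mult.assoc[symmetric] exp_add[symmetric])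
          then have "?P \<epsilon> z - A z * u' \<epsilon> (G z) = - (A z * (u' \<epsilon> (G z) - exp (- \<i> * \<beta> z) * g' \<epsilon> (fst z)))"
            by (simp add: A_def right_diff_distrib mult.assoc)
          then have "cmod (?P \<epsilon> z - A z * u' \<epsilon> (G z)) \<le> \<bar>M\<bar> * cmod (u' \<epsilon> (G z) - exp (- \<i> * \<beta> z) * g' \<epsilon> (fst z))"
            using M[OF z] by (simp only: norm_minus_cancel norm_mult) (intro mult_right_mono; simp)
          then show "\<exists>y\<in>C. cmod (?P \<epsilon> z - A z * u' \<epsilon> (G z))
              \<le> \<bar>M\<bar> * cmod (u' \<epsilon> (G y) - exp (- \<i> * \<beta> y) * g' \<epsilon> (fst y))" using z by blast
        qed auto
        show "?P \<epsilon> z = 0" if "z \<notin> C" for \<epsilon> z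
          using that \<phi>(3)[of "fst z"] \<kappa>(2)[of "snd z"] by (cases z) (auto simp: C_def)
      qed (simp_all add: A(2))
      then show "sup_bigo \<Gamma>'' (\<lambda>\<epsilon> \<eta>. cmod (fourier (\<lambda>x. \<phi> x * g' \<epsilon> x) \<eta> - inverse I * fourier (\<lambda>z. A z * u' \<epsilon> (G z)) (\<eta>, 0))) q"
      proof (rule sup_bigo_bound[where c = "cmod (inverse I)"])
        fix \<epsilon> \<eta> assume \<epsilon>: "\<epsilon> \<in> {0<..1::real}"
        then have sg: "smooth_on \<Omega> (g' \<epsilon>)" using gm by (simp add: moderate_nets_def)
        have "integrable lborel (\<lambda>x. \<phi> x * g' \<epsilon> x)"
          by (rule integrable_compact_support[OF smooth_on_imp_continuous[OF open_UNIV test_function_product[OF \<Omega> t\<phi> sg]]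
              compact_cball[of y0 \<rho>]]) (simp only: \<phi>(3) mult_zero_left simp_thms)
        from fourier_of_product_at_zero[OF this i\<kappa>(1)]
        have "fourier (\<lambda>x. \<phi> x * g' \<epsilon> x) \<eta> = inverse I * fourier (?P \<epsilon>) (\<eta>, 0)" using I by (simp add: I_def)
        then have "cmod (fourier (\<lambda>x. \<phi> x * g' \<epsilon> x) \<eta> - inverse I * fourier (\<lambda>z. A z * u' \<epsilon> (G z)) (\<eta>, 0))
          = cmod (inverse I) * cmod (fourier (?P \<epsilon>) (\<eta>, 0) - fourier (\<lambda>z. A z * u' \<epsilon> (G z)) (\<eta>, 0))"
          by (simp only: right_diff_distrib[symmetric] norm_mult)
        then show "\<exists>\<zeta>\<in>UNIV. cmod (fourier (\<lambda>x. \<phi> x * g' \<epsilon> x) \<eta> - inverse I * fourier (\<lambda>z. A z * u' \<epsilon> (G z)) (\<eta>, 0))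
            \<le> cmod (inverse I) * cmod (fourier (?P \<epsilon>) \<zeta> - fourier (\<lambda>z. A z * u' \<epsilon> (G z)) \<zeta>)"
          by (intro bexI[of _ "(\<eta>, 0)"]) simp_all
      qed auto
    qed
  qed (use t\<phi> \<phi>(2) \<Gamma>'' in auto)
qed

text \<open>If \<open>u\<close> is singular at (z, \<zeta>), \<open>regular_solution\<close> forces
  a singular (F z, \<eta>) of \<open>g\<close> with \<zeta> the covector of \<eta> at
  \<open>z\<close>, which lies on its curve at time \<open>snd z\<close>. Conversely, regularity of
  \<open>u\<close> at a single point of a curve already gives regularity of \<open>g\<close> at its
  start, by \<open>regular_data\<close>.\<close>

lemma WF_g_solution:
  assumes uniq: "\<And>v. cauchy_solution \<Omega> a b g v \<Longrightarrow> v = u" and sol: "cauchy_solution \<Omega> a b g u"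
    and g: "g \<in> colombeau \<Omega>"
  shows "WF_g XX u = (\<Union>(x0, \<xi>0)\<in>WF_g \<Omega> g. bichar_curve \<Omega> a x0 \<xi>0)"
proof -
  have finv: "F z \<in> \<Omega>" if "z \<in> XX" for z by (rule F_mem[OF uniq sol that])
  have inv: "G (y, t) \<in> XX" if "y \<in> \<Omega>" for y t by (rule G_mem[OF finv that])
  have curve: "bichar_curve \<Omega> a x \<xi> = range (\<lambda>s. (G (x, s), covector \<xi> (G (x, s))))"
    if "(x, \<xi>) \<in> WF_g \<Omega> g" for x \<xi>
    using that by (intro bichar_curve_eq inv) (auto simp: WF_g_def cotangent_minus_zero_def)
  show ?thesis
  proof (intro equalityI subsetI)
    fix w assume "w \<in> WF_g XX u"
    then obtain z \<zeta> where w: "w = (z, \<zeta>)" and z: "z \<in> XX" and \<zeta>: "\<zeta> \<noteq> 0" and nr: "\<not> microlocally_regular XX u z \<zeta>"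
      by (auto simp: WF_g_def cotangent_minus_zero_def)
    obtain \<eta> where \<eta>: "\<eta> \<noteq> 0" "\<And>k. DF z k \<bullet> \<eta> = k \<bullet> \<zeta>" "\<not> microlocally_regular \<Omega> g (F z) \<eta>"
      using regular_solution[OF finv inv sol g z \<zeta>] nr by blast
    have WF: "(F z, \<eta>) \<in> WF_g \<Omega> g" using \<eta>(1,3) finv[OF z] by (simp add: WF_g_def cotangent_minus_zero_def)
    have "\<forall>k. covector \<eta> z \<bullet> k = \<zeta> \<bullet> k"
      unfolding covector_inner \<eta>(2) by (intro allI inner_commute)
    then have "covector \<eta> z = \<zeta>" unfolding vector_eq_rdot .
    then have "w = (G (F z, snd z), covector \<eta> (G (F z, snd z)))" by (simp only: w G_F)
    then have "w \<in> bichar_curve \<Omega> a (F z) \<eta>" unfolding curve[OF WF] by blast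
    then show "w \<in> (\<Union>(x0, \<xi>0)\<in>WF_g \<Omega> g. bichar_curve \<Omega> a x0 \<xi>0)" using WF by blast
  next
    fix w assume "w \<in> (\<Union>(x0, \<xi>0)\<in>WF_g \<Omega> g. bichar_curve \<Omega> a x0 \<xi>0)"
    then obtain y \<eta> where WF: "(y, \<eta>) \<in> WF_g \<Omega> g" and "w \<in> bichar_curve \<Omega> a y \<eta>" by blast
    then obtain s where w: "w = (G (y, s), covector \<eta> (G (y, s)))" unfolding curve[OF WF] by blast
    have y: "y \<in> \<Omega>" "\<eta> \<noteq> 0" "\<not> microlocally_regular \<Omega> g y \<eta>" using WF by (auto simp: WF_g_def cotangent_minus_zero_def)
    have "\<not> microlocally_regular XX u (G (y, s)) (covector \<eta> (G (y, s)))"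
      using regular_data[OF inv sol g y(1,2)] y(3) by blast
    then show "w \<in> WF_g XX u" unfolding w WF_g_def cotangent_minus_zero_def
      using inv[OF y(1), of s] covector_nonzero[OF y(2)] by simp
  qed
qed

end

theorem theorem3p7:
  fixes \<Omega> :: "(real^'n) set"
    and a :: "'n \<Rightarrow> real \<times> (real^'n) \<Rightarrow> complex"
    and b :: "real \<times> (real^'n) \<Rightarrow> complex"
    and g :: "(real^'n) net set"
    and u :: "((real^'n) \<times> real) net set"
  assumes "open \<Omega>"
    and "\<And>j. smooth_on (UNIV \<times> \<Omega>) (a j)"
    and "smooth_on (UNIV \<times> \<Omega>) b"
    and "\<And>j. constant_outside_compact \<Omega> (a j)"
    and "constant_outside_compact \<Omega> b"
    and "\<And>t x \<xi>. x \<in> \<Omega> \<Longrightarrow> principal_symbol a t x \<xi> \<in> \<real>"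
    and "g \<in> colombeau \<Omega>"
    and "cauchy_solution \<Omega> a b g u"
    and "\<And>v. cauchy_solution \<Omega> a b g v \<Longrightarrow> v = u"
  shows "WF_g (\<Omega> \<times> UNIV) u = (\<Union>(x0, \<xi>0)\<in>WF_g \<Omega> g. bichar_curve \<Omega> a x0 \<xi>0)"
proof -
  define P where "P f f' K c \<longleftrightarrow> smooth_on UNIV f' \<and> compact K \<and> K \<subseteq> \<Omega> \<and>
      (\<forall>x t. x \<in> \<Omega> \<longrightarrow> f' (x, t) = f (t, x)) \<and> (\<forall>x t. x \<notin> K \<longrightarrow> f' (x, t) = c)"
    for f :: "real \<times> (real^'n) \<Rightarrow> complex" and f' K c
  have "\<forall>j. \<exists>f' K c. P (a j) f' K c"
    unfolding P_def using smooth_coefficient_extension[OF assms(1) assms(2) assms(4)] by (rule allI)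
  then obtain a' K c where "\<forall>j. P (a j) (a' j) (K j) (c j)" by metis
  then have a': "\<And>j. smooth_on UNIV (a' j)" "\<And>j. compact (K j)" "\<And>j. K j \<subseteq> \<Omega>"
      "\<And>j x t. x \<in> \<Omega> \<Longrightarrow> a' j (x, t) = a j (t, x)" "\<And>j x t. x \<notin> K j \<Longrightarrow> a' j (x, t) = c j"
    unfolding P_def by blast+
  obtain b' Kb cb where "P b b' Kb cb"
    unfolding P_def using smooth_coefficient_extension[OF assms(1,3,5)] by (elim exE)
  then have b': "smooth_on UNIV b'" "\<And>x t. x \<in> \<Omega> \<Longrightarrow> b' (x, t) = b (t, x)" unfolding P_def by blast+
  \<comment> \<open>The extended coefficients may be complex off \<Omega>, so real parts are taken;
    \<open>a_real\<close> shows that over \<Omega> this changes nothing.\<close>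
  define av where "av z = (\<Sum>j\<in>UNIV. Re (a' j z) *\<^sub>R (axis j 1 :: real^'n))" for z
  have av_nth: "av z $ j = Re (a' j z)" for z j
    by (simp add: av_def axis_def if_distrib[of "\<lambda>x. _ * x"] cong: if_cong)
  \<comment> \<open>A coefficient is the principal symbol at a unit covector, hence real by
    assumption.\<close>
  have a_real: "a j (t, x) = complex_of_real (av (x, t) $ j)" if "x \<in> \<Omega>" for j t x
  proof -
    have "principal_symbol a t x (axis j 1) = a j (t, x)"
      by (simp add: principal_symbol_def axis_def if_distrib[of complex_of_real] if_distrib[of "\<lambda>x. _ * x"] cong: if_cong)
    then have "a j (t, x) \<in> \<real>" using assms(6)[OF that, of t "axis j 1"] by simp
    then show ?thesis using a'(4)[OF that, of j t] by (simp add: av_nth of_real_Re)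
  qed
  interpret cauchy av "\<Union>j. K j" "\<Sum>j\<in>UNIV. Re (c j) *\<^sub>R axis j 1" b' \<Omega> a b
  proof
    show "smooth_on UNIV av" unfolding av_def[abs_def]
      by (intro smooth_on_sum smooth_on_scaleR smooth_on_const open_UNIV smooth_on_bounded_linear[OF open_UNIV bounded_linear_Re] a'(1))
    show "compact (\<Union>j. K j)" by (intro compact_UN) (auto simp: a'(2))
    show "av (x, t) = (\<Sum>j\<in>UNIV. Re (c j) *\<^sub>R axis j 1)" if "x \<notin> (\<Union>j. K j)" for x t
      using that a'(5) by (simp add: av_def)
    show "(\<Union>j. K j) \<subseteq> \<Omega>" using a'(3) by blast
    show "b (t, x) = b' (x, t)" if "x \<in> \<Omega>" for x t using b'(2)[OF that] by simp
  qed (use assms(1) b'(1) a_real in auto)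
  show ?thesis by (rule WF_g_solution[OF assms(9,8,7)])
qed

end
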